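(* Let $\omega\in[2,2.373)$ be the exponent for matrix multiplication and let $d\ge 1$. There is an algorithm which, given a $1$-critical $d$-parameter simplicial filtration $X=\{X_{\mathbf{u}}\}_{\mathbf{u}\in\mathbb{Z}^d}$ consisting of $n$ simplices, with at most one new simplex at each grid point of $\mathbb{Z}^d$, computes the total decomposition of the zero-dimensional persistence module $H_0(X)$ with coefficients in $\mathbb{F}_2$ (a presentation matrix for each indecomposable summand) in $O(n^{2\omega+1})$ time.
   Context: $\mathbb{Z}^d$ carries the product partial order. $\omega$ is the exponent for matrix multiplication: two $N\times N$ matrices over the field can be multiplied in $O(N^\omega)$ time. Field operations and comparisons of grades are counted as unit-cost operations. A $d$-parameter simplicial filtration is a family of simplicial complexes $\{X_{\mathbf{u}}\}_{\mathbf{u}\in\mathbb{Z}^d}$ with $X_{\mathbf{u}}\subseteq X_{\mathbf{u}+e_i}$ for all $\mathbf{u}$ and $i$. It is $1$-critical if every simplex $\sigma$ has a unique earliest birth grade $f(\sigma)\in\mathbb{Z}^d$, i.e. $\sigma\in X_{\mathbf{u}}$ iff $f(\sigma)\le\mathbf{u}$. The input is the list of simplices with their birth grades. Let $R=\mathbb{F}_2[t_1,\dots,t_d]$. A $\mathbb{Z}^d$-graded $R$-module is an $R$-module $M=\bigoplus_{\mathbf{u}\in\mathbb{Z}^d}M_{\mathbf{u}}$ with $t_i\cdot M_{\mathbf{u}}\subseteq M_{\mathbf{u}+e_i}$; morphisms are $R$-linear grade-preserving maps. The module $H_0(X)=\bigoplus_{\mathbf{u}}H_0(X_{\mathbf{u}};\mathbb{F}_2)$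 has $t_i$ acting by the maps induced by the inclusions $X_{\mathbf{u}}\subseteq X_{\mathbf{u}+e_i}$. A presentation matrix of $M$ is the matrix, in homogeneous bases, of a morphism $f:F^1\to F^0$ of finitely generated free graded modules with $\mathrm{coker}\, f\simeq M$. A nonzero module is indecomposable if it is not isomorphic to a direct sum of two nonzero graded modules. The total decomposition of $M$ is the essentially unique (Krull–Schmidt) decomposition $M\simeq\bigoplus M^i$ into indecomposables. *)

theory Defs
  imports
    "HOL-Algebra.AbelCoset"
    "HOL-Algebra.Module"
    "HOL-Analysis.Finite_Cartesian_Product"
    "HOL-Library.Poly_Mapping"
    "HOL-Library.Z2"
    "HOL-Library.Landau_Symbols"
begin

section \<open>Graded modules\<close>

text \<open>
  The grading set is \<open>int ^ 'd\<close> with the componentwise order; the number of parameters is the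
  (automatically positive) cardinality of the finite type \<open>'d\<close>.  The field with two elements is
  the type \<^typ>\<open>bit\<close>, and polynomials in the variables indexed by \<open>'d\<close> are finitely supported
  functions from exponents to coefficients, multiplied by convolution.
\<close>

type_synonym 'd grade = "int ^ 'd"
type_synonym 'd exponent = "'d \<Rightarrow>\<^sub>0 nat"
type_synonym 'd polynomial = "'d exponent \<Rightarrow>\<^sub>0 bit"

definition ring_of_class :: "'r::comm_ring_1 ring" where
  "ring_of_class = \<lparr>carrier = UNIV, monoid.mult = (*), one = 1, ring.zero = 0, add = (+)\<rparr>"

abbreviation poly_ring :: "'d polynomial ring" where
  "poly_ring \<equiv> ring_of_class"

definition variable_poly :: "'d \<Rightarrow> 'd polynomial" where
  "variable_poly i = Poly_Mapping.single (Poly_Mapping.single i 1) 1"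

definition exponent_grade :: "'d::finite exponent \<Rightarrow> 'd grade" where
  "exponent_grade \<alpha> = (\<chi> i. int (Poly_Mapping.lookup \<alpha> i))"

definition grade_exponent :: "'d::finite grade \<Rightarrow> 'd exponent" where
  "grade_exponent u = Abs_poly_mapping (\<lambda>i. nat (u $ i))"

record ('r, 'm, 'g) graded_module = "('r, 'm) module" +
  component :: "'g \<Rightarrow> 'm set"

type_synonym ('m, 'd) gmod = "('d polynomial, 'm, 'd grade) graded_module"

text \<open>Over the field with two elements an additive subgroup is the same as a linear subspace.\<close>

definition is_graded_module :: "('m, 'd::finite) gmod \<Rightarrow> bool" where
  "is_graded_module M \<longleftrightarrow>
     Module.module poly_ring M \<and>
     (\<forall>u. additive_subgroup (component M u) M) \<and>
     (\<forall>x \<in> carrier M. \<exists>!z. (\<forall>u. z u \<in> component M u) \<and> finite {u. z u \<noteq> \<zero>\<^bsub>M\<^esub>} \<and>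
        x = (\<Oplus>\<^bsub>M\<^esub>u \<in> {u. z u \<noteq> \<zero>\<^bsub>M\<^esub>}. z u)) \<and>
     (\<forall>u i. \<forall>x \<in> component M u. variable_poly i \<odot>\<^bsub>M\<^esub> x \<in> component M (u + axis i 1))"

definition graded_hom :: "('m, 'd::finite) gmod \<Rightarrow> ('n, 'd) gmod \<Rightarrow> ('m \<Rightarrow> 'n) set" where
  "graded_hom M N = {h \<in> carrier M \<rightarrow> carrier N.
     (\<forall>x \<in> carrier M. \<forall>y \<in> carrier M. h (x \<oplus>\<^bsub>M\<^esub> y) = h x \<oplus>\<^bsub>N\<^esub> h y) \<and>
     (\<forall>p. \<forall>x \<in> carrier M. h (p \<odot>\<^bsub>M\<^esub> x) = p \<odot>\<^bsub>N\<^esub> h x) \<and>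
     (\<forall>u. \<forall>x \<in> component M u. h x \<in> component N u)}"

definition graded_iso :: "('m, 'd::finite) gmod \<Rightarrow> ('n, 'd) gmod \<Rightarrow> bool" where
  "graded_iso M N \<longleftrightarrow> (\<exists>h \<in> graded_hom M N. bij_betw h (carrier M) (carrier N))"

text \<open>The direct sum of a finite list of modules; its elements are lists of the same length.\<close>

definition direct_sum :: "('m, 'd) gmod list \<Rightarrow> ('m list, 'd) gmod" where
  "direct_sum Ms =
     \<lparr>carrier = {xs. list_all2 (\<lambda>x M. x \<in> carrier M) xs Ms},
      monoid.mult = undefined, one = undefined,
      ring.zero = map ring.zero Ms,
      add = (\<lambda>xs ys. map (\<lambda>i. xs ! i \<oplus>\<^bsub>Ms ! i\<^esub> ys ! i) [0..<length Ms]),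
      smult = (\<lambda>p xs. map (\<lambda>i. p \<odot>\<^bsub>Ms ! i\<^esub> xs ! i) [0..<length Ms]),
      component = (\<lambda>u. {xs. list_all2 (\<lambda>x M. x \<in> component M u) xs Ms})\<rparr>"

definition nonzero_module :: "('m, 'd) gmod \<Rightarrow> bool" where
  "nonzero_module M \<longleftrightarrow> carrier M \<noteq> {\<zero>\<^bsub>M\<^esub>}"

text \<open>
  Letting the two summands range over graded modules on the element type of \<open>M\<close> is no
  restriction: any summand of \<open>M\<close> is isomorphic to a graded submodule of \<open>M\<close>.
  For the same reason the summands of a total decomposition may be sought on the element type of
  \<open>M\<close>.
\<close>

definition indecomposable :: "('m, 'd::finite) gmod \<Rightarrow> bool" where
  "indecomposable M \<longleftrightarrow>
     is_graded_module M \<and> nonzero_module M \<and>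
     \<not> (\<exists>A B :: ('m, 'd) gmod.
          is_graded_module A \<and> nonzero_module A \<and> is_graded_module B \<and> nonzero_module B \<and>
          graded_iso M (direct_sum [A, B]))"

definition total_decomposition :: "('m, 'd::finite) gmod \<Rightarrow> ('n, 'd) gmod list \<Rightarrow> bool" where
  "total_decomposition M Ms \<longleftrightarrow> (\<forall>N \<in> set Ms. indecomposable N) \<and> graded_iso M (direct_sum Ms)"

definition quotient_module :: "('r, 'm, 'e) module_scheme \<Rightarrow> 'm set \<Rightarrow> ('r, 'm set) module" where
  "quotient_module M N =
     \<lparr>carrier = a_rcosets\<^bsub>M\<^esub> N, monoid.mult = undefined, one = undefined,
      ring.zero = N, add = set_add M,
      smult = (\<lambda>a S. \<Union>x\<in>S. N +>\<^bsub>M\<^esub> (a \<odot>\<^bsub>M\<^esub> x))\<rparr>"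

definition graded_quotient :: "('m, 'd) gmod \<Rightarrow> 'm set \<Rightarrow> ('m set, 'd) gmod" where
  "graded_quotient M N =
     (let Q = quotient_module M N
      in \<lparr>carrier = carrier Q, monoid.mult = monoid.mult Q, one = one Q,
          ring.zero = ring.zero Q, add = add Q, smult = smult Q,
          component = (\<lambda>u. (\<lambda>x. N +>\<^bsub>M\<^esub> x) ` component M u)\<rparr>)"

section \<open>Presentation matrices\<close>

text \<open>
  In homogeneous bases the \<open>(i, j)\<close> entry of a morphism between free modules is a scalar times the
  monomial whose exponent is the column grade minus the row grade, and it vanishes unless the row
  grade is below the column grade.  Hence the scalars and the grades determine the matrix.
\<close>

record 'd graded_matrix =
  row_grades :: "'d grade list"
  col_grades :: "'d grade list"
  entry :: "nat \<Rightarrow> nat \<Rightarrow> bit"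

definition valid_graded_matrix :: "'d::finite graded_matrix \<Rightarrow> bool" where
  "valid_graded_matrix P \<longleftrightarrow>
     (\<forall>i < length (row_grades P). \<forall>j < length (col_grades P).
        entry P i j \<noteq> 0 \<longrightarrow> row_grades P ! i \<le> col_grades P ! j)"

definition poly_entry :: "'d::finite graded_matrix \<Rightarrow> nat \<Rightarrow> nat \<Rightarrow> 'd polynomial" where
  "poly_entry P i j =
     Poly_Mapping.single (grade_exponent (col_grades P ! j - row_grades P ! i)) (entry P i j)"

definition free_module :: "'d::finite grade list \<Rightarrow> (nat \<Rightarrow>\<^sub>0 'd polynomial, 'd) gmod" where
  "free_module gs =
     \<lparr>carrier = {v. Poly_Mapping.keys v \<subseteq> {..<length gs}},
      monoid.mult = undefined, one = undefined, ring.zero = 0, add = (+),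
      smult = (\<lambda>p. Poly_Mapping.map ((*) p)),
      component = (\<lambda>u. {v. Poly_Mapping.keys v \<subseteq> {..<length gs} \<and>
        (\<forall>i < length gs. \<forall>\<alpha> \<in> Poly_Mapping.keys (Poly_Mapping.lookup v i). gs ! i + exponent_grade \<alpha> = u)})\<rparr>"

definition matrix_map ::
    "'d::finite graded_matrix \<Rightarrow> (nat \<Rightarrow>\<^sub>0 'd polynomial) \<Rightarrow> (nat \<Rightarrow>\<^sub>0 'd polynomial)" where
  "matrix_map P v =
     (\<Sum>i < length (row_grades P). Poly_Mapping.single i
        (\<Sum>j < length (col_grades P). poly_entry P i j * Poly_Mapping.lookup v j))"

definition cokernel :: "'d::finite graded_matrix \<Rightarrow> ((nat \<Rightarrow>\<^sub>0 'd polynomial) set, 'd) gmod" where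
  "cokernel P =
     graded_quotient (free_module (row_grades P))
       (matrix_map P ` carrier (free_module (col_grades P)))"

definition is_presentation_matrix :: "'d::finite graded_matrix \<Rightarrow> ('m, 'd) gmod \<Rightarrow> bool" where
  "is_presentation_matrix P M \<longleftrightarrow> valid_graded_matrix P \<and> graded_iso (cokernel P) M"

section \<open>Simplicial filtrations and their homology\<close>

definition simplicial_complex :: "'v set set \<Rightarrow> bool" where
  "simplicial_complex K \<longleftrightarrow>
     (\<forall>s \<in> K. finite s \<and> s \<noteq> {} \<and> (\<forall>t. t \<subseteq> s \<and> t \<noteq> {} \<longrightarrow> t \<in> K))"

definition simplicial_filtration :: "('d::finite grade \<Rightarrow> 'v set set) \<Rightarrow> bool" where
  "simplicial_filtration X \<longleftrightarrow>
     (\<forall>u. simplicial_complex (X u)) \<and> (\<forall>u i. X u \<subseteq> X (u + axis i 1))"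

definition simplices :: "('d grade \<Rightarrow> 'v set set) \<Rightarrow> 'v set set" where
  "simplices X = (\<Union>u. X u)"

definition one_critical :: "('d::finite grade \<Rightarrow> 'v set set) \<Rightarrow> bool" where
  "one_critical X \<longleftrightarrow> (\<forall>s \<in> simplices X. \<exists>!g. \<forall>u. s \<in> X u \<longleftrightarrow> g \<le> u)"

definition birth_grade :: "('d::finite grade \<Rightarrow> 'v set set) \<Rightarrow> 'v set \<Rightarrow> 'd grade" where
  "birth_grade X s = (THE g. \<forall>u. s \<in> X u \<longleftrightarrow> g \<le> u)"

definition new_simplices :: "('d::finite grade \<Rightarrow> 'v set set) \<Rightarrow> 'd grade \<Rightarrow> 'v set set" where
  "new_simplices X u = X u - (\<Union>v \<in> {v. v < u}. X v)"

type_synonym 'v chain = "'v set \<Rightarrow>\<^sub>0 bit"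

definition chains :: "'v set set \<Rightarrow> nat \<Rightarrow> 'v chain set" where
  "chains K k = {c. Poly_Mapping.keys c \<subseteq> {s \<in> K. card s = Suc k}}"

text \<open>Signs are irrelevant modulo 2; the empty face is left out, so homology is not reduced.\<close>

definition boundary :: "'v chain \<Rightarrow> 'v chain" where
  "boundary c =
     (\<Sum>s \<in> Poly_Mapping.keys c. \<Sum>v \<in> {v \<in> s. s - {v} \<noteq> {}}. Poly_Mapping.single (s - {v}) (Poly_Mapping.lookup c s))"

definition cycle_module :: "'v set set \<Rightarrow> nat \<Rightarrow> (bit, 'v chain) module" where
  "cycle_module K k =
     \<lparr>carrier = {c \<in> chains K k. boundary c = 0},
      monoid.mult = undefined, one = undefined, ring.zero = 0, add = (+),
      smult = (\<lambda>a. Poly_Mapping.map ((*) a))\<rparr>"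

definition boundaries :: "'v set set \<Rightarrow> nat \<Rightarrow> 'v chain set" where
  "boundaries K k = boundary ` chains K (Suc k)"

definition homology :: "nat \<Rightarrow> 'v set set \<Rightarrow> (bit, 'v chain set) module" where
  "homology k K = quotient_module (cycle_module K k) (boundaries K k)"

text \<open>The map into the homology of \<open>L\<close> induced by the inclusion of a subcomplex.\<close>

definition inclusion_map :: "nat \<Rightarrow> 'v set set \<Rightarrow> 'v chain set \<Rightarrow> 'v chain set" where
  "inclusion_map k L S = (\<Union>c \<in> S. boundaries L k +>\<^bsub>cycle_module L k\<^esub> c)"

text \<open>
  Elements of the direct sum over all grades are finitely supported families of classes.  Each variable
  acts by the maps induced by the inclusions, so the monomial of exponent \<open>\<alpha>\<close> acts by the map
  induced by the inclusion of \<open>X (v - exponent_grade \<alpha>)\<close> into \<open>X v\<close>.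
\<close>

definition persistent_homology ::
    "nat \<Rightarrow> ('d::finite grade \<Rightarrow> 'v set set) \<Rightarrow> ('d grade \<Rightarrow> 'v chain set, 'd) gmod" where
  "persistent_homology k X =
     (let C = {z. (\<forall>u. z u \<in> carrier (homology k (X u))) \<and>
                  finite {u. z u \<noteq> \<zero>\<^bsub>homology k (X u)\<^esub>}}
      in \<lparr>carrier = C, monoid.mult = undefined, one = undefined,
          ring.zero = (\<lambda>u. \<zero>\<^bsub>homology k (X u)\<^esub>),
          add = (\<lambda>y z u. y u \<oplus>\<^bsub>homology k (X u)\<^esub> z u),
          smult = (\<lambda>p z v. \<Oplus>\<^bsub>homology k (X v)\<^esub>\<alpha> \<in> Poly_Mapping.keys p.
            Poly_Mapping.lookup p \<alpha> \<odot>\<^bsub>homology k (X v)\<^esub> inclusion_map k (X v) (z (v - exponent_grade \<alpha>))),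
          component = (\<lambda>u. {z \<in> C. \<forall>v. v \<noteq> u \<longrightarrow> z v = \<zero>\<^bsub>homology k (X v)\<^esub>})\<rparr>)"

section \<open>Model of computation\<close>

text \<open>
  A word RAM with three sorts of data: words (natural numbers, used for counting and addressing),
  elements of the field with two elements, and grades.  There are registers of each sort and
  random-access arrays of each sort, the latter indexed by words.  Grades are opaque: they can be
  moved and compared, nothing else.  Every instruction and every test costs one unit.
  A run gets stuck when a word reaches the word bound \<open>W\<close>; algorithms are run with \<open>W\<close> polynomial in
  the input size (words of logarithmic length), so that unit-cost word arithmetic cannot be abused.
\<close>

datatype word_op = WAdd | WSub | WMul | WDiv | WMod
datatype field_op = FAdd | FSub | FMul | FDiv

datatype instr =
    WConst nat nat             \<comment> \<open>target register, constant\<close>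
  | WOp word_op nat nat nat    \<comment> \<open>target register, two source registers\<close>
  | WLoad nat nat nat          \<comment> \<open>target register, array, register holding the index\<close>
  | WStore nat nat nat         \<comment> \<open>array, register holding the index, source register\<close>
  | FConst nat bit
  | FOp field_op nat nat nat
  | FLoad nat nat nat
  | FStore nat nat nat
  | GMove nat nat              \<comment> \<open>target register, source register\<close>
  | GLoad nat nat nat
  | GStore nat nat nat

datatype test = WLess nat nat | WEq nat nat | FEq nat nat | GLe nat nat

datatype program =
    Skip
  | Do instr
  | Seq program program
  | Cond test program program
  | While test program

record 'g state =
  wreg :: "nat \<Rightarrow> nat"
  freg :: "nat \<Rightarrow> bit"
  greg :: "nat \<Rightarrow> 'g"
  warr :: "nat \<Rightarrow> nat \<Rightarrow> nat"
  farr :: "nat \<Rightarrow> nat \<Rightarrow> bit"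
  garr :: "nat \<Rightarrow> nat \<Rightarrow> 'g"

fun eval_word_op :: "word_op \<Rightarrow> nat \<Rightarrow> nat \<Rightarrow> nat" where
  "eval_word_op WAdd x y = x + y"
| "eval_word_op WSub x y = x - y"
| "eval_word_op WMul x y = x * y"
| "eval_word_op WDiv x y = x div y"
| "eval_word_op WMod x y = x mod y"

fun eval_field_op :: "field_op \<Rightarrow> bit \<Rightarrow> bit \<Rightarrow> bit" where
  "eval_field_op FAdd x y = x + y"
| "eval_field_op FSub x y = x - y"
| "eval_field_op FMul x y = x * y"
| "eval_field_op FDiv x y = x / y"

definition array_write :: "(nat \<Rightarrow> nat \<Rightarrow> 'x) \<Rightarrow> nat \<Rightarrow> nat \<Rightarrow> 'x \<Rightarrow> nat \<Rightarrow> nat \<Rightarrow> 'x" where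
  "array_write m a i x = m(a := (m a)(i := x))"

fun effect :: "instr \<Rightarrow> 'g state \<Rightarrow> 'g state" where
  "effect (WConst r c) s = s\<lparr>wreg := (wreg s)(r := c)\<rparr>"
| "effect (WOp f r p q) s = s\<lparr>wreg := (wreg s)(r := eval_word_op f (wreg s p) (wreg s q))\<rparr>"
| "effect (WLoad r a i) s = s\<lparr>wreg := (wreg s)(r := warr s a (wreg s i))\<rparr>"
| "effect (WStore a i r) s = s\<lparr>warr := array_write (warr s) a (wreg s i) (wreg s r)\<rparr>"
| "effect (FConst r c) s = s\<lparr>freg := (freg s)(r := c)\<rparr>"
| "effect (FOp f r p q) s = s\<lparr>freg := (freg s)(r := eval_field_op f (freg s p) (freg s q))\<rparr>"
| "effect (FLoad r a i) s = s\<lparr>freg := (freg s)(r := farr s a (wreg s i))\<rparr>"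
| "effect (FStore a i r) s = s\<lparr>farr := array_write (farr s) a (wreg s i) (freg s r)\<rparr>"
| "effect (GMove r p) s = s\<lparr>greg := (greg s)(r := greg s p)\<rparr>"
| "effect (GLoad r a i) s = s\<lparr>greg := (greg s)(r := garr s a (wreg s i))\<rparr>"
| "effect (GStore a i r) s = s\<lparr>garr := array_write (garr s) a (wreg s i) (greg s r)\<rparr>"

fun word_fits :: "nat \<Rightarrow> instr \<Rightarrow> 'g state \<Rightarrow> bool" where
  "word_fits W (WConst r c) s \<longleftrightarrow> c < W"
| "word_fits W (WOp f r p q) s \<longleftrightarrow> eval_word_op f (wreg s p) (wreg s q) < W"
| "word_fits W _ s \<longleftrightarrow> True"

fun holds :: "test \<Rightarrow> 'g::ord state \<Rightarrow> bool" where
  "holds (WLess p q) s \<longleftrightarrow> wreg s p < wreg s q"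
| "holds (WEq p q) s \<longleftrightarrow> wreg s p = wreg s q"
| "holds (FEq p q) s \<longleftrightarrow> freg s p = freg s q"
| "holds (GLe p q) s \<longleftrightarrow> greg s p \<le> greg s q"

text \<open>\<open>exec W c s t s'\<close>: started in \<open>s\<close>, the program \<open>c\<close> halts after \<open>t\<close> steps in \<open>s'\<close>.\<close>

inductive exec :: "nat \<Rightarrow> program \<Rightarrow> 'g::ord state \<Rightarrow> nat \<Rightarrow> 'g state \<Rightarrow> bool" for W where
  Skip: "exec W Skip s 0 s"
| Do: "word_fits W i s \<Longrightarrow> exec W (Do i) s 1 (effect i s)"
| Seq: "exec W c s t s' \<Longrightarrow> exec W c' s' t' s'' \<Longrightarrow> exec W (Seq c c') s (t + t') s''"
| CondTrue: "holds b s \<Longrightarrow> exec W c s t s' \<Longrightarrow> exec W (Cond b c c') s (1 + t) s'"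
| CondFalse: "\<not> holds b s \<Longrightarrow> exec W c' s t s' \<Longrightarrow> exec W (Cond b c c') s (1 + t) s'"
| WhileFalse: "\<not> holds b s \<Longrightarrow> exec W (While b c) s 1 s"
| WhileTrue: "holds b s \<Longrightarrow> exec W c s t s' \<Longrightarrow> exec W (While b c) s' t' s'' \<Longrightarrow>
    exec W (While b c) s (1 + t + t') s''"

definition blank_state :: "'g::zero state" where
  "blank_state =
     \<lparr>wreg = (\<lambda>_. 0), freg = (\<lambda>_. 0), greg = (\<lambda>_. 0),
      warr = (\<lambda>_ _. 0), farr = (\<lambda>_ _. 0), garr = (\<lambda>_ _. 0)\<rparr>"

definition list_array :: "'x::zero list \<Rightarrow> nat \<Rightarrow> 'x" where
  "list_array xs i = (if i < length xs then xs ! i else 0)"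

section \<open>Matrix multiplication\<close>

text \<open>
  Square matrices are stored row by row.  The input contains no grades; the type of integers is
  an arbitrary choice for the unused grade registers.
\<close>

definition matmul_input ::
    "nat \<Rightarrow> (nat \<Rightarrow> nat \<Rightarrow> bit) \<Rightarrow> (nat \<Rightarrow> nat \<Rightarrow> bit) \<Rightarrow> int state" where
  "matmul_input N A B = blank_state
     \<lparr>wreg := (\<lambda>_. 0)(0 := N),
      farr := (\<lambda>_ _. 0)
        (0 := list_array (concat (map (\<lambda>i. map (A i) [0..<N]) [0..<N])),
         1 := list_array (concat (map (\<lambda>i. map (B i) [0..<N]) [0..<N])))\<rparr>"

definition matmul_exponent :: "real \<Rightarrow> bool" where
  "matmul_exponent \<omega> \<longleftrightarrow>
     (\<exists>prog k T. (\<lambda>N. real (T N)) \<in> O(\<lambda>N. real N powr \<omega>) \<and>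
        (\<forall>N A B. \<exists>t s. exec ((N + 2) ^ k) prog (matmul_input N A B) t s \<and> t \<le> T N \<and>
           (\<forall>i<N. \<forall>j<N. farr s 2 (i * N + j) = (\<Sum>l<N. A i l * B l j))))"

section \<open>Input and output of the decomposition algorithm\<close>

text \<open>
  The simplices are given as a list \<open>ss\<close>.  A simplex is described by its number of vertices
  (word array 0), the increasing list of its vertices (row of word array 1, rows having length \<open>n\<close>),
  and its birth grade (grade array 0); a vertex is named by its position in \<open>ss\<close>.
  Register 0 contains the number \<open>n\<close> of simplices.
\<close>

definition vertex_positions :: "'v set list \<Rightarrow> 'v set \<Rightarrow> nat list" where
  "vertex_positions ss s = filter (\<lambda>j. card (ss ! j) = 1 \<and> ss ! j \<subseteq> s) [0..<length ss]"

definition filtration_input ::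
    "('d::finite grade \<Rightarrow> 'v set set) \<Rightarrow> 'v set list \<Rightarrow> 'd grade state" where
  "filtration_input X ss = blank_state
     \<lparr>wreg := (\<lambda>_. 0)(0 := length ss),
      warr := (\<lambda>_ _. 0)
        (0 := list_array (map card ss),
         1 := (\<lambda>x. if x < length ss * length ss
                   then list_array (vertex_positions ss (ss ! (x div length ss))) (x mod length ss)
                   else 0)),
      garr := (\<lambda>_ _. 0)(0 := list_array (map (birth_grade X) ss))\<rparr>"

text \<open>
  Register 0 contains the number of matrices.  For the \<open>l\<close>-th matrix, word arrays 0 and 1 contain
  the numbers of rows and columns; word arrays 2, 3 and 4 contain the addresses of the row grades
  in grade array 0, of the column grades in grade array 1, and of the entries (row by row) in
  field array 0.
\<close>

definition output_matrix :: "'d grade state \<Rightarrow> nat \<Rightarrow> 'd graded_matrix" where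
  "output_matrix s l =
     \<lparr>row_grades = map (\<lambda>i. garr s 0 (warr s 2 l + i)) [0..<warr s 0 l],
      col_grades = map (\<lambda>j. garr s 1 (warr s 3 l + j)) [0..<warr s 1 l],
      entry = (\<lambda>i j. farr s 0 (warr s 4 l + i * warr s 1 l + j))\<rparr>"

definition output_matrices :: "'d grade state \<Rightarrow> 'd graded_matrix list" where
  "output_matrices s = map (output_matrix s) [0..<wreg s 0]"

end

theory Submission
  imports Defs "HOL-Library.Function_Algebras"
begin

text \<open>
  Order the simplices as \<open>0, ..., n - 1\<close>. Over grade \<open>u\<close> let \<open>F u\<close> be spanned by the vertices born by \<open>u\<close> and
  \<open>B u\<close> by the boundaries of the edges born by \<open>u\<close>; then \<open>H_0\<close> is the quotient of these two filtrations. A graded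
  endomorphism is represented by a matrix \<open>M\<close> over the two-element field with \<open>M i j = 0\<close> unless \<open>f i \<le> f j\<close>
  (\<open>tri\<close>) that sends the boundary of each edge \<open>e\<close> into \<open>B (f e)\<close> (\<open>endo\<close>). Births are pairwise distinct, so
  such matrices are triangular: taking diagonals is multiplicative (\<open>diag_mm\<close>), and a matrix with zero diagonal is
  nilpotent (\<open>strict_nilpotent\<close>). Over the two-element field every diagonal is idempotent, so repeated squaring
  turns any endomorphism into an idempotent with the same diagonal (\<open>sqs_idempotent\<close>).

  Hence a summand, given by an idempotent \<open>E\<close>, splits as soon as some endomorphism takes both values 0 and 1 on the
  diagonal positions where \<open>E\<close> is 1 (\<open>separates\<close>, \<open>idems_split\<close>). Diagonals are linear, so it suffices to test a
  spanning set of endomorphisms (\<open>unseparated\<close>). If nothing separates, each endomorphism of the summand differs from 0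
  or from the identity by a nilpotent, its idempotents are trivial, and the summand is indecomposable
  (\<open>summand_idempotents\<close>, \<open>indecomposable_criterion\<close>). Adjoining the relations \<open>x + E x\<close> to those of the edges
  presents the summand (\<open>part_presentation\<close>, \<open>cokernel_iso\<close>).

  The spanning set starts from all elementary triangular matrices, at most \<open>n\<^sup>2\<close> of them, and is restricted edge by edge.
  Modulo \<open>B (f e)\<close> the image of the boundary of \<open>e\<close> is recorded by the connected components at grade \<open>f e\<close>
  (\<open>label_combos\<close>), that is, by \<open>n\<close> linear functionals, whose common kernel is found by Gaussian elimination
  (\<open>elim_step\<close>). Row operations on vectors of length \<open>n\<^sup>2\<close> are delayed and carried out as \<open>n\<^sup>2\<close> products of
  \<open>n\<close> by \<open>n\<close> matrices per edge. Altogether there are \<open>n\<^sup>3\<close> products and five nested loops, and since \<open>2 \<le> \<omega>\<close> both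
  \<open>n\<^sup>3 n\<^sup>\<omega>\<close> and \<open>n\<^sup>5\<close> are at most \<open>n\<close> to the power \<open>2 \<omega> + 1\<close> (\<open>cost_asymptotics\<close>).

  The program is written in a small structured language in which the cost of a statement depends on \<open>n\<close> only. It is compiled
  to the machine (\<open>compile_correct\<close>), with the given multiplication program as a subroutine.
\<close>

section \<open>Running a program in displaced memory\<close>

fun instr_below :: "nat => instr => bool" where
  "instr_below R (WConst r c) \<longleftrightarrow> r < R"
| "instr_below R (WOp f r p q) \<longleftrightarrow> r < R & p < R & q < R"
| "instr_below R (WLoad r a i) \<longleftrightarrow> r < R & a < R & i < R"
| "instr_below R (WStore a i r) \<longleftrightarrow> r < R & a < R & i < R"
| "instr_below R (FConst r c) \<longleftrightarrow> r < R"
| "instr_below R (FOp f r p q) \<longleftrightarrow> r < R & p < R & q < R"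
| "instr_below R (FLoad r a i) \<longleftrightarrow> r < R & a < R & i < R"
| "instr_below R (FStore a i r) \<longleftrightarrow> r < R & a < R & i < R"
| "instr_below R (GMove r p) \<longleftrightarrow> r < R & p < R"
| "instr_below R (GLoad r a i) \<longleftrightarrow> r < R & a < R & i < R"
| "instr_below R (GStore a i r) \<longleftrightarrow> r < R & a < R & i < R"

fun test_below :: "nat => test => bool" where
  "test_below R (WLess p q) \<longleftrightarrow> p < R & q < R"
| "test_below R (WEq p q) \<longleftrightarrow> p < R & q < R"
| "test_below R (FEq p q) \<longleftrightarrow> p < R & q < R"
| "test_below R (GLe p q) \<longleftrightarrow> p < R & q < R"

primrec prog_below :: "nat => program => bool" where
  "prog_below R Skip \<longleftrightarrow> True"
| "prog_below R (Do i) \<longleftrightarrow> instr_below R i"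
| "prog_below R (Seq c d) \<longleftrightarrow> prog_below R c & prog_below R d"
| "prog_below R (Cond b c d) \<longleftrightarrow> test_below R b & prog_below R c & prog_below R d"
| "prog_below R (While b c) \<longleftrightarrow> test_below R b & prog_below R c"

lemma instr_below_mono: "instr_below R i ==> R \<le> R' ==> instr_below R' i"
  by (cases i) auto

lemma test_below_mono: "test_below R b ==> R \<le> R' ==> test_below R' b"
  by (cases b) auto

lemma prog_below_mono: "prog_below R c ==> R \<le> R' ==> prog_below R' c"
  by (induction c) (auto intro: instr_below_mono test_below_mono)

lemma instr_below_exists: "\<exists>R. instr_below R i"
proof (cases i)
  case (WConst r c) then show ?thesis by (intro exI[of _ "Suc r"]) simp
next
  case (WOp f r p q) then show ?thesis by (intro exI[of _ "Suc (r + p + q)"]) simp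
next
  case (WLoad r p q) then show ?thesis by (intro exI[of _ "Suc (r + p + q)"]) simp
next
  case (WStore r p q) then show ?thesis by (intro exI[of _ "Suc (r + p + q)"]) simp
next
  case (FConst r c) then show ?thesis by (intro exI[of _ "Suc r"]) simp
next
  case (FOp f r p q) then show ?thesis by (intro exI[of _ "Suc (r + p + q)"]) simp
next
  case (FLoad r p q) then show ?thesis by (intro exI[of _ "Suc (r + p + q)"]) simp
next
  case (FStore r p q) then show ?thesis by (intro exI[of _ "Suc (r + p + q)"]) simp
next
  case (GMove r p) then show ?thesis by (intro exI[of _ "Suc (r + p)"]) simp
next
  case (GLoad r p q) then show ?thesis by (intro exI[of _ "Suc (r + p + q)"]) simp
next
  case (GStore r p q) then show ?thesis by (intro exI[of _ "Suc (r + p + q)"]) simp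
qed

lemma test_below_exists: "\<exists>R. test_below R b"
proof -
  have "\<exists>R>p. q < R" for p q :: nat
    by (intro exI[of _ "Suc (p + q)"]) simp
  then show ?thesis by (cases b) auto
qed

lemma prog_below_exists: "\<exists>R. prog_below R c"
proof (induction c)
  case Skip then show ?case by simp
next
  case (Do i) then show ?case using instr_below_exists by simp
next
  case (Seq c d)
  then obtain R R' where "prog_below R c" "prog_below R' d" by blast
  then have "prog_below (max R R') (Seq c d)" by (auto intro: prog_below_mono)
  then show ?case ..
next
  case (Cond b c d)
  then obtain R R' where "prog_below R c" "prog_below R' d" by blast
  moreover obtain R'' where "test_below R'' b" using test_below_exists by blast
  ultimately have "prog_below (max R (max R' R'')) (Cond b c d)"
    by (auto intro: prog_below_mono test_below_mono)
  then show ?case ..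
next
  case (While b c)
  then obtain R where "prog_below R c" by blast
  moreover obtain R'' where "test_below R'' b" using test_below_exists by blast
  ultimately have "prog_below (max R R'') (While b c)"
    by (auto intro: prog_below_mono test_below_mono)
  then show ?case ..
qed

fun shift_instr :: "nat => nat => instr => program" where
  "shift_instr b t (WLoad r a i) = Seq (Do (WOp WAdd t i b)) (Do (WLoad r a t))"
| "shift_instr b t (WStore a i r) = Seq (Do (WOp WAdd t i b)) (Do (WStore a t r))"
| "shift_instr b t (FLoad r a i) = Seq (Do (WOp WAdd t i b)) (Do (FLoad r a t))"
| "shift_instr b t (FStore a i r) = Seq (Do (WOp WAdd t i b)) (Do (FStore a t r))"
| "shift_instr b t (GLoad r a i) = Seq (Do (WOp WAdd t i b)) (Do (GLoad r a t))"
| "shift_instr b t (GStore a i r) = Seq (Do (WOp WAdd t i b)) (Do (GStore a t r))"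
| "shift_instr b t i = Do i"

primrec shift_prog :: "nat => nat => program => program" where
  "shift_prog b t Skip = Skip"
| "shift_prog b t (Do i) = shift_instr b t i"
| "shift_prog b t (Seq c d) = Seq (shift_prog b t c) (shift_prog b t d)"
| "shift_prog b t (Cond x c d) = Cond x (shift_prog b t c) (shift_prog b t d)"
| "shift_prog b t (While x c) = While x (shift_prog b t c)"

text \<open>The embedded program may have another type of grades; grades are invisible to it because all of them are 0 and it can only compare them.\<close>

definition displaced :: "nat => nat => nat => 'a::zero state => 'b::zero state => bool" where
  "displaced R b S s s' \<longleftrightarrow>
     (\<forall>r<R. wreg s' r = wreg s r & wreg s r < S & freg s' r = freg s r & greg s r = 0 & greg s' r = 0) &
     (\<forall>a<R. \<forall>i<S. warr s' a (b + i) = warr s a i & warr s a i < S &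
        farr s' a (b + i) = farr s a i & garr s a i = 0 & garr s' a (b + i) = 0)"

definition outside_same :: "nat => nat => nat => nat => 'b state => 'b state => bool" where
  "outside_same R t b S s s' \<longleftrightarrow>
     (\<forall>r\<ge>R. r ~= t --> wreg s' r = wreg s r) & (\<forall>r\<ge>R. freg s' r = freg s r) &
     (\<forall>a i. \<not> (a < R & b \<le> i & i < b + S) -->
        warr s' a i = warr s a i & farr s' a i = farr s a i & garr s' a i = garr s a i)"

lemma outside_same_refl: "outside_same R t b S s s"
  by (simp add: outside_same_def)

lemma outside_same_trans:
  "outside_same R t b S s s' ==> outside_same R t b S s' s'' ==> outside_same R t b S s s''"
  by (simp add: outside_same_def)

lemma exec_one: "word_fits W i s ==> s' = effect i s ==> exec W (Do i) s (Suc 0) s'"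
  using exec.Do[of W i s] by simp

lemma exec_two: "word_fits W i s ==> word_fits W j (effect i s) ==> s' = effect j (effect i s) ==>
    exec W (Seq (Do i) (Do j)) s 2 s'"
  using exec.Seq[OF exec.Do exec.Do, of W i s j] by (simp add: numeral_2_eq_2)

lemma displaced_instr:
  fixes s :: "'a::{zero,ord} state" and s' :: "'b::{zero,ord} state"
  assumes "word_fits W0 i s" "instr_below R i" "displaced R b S s s'" "wreg s' br = b"
    "R \<le> br" "R \<le> t" "t ~= br" "W0 \<le> S" "W0 \<le> W" "b + S \<le> W"
  shows "\<exists>t' s1'. exec W (shift_instr br t i) s' t' s1' & t' \<le> 2 & displaced R b S (effect i s) s1' &
     outside_same R t b S s' s1'"
proof (cases i)
  case (WConst r c)
  then show ?thesis using assms
    by (intro exI[of _ 1] exI[of _ "effect i s'"])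
      (auto intro!: exec_one simp: displaced_def outside_same_def)
next
  case (WOp f r p q)
  then show ?thesis using assms
    by (intro exI[of _ 1] exI[of _ "effect i s'"])
      (auto intro!: exec_one simp: displaced_def outside_same_def)
next
  case (FConst r c)
  then show ?thesis using assms
    by (intro exI[of _ 1] exI[of _ "effect i s'"])
      (auto intro!: exec_one simp: displaced_def outside_same_def)
next
  case (FOp f r p q)
  then show ?thesis using assms
    by (intro exI[of _ 1] exI[of _ "effect i s'"])
      (auto intro!: exec_one simp: displaced_def outside_same_def)
next
  case (GMove r p)
  then show ?thesis using assms
    by (intro exI[of _ 1] exI[of _ "effect i s'"])
      (auto intro!: exec_one simp: displaced_def outside_same_def)
next
  case (WLoad r a x)
  then have "wreg s' x + b < W" using assms by (fastforce simp: displaced_def)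
  with WLoad show ?thesis using assms
    by (intro exI[of _ 2] exI[of _ "effect (WLoad r a t) (effect (WOp WAdd t x br) s')"])
      (auto intro!: exec_two simp: displaced_def outside_same_def add.commute)
next
  case (FLoad r a x)
  then have "wreg s' x + b < W" using assms by (fastforce simp: displaced_def)
  with FLoad show ?thesis using assms
    by (intro exI[of _ 2] exI[of _ "effect (FLoad r a t) (effect (WOp WAdd t x br) s')"])
      (auto intro!: exec_two simp: displaced_def outside_same_def add.commute)
next
  case (GLoad r a x)
  then have "wreg s' x + b < W" using assms by (fastforce simp: displaced_def)
  with GLoad show ?thesis using assms
    by (intro exI[of _ 2] exI[of _ "effect (GLoad r a t) (effect (WOp WAdd t x br) s')"])
      (auto intro!: exec_two simp: displaced_def outside_same_def add.commute)
next
  case (WStore a x r)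
  then have "wreg s' x + b < W" using assms by (fastforce simp: displaced_def)
  with WStore show ?thesis using assms
    by (intro exI[of _ 2] exI[of _ "effect (WStore a t r) (effect (WOp WAdd t x br) s')"])
      (auto intro!: exec_two simp: displaced_def outside_same_def array_write_def add.commute)
next
  case (FStore a x r)
  then have "wreg s' x + b < W" using assms by (fastforce simp: displaced_def)
  with FStore show ?thesis using assms
    by (intro exI[of _ 2] exI[of _ "effect (FStore a t r) (effect (WOp WAdd t x br) s')"])
      (auto intro!: exec_two simp: displaced_def outside_same_def array_write_def add.commute)
next
  case (GStore a x r)
  then have "wreg s' x + b < W" using assms by (fastforce simp: displaced_def)
  with GStore show ?thesis using assms
    by (intro exI[of _ 2] exI[of _ "effect (GStore a t r) (effect (WOp WAdd t x br) s')"])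
      (auto intro!: exec_two simp: displaced_def outside_same_def array_write_def add.commute)
qed

lemma displaced_holds:
  fixes s :: "'a::{zero,preorder} state" and s' :: "'b::{zero,preorder} state"
  shows "displaced R b S s s' ==> test_below R x ==> holds x s' \<longleftrightarrow> holds x s"
  by (cases x) (auto simp: displaced_def)

text \<open>A multiplication program is only known to work on blank memory. Adding a base address to every access lets it run in a blank zone of a larger memory, at most doubling the time.\<close>

lemma displaced_exec:
  fixes s :: "'a::{zero,preorder} state" and s' :: "'b::{zero,preorder} state"
  assumes "exec W0 c s tm s1" "prog_below R c" "displaced R b S s s'" "wreg s' br = b"
    "R \<le> br" "R \<le> t" "t ~= br" "W0 \<le> S" "W0 \<le> W" "b + S \<le> W"
  shows "\<exists>t' s1'. exec W (shift_prog br t c) s' t' s1' & t' \<le> 2 * tm & displaced R b S s1 s1' &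
     outside_same R t b S s' s1'"
  using assms(1-4)
proof (induction arbitrary: s' rule: exec.induct)
  case (Skip s)
  then show ?case by (auto intro!: exec.Skip exI[of _ s'] simp: outside_same_refl)
next
  case (Do i s)
  then show ?case using displaced_instr[OF Do(1) _ Do(3) Do(4)] assms(5-) by auto
next
  case (Seq c s tm1 s1 d tm2 s2)
  obtain t1 s1' where 1: "exec W (shift_prog br t c) s' t1 s1'" "t1 \<le> 2 * tm1"
      "displaced R b S s1 s1'" "outside_same R t b S s' s1'"
    using Seq.IH(1)[OF _ Seq.prems(2,3)] Seq.prems(1) by auto
  have "wreg s1' br = b" using 1(4) Seq.prems assms(5,7) by (auto simp: outside_same_def)
  then obtain t2 s2' where 2: "exec W (shift_prog br t d) s1' t2 s2'" "t2 \<le> 2 * tm2"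
      "displaced R b S s2 s2'" "outside_same R t b S s1' s2'"
    using Seq.IH(2)[OF _ 1(3)] Seq.prems by auto
  show ?case
    using exec.Seq[OF 1(1) 2(1)] 1(2) 2(2,3) outside_same_trans[OF 1(4) 2(4)] by fastforce
next
  case (CondTrue x s c tm1 s1 d)
  obtain t1 s1' where 1: "exec W (shift_prog br t c) s' t1 s1'" "t1 \<le> 2 * tm1"
      "displaced R b S s1 s1'" "outside_same R t b S s' s1'"
    using CondTrue.IH[OF _ CondTrue.prems(2,3)] CondTrue.prems(1) by auto
  have "holds x s'" using CondTrue.hyps(1) displaced_holds[OF CondTrue.prems(2)] CondTrue.prems(1) by auto
  from exec.CondTrue[OF this 1(1)] 1 show ?case by fastforce
next
  case (CondFalse x s c tm1 s1 d)
  obtain t1 s1' where 1: "exec W (shift_prog br t c) s' t1 s1'" "t1 \<le> 2 * tm1"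
      "displaced R b S s1 s1'" "outside_same R t b S s' s1'"
    using CondFalse.IH[OF _ CondFalse.prems(2,3)] CondFalse.prems(1) by auto
  have "\<not> holds x s'" using CondFalse.hyps(1) displaced_holds[OF CondFalse.prems(2)] CondFalse.prems(1) by auto
  from exec.CondFalse[OF this 1(1)] 1 show ?case by fastforce
next
  case (WhileFalse x s c)
  have "\<not> holds x s'" using WhileFalse.hyps(1) displaced_holds[OF WhileFalse.prems(2)] WhileFalse.prems(1) by auto
  from exec.WhileFalse[OF this] show ?case
    using WhileFalse by (fastforce simp: outside_same_refl)
next
  case (WhileTrue x s c tm1 s1 tm2 s2)
  have h: "holds x s'" using WhileTrue.hyps(1) displaced_holds[OF WhileTrue.prems(2)] WhileTrue.prems(1) by auto
  obtain t1 s1' where 1: "exec W (shift_prog br t c) s' t1 s1'" "t1 \<le> 2 * tm1"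
      "displaced R b S s1 s1'" "outside_same R t b S s' s1'"
    using WhileTrue.IH(1)[OF _ WhileTrue.prems(2,3)] WhileTrue.prems(1) by auto
  have "wreg s1' br = b" using 1(4) WhileTrue.prems assms(5,7) by (auto simp: outside_same_def)
  then obtain t2 s2' where 2: "exec W (shift_prog br t (While x c)) s1' t2 s2'" "t2 \<le> 2 * tm2"
      "displaced R b S s2 s2'" "outside_same R t b S s1' s2'"
    using WhileTrue.IH(2)[OF _ 1(3)] WhileTrue.prems by auto
  have "exec W (shift_prog br t (While x c)) s' (1 + t1 + t2) s2'"
    using exec.WhileTrue[OF h 1(1)] 2(1) by simp
  then show ?case using 1(2) 2(2,3) outside_same_trans[OF 1(4) 2(4)] by fastforce
qed

section \<open>A structured language with static cost\<close>

datatype wexp = WVar nat | WSize nat | WGet nat wexp | WBin word_op wexp wexp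

datatype fexp = FLit bit | FGet nat wexp | FBin field_op fexp fexp
  | FIsEq wexp wexp | FIsLess wexp wexp | FIsLe wexp wexp

datatype stmt =
    Pass
  | Then stmt stmt
  | When fexp stmt
  | For nat nat stmt           \<comment> \<open>loop variable, exponent of the number of iterations\<close>
  | PutW nat wexp wexp
  | PutF nat wexp fexp
  | PutG nat wexp nat wexp     \<comment> \<open>target array and index, source array and index\<close>
  | MatMul nat nat nat         \<comment> \<open>two source arrays, target array\<close>

record 'g mem =
  wmem :: "nat => nat => nat"
  fmem :: "nat => nat => bit"
  gmem :: "nat => nat => 'g"

primrec weval :: "nat => (nat => nat) => 'g mem => wexp => nat" where
  "weval n e h (WVar v) = e v"
| "weval n e h (WSize j) = n ^ j"
| "weval n e h (WGet a x) = wmem h a (weval n e h x)"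
| "weval n e h (WBin f x y) = eval_word_op f (weval n e h x) (weval n e h y)"

primrec feval :: "nat => (nat => nat) => 'g::ord mem => fexp => bit" where
  "feval n e h (FLit b) = b"
| "feval n e h (FGet a x) = fmem h a (weval n e h x)"
| "feval n e h (FBin f x y) = eval_field_op f (feval n e h x) (feval n e h y)"
| "feval n e h (FIsEq x y) = of_bool (weval n e h x = weval n e h y)"
| "feval n e h (FIsLess x y) = of_bool (weval n e h x < weval n e h y)"
| "feval n e h (FIsLe x y) = of_bool (gmem h 0 (weval n e h x) \<le> gmem h 0 (weval n e h y))"

definition word_limit :: "nat => nat" where
  "word_limit n = (n + 2) ^ 4"

primrec run :: "nat => stmt => (nat => nat) => 'g::ord mem => 'g mem" where
  "run n Pass e h = h"
| "run n (Then c d) e h = run n d e (run n c e h)"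
| "run n (When b c) e h = (if feval n e h b = 1 then run n c e h else h)"
| "run n (For v j c) e h = fold (%k. run n c (e(v := k))) [0..<n ^ j] h"
| "run n (PutW a x y) e h =
     h(|wmem := array_write (wmem h) a (weval n e h x) (weval n e h y mod word_limit n)|)"
| "run n (PutF a x y) e h = h(|fmem := array_write (fmem h) a (weval n e h x) (feval n e h y)|)"
| "run n (PutG a x b y) e h =
     h(|gmem := array_write (gmem h) a (weval n e h x) (gmem h b (weval n e h y))|)"
| "run n (MatMul a b c) e h = h(|fmem := (fmem h)(c := %i. if i < n * n
     then \<Sum>l<n. fmem h a (i div n * n + l) * fmem h b (l * n + i mod n) else fmem h c i)|)"

primrec leaves :: "wexp => nat" where
  "leaves (WVar v) = 1"
| "leaves (WSize j) = 1"
| "leaves (WGet a x) = leaves x"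
| "leaves (WBin f x y) = leaves x + leaves y"

primrec wscoped :: "nat set => wexp => bool" where
  "wscoped V (WVar v) \<longleftrightarrow> v \<in> V"
| "wscoped V (WSize j) \<longleftrightarrow> j \<le> 4"
| "wscoped V (WGet a x) \<longleftrightarrow> wscoped V x"
| "wscoped V (WBin f x y) \<longleftrightarrow> wscoped V x & wscoped V y"

definition wexp_ok :: "nat => nat set => wexp => bool" where
  "wexp_ok m V x \<longleftrightarrow> leaves x \<le> m & wscoped V x"

primrec fexp_ok :: "nat => nat set => fexp => bool" where
  "fexp_ok m V (FLit b) \<longleftrightarrow> True"
| "fexp_ok m V (FGet a x) \<longleftrightarrow> wexp_ok m V x"
| "fexp_ok m V (FBin f x y) \<longleftrightarrow> fexp_ok m V x & fexp_ok m V y"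
| "fexp_ok m V (FIsEq x y) \<longleftrightarrow> wexp_ok m V x & wexp_ok m V y"
| "fexp_ok m V (FIsLess x y) \<longleftrightarrow> wexp_ok m V x & wexp_ok m V y"
| "fexp_ok m V (FIsLe x y) \<longleftrightarrow> wexp_ok m V x & wexp_ok m V y"

primrec stmt_ok :: "nat => nat set => stmt => bool" where
  "stmt_ok m V Pass \<longleftrightarrow> True"
| "stmt_ok m V (Then c d) \<longleftrightarrow> stmt_ok m V c & stmt_ok m V d"
| "stmt_ok m V (When b c) \<longleftrightarrow> fexp_ok m V b & stmt_ok m V c"
| "stmt_ok m V (For v j c) \<longleftrightarrow> v < 24 & v \<notin> V & j \<le> 4 & stmt_ok m (insert v V) c"
| "stmt_ok m V (PutW a x y) \<longleftrightarrow> wexp_ok m V x & wexp_ok m V y"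
| "stmt_ok m V (PutF a x y) \<longleftrightarrow> wexp_ok m V x & fexp_ok m V y"
| "stmt_ok m V (PutG a x b y) \<longleftrightarrow> wexp_ok m V x & wexp_ok m V y"
| "stmt_ok m V (MatMul a b c) \<longleftrightarrow> 5 \<le> a & 5 \<le> b & 5 \<le> c"

primrec wcost :: "wexp => nat" where
  "wcost (WVar v) = 2"
| "wcost (WSize j) = 2"
| "wcost (WGet a x) = wcost x + 1"
| "wcost (WBin f x y) = wcost x + wcost y + 1"

primrec fcost :: "fexp => nat" where
  "fcost (FLit b) = 1"
| "fcost (FGet a x) = wcost x + 1"
| "fcost (FBin f x y) = fcost x + fcost y + 1"
| "fcost (FIsEq x y) = wcost x + wcost y + 2"
| "fcost (FIsLess x y) = wcost x + wcost y + 2"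
| "fcost (FIsLe x y) = wcost x + wcost y + 4"

text \<open>\<open>p\<close> is the cost of one matrix product.\<close>

primrec cost :: "nat => nat => stmt => nat" where
  "cost n p Pass = 0"
| "cost n p (Then c d) = cost n p c + cost n p d"
| "cost n p (When b c) = fcost b + 2 + cost n p c"
| "cost n p (For v j c) = n ^ j * (cost n p c + 3) + 2"
| "cost n p (PutW a x y) = wcost x + wcost y + 2"
| "cost n p (PutF a x y) = fcost y + wcost x + 1"
| "cost n p (PutG a x b y) = wcost x + wcost y + 2"
| "cost n p (MatMul a b c) = p"

primrec calls :: "nat => stmt => nat" where
  "calls n Pass = 0"
| "calls n (Then c d) = calls n c + calls n d"
| "calls n (When b c) = calls n c"
| "calls n (For v j c) = n ^ j * calls n c"
| "calls n (PutW a x y) = 0"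
| "calls n (PutF a x y) = 0"
| "calls n (PutG a x b y) = 0"
| "calls n (MatMul a b c) = 1"

section \<open>Compilation\<close>

definition array_name :: "nat => nat => nat" where
  "array_name R a = (if a < 5 then a else R + a)"

lemma array_name_inj: "5 \<le> R ==> array_name R a = array_name R b \<longleftrightarrow> a = b"
  by (auto simp: array_name_def)

abbreviation seq2 :: "program => program => program" (infixr ";;" 60) where
  "c ;; d \<equiv> Seq c d"

primrec compw :: "nat => wexp => nat => program" where
  "compw R (WVar v) t = Do (WConst t 0) ;; Do (WOp WAdd t (R + 16 + v) t)"
| "compw R (WSize j) t = Do (WConst t 0) ;; Do (WOp WAdd t (R + j) t)"
| "compw R (WGet a x) t = compw R x t ;; Do (WLoad t (array_name R a) t)"
| "compw R (WBin f x y) t = (compw R x t ;; compw R y (Suc t)) ;; Do (WOp f t t (Suc t))"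

definition cond_bit :: "nat => test => program" where
  "cond_bit t b = Cond b (Do (FConst t 1)) (Do (FConst t 0))"

definition compw2 :: "nat => wexp => wexp => program" where
  "compw2 R x y = compw R x (R + 40) ;; compw R y (R + 41)"

primrec compf :: "nat => fexp => nat => program" where
  "compf R (FLit b) t = Do (FConst t b)"
| "compf R (FGet a x) t = compw R x (R + 40) ;; Do (FLoad t (array_name R a) (R + 40))"
| "compf R (FBin f x y) t = (compf R x t ;; compf R y (Suc t)) ;; Do (FOp f t t (Suc t))"
| "compf R (FIsEq x y) t = compw2 R x y ;; cond_bit t (WEq (R + 40) (R + 41))"
| "compf R (FIsLess x y) t = compw2 R x y ;; cond_bit t (WLess (R + 40) (R + 41))"
| "compf R (FIsLe x y) t = compw2 R x y ;; (Do (GLoad R 0 (R + 40)) ;; Do (GLoad (R + 1) 0 (R + 41))) ;;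
     cond_bit t (GLe R (R + 1))"

primrec reset_regs :: "nat => program" where
  "reset_regs 0 = Skip"
| "reset_regs (Suc r) = reset_regs r ;; (Do (WConst r 0) ;; Do (FConst r 0))"

definition copy_step :: "nat => nat => nat => nat => nat => program" where
  "copy_step R so a to b =
     (Do (WOp WAdd (R + 9) (R + 8) so) ;; Do (FLoad R a (R + 9))) ;;
     (Do (WOp WAdd (R + 9) (R + 8) to) ;; Do (FStore b (R + 9) R)) ;;
     (Do (WConst (R + 9) 1) ;; Do (WOp WAdd (R + 8) (R + 8) (R + 9)))"

definition copy_code :: "nat => nat => nat => nat => nat => program" where
  "copy_code R so a to b = Do (WConst (R + 8) 0) ;; While (WLess (R + 8) (R + 2)) (copy_step R so a to b)"

text \<open>The zone used by one multiplication is left dirty; register \<open>R + 6\<close> therefore advances by \<open>S\<close>, so that the next call again finds blank memory.\<close>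

definition matmul_code :: "nat => program => nat => nat => nat => program" where
  "matmul_code R mm a b c =
     reset_regs R ;; Do (WOp WAdd 0 0 (R + 1)) ;;
     copy_code R (R + 10) (array_name R a) (R + 6) 0 ;;
     copy_code R (R + 10) (array_name R b) (R + 6) 1 ;;
     shift_prog (R + 6) (R + 11) mm ;;
     copy_code R (R + 6) 2 (R + 10) (array_name R c) ;;
     Do (WOp WAdd (R + 6) (R + 6) (R + 7))"

primrec compile :: "nat => program => stmt => program" where
  "compile R mm Pass = Skip"
| "compile R mm (Then c d) = compile R mm c ;; compile R mm d"
| "compile R mm (When b c) = compf R b (R + 2) ;; Do (FConst R 1) ;;
     Cond (FEq (R + 2) R) (compile R mm c) Skip"
| "compile R mm (For v j c) = Do (WConst (R + 16 + v) 0) ;;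
     While (WLess (R + 16 + v) (R + j)) (compile R mm c ;;
       (Do (WConst (R + 40) 1) ;; Do (WOp WAdd (R + 16 + v) (R + 16 + v) (R + 40))))"
| "compile R mm (PutW a x y) = compw2 R x y ;;
     (Do (WOp WMod (R + 41) (R + 41) (R + 5)) ;; Do (WStore (array_name R a) (R + 40) (R + 41)))"
| "compile R mm (PutF a x y) = compf R y (R + 2) ;; compw R x (R + 40) ;;
     Do (FStore (array_name R a) (R + 40) (R + 2))"
| "compile R mm (PutG a x b y) = compw2 R x y ;;
     (Do (GLoad R (array_name R b) (R + 41)) ;; Do (GStore (array_name R a) (R + 40) R))"
| "compile R mm (MatMul a b c) = matmul_code R mm a b c"

section \<open>Correctness of compilation\<close>

text \<open>Bounding a word by a power of the word limit with one factor per leaf keeps all intermediate results polynomial in the input size.\<close>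

lemma word_op_bound:
  fixes B :: nat
  assumes "x < B ^ a" "y < B ^ b" "2 \<le> B" "1 \<le> a" "1 \<le> b"
  shows "eval_word_op f x y < B ^ (a + b)"
proof -
  have pq: "2 \<le> B ^ a" "2 \<le> B ^ b"
    using assms(3-5) self_le_power[of B a] self_le_power[of B b] by auto
  have add: "p + q \<le> p * q" if "2 \<le> p" "2 \<le> q" for p q :: nat
  proof -
    obtain p' q' where "p = 2 + p'" "q = 2 + q'" using le_Suc_ex[OF \<open>2 \<le> p\<close>] le_Suc_ex[OF \<open>2 \<le> q\<close>] by blast
    then show ?thesis by (simp add: algebra_simps)
  qed
  have s: "B ^ a + B ^ b \<le> B ^ (a + b)" using add[OF pq] by (simp add: power_add)
  show ?thesis
  proof (cases f)
    case WAdd then show ?thesis using s assms(1,2) by simp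
  next
    case WSub
    have "x - y < B ^ (a + b)" using s assms(1) by linarith
    then show ?thesis by (simp only: WSub eval_word_op.simps)
  next
    case WMul
    have "x * y < B ^ a * B ^ b" using assms(1-3) by (intro mult_strict_mono) auto
    then show ?thesis using WMul by (simp add: power_add)
  next
    case WDiv
    have "x div y \<le> x" by simp
    then have "x div y < B ^ (a + b)" using s assms(1) by linarith
    then show ?thesis using WDiv by simp
  next
    case WMod
    have "x mod y \<le> x" by simp
    then have "x mod y < B ^ (a + b)" using s assms(1) by linarith
    then show ?thesis using WMod by simp
  qed
qed

lemma leaves_pos: "1 \<le> leaves x"
  by (induction x) auto

lemma rows_length: "length (concat (map (%i. map (A i) [0..<N]) [0..<M])) = M * N"
  by (simp add: length_concat o_def sum_list_triv)

lemma rows_nth: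
  "k < M * N ==> concat (map (%i. map (A i) [0..<N]) [0..<M]) ! k = A (k div N) (k mod N)"
proof (induction M)
  case (Suc M)
  show ?case
  proof (cases "k < M * N")
    case True
    then show ?thesis using Suc.IH by (simp add: nth_append rows_length)
  next
    case False
    then obtain j where j: "k = M * N + j" using le_Suc_ex not_less by blast
    then have "j < N" using Suc.prems by simp
    then have "k div N = M" "k mod N = j" using j by simp_all
    then show ?thesis using j \<open>j < N\<close> by (simp add: nth_append rows_length)
  qed
qed simp

locale machine =
  fixes R n S W W0 m T :: nat and mm :: program
  assumes R5: "5 \<le> R" and mm_below: "prog_below R mm"
    and mult: "!!A B. \<exists>t s. exec W0 mm (matmul_input n A B) t s & t \<le> T &
      (\<forall>i<n. \<forall>j<n. farr s 2 (i * n + j) = (\<Sum>l<n. A i l * B l j))"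
    and S: "W0 \<le> S" "n < S" "n * n \<le> S" and m: "1 \<le> m"
begin

definition D :: nat where "D = word_limit n ^ m"

definition regs_ok :: "nat set => (nat => nat) => (nat => nat) => bool" where
  "regs_ok V e w \<longleftrightarrow> (\<forall>j\<le>4. w (R + j) = n ^ j) & w (R + 5) = word_limit n & w (R + 7) = S &
     w (R + 10) = 0 & (\<forall>v\<in>V. v < 24 & e v < word_limit n & w (R + 16 + v) = e v)"

definition mem_ok :: "'g mem => 'g state => bool" where
  "mem_ok h s \<longleftrightarrow> (\<forall>a i. wmem h a i < word_limit n) & (\<forall>a. \<forall>i<D. warr s (array_name R a) i = wmem h a i &
     farr s (array_name R a) i = fmem h a i & garr s (array_name R a) i = gmem h a i)"

text \<open>After \<open>q\<close> multiplications at most \<open>q\<close> zones of size \<open>S\<close> lie between the data and the untouched memory.\<close>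

definition scratch_ok :: "nat => 'g::zero state => bool" where
  "scratch_ok q s \<longleftrightarrow> D \<le> wreg s (R + 6) & wreg s (R + 6) \<le> D + q * S &
     (\<forall>a<R. \<forall>i\<ge>wreg s (R + 6). warr s a i = 0 & farr s a i = 0 & garr s a i = 0) &
     (\<forall>r<R. greg s r = 0)"

lemma limit2: "2 \<le> word_limit n"
  using self_le_power[of "n + 2" 4] by (simp add: word_limit_def)

lemma limit_D: "word_limit n \<le> D"
  using self_le_power[of "word_limit n" m] limit2 m by (simp add: D_def)

lemma size_limit: "j \<le> 4 ==> n ^ j < word_limit n"
proof -
  assume "j \<le> 4"
  have "n ^ j < (n + 2) ^ j | j = 0" using power_strict_mono[of n "n + 2" j] by auto
  moreover have "(n + 2) ^ j \<le> word_limit n"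
    unfolding word_limit_def using \<open>j \<le> 4\<close> by (intro power_increasing) auto
  ultimately show ?thesis using limit2 by auto
qed

lemma exec_copy:
  "r ~= t ==> wreg s r < W ==>
    exec W (Do (WConst t 0) ;; Do (WOp WAdd t r t)) s 2 (s(|wreg := (wreg s)(t := wreg s r)|))"
  by (rule exec_two) simp_all

lemma compw_correct:
  fixes s :: "'g::ord state"
  assumes "mem_ok h s" "D \<le> W"
  shows "wexp_ok m V x ==> regs_ok V e (wreg s) ==> R + 40 \<le> t ==>
    weval n e h x < word_limit n ^ leaves x &
    (\<exists>w. exec W (compw R x t) s (wcost x) (s(|wreg := w|)) & (\<forall>r<t. w r = wreg s r) & w t = weval n e h x)"
  using assms(1)
proof (induction x arbitrary: t s)
  case (WVar v)
  then have v: "v < 24" "e v < word_limit n" "wreg s (R + 16 + v) = e v"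
    by (auto simp: wexp_ok_def regs_ok_def)
  then have eW: "e v < W" using limit_D assms(2) by simp
  have E: "exec W (compw R (WVar v) t) s (wcost (WVar v)) (s(|wreg := (wreg s)(t := e v)|))"
    using exec_copy[of "R + 16 + v" t s] v eW WVar by simp
  show ?case
    by (intro conjI, use v in simp, rule exI, rule conjI, rule E) simp
next
  case (WSize j)
  then have j: "j \<le> 4" by (simp add: wexp_ok_def)
  then have v: "n ^ j < word_limit n" "wreg s (R + j) = n ^ j"
    using size_limit WSize by (auto simp: regs_ok_def)
  then have eW: "n ^ j < W" using limit_D assms(2) by simp
  have E: "exec W (compw R (WSize j) t) s (wcost (WSize j)) (s(|wreg := (wreg s)(t := n ^ j)|))"
    using exec_copy[of "R + j" t s] v eW WSize j by simp
  show ?case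
    by (intro conjI, use v in simp, rule exI, rule conjI, rule E) simp
next
  case (WGet a x)
  have ok: "wexp_ok m V x" using WGet.prems(1) by (simp add: wexp_ok_def)
  obtain w where w: "exec W (compw R x t) s (wcost x) (s(|wreg := w|))" "\<forall>r<t. w r = wreg s r"
      "w t = weval n e h x" and b: "weval n e h x < word_limit n ^ leaves x"
    using WGet.IH[OF ok WGet.prems(2-4)] by blast
  have "word_limit n ^ leaves x \<le> D" unfolding D_def
    using ok limit2 by (intro power_increasing) (auto simp: wexp_ok_def)
  then have iD: "weval n e h x < D" using b by simp
  have L: "exec W (Do (WLoad t (array_name R a) t)) (s(|wreg := w|)) 1
      (s(|wreg := w(t := wmem h a (weval n e h x))|))"
    using w(3) iD WGet.prems(4) by (auto intro!: exec_one simp: mem_ok_def)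
  have E: "exec W (compw R (WGet a x) t) s (wcost (WGet a x)) (s(|wreg := w(t := wmem h a (weval n e h x))|))"
    using exec.Seq[OF w(1) L] by simp
  have b2: "wmem h a (weval n e h x) < word_limit n ^ leaves x"
    using WGet.prems(4) leaves_pos[of x] limit2 self_le_power[of "word_limit n" "leaves x"]
    by (auto simp: mem_ok_def intro: less_le_trans)
  show ?case
    by (intro conjI, use b2 in simp, rule exI, rule conjI, rule E) (use w(2) in simp)
next
  case (WBin f x y)
  have ok: "wexp_ok m V x" "wexp_ok m V y" using WBin.prems(1) by (auto simp: wexp_ok_def)
  obtain w where w: "exec W (compw R x t) s (wcost x) (s(|wreg := w|))" "\<forall>r<t. w r = wreg s r"
      "w t = weval n e h x" and b: "weval n e h x < word_limit n ^ leaves x"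
    using WBin.IH(1)[OF ok(1) WBin.prems(2-4)] by blast
  have r: "regs_ok V e w" using WBin.prems(2,3) w(2) by (auto simp: regs_ok_def)
  have m': "mem_ok h (s(|wreg := w|))" using WBin.prems(4) by (simp add: mem_ok_def)
  obtain w' where w': "exec W (compw R y (Suc t)) (s(|wreg := w|)) (wcost y) (s(|wreg := w'|))" "\<forall>r<Suc t. w' r = w r"
      "w' (Suc t) = weval n e h y" and b': "weval n e h y < word_limit n ^ leaves y"
    using WBin.IH(2)[OF ok(2) _ _ m', of "Suc t"] r WBin.prems(3) by auto
  have b'': "eval_word_op f (weval n e h x) (weval n e h y) < word_limit n ^ (leaves x + leaves y)"
    using word_op_bound[OF b b' limit2] leaves_pos by blast
  have "word_limit n ^ (leaves x + leaves y) \<le> D" unfolding D_def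
    using WBin.prems(1) limit2 by (intro power_increasing) (auto simp: wexp_ok_def)
  then have "eval_word_op f (weval n e h x) (weval n e h y) < W" using b'' assms(2) by simp
  then have L: "exec W (Do (WOp f t t (Suc t))) (s(|wreg := w'|)) 1
      (s(|wreg := w'(t := eval_word_op f (weval n e h x) (weval n e h y))|))"
    using w(3) w'(2,3) by (auto intro!: exec_one)
  have E: "exec W (compw R (WBin f x y) t) s (wcost (WBin f x y))
      (s(|wreg := w'(t := eval_word_op f (weval n e h x) (weval n e h y))|))"
    using exec.Seq[OF exec.Seq[OF w(1) w'(1)] L] by simp
  show ?case
    by (intro conjI, use b'' in simp, rule exI, rule conjI, rule E) (use w(2) w'(2) in simp)
qed

lemma weval_D:
  fixes s :: "'g::ord state"
  assumes "mem_ok h s" "D \<le> W" "wexp_ok m V x" "regs_ok V e (wreg s)"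
  shows "weval n e h x < D"
proof -
  have "weval n e h x < word_limit n ^ leaves x"
    using compw_correct[OF assms order_refl] by blast
  also have "\<dots> \<le> D" unfolding D_def
    using assms(3) limit2 by (intro power_increasing) (auto simp: wexp_ok_def)
  finally show ?thesis .
qed

lemma regs_ok_cong: "regs_ok V e w ==> (!!r. R \<le> r ==> r < R + 40 ==> w' r = w r) ==> regs_ok V e w'"
  by (auto simp: regs_ok_def)

lemma compw2_correct:
  fixes s :: "'g::ord state"
  assumes "mem_ok h s" "D \<le> W" "wexp_ok m V x" "wexp_ok m V y" "regs_ok V e (wreg s)"
  shows "\<exists>w. exec W (compw2 R x y) s (wcost x + wcost y) (s(|wreg := w|)) & (\<forall>r<R + 40. w r = wreg s r) &
     w (R + 40) = weval n e h x & w (R + 41) = weval n e h y"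
proof -
  obtain w where w: "exec W (compw R x (R + 40)) s (wcost x) (s(|wreg := w|))" "\<forall>r<R + 40. w r = wreg s r"
      "w (R + 40) = weval n e h x"
    using compw_correct[OF assms(1,2,3,5) order_refl] by blast
  have "regs_ok V e (wreg (s(|wreg := w|)))" using regs_ok_cong[OF assms(5)] w(2) by simp
  moreover have "mem_ok h (s(|wreg := w|))" using assms(1) by (simp add: mem_ok_def)
  ultimately obtain w' where w': "exec W (compw R y (R + 41)) (s(|wreg := w|)) (wcost y) (s(|wreg := w'|))"
      "\<forall>r<R + 41. w' r = w r" "w' (R + 41) = weval n e h y"
    using compw_correct[OF _ assms(2,4), of h "s(|wreg := w|)" e "R + 41"] by auto
  have E: "exec W (compw2 R x y) s (wcost x + wcost y) (s(|wreg := w'|))"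
    using exec.Seq[OF w(1) w'(1)] by (simp add: compw2_def)
  show ?thesis by (rule exI, rule conjI, rule E) (use w(2,3) w'(2,3) in simp)
qed

lemma cond_bit_exec: "exec W (cond_bit t b) s 2 (s(|freg := (freg s)(t := of_bool (holds b s))|))"
proof (cases "holds b s")
  case True
  then show ?thesis using exec.CondTrue[OF True exec.Do, of W "FConst t 1"]
    by (simp add: cond_bit_def numeral_2_eq_2)
next
  case False
  then show ?thesis using exec.CondFalse[OF False exec.Do, of W "FConst t 0"]
    by (simp add: cond_bit_def numeral_2_eq_2)
qed

definition same_but :: "nat => 'g state => 'g state => bool" where
  "same_but t s s' \<longleftrightarrow> warr s' = warr s & farr s' = farr s & garr s' = garr s &
     (\<forall>r<R + 40. wreg s' r = wreg s r) & (\<forall>r<R. greg s' r = greg s r) & (\<forall>r<t. freg s' r = freg s r)"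

lemma compf_correct:
  fixes s :: "'g::ord state"
  assumes "mem_ok h s" "D \<le> W"
  shows "fexp_ok m V x ==> regs_ok V e (wreg s) ==> R + 2 \<le> t ==>
    \<exists>s'. exec W (compf R x t) s (fcost x) s' & same_but t s s' & freg s' t = feval n e h x"
  using assms(1)
proof (induction x arbitrary: t s)
  case (FLit b)
  then show ?case
    by (intro exI[of _ "s(|freg := (freg s)(t := b)|)"]) (auto intro!: exec_one simp: same_but_def)
next
  case (FGet a x)
  then have ok: "wexp_ok m V x" by simp
  obtain w where w: "exec W (compw R x (R + 40)) s (wcost x) (s(|wreg := w|))" "\<forall>r<R + 40. w r = wreg s r"
      "w (R + 40) = weval n e h x"
    using compw_correct[OF FGet.prems(4) assms(2) ok FGet.prems(2) order_refl] by blast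
  have iD: "weval n e h x < D" using weval_D[OF FGet.prems(4) assms(2) ok FGet.prems(2)] .
  have "exec W (Do (FLoad t (array_name R a) (R + 40))) (s(|wreg := w|)) 1
      (s(|wreg := w, freg := (freg s)(t := fmem h a (weval n e h x))|))"
    using w(3) iD FGet.prems(4) by (auto intro!: exec_one simp: mem_ok_def)
  from exec.Seq[OF w(1) this] have E: "exec W (compf R (FGet a x) t) s (fcost (FGet a x))
      (s(|wreg := w, freg := (freg s)(t := fmem h a (weval n e h x))|))" by simp
  show ?case by (rule exI, rule conjI, rule E) (use w(2) in \<open>simp add: same_but_def\<close>)
next
  case (FBin f x y)
  obtain s1 where 1: "exec W (compf R x t) s (fcost x) s1" "same_but t s s1" "freg s1 t = feval n e h x"
    using FBin.IH(1)[OF _ FBin.prems(2-4)] FBin.prems(1) by auto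
  have "regs_ok V e (wreg s1)" using regs_ok_cong[OF FBin.prems(2)] 1(2) by (simp add: same_but_def)
  moreover have "mem_ok h s1" using FBin.prems(4) 1(2) by (simp add: mem_ok_def same_but_def)
  ultimately obtain s2 where 2: "exec W (compf R y (Suc t)) s1 (fcost y) s2" "same_but (Suc t) s1 s2"
      "freg s2 (Suc t) = feval n e h y"
    using FBin.IH(2)[of s1 "Suc t"] FBin.prems(1,3) by auto
  have "exec W (Do (FOp f t t (Suc t))) s2 1 (s2(|freg := (freg s2)(t := feval n e h (FBin f x y))|))"
    using 1(3) 2(2,3) by (auto intro!: exec_one simp: same_but_def)
  from exec.Seq[OF exec.Seq[OF 1(1) 2(1)] this] have E: "exec W (compf R (FBin f x y) t) s
      (fcost (FBin f x y)) (s2(|freg := (freg s2)(t := feval n e h (FBin f x y))|))" by simp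
  show ?case by (rule exI, rule conjI, rule E) (use 1(2) 2(2) in \<open>simp add: same_but_def\<close>)
next
  case (FIsEq x y)
  then have ok: "wexp_ok m V x" "wexp_ok m V y" by auto
  obtain w where w: "exec W (compw2 R x y) s (wcost x + wcost y) (s(|wreg := w|))" "\<forall>r<R + 40. w r = wreg s r"
     "w (R + 40) = weval n e h x" "w (R + 41) = weval n e h y"
    using compw2_correct[OF FIsEq.prems(4) assms(2) ok FIsEq.prems(2)] by blast
  have E: "exec W (compf R (FIsEq x y) t) s (fcost (FIsEq x y))
      (s(|wreg := w, freg := (freg s)(t := feval n e h (FIsEq x y))|))"
    using exec.Seq[OF w(1) cond_bit_exec[of t "WEq (R + 40) (R + 41)"]] w by simp
  show ?case by (rule exI, rule conjI, rule E) (use w(2) in \<open>simp add: same_but_def\<close>)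
next
  case (FIsLess x y)
  then have ok: "wexp_ok m V x" "wexp_ok m V y" by auto
  obtain w where w: "exec W (compw2 R x y) s (wcost x + wcost y) (s(|wreg := w|))" "\<forall>r<R + 40. w r = wreg s r"
     "w (R + 40) = weval n e h x" "w (R + 41) = weval n e h y"
    using compw2_correct[OF FIsLess.prems(4) assms(2) ok FIsLess.prems(2)] by blast
  have E: "exec W (compf R (FIsLess x y) t) s (fcost (FIsLess x y))
      (s(|wreg := w, freg := (freg s)(t := feval n e h (FIsLess x y))|))"
    using exec.Seq[OF w(1) cond_bit_exec[of t "WLess (R + 40) (R + 41)"]] w by simp
  show ?case by (rule exI, rule conjI, rule E) (use w(2) in \<open>simp add: same_but_def\<close>)
next
  case (FIsLe x y)
  then have ok: "wexp_ok m V x" "wexp_ok m V y" by auto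
  obtain w where w: "exec W (compw2 R x y) s (wcost x + wcost y) (s(|wreg := w|))" "\<forall>r<R + 40. w r = wreg s r"
     "w (R + 40) = weval n e h x" "w (R + 41) = weval n e h y"
    using compw2_correct[OF FIsLe.prems(4) assms(2) ok FIsLe.prems(2)] by blast
  have iD: "weval n e h x < D" "weval n e h y < D"
    using weval_D[OF FIsLe.prems(4) assms(2) _ FIsLe.prems(2)] ok by auto
  have g: "garr s 0 i = gmem h 0 i" if "i < D" for i
    using FIsLe.prems(4) that unfolding mem_ok_def by (metis array_name_def zero_less_numeral)
  let ?g = "(greg s)(R := gmem h 0 (weval n e h x), R + 1 := gmem h 0 (weval n e h y))"
  have "exec W (Do (GLoad R 0 (R + 40)) ;; Do (GLoad (R + 1) 0 (R + 41))) (s(|wreg := w|)) 2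
     (s(|wreg := w, greg := ?g|))"
    using w(3,4) iD g by (auto intro!: exec_two)
  from exec.Seq[OF w(1) exec.Seq[OF this cond_bit_exec[of t "GLe R (R + 1)"]]]
  have E: "exec W (compf R (FIsLe x y) t) s (fcost (FIsLe x y))
      (s(|wreg := w, greg := ?g, freg := (freg s)(t := feval n e h (FIsLe x y))|))"
    using w by (simp add: add.assoc)
  show ?case by (rule exI, rule conjI, rule E) (use w(2) in \<open>simp add: same_but_def\<close>)
qed

end

lemma exec_Seq: "exec W c s t s1 ==> exec W d s1 t' s2 ==> u = t + t' ==> exec W (c ;; d) s u s2"
  using exec.Seq by blast

context machine begin

lemma reset_correct: "0 < W ==> \<exists>w f. exec W (reset_regs r) s (2 * r) (s(|wreg := w, freg := f|)) &
   (\<forall>k. w k = (if k < r then 0 else wreg s k)) & (\<forall>k. f k = (if k < r then 0 else freg s k))"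
proof (induction r)
  case 0
  have "exec W (reset_regs 0) s (2 * 0) (s(|wreg := wreg s, freg := freg s|))" by (simp add: exec.Skip)
  then show ?case by force
next
  case (Suc r)
  then obtain w f where 1: "exec W (reset_regs r) s (2 * r) (s(|wreg := w, freg := f|))"
    "!!k. w k = (if k < r then 0 else wreg s k)" "!!k. f k = (if k < r then 0 else freg s k)" by blast
  have 2: "exec W (Do (WConst r 0) ;; Do (FConst r 0)) (s(|wreg := w, freg := f|)) 2
      (s(|wreg := w(r := 0), freg := f(r := 0)|))"
    using Suc.prems by (intro exec_two) simp_all
  have E: "exec W (reset_regs (Suc r)) s (2 * Suc r) (s(|wreg := w(r := 0), freg := f(r := 0)|))"
    using exec_Seq[OF 1(1) 2] by simp
  show ?case by (rule exI, rule exI, rule conjI, rule E) (use 1(2,3) in auto)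
qed

lemma copy_step_correct:
  fixes s :: "'g::ord state"
  assumes "so ~= R + 8" "so ~= R + 9" "to ~= R + 8" "to ~= R + 9" "wreg s (R + 8) = k"
    "wreg s so + k < W" "wreg s to + k < W" "Suc k < W"
  shows "exec W (copy_step R so a to b) s 6 (s(|wreg := (wreg s)(R + 9 := 1, R + 8 := Suc k),
     freg := (freg s)(R := farr s a (wreg s so + k)),
     farr := array_write (farr s) b (wreg s to + k) (farr s a (wreg s so + k))|))"
proof -
  let ?v = "farr s a (wreg s so + k)"
  have 1: "exec W (Do (WOp WAdd (R + 9) (R + 8) so) ;; Do (FLoad R a (R + 9))) s 2
      (s(|wreg := (wreg s)(R + 9 := wreg s so + k), freg := (freg s)(R := ?v)|))" (is "exec _ _ _ _ ?s1")
    using assms by (intro exec_two) (simp_all add: add.commute)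
  have 2: "exec W (Do (WOp WAdd (R + 9) (R + 8) to) ;; Do (FStore b (R + 9) R)) ?s1 2
      (s(|wreg := (wreg s)(R + 9 := wreg s to + k), freg := (freg s)(R := ?v),
        farr := array_write (farr s) b (wreg s to + k) ?v|))" (is "exec _ _ _ _ ?s2")
    using assms by (intro exec_two) (simp_all add: add.commute)
  have 3: "exec W (Do (WConst (R + 9) 1) ;; Do (WOp WAdd (R + 8) (R + 8) (R + 9))) ?s2 2
      (s(|wreg := (wreg s)(R + 9 := 1, R + 8 := Suc k), freg := (freg s)(R := ?v),
        farr := array_write (farr s) b (wreg s to + k) ?v|))"
    using assms by (intro exec_two) (simp_all add: fun_upd_twist)
  show ?thesis unfolding copy_step_def
    by (rule exec_Seq[OF 1 exec_Seq[OF 2 3 refl]]) simp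
qed

definition copied :: "(nat => nat => bit) => nat => nat => nat => nat => nat => nat => nat => bit" where
  "copied M x a y b k = M(b := %i. if y \<le> i & i < y + k then M a (x + (i - y)) else M b i)"

lemma copy_correct:
  fixes s :: "'g::ord state"
  assumes r: "so ~= R + 8" "so ~= R + 9" "to ~= R + 8" "to ~= R + 9" and ab: "a ~= b"
    and n2: "wreg s (R + 2) = n * n" and fits: "wreg s so + n * n < W" "wreg s to + n * n < W"
  shows "\<exists>w f. exec W (copy_code R so a to b) s (7 * (n * n) + 2)
      (s(|wreg := w, freg := f, farr := copied (farr s) (wreg s so) a (wreg s to) b (n * n)|)) &
    (\<forall>r. r ~= R + 8 --> r ~= R + 9 --> w r = wreg s r) & (\<forall>r. r ~= R --> f r = freg s r)"
proof -
  let ?x = "wreg s so" and ?y = "wreg s to"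
  have loop: "\<exists>w' f'. exec W (While (WLess (R + 8) (R + 2)) (copy_step R so a to b))
        (s(|wreg := w, freg := f, farr := copied (farr s) ?x a ?y b (n * n - d)|)) (7 * d + 1)
        (s(|wreg := w', freg := f', farr := copied (farr s) ?x a ?y b (n * n)|)) &
      (\<forall>r. r ~= R + 8 --> r ~= R + 9 --> w' r = wreg s r) & (\<forall>r. r ~= R --> f' r = freg s r)"
    if "d \<le> n * n" "w (R + 8) = n * n - d" "!!r. r ~= R + 8 ==> r ~= R + 9 ==> w r = wreg s r"
       "!!r. r ~= R ==> f r = freg s r" for d w f
    using that
  proof (induction d arbitrary: w f)
    case 0
    let ?s = "s(|wreg := w, freg := f, farr := copied (farr s) ?x a ?y b (n * n)|)"
    have "\<not> holds (WLess (R + 8) (R + 2)) ?s" using 0 n2 by simp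
    from exec.WhileFalse[OF this] 0 show ?case
      by (intro exI[of _ w] exI[of _ f]) simp
  next
    case (Suc d)
    let ?k = "n * n - Suc d"
    let ?s = "s(|wreg := w, freg := f, farr := copied (farr s) ?x a ?y b ?k|)"
    have k: "?k < n * n" "n * n - d = Suc ?k" using Suc.prems(1) by auto
    have h: "holds (WLess (R + 8) (R + 2)) ?s" using Suc.prems(2,3) n2 k(1) by simp
    have c: "array_write (copied (farr s) ?x a ?y b ?k) b (?y + ?k) (copied (farr s) ?x a ?y b ?k a (?x + ?k))
       = copied (farr s) ?x a ?y b (Suc ?k)"
      using ab by (auto simp: copied_def array_write_def fun_eq_iff)
    have st: "exec W (copy_step R so a to b) ?s 6 (?s(|wreg := (wreg ?s)(R + 9 := 1, R + 8 := Suc ?k),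
       freg := (freg ?s)(R := farr ?s a (wreg ?s so + ?k)),
       farr := array_write (farr ?s) b (wreg ?s to + ?k) (farr ?s a (wreg ?s so + ?k))|))"
    proof (rule copy_step_correct)
      have "w so = wreg s so" "w to = wreg s to" using Suc.prems(3) r by blast+
      then show "wreg ?s so + ?k < W" "wreg ?s to + ?k < W" using fits k by auto
      show "wreg ?s (R + 8) = ?k" using Suc.prems(2) by simp
      show "Suc ?k < W" using fits k by auto
    qed (use r in auto)
    have st': "exec W (copy_step R so a to b) ?s 6 (s(|wreg := w(R + 9 := 1, R + 8 := Suc ?k),
       freg := f(R := farr ?s a (w so + ?k)), farr := copied (farr s) ?x a ?y b (n * n - d)|))"
      using st c k(2) Suc.prems(3) r by simp
    have "(w(R + 9 := 1, R + 8 := Suc ?k)) (R + 8) = n * n - d" using k(2) by simp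
    then have "\<exists>w' f'. exec W (While (WLess (R + 8) (R + 2)) (copy_step R so a to b))
        (s(|wreg := w(R + 9 := 1, R + 8 := Suc ?k), freg := f(R := farr ?s a (w so + ?k)),
          farr := copied (farr s) ?x a ?y b (n * n - d)|)) (7 * d + 1)
        (s(|wreg := w', freg := f', farr := copied (farr s) ?x a ?y b (n * n)|)) &
      (\<forall>r. r ~= R + 8 --> r ~= R + 9 --> w' r = wreg s r) & (\<forall>r. r ~= R --> f' r = freg s r)"
      by (rule Suc.IH[rotated]) (use Suc.prems in auto)
    then obtain w' f' where I: "exec W (While (WLess (R + 8) (R + 2)) (copy_step R so a to b))
        (s(|wreg := w(R + 9 := 1, R + 8 := Suc ?k), freg := f(R := farr ?s a (w so + ?k)),
          farr := copied (farr s) ?x a ?y b (n * n - d)|)) (7 * d + 1)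
        (s(|wreg := w', freg := f', farr := copied (farr s) ?x a ?y b (n * n)|))"
      "\<forall>r. r ~= R + 8 --> r ~= R + 9 --> w' r = wreg s r" "\<forall>r. r ~= R --> f' r = freg s r"
      by blast
    have E: "exec W (While (WLess (R + 8) (R + 2)) (copy_step R so a to b)) ?s (7 * Suc d + 1)
        (s(|wreg := w', freg := f', farr := copied (farr s) ?x a ?y b (n * n)|))"
      using exec.WhileTrue[OF h st' I(1)] by simp
    show ?case by (rule exI, rule exI, rule conjI, rule E) (use I(2,3) in simp)
  qed
  have "(%i. if ?y \<le> i & i < ?y + 0 then farr s a (?x + (i - ?y)) else farr s b i) = farr s b"
    by (intro ext) auto
  then have c0: "copied (farr s) ?x a ?y b 0 = farr s" unfolding copied_def by simp
  obtain w' f' where L: "exec W (While (WLess (R + 8) (R + 2)) (copy_step R so a to b))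
        (s(|wreg := (wreg s)(R + 8 := 0)|)) (7 * (n * n) + 1)
        (s(|wreg := w', freg := f', farr := copied (farr s) ?x a ?y b (n * n)|))"
      "\<forall>r. r ~= R + 8 --> r ~= R + 9 --> w' r = wreg s r" "\<forall>r. r ~= R --> f' r = freg s r"
    using loop[of "n * n" "(wreg s)(R + 8 := 0)" "freg s"] c0 by auto
  have "exec W (Do (WConst (R + 8) 0)) s (Suc 0) (s(|wreg := (wreg s)(R + 8 := 0)|))"
    using fits by (intro exec_one) auto
  from exec_Seq[OF this L(1), of "7 * (n * n) + 2"]
  have E: "exec W (copy_code R so a to b) s (7 * (n * n) + 2)
      (s(|wreg := w', freg := f', farr := copied (farr s) ?x a ?y b (n * n)|))"
    by (simp add: copy_code_def)
  show ?thesis by (rule exI, rule exI, rule conjI, rule E) (use L(2,3) in simp)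
qed

definition product_cost :: nat where
  "product_cost = 2 * R + 2 * T + 21 * (n * n) + 8"

lemma matmul_code_correct:
  fixes s :: "'g::{zero,preorder} state"
  assumes mem: "mem_ok h s" and sc: "scratch_ok q s" and regs: "regs_ok V e (wreg s)"
    and fit: "D + Suc q * S < W" and a: "5 \<le> a" "5 \<le> b" "5 \<le> c"
  shows "\<exists>t s'. exec W (matmul_code R mm a b c) s t s' & t \<le> product_cost &
    mem_ok (run n (MatMul a b c) e h) s' & scratch_ok (Suc q) s' &
    (\<forall>r. R \<le> r --> r \<notin> {R + 6, R + 8, R + 9, R + 11} --> wreg s' r = wreg s r)"
proof -
  define base where "base = wreg s (R + 6)"
  have base: "D \<le> base" "base + S < W"
    using sc fit by (auto simp: scratch_ok_def base_def)
  have zero: "warr s x i = 0" "farr s x i = 0" "garr s x i = 0" if "x < R" "base \<le> i" for x i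
    using sc that by (auto simp: scratch_ok_def base_def)
  have nD: "n * n < D" using size_limit[of 2] limit_D by (simp add: power2_eq_square)
  have rg: "wreg s (R + 1) = n" "wreg s (R + 2) = n * n" "wreg s (R + 10) = 0" "wreg s (R + 7) = S"
  proof -
    have "wreg s (R + j) = n ^ j" if "j \<le> 4" for j using regs that by (simp add: regs_ok_def)
    from this[of 1] this[of 2] show "wreg s (R + 1) = n" "wreg s (R + 2) = n * n"
      by (simp_all add: power2_eq_square)
    show "wreg s (R + 10) = 0" "wreg s (R + 7) = S" using regs by (auto simp: regs_ok_def)
  qed
  have nm: "array_name R a = R + a" "array_name R b = R + b" "array_name R c = R + c"
    using a by (auto simp: array_name_def)
  have W: "0 < W" "n < W" "n * n < W" using base nD S by auto
  obtain w1 f1 where 1: "exec W (reset_regs R) s (2 * R) (s(|wreg := w1, freg := f1|))"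
     "!!k. w1 k = (if k < R then 0 else wreg s k)" "!!k. f1 k = (if k < R then 0 else freg s k)"
    using reset_correct[OF W(1), of R s] by blast
  let ?s2 = "s(|wreg := w1(0 := n), freg := f1|)"
  have 2: "exec W (Do (WOp WAdd 0 0 (R + 1))) (s(|wreg := w1, freg := f1|)) 1 ?s2"
    unfolding One_nat_def by (rule exec_one) (use 1(2) rg W R5 in simp_all)
  define F3 where "F3 = copied (farr s) 0 (R + a) base 0 (n * n)"
  obtain w3 f3 where 3: "exec W (copy_code R (R + 10) (R + a) (R + 6) 0) ?s2 (7 * (n * n) + 2)
      (?s2(|wreg := w3, freg := f3, farr := F3|))"
     "!!r. r ~= R + 8 ==> r ~= R + 9 ==> w3 r = wreg ?s2 r" "!!r. r ~= R ==> f3 r = freg ?s2 r"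
    using copy_correct[of "R + 10" "R + 6" "R + a" 0 ?s2] 1(2) rg base R5 W S a unfolding F3_def base_def by auto
  let ?s3 = "s(|wreg := w3, freg := f3, farr := F3|)"
  define F4 where "F4 = copied F3 0 (R + b) base 1 (n * n)"
  have w3: "w3 (R + 2) = n * n" "w3 (R + 10) = 0" "w3 (R + 6) = base"
    using 3(2) 1(2) rg R5 by (auto simp: base_def)
  obtain w4 f4 where 4: "exec W (copy_code R (R + 10) (R + b) (R + 6) 1) ?s3 (7 * (n * n) + 2)
      (?s3(|wreg := w4, freg := f4, farr := F4|))"
     "!!r. r ~= R + 8 ==> r ~= R + 9 ==> w4 r = w3 r" "!!r. r ~= R ==> f4 r = f3 r"
    using copy_correct[of "R + 10" "R + 6" "R + b" 1 ?s3] w3 base R5 W S a unfolding F4_def by auto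
  let ?s4 = "s(|wreg := w4, freg := f4, farr := F4|)"
  let ?A = "%i l. fmem h a (i * n + l)" and ?B = "%i l. fmem h b (i * n + l)"
  have ha: "farr s (R + a) i = fmem h a i" "farr s (R + b) i = fmem h b i" if "i < D" for i
    using mem that nm unfolding mem_ok_def by metis+
  have w4: "w4 r = (if r = 0 then n else 0)" if "r < R" for r
    using 4(2)[of r] 3(2)[of r] 1(2)[of r] that R5 by auto
  have w4': "w4 r = wreg s r" if "R \<le> r" "r ~= R + 8" "r ~= R + 9" for r
    using 4(2)[of r] 3(2)[of r] 1(2)[of r] that R5 by auto
  have f4: "f4 r = 0" if "r < R" for r
    using 4(3)[of r] 3(3)[of r] 1(3)[of r] that R5 by auto
  have lst: "list_array (concat (map (%i. map (%l. fmem h x (i * n + l)) [0..<n]) [0..<n])) i =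
      (if i < n * n then fmem h x i else 0)" for x i
    by (simp add: list_array_def rows_length rows_nth)
  have disp: "displaced R base S (matmul_input n ?A ?B) ?s4"
  proof -
    have F4: "F4 x (base + i) = farr (matmul_input n ?A ?B) x i" if "x < R" "i < S" for x i
      using that ha nD zero R5
      by (auto simp: F4_def F3_def copied_def matmul_input_def blank_state_def lst)
    show ?thesis unfolding displaced_def
      using w4 f4 F4 zero S R5 sc by (auto simp: matmul_input_def blank_state_def scratch_ok_def)
  qed
  obtain t0 s0 where M: "exec W0 mm (matmul_input n ?A ?B) t0 s0" "t0 \<le> T"
     "!!i j. i < n ==> j < n ==> farr s0 2 (i * n + j) = (\<Sum>l<n. ?A i l * ?B l j)"
    using mult[of ?A ?B] by blast
  have "wreg ?s4 (R + 6) = base" using w4' by (simp add: base_def)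
  moreover have "W0 \<le> W" "base + S \<le> W" using S base by auto
  ultimately obtain t5 s5 where 5: "exec W (shift_prog (R + 6) (R + 11) mm) ?s4 t5 s5" "t5 \<le> 2 * t0"
      "displaced R base S s0 s5" "outside_same R (R + 11) base S ?s4 s5"
    using displaced_exec[OF M(1) mm_below disp, of "R + 6" "R + 11" W] S by auto
  have w5: "wreg s5 r = wreg s r" if "R \<le> r" "r \<notin> {R + 8, R + 9, R + 11}" for r
    using 5(4) w4' that by (auto simp: outside_same_def)
  have o5: "warr s5 x i = warr s x i" "farr s5 x i = farr s x i" "garr s5 x i = garr s x i"
    if "\<not> (x < R & base \<le> i & i < base + S)" for x i
  proof -
    have "F4 x i = farr s x i" using that S R5 by (auto simp: F4_def F3_def copied_def)
    then show "warr s5 x i = warr s x i" "farr s5 x i = farr s x i" "garr s5 x i = garr s x i"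
      using 5(4) that by (auto simp: outside_same_def)
  qed
  define F6 where "F6 = copied (farr s5) base 2 0 (R + c) (n * n)"
  obtain w6 f6 where 6: "exec W (copy_code R (R + 6) 2 (R + 10) (R + c)) s5 (7 * (n * n) + 2)
      (s5(|wreg := w6, freg := f6, farr := F6|))"
     "!!r. r ~= R + 8 ==> r ~= R + 9 ==> w6 r = wreg s5 r"
    using copy_correct[of "R + 6" "R + 10" 2 "R + c" s5] w5 rg base R5 W S a unfolding F6_def base_def by auto
  let ?s6 = "s5(|wreg := w6, freg := f6, farr := F6|)"
  let ?s7 = "s5(|wreg := w6(R + 6 := base + S), freg := f6, farr := F6|)"
  have w6: "w6 (R + 6) = base" "w6 (R + 7) = S" using 6(2) w5 rg by (auto simp: base_def)
  have 7: "exec W (Do (WOp WAdd (R + 6) (R + 6) (R + 7))) ?s6 1 ?s7"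
    unfolding One_nat_def by (rule exec_one) (use w6 base in simp_all)
  have cp3: "exec W (copy_code R (R + 10) (R + a) (R + 6) 0) ?s2 (7 * (n * n) + 2) ?s3"
    using 3(1) by simp
  have cp4: "exec W (copy_code R (R + 10) (R + b) (R + 6) 1) ?s3 (7 * (n * n) + 2) ?s4"
    using 4(1) by simp
  have E: "exec W (matmul_code R mm a b c) s
     (2 * R + (1 + ((7 * (n * n) + 2) + ((7 * (n * n) + 2) + (t5 + ((7 * (n * n) + 2) + 1)))))) ?s7"
    unfolding matmul_code_def nm
    by (rule exec_Seq[OF 1(1) exec_Seq[OF 2 exec_Seq[OF cp3 exec_Seq[OF cp4 exec_Seq[OF 5(1) exec_Seq[OF 6(1) 7
      refl] refl] refl] refl] refl] refl])
  have Fc: "F6 (R + c) i = (\<Sum>l<n. fmem h a (i div n * n + l) * fmem h b (l * n + i mod n))" if "i < n * n" for i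
  proof -
    have n0: "0 < n" using that by (cases n) auto
    then have ij: "i div n < n" "i mod n < n" using that by (auto simp: less_mult_imp_div_less)
    have "F6 (R + c) i = farr s5 2 (base + i)" using that by (simp add: F6_def copied_def)
    also have "\<dots> = farr s0 2 (i div n * n + i mod n)"
      using 5(3) that S R5 by (simp add: displaced_def)
    also have "\<dots> = (\<Sum>l<n. fmem h a (i div n * n + l) * fmem h b (l * n + i mod n))"
      using M(3)[OF ij] .
    finally show ?thesis .
  qed
  have "mem_ok (run n (MatMul a b c) e h) ?s7"
    unfolding mem_ok_def
  proof (intro conjI allI impI)
    fix x i
    show "wmem (run n (MatMul a b c) e h) x i < word_limit n" using mem by (simp add: mem_ok_def)
    assume i: "i < D"
    have out: "\<not> (array_name R x < R & base \<le> i & i < base + S)" using i base by auto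
    have m1: "warr s (array_name R x) i = wmem h x i" "farr s (array_name R x) i = fmem h x i"
      "garr s (array_name R x) i = gmem h x i" using mem i by (auto simp: mem_ok_def)
    show "warr ?s7 (array_name R x) i = wmem (run n (MatMul a b c) e h) x i"
      "garr ?s7 (array_name R x) i = gmem (run n (MatMul a b c) e h) x i"
      using o5[OF out] m1 by simp_all
    show "farr ?s7 (array_name R x) i = fmem (run n (MatMul a b c) e h) x i"
    proof (cases "x = c & i < n * n")
      case True
      then show ?thesis using Fc nm by simp
    next
      case False
      then have "F6 (array_name R x) i = farr s5 (array_name R x) i"
        using array_name_inj[OF R5, of x c] nm by (auto simp: F6_def copied_def)
      then show ?thesis using False o5[OF out] m1 by simp
    qed
  qed
  moreover have "scratch_ok (Suc q) ?s7"
  proof -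
    have "F6 x i = farr s5 x i" if "x < R" for x i using that by (simp add: F6_def copied_def)
    moreover have "greg s5 r = 0" if "r < R" for r using 5(3) that by (simp add: displaced_def)
    ultimately show ?thesis
      using sc base o5 zero by (auto simp: scratch_ok_def base_def)
  qed
  moreover have "\<forall>r. R \<le> r --> r \<notin> {R + 6, R + 8, R + 9, R + 11} --> wreg ?s7 r = wreg s r"
    using 6(2) w5 by simp
  moreover have "2 * R + (1 + ((7 * (n * n) + 2) + ((7 * (n * n) + 2) + (t5 + ((7 * (n * n) + 2) + 1))))) \<le> product_cost"
    using 5(2) M(2) by (simp add: product_cost_def)
  ultimately show ?thesis using E by blast
qed


definition simulates :: "nat => nat set => (nat => nat) => 'g mem => 'g::zero state => bool" where
  "simulates q V e h s \<longleftrightarrow> regs_ok V e (wreg s) & mem_ok h s & scratch_ok q s"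

lemma simulates_mono: "simulates q V e h s ==> q \<le> q' ==> simulates q' V e h s"
  using mult_le_mono1[of q q' S] by (auto simp: simulates_def scratch_ok_def intro: le_trans)

lemma simulates_regs:
  assumes "simulates q V e h s" "warr s' = warr s" "farr s' = farr s" "garr s' = garr s"
    "!!r. r < R + 40 ==> wreg s' r = wreg s r" "!!r. r < R ==> greg s' r = greg s r"
  shows "simulates q V e h s'"
  using assms by (auto simp: simulates_def regs_ok_def mem_ok_def scratch_ok_def)

lemma simulates_same_but: "simulates q V e h s ==> same_but t s s' ==> simulates q V e h s'"
  by (erule simulates_regs) (auto simp: same_but_def)

lemma scratch_low: "simulates q V e h s ==> i < D ==> i < wreg s (R + 6)"
  by (auto simp: simulates_def scratch_ok_def)

lemma compile_correct:
  fixes s :: "'g::{zero,preorder} state"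
  shows "stmt_ok m V c ==> simulates q V e h s ==> D + (q + calls n c) * S < W ==>
    \<exists>t s'. exec W (compile R mm c) s t s' & t \<le> cost n product_cost c &
      simulates (q + calls n c) V e (run n c e h) s'"
proof (induction c arbitrary: V q e h s)
  case Pass
  then show ?case by (auto intro!: exec.Skip)
next
  case (Then c d)
  obtain t s' where 1: "exec W (compile R mm c) s t s'" "t \<le> cost n product_cost c"
      "simulates (q + calls n c) V e (run n c e h) s'"
    using Then.IH(1)[OF _ Then.prems(2)] Then.prems(1,3) by (auto simp: algebra_simps)
  obtain t' s'' where 2: "exec W (compile R mm d) s' t' s''" "t' \<le> cost n product_cost d"
      "simulates (q + calls n c + calls n d) V e (run n d e (run n c e h)) s''"
    using Then.IH(2)[OF _ 1(3)] Then.prems(1,3) by (auto simp: algebra_simps)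
  have "exec W (compile R mm (Then c d)) s (t + t') s''" using exec.Seq[OF 1(1) 2(1)] by simp
  moreover have "t + t' \<le> cost n product_cost (Then c d)" using 1(2) 2(2) by simp
  ultimately show ?case using 2(3) by (intro exI conjI) (auto simp: add.assoc)
next
  case (When b c)
  have DW: "D \<le> W" using When.prems(3) by simp
  obtain s1 where 1: "exec W (compf R b (R + 2)) s (fcost b) s1" "same_but (R + 2) s s1"
      "freg s1 (R + 2) = feval n e h b"
    using compf_correct[of h s V b e "R + 2"] DW When.prems(1,2) by (auto simp: simulates_def)
  let ?s2 = "s1(|freg := (freg s1)(R := 1)|)"
  have 2: "exec W (Do (FConst R 1)) s1 (Suc 0) ?s2" by (rule exec_one) simp_all
  have sim: "simulates q V e h ?s2"
    by (rule simulates_regs[OF simulates_same_but[OF When.prems(2) 1(2)]]) simp_all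
  have holds: "holds (FEq (R + 2) R) ?s2 \<longleftrightarrow> feval n e h b = 1" using 1(3) by simp
  show ?case
  proof (cases "feval n e h b = 1")
    case True
    obtain t s' where 3: "exec W (compile R mm c) ?s2 t s'" "t \<le> cost n product_cost c"
        "simulates (q + calls n c) V e (run n c e h) s'"
      using When.IH[OF _ sim] When.prems(1,3) by auto
    have "exec W (compile R mm (When b c)) s (fcost b + (Suc 0 + (1 + t))) s'"
      using exec.Seq[OF 1(1) exec.Seq[OF 2 exec.CondTrue[OF _ 3(1)]]] holds True by simp
    then show ?thesis using 3(2,3) True by (intro exI conjI) auto
  next
    case False
    have "exec W (compile R mm (When b c)) s (fcost b + (Suc 0 + (1 + 0))) ?s2"
      using exec.Seq[OF 1(1) exec.Seq[OF 2 exec.CondFalse[OF _ exec.Skip]]] holds False by simp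
    moreover have "simulates (q + calls n c) V e h ?s2" using simulates_mono[OF sim] by simp
    ultimately show ?thesis using False by (intro exI conjI) auto
  qed
next
  case (For v j c)
  let ?v = "R + 16 + v"
  have v: "v < 24" "v \<notin> V" "j \<le> 4" and ok: "stmt_ok m (insert v V) c" using For.prems(1) by auto
  have DW: "D \<le> W" using For.prems(3) by simp
  let ?b = "compile R mm c ;; (Do (WConst (R + 40) 1) ;; Do (WOp WAdd ?v ?v (R + 40)))"
  have nj: "n ^ j < word_limit n" "n ^ j < W" using size_limit[OF v(3)] limit_D DW by auto
  have loop: "\<exists>t s'. exec W (While (WLess ?v (R + j)) ?b) s t s' & t \<le> d * (cost n product_cost c + 3) + 1 &
      simulates (q' + d * calls n c) V e (fold (%k. run n c (e(v := k))) [n ^ j - d..<n ^ j] h) s'"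
    if "d \<le> n ^ j" "simulates q' (insert v V) (e(v := n ^ j - d)) h s" "D + (q' + d * calls n c) * S < W"
    for d q' and h :: "'g mem" and s :: "'g state"
    using that
  proof (induction d arbitrary: q' h s)
    case 0
    have r: "wreg s (R + j) = n ^ j" "wreg s ?v = n ^ j"
      using 0(2) v by (auto simp: simulates_def regs_ok_def)
    have nh: "\<not> holds (WLess ?v (R + j)) s" using r by simp
    have "simulates q' V e h s"
      using 0(2) v(2) unfolding simulates_def regs_ok_def by (metis fun_upd_other insertCI)
    then show ?case using exec.WhileFalse[OF nh] by (intro exI conjI) auto
  next
    case (Suc d)
    let ?k = "n ^ j - Suc d"
    have k: "?k < n ^ j" "n ^ j - d = Suc ?k" using Suc.prems(1) by auto
    have r: "wreg s (R + j) = n ^ j" "wreg s ?v = ?k"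
      using Suc.prems(2) v by (auto simp: simulates_def regs_ok_def)
    have hh: "holds (WLess ?v (R + j)) s" using r k by simp
    have fit0: "D + (q' + calls n c) * S < W" using Suc.prems(3) by (simp add: algebra_simps)
    obtain t1 s1 where 1: "exec W (compile R mm c) s t1 s1" "t1 \<le> cost n product_cost c"
        "simulates (q' + calls n c) (insert v V) (e(v := ?k)) (run n c (e(v := ?k)) h) s1"
      using For.IH[OF ok Suc.prems(2) fit0] by blast
    have r1: "wreg s1 ?v = ?k" using 1(3) v by (auto simp: simulates_def regs_ok_def)
    let ?s2 = "s1(|wreg := (wreg s1)(R + 40 := 1, ?v := Suc ?k)|)"
    have 2: "exec W (Do (WConst (R + 40) 1) ;; Do (WOp WAdd ?v ?v (R + 40))) s1 2 ?s2"
      by (rule exec_two) (use r1 v nj k in simp_all)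
    have sim2: "simulates (q' + calls n c) (insert v V) (e(v := n ^ j - d)) (run n c (e(v := ?k)) h) ?s2"
      using 1(3) v k nj(1) unfolding simulates_def regs_ok_def mem_ok_def scratch_ok_def by auto
    have dle: "d \<le> n ^ j" and fit: "D + (q' + calls n c + d * calls n c) * S < W"
      using Suc.prems(1,3) by (simp_all add: algebra_simps)
    obtain t3 s3 where 3: "exec W (While (WLess ?v (R + j)) ?b) ?s2 t3 s3"
        "t3 \<le> d * (cost n product_cost c + 3) + 1"
        "simulates (q' + calls n c + d * calls n c) V e
          (fold (%k. run n c (e(v := k))) [n ^ j - d..<n ^ j] (run n c (e(v := ?k)) h)) s3"
      using Suc.IH[OF dle sim2 fit] by blast
    have E: "exec W (While (WLess ?v (R + j)) ?b) s (1 + (t1 + 2) + t3) s3"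
      using exec.WhileTrue[OF hh exec.Seq[OF 1(1) 2] 3(1)] .
    have "[?k..<n ^ j] = ?k # [n ^ j - d..<n ^ j]" using k upt_conv_Cons by metis
    then show ?case
      by - (rule exI, rule exI, rule conjI, rule E, use 1(2) 3(2,3) in \<open>simp add: algebra_simps del: fun_upd_apply\<close>)
  qed
  let ?s0 = "s(|wreg := (wreg s)(?v := 0)|)"
  have 0: "exec W (Do (WConst ?v 0)) s 1 ?s0" unfolding One_nat_def by (rule exec_one) (use nj in simp_all)
  have "simulates q (insert v V) (e(v := n ^ j - n ^ j)) h ?s0"
    using For.prems(2) v limit2 unfolding simulates_def regs_ok_def mem_ok_def scratch_ok_def by auto
  from loop[OF order_refl this] obtain t s' where L: "exec W (While (WLess ?v (R + j)) ?b) ?s0 t s'"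
      "t \<le> n ^ j * (cost n product_cost c + 3) + 1"
      "simulates (q + n ^ j * calls n c) V e (fold (%k. run n c (e(v := k))) [0..<n ^ j] h) s'"
    using For.prems(3) by auto
  have "exec W (compile R mm (For v j c)) s (1 + t) s'" using exec.Seq[OF 0 L(1)] by simp
  then show ?case using L(2,3) by (intro exI conjI) auto
next
  case (PutW a x y)
  have DW: "D \<le> W" using PutW.prems(3) by simp
  have mem: "mem_ok h s" and regs: "regs_ok V e (wreg s)" using PutW.prems(2) by (auto simp: simulates_def)
  have ok: "wexp_ok m V x" "wexp_ok m V y" using PutW.prems(1) by auto
  obtain w where w: "exec W (compw2 R x y) s (wcost x + wcost y) (s(|wreg := w|))" "\<forall>r<R + 40. w r = wreg s r"
     "w (R + 40) = weval n e h x" "w (R + 41) = weval n e h y"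
    using compw2_correct[OF mem DW ok regs] by blast
  have iD: "weval n e h x < D" using weval_D[OF mem DW ok(1) regs] .
  have w5: "w (R + 5) = word_limit n" using regs w(2) by (simp add: regs_ok_def)
  let ?y = "weval n e h y mod word_limit n"
  have y: "?y < word_limit n" using limit2 by simp
  then have y': "?y < W" using limit_D DW by linarith
  let ?s' = "s(|wreg := w(R + 41 := ?y), warr := array_write (warr s) (array_name R a) (weval n e h x) ?y|)"
  have 2: "exec W (Do (WOp WMod (R + 41) (R + 41) (R + 5)) ;; Do (WStore (array_name R a) (R + 40) (R + 41)))
      (s(|wreg := w|)) 2 ?s'"
    by (rule exec_two) (use w w5 y y' in simp_all)
  have "simulates q V e (run n (PutW a x y) e h) ?s'"
    using PutW.prems(2) w(2) y array_name_inj[OF R5] scratch_low[OF PutW.prems(2) iD]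
    unfolding simulates_def regs_ok_def mem_ok_def scratch_ok_def by (auto simp: array_write_def)
  then show ?case using exec.Seq[OF w(1) 2] by (intro exI conjI) auto
next
  case (PutF a x y)
  have DW: "D \<le> W" using PutF.prems(3) by simp
  have ok: "wexp_ok m V x" "fexp_ok m V y" using PutF.prems(1) by auto
  obtain s1 where 1: "exec W (compf R y (R + 2)) s (fcost y) s1" "same_but (R + 2) s s1"
      "freg s1 (R + 2) = feval n e h y"
    using compf_correct[of h s V y e "R + 2"] DW PutF.prems(1,2) by (auto simp: simulates_def)
  have sim: "simulates q V e h s1" using simulates_same_but[OF PutF.prems(2) 1(2)] .
  then have mem: "mem_ok h s1" and regs: "regs_ok V e (wreg s1)" by (auto simp: simulates_def)
  obtain w where w: "exec W (compw R x (R + 40)) s1 (wcost x) (s1(|wreg := w|))" "\<forall>r<R + 40. w r = wreg s1 r"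
      "w (R + 40) = weval n e h x"
    using compw_correct[OF mem DW ok(1) regs order_refl] by blast
  have iD: "weval n e h x < D" using weval_D[OF mem DW ok(1) regs] .
  let ?s' = "s1(|wreg := w, farr := array_write (farr s1) (array_name R a) (weval n e h x) (feval n e h y)|)"
  have 2: "exec W (Do (FStore (array_name R a) (R + 40) (R + 2))) (s1(|wreg := w|)) (Suc 0) ?s'"
    by (rule exec_one) (use w 1(3) in simp_all)
  have "simulates q V e (run n (PutF a x y) e h) ?s'"
    using sim w(2) array_name_inj[OF R5] scratch_low[OF sim iD]
    unfolding simulates_def regs_ok_def mem_ok_def scratch_ok_def by (auto simp: array_write_def)
  then show ?case using exec.Seq[OF 1(1) exec.Seq[OF w(1) 2]] by (intro exI conjI) auto
next
  case (PutG a x b y)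
  have DW: "D \<le> W" using PutG.prems(3) by simp
  have mem: "mem_ok h s" and regs: "regs_ok V e (wreg s)" using PutG.prems(2) by (auto simp: simulates_def)
  have ok: "wexp_ok m V x" "wexp_ok m V y" using PutG.prems(1) by auto
  obtain w where w: "exec W (compw2 R x y) s (wcost x + wcost y) (s(|wreg := w|))" "\<forall>r<R + 40. w r = wreg s r"
     "w (R + 40) = weval n e h x" "w (R + 41) = weval n e h y"
    using compw2_correct[OF mem DW ok regs] by blast
  have iD: "weval n e h x < D" "weval n e h y < D"
    using weval_D[OF mem DW ok(1) regs] weval_D[OF mem DW ok(2) regs] .
  have g: "garr s (array_name R b) (weval n e h y) = gmem h b (weval n e h y)"
    using mem iD(2) by (simp add: mem_ok_def)
  let ?s' = "s(|wreg := w, greg := (greg s)(R := gmem h b (weval n e h y)),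
     garr := array_write (garr s) (array_name R a) (weval n e h x) (gmem h b (weval n e h y))|)"
  have 2: "exec W (Do (GLoad R (array_name R b) (R + 41)) ;; Do (GStore (array_name R a) (R + 40) R))
      (s(|wreg := w|)) 2 ?s'"
    by (rule exec_two) (use w g in simp_all)
  have "simulates q V e (run n (PutG a x b y) e h) ?s'"
    using PutG.prems(2) w(2) array_name_inj[OF R5] scratch_low[OF PutG.prems(2) iD(1)]
    unfolding simulates_def regs_ok_def mem_ok_def scratch_ok_def by (auto simp: array_write_def)
  then show ?case using exec.Seq[OF w(1) 2] by (intro exI conjI) auto
next
  case (MatMul a b c)
  have ok: "5 \<le> a" "5 \<le> b" "5 \<le> c" using MatMul.prems(1) by auto
  obtain t s' where 1: "exec W (matmul_code R mm a b c) s t s'" "t \<le> product_cost"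
    "mem_ok (run n (MatMul a b c) e h) s'" "scratch_ok (Suc q) s'"
    "\<forall>r. R \<le> r --> r \<notin> {R + 6, R + 8, R + 9, R + 11} --> wreg s' r = wreg s r"
    using matmul_code_correct[OF _ _ _ _ ok, of h s q V e] MatMul.prems(2,3) by (auto simp: simulates_def)
  have "regs_ok V e (wreg s')"
    using MatMul.prems(2) 1(5) unfolding simulates_def regs_ok_def by auto
  then show ?case using 1(1-4) by (intro exI conjI) (auto simp: simulates_def)
qed

end

primrec pow_code :: "nat => nat => nat => program" where
  "pow_code x r 0 = Do (WConst r 1)"
| "pow_code x r (Suc k) = pow_code x r k ;; Do (WOp WMul r r x)"

lemma pow_code_correct:
  "r ~= x ==> 1 < W ==> wreg s x ^ k < W ==> 0 < wreg s x | k \<le> 4 ==>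
    exec W (pow_code x r k) s (Suc k) (s(|wreg := (wreg s)(r := wreg s x ^ k)|))"
proof (induction k)
  case 0
  show ?case unfolding pow_code.simps by (rule exec_one) (use 0 in \<open>simp_all del: fun_upd_apply\<close>)
next
  case (Suc k)
  have "wreg s x ^ k < W"
  proof (cases "wreg s x = 0")
    case True
    then show ?thesis using Suc.prems(2) by (cases k) auto
  next
    case False
    then have "wreg s x ^ k \<le> wreg s x ^ Suc k" by simp
    then show ?thesis using Suc.prems(3) by linarith
  qed
  then have 1: "exec W (pow_code x r k) s (Suc k) (s(|wreg := (wreg s)(r := wreg s x ^ k)|))"
    using Suc by (auto simp del: fun_upd_apply)
  have 2: "exec W (Do (WOp WMul r r x)) (s(|wreg := (wreg s)(r := wreg s x ^ k)|)) (Suc 0)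
     (s(|wreg := (wreg s)(r := wreg s x ^ Suc k)|))"
    by (rule exec_one) (use Suc.prems in \<open>simp_all add: mult.commute\<close>)
  show ?case using exec_Seq[OF 1 2, of "Suc (Suc k)"] by (simp del: fun_upd_apply)
qed

primrec pows_code :: "nat => (nat \<times> nat) list => program" where
  "pows_code x [] = Skip"
| "pows_code x (p # ps) = pow_code x (fst p) (snd p) ;; pows_code x ps"

lemma pows_code_correct:
  "x \<notin> fst ` set ps ==> 1 < W ==> \<forall>p\<in>set ps. wreg s x ^ snd p < W & (0 < wreg s x | snd p \<le> 4) ==>
    exec W (pows_code x ps) s (\<Sum>p\<leftarrow>ps. Suc (snd p))
      (s(|wreg := fold (%p w. w(fst p := wreg s x ^ snd p)) ps (wreg s)|))"
proof (induction ps arbitrary: s)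
  case Nil
  then show ?case by (simp add: exec.Skip)
next
  case (Cons p ps)
  let ?s = "s(|wreg := (wreg s)(fst p := wreg s x ^ snd p)|)"
  have 1: "exec W (pow_code x (fst p) (snd p)) s (Suc (snd p)) ?s"
    using Cons.prems by (intro pow_code_correct) auto
  have x: "wreg ?s x = wreg s x" using Cons.prems(1) by auto
  have 2: "exec W (pows_code x ps) ?s (\<Sum>p\<leftarrow>ps. Suc (snd p))
      (?s(|wreg := fold (%p w. w(fst p := wreg ?s x ^ snd p)) ps (wreg ?s)|))"
    using Cons.prems by (intro Cons.IH) (auto simp: x)
  show ?case using exec_Seq[OF 1 2[unfolded x] refl] by (simp del: fun_upd_apply)
qed

definition prologue :: "nat => nat => nat => program" where
  "prologue R m k =
     pows_code 0 [(R, 0), (R + 1, 1), (R + 2, 2), (R + 3, 3), (R + 4, 4)] ;;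
     (Do (WConst (R + 12) 2) ;; Do (WOp WAdd (R + 12) (R + 12) 0)) ;;
     pows_code (R + 12) [(R + 5, 4), (R + 6, 4 * m), (R + 7, k + 2)]"

lemma prologue_correct:
  assumes "wreg s 0 = n" "1 < W" "(n + 2) ^ (4 * m) < W" "(n + 2) ^ (k + 2) < W" "(n + 2) ^ 4 < W" "1 \<le> R"
  shows "\<exists>w. exec W (prologue R m k) s (4 * m + k + 26) (s(|wreg := w|)) &
     (\<forall>j\<le>4. w (R + j) = n ^ j) & w (R + 5) = (n + 2) ^ 4 & w (R + 6) = (n + 2) ^ (4 * m) &
     w (R + 7) = (n + 2) ^ (k + 2) & (\<forall>r. (r < R | r > R + 7) --> r ~= R + 12 --> w r = wreg s r)"
proof -
  have nW: "n ^ j < W" if "j \<le> 4" for j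
  proof -
    have "n ^ j \<le> (n + 2) ^ j" by (rule power_mono) auto
    also have "\<dots> \<le> (n + 2) ^ 4" using that by (intro power_increasing) auto
    finally show ?thesis using assms(5) by linarith
  qed
  let ?ps = "[(R, 0), (R + 1, 1), (R + 2, 2), (R + 3, 3), (R + 4, 4::nat)]"
  let ?w1 = "(wreg s)(R := n ^ 0, R + 1 := n ^ 1, R + 2 := n ^ 2, R + 3 := n ^ 3, R + 4 := n ^ 4)"
  have "exec W (pows_code 0 ?ps) s (\<Sum>p\<leftarrow>?ps. Suc (snd p))
      (s(|wreg := fold (%p w. w(fst p := wreg s 0 ^ snd p)) ?ps (wreg s)|))"
    by (rule pows_code_correct) (use nW[of 0] nW[of 1] nW[of 2] nW[of 3] nW[of 4] assms in auto)
  then have 1: "exec W (pows_code 0 ?ps) s 15 (s(|wreg := ?w1|))"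
    using assms(1) by (simp del: power_0 power_one_right)
  let ?s1 = "s(|wreg := ?w1|)" and ?s2 = "s(|wreg := ?w1(R + 12 := n + 2)|)"
  have "n + 2 \<le> (n + 2) ^ 4" by (rule self_le_power) auto
  then have n2: "n + 2 < W" using assms(5) by linarith
  have 2: "exec W (Do (WConst (R + 12) 2) ;; Do (WOp WAdd (R + 12) (R + 12) 0)) ?s1 2 ?s2"
    by (rule exec_two) (use n2 assms in \<open>simp_all\<close>)
  let ?qs = "[(R + 5, 4), (R + 6, 4 * m), (R + 7, k + 2)]"
  let ?w3 = "(?w1(R + 12 := n + 2))(R + 5 := (n + 2) ^ 4, R + 6 := (n + 2) ^ (4 * m), R + 7 := (n + 2) ^ (k + 2))"
  have "exec W (pows_code (R + 12) ?qs) ?s2 (\<Sum>p\<leftarrow>?qs. Suc (snd p))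
      (?s2(|wreg := fold (%p w. w(fst p := wreg ?s2 (R + 12) ^ snd p)) ?qs (wreg ?s2)|))"
    by (rule pows_code_correct) (use assms in auto)
  then have 3: "exec W (pows_code (R + 12) ?qs) ?s2 (4 * m + k + 9) (s(|wreg := ?w3|))"
    by (simp add: add.commute del: power_0 power_one_right power_Suc)
  have E: "exec W (prologue R m k) s (4 * m + k + 26) (s(|wreg := ?w3|))"
    unfolding prologue_def by (rule exec_Seq[OF 1 exec_Seq[OF 2 3 refl]]) simp
  have j: "j = 0 | j = 1 | j = 2 | j = 3 | j = 4" if "j \<le> 4" for j :: nat using that by linarith
  show ?thesis
    by (rule exI, rule conjI, rule E) (auto dest!: j)
qed

definition mem_of :: "'g state => 'g mem" where
  "mem_of s = (|wmem = warr s, fmem = farr s, gmem = garr s|)"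

definition clean_input :: "nat => 'g::zero state => bool" where
  "clean_input n s \<longleftrightarrow> wreg s = (%_. 0)(0 := n) & (\<forall>r. freg s r = 0 & greg s r = 0) &
     (\<forall>a i. 5 \<le> a | n * n \<le> i --> warr s a i = 0 & farr s a i = 0 & garr s a i = 0) &
     (\<forall>a i. warr s a i < word_limit n)"

lemma cost_calls: "cost n p c = cost n 0 c + calls n c * p"
  by (induction c) (auto simp: algebra_simps)

primrec loop_degree :: "stmt => nat" where
  "loop_degree Pass = 0"
| "loop_degree (Then c d) = max (loop_degree c) (loop_degree d)"
| "loop_degree (When b c) = loop_degree c"
| "loop_degree (For v j c) = j + loop_degree c"
| "loop_degree (PutW a x y) = 0"
| "loop_degree (PutF a x y) = 0"
| "loop_degree (PutG a x b y) = 0"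
| "loop_degree (MatMul a b c) = 0"

lemma cost_polynomial: "\<exists>K. \<forall>n. cost n 0 c \<le> K * (n + 1) ^ loop_degree c"
proof (induction c)
  case (Then c d)
  then obtain K L where KL: "!!n. cost n 0 c \<le> K * (n + 1) ^ loop_degree c" "!!n. cost n 0 d \<le> L * (n + 1) ^ loop_degree d"
    by blast
  have "cost n 0 (Then c d) \<le> (K + L) * (n + 1) ^ loop_degree (Then c d)" for n
  proof -
    have "(n + 1) ^ loop_degree c \<le> (n + 1) ^ loop_degree (Then c d)"
      "(n + 1) ^ loop_degree d \<le> (n + 1) ^ loop_degree (Then c d)" by (intro power_increasing; simp)+
    then have "K * (n + 1) ^ loop_degree c \<le> K * (n + 1) ^ loop_degree (Then c d)"
      "L * (n + 1) ^ loop_degree d \<le> L * (n + 1) ^ loop_degree (Then c d)" by (intro mult_le_mono2; simp)+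
    then show ?thesis using KL[of n] by (simp only: cost.simps distrib_right)
  qed
  then show ?case by blast
next
  case (When b c)
  then obtain K where K: "!!n. cost n 0 c \<le> K * (n + 1) ^ loop_degree c" by blast
  have "cost n 0 (When b c) \<le> (K + fcost b + 2) * (n + 1) ^ loop_degree (When b c)" for n
  proof -
    have "1 \<le> (n + 1) ^ loop_degree c" by simp
    then have "(fcost b + 2) * 1 \<le> (fcost b + 2) * (n + 1) ^ loop_degree c" by (intro mult_le_mono2)
    then show ?thesis using K[of n] by (simp add: algebra_simps)
  qed
  then show ?case by blast
next
  case (For v j c)
  then obtain K where K: "!!n. cost n 0 c \<le> K * (n + 1) ^ loop_degree c" by blast
  have "cost n 0 (For v j c) \<le> (K + 5) * (n + 1) ^ loop_degree (For v j c)" for n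
  proof -
    let ?N = "(n + 1) ^ loop_degree c"
    have "1 \<le> ?N" by simp
    then have "cost n 0 c + 3 \<le> K * ?N + 3 * ?N" using K[of n] by linarith
    then have "cost n 0 c + 3 \<le> (K + 3) * ?N" by (simp add: distrib_right)
    moreover have "n ^ j \<le> (n + 1) ^ j" by (rule power_mono) auto
    ultimately have "n ^ j * (cost n 0 c + 3) \<le> (n + 1) ^ j * ((K + 3) * ?N)" by (intro mult_le_mono)
    moreover have "1 \<le> (n + 1) ^ j * ?N" by simp
    ultimately have "n ^ j * (cost n 0 c + 3) + 2 \<le> (n + 1) ^ j * ((K + 3) * ?N) + 2 * ((n + 1) ^ j * ?N)"
      by linarith
    then show ?thesis by (simp add: algebra_simps power_add)
  qed
  then show ?case by blast
qed (auto intro: exI[of _ "_ :: nat"])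

definition bounded_program :: "nat => wexp => stmt => bool" where
  "bounded_program m x c \<longleftrightarrow> 1 \<le> m & stmt_ok m {} c & wexp_ok m {} x & (\<forall>n. calls n c \<le> (n + 2) ^ 3)"

lemma run_on_machine:
  assumes mult: "!!N A B. \<exists>t s. exec ((N + 2) ^ k) mm (matmul_input N A B) t s & t \<le> T N &
      (\<forall>i<N. \<forall>j<N. farr s 2 (i * N + j) = (\<Sum>l<N. A i l * B l j))"
    and c: "bounded_program m x c"
  shows "\<exists>prog K a. \<forall>n (s :: 'g::{zero,preorder} state). clean_input n s -->
    (\<exists>t s'. exec ((n + 2) ^ K) prog s t s' & t \<le> a + cost n 0 c + calls n c * (a + 2 * T n + 21 * (n * n)) &
       wreg s' 0 = weval n (%_. 0) (run n c (%_. 0) (mem_of s)) x &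
       (\<forall>a<5. \<forall>i<(n + 2) ^ (4 * m). warr s' a i = wmem (run n c (%_. 0) (mem_of s)) a i &
          farr s' a i = fmem (run n c (%_. 0) (mem_of s)) a i & garr s' a i = gmem (run n c (%_. 0) (mem_of s)) a i))"
proof -
  obtain R0 where R0: "prog_below R0 mm" using prog_below_exists by blast
  define R where "R = max 5 R0"
  have R: "5 \<le> R" "prog_below R mm" using prog_below_mono[OF R0] by (auto simp: R_def)
  have m1: "1 \<le> m" and cok: "stmt_ok m {} c" and xok: "wexp_ok m {} x" and cl: "!!n. calls n c \<le> (n + 2) ^ 3"
    using c by (auto simp: bounded_program_def)
  define K where "K = 4 * m + (k + 5) + 1"
  define prog where "prog = prologue R m k ;; compile R mm c ;; (compw R x (R + 40) ;;
    (Do (WConst 0 0) ;; Do (WOp WAdd 0 (R + 40) 0)))"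
  define a where "a = 4 * m + k + 26 + wcost x + 2 + 2 * R + 8"
  have "\<exists>t s'. exec ((n + 2) ^ K) prog s t s' & t \<le> a + cost n 0 c + calls n c * (a + 2 * T n + 21 * (n * n)) &
       wreg s' 0 = weval n (%_. 0) (run n c (%_. 0) (mem_of s)) x &
       (\<forall>a<5. \<forall>i<(n + 2) ^ (4 * m). warr s' a i = wmem (run n c (%_. 0) (mem_of s)) a i &
          farr s' a i = fmem (run n c (%_. 0) (mem_of s)) a i & garr s' a i = gmem (run n c (%_. 0) (mem_of s)) a i)"
    if inp: "clean_input n s" for n and s :: "'g state"
  proof -
    define S W where "S = (n + 2) ^ (k + 2)" and "W = (n + 2) ^ K"
    interpret machine R n S W "(n + 2) ^ k" m "T n" mm
    proof
      show "5 \<le> R" "prog_below R mm" "1 \<le> m" using R m1 by auto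
      show "\<exists>t s. exec ((n + 2) ^ k) mm (matmul_input n A B) t s & t \<le> T n &
        (\<forall>i<n. \<forall>j<n. farr s 2 (i * n + j) = (\<Sum>l<n. A i l * B l j))" for A B by (rule mult)
      show "(n + 2) ^ k \<le> S" unfolding S_def by (rule power_increasing) auto
      have "(n + 2) ^ 2 \<le> S" unfolding S_def by (rule power_increasing) auto
      then show "n * n \<le> S" "n < S" by (auto simp: power2_eq_square algebra_simps)
    qed
    let ?e = "%_::nat. 0::nat"
    have Dp: "D = (n + 2) ^ (4 * m)" by (simp add: D_def word_limit_def power_mult)
    have lt: "(n + 2) ^ i < W" if "i < K" for i using that unfolding W_def by (intro power_strict_increasing) auto
    have fit: "D + calls n c * S < W"
    proof -
      have "calls n c * S \<le> (n + 2) ^ 3 * S" using cl by (rule mult_le_mono1)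
      also have "\<dots> = (n + 2) ^ (k + 5)" by (simp add: S_def power_add[symmetric] add.commute del: power_Suc)
      finally have 1: "D + calls n c * S \<le> (n + 2) ^ (4 * m) + (n + 2) ^ (k + 5)" using Dp by simp
      have add: "p + q \<le> p * q" if p: "2 \<le> p" and q: "2 \<le> q" for p q :: nat
      proof -
        obtain p' q' where "p = 2 + p'" "q = 2 + q'" using le_Suc_ex[OF p] le_Suc_ex[OF q] by blast
        then show ?thesis by (simp add: algebra_simps)
      qed
      have "2 \<le> (n + 2) ^ i" if "1 \<le> i" for i
        using self_le_power[of "n + 2" i] that by auto
      from add[OF this this, of "4 * m" "k + 5"] m1
      have "(n + 2) ^ (4 * m) + (n + 2) ^ (k + 5) \<le> (n + 2) ^ (4 * m + (k + 5))" by (simp add: power_add)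
      also have "\<dots> < W" by (rule lt) (simp add: K_def)
      finally show ?thesis using 1 by linarith
    qed
    have w0: "wreg s r = (if r = 0 then n else 0)" for r using inp by (simp add: clean_input_def)
    obtain w where w: "exec W (prologue R m k) s (4 * m + k + 26) (s(|wreg := w|))"
       "!!j. j \<le> 4 ==> w (R + j) = n ^ j" "w (R + 5) = (n + 2) ^ 4" "w (R + 6) = (n + 2) ^ (4 * m)"
       "w (R + 7) = S" "!!r. r < R | r > R + 7 ==> r ~= R + 12 ==> w r = wreg s r"
      using prologue_correct[of s n W m k R] w0[of 0] lt[of 0] lt[of "4 * m"] lt[of "k + 2"] lt[of 4] R m1
      by (auto simp: K_def S_def)
    have nD: "n * n \<le> D" using size_limit[of 2] limit_D by (simp add: power2_eq_square)
    have sim: "simulates 0 {} ?e (mem_of s) (s(|wreg := w|))"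
      unfolding simulates_def
    proof (intro conjI)
      show "regs_ok {} ?e (wreg (s(|wreg := w|)))"
        using w w0 R by (simp add: regs_ok_def word_limit_def)
      have "warr s (array_name R a) = warr s a & farr s (array_name R a) = farr s a & garr s (array_name R a) = garr s a" for a
        using inp R unfolding clean_input_def array_name_def fun_eq_iff by auto
      then show "mem_ok (mem_of s) (s(|wreg := w|))"
        using inp by (simp add: mem_ok_def mem_of_def clean_input_def)
      have "warr s a i = 0 & farr s a i = 0 & garr s a i = 0" if "D \<le> i" for a i
        using inp that nD unfolding clean_input_def by (meson le_trans)
      moreover have "greg s r = 0" for r using inp by (simp add: clean_input_def)
      ultimately show "scratch_ok 0 (s(|wreg := w|))"
        using w(4) Dp by (simp add: scratch_ok_def)
    qed
    define h where "h = run n c ?e (mem_of s)"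
    obtain t1 s1 where 1: "exec W (compile R mm c) (s(|wreg := w|)) t1 s1" "t1 \<le> cost n product_cost c"
       "simulates (calls n c) {} ?e h s1"
      using compile_correct[OF cok sim] fit by (auto simp: h_def)
    have mem: "mem_ok h s1" and regs: "regs_ok {} ?e (wreg s1)" using 1(3) by (auto simp: simulates_def)
    have DW: "D \<le> W" using fit by simp
    obtain w' where w': "exec W (compw R x (R + 40)) s1 (wcost x) (s1(|wreg := w'|))"
        "w' (R + 40) = weval n ?e h x"
      using compw_correct[OF mem DW xok regs order_refl] by blast
    have "weval n ?e h x < D" using weval_D[OF mem DW xok regs] .
    then have xW: "weval n ?e h x < W" using DW by linarith
    let ?s' = "s1(|wreg := w'(0 := weval n ?e h x)|)"
    have 2: "exec W (Do (WConst 0 0) ;; Do (WOp WAdd 0 (R + 40) 0)) (s1(|wreg := w'|)) 2 ?s'"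
      by (rule exec_two) (use w' xW in simp_all)
    have E: "exec W prog s ((4 * m + k + 26) + (t1 + (wcost x + 2))) ?s'"
      unfolding prog_def by (rule exec_Seq[OF w(1) exec_Seq[OF 1(1) exec_Seq[OF w'(1) 2 refl] refl] refl])
    have "cost n product_cost c \<le> cost n 0 c + calls n c * (a + 2 * T n + 21 * (n * n))"
      by (subst cost_calls) (auto simp: product_cost_def a_def)
    then have "(4 * m + k + 26) + (t1 + (wcost x + 2)) \<le> a + cost n 0 c + calls n c * (a + 2 * T n + 21 * (n * n))"
      using 1(2) by (simp add: a_def)
    moreover have "warr ?s' b i = wmem h b i & farr ?s' b i = fmem h b i & garr ?s' b i = gmem h b i"
      if "b < 5" "i < (n + 2) ^ (4 * m)" for b i
    proof -
      have "array_name R b = b" using that by (simp add: array_name_def)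
      then show ?thesis using mem that Dp unfolding mem_ok_def by simp (metis)
    qed
    ultimately show ?thesis unfolding W_def[symmetric] h_def[symmetric]
      by - (rule exI, rule exI, rule conjI, rule E, auto)
  qed
  then show ?thesis by blast
qed


text \<open>Three nested loops around one product cost \<open>n\<^sup>3 n\<^sup>\<omega>\<close>, which is absorbed because \<open>3 + \<omega> \<le> 2 \<omega> + 1\<close>; the remaining work of degree five is absorbed because \<open>5 \<le> 2 \<omega> + 1\<close>.\<close>

lemma cost_asymptotics:
  fixes \<omega> :: real
  assumes w: "2 \<le> \<omega>" and T: "(%N. real (T N)) \<in> O(%N. real N powr \<omega>)"
    and calls: "!!n. calls n c = n ^ 3" and deg: "loop_degree c = 5"
  shows "(%n. real (a + cost n 0 c + calls n c * (a + 2 * T n + 21 * (n * n)))) \<in> O(%n. real n powr (2 * \<omega> + 1))"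
proof -
  obtain K where K: "!!n. cost n 0 c \<le> K * (n + 1) ^ 5" using cost_polynomial[of c] deg by auto
  obtain C where C: "\<forall>\<^sub>F n in at_top. norm (real (T n)) \<le> C * norm (real n powr \<omega>)"
    using T by (elim landau_o.bigE)
  have "\<forall>\<^sub>F n in at_top. norm (real (a + cost n 0 c + calls n c * (a + 2 * T n + 21 * (n * n))))
      \<le> (2 * real a + 32 * real K + 2 * C + 21) * norm (real n powr (2 * \<omega> + 1))"
    using C eventually_ge_at_top[of 1]
  proof eventually_elim
    case (elim n)
    define P where "P = real n powr (2 * \<omega> + 1)"
    have n: "1 \<le> real n" using elim(2) by simp
    have "real n powr 5 \<le> P" unfolding P_def using n w by (intro powr_mono) auto
    then have P5: "real n ^ 5 \<le> P" using n by simp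
    have n35: "real n ^ 3 \<le> real n ^ 5" "1 \<le> real n ^ 5" using n by (auto intro: power_increasing)
    have "real n ^ 3 * real n powr \<omega> = real n powr (3 + \<omega>)"
      using n by (simp add: powr_add)
    also have "\<dots> \<le> P" unfolding P_def using n w by (intro powr_mono) auto
    finally have Pw: "real n ^ 3 * real n powr \<omega> \<le> P" .
    have C0: "0 \<le> C"
    proof (rule ccontr)
      assume "\<not> 0 \<le> C"
      then have "C * real n powr \<omega> < 0" using n by (intro mult_neg_pos) auto
      then show False using elim(1) by simp
    qed
    have "real n ^ 3 * real (T n) \<le> real n ^ 3 * (C * real n powr \<omega>)" using elim(1) by (intro mult_left_mono) auto
    also have "\<dots> = C * (real n ^ 3 * real n powr \<omega>)" by simp
    also have "\<dots> \<le> C * P" using Pw C0 by (rule mult_left_mono)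
    finally have 1: "real n ^ 3 * real (T n) \<le> C * P" .
    have "real (cost n 0 c) \<le> real (K * (n + 1) ^ 5)" using K by (rule of_nat_mono)
    also have "\<dots> = real K * (real n + 1) ^ 5" by (simp add: add.commute)
    also have "\<dots> \<le> real K * (2 * real n) ^ 5" using n by (intro mult_left_mono power_mono) auto
    also have "\<dots> = 32 * real K * real n ^ 5" by (simp add: power_mult_distrib)
    also have "\<dots> \<le> 32 * real K * P" using P5 by (intro mult_left_mono) auto
    finally have 2: "real (cost n 0 c) \<le> 32 * real K * P" .
    have 3: "real a \<le> real a * P" using P5 n35 mult_left_mono[of 1 P "real a"] by simp
    have 4: "real n ^ 3 * real a \<le> real a * P" using P5 n35 mult_left_mono[of "real n ^ 3" P "real a"] by (simp add: mult.commute)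
    have 5: "real n ^ 3 * (21 * (real n * real n)) \<le> 21 * P" 
    proof -
      have "real n ^ 3 * (21 * (real n * real n)) = 21 * real n ^ 5" by (simp add: numeral_eq_Suc)
      then show ?thesis using P5 by linarith
    qed
    have "real (a + cost n 0 c + calls n c * (a + 2 * T n + 21 * (n * n))) =
        real a + real (cost n 0 c) + real n ^ 3 * real a + 2 * (real n ^ 3 * real (T n)) + real n ^ 3 * (21 * (real n * real n))"
      by (simp add: calls algebra_simps)
    also have "\<dots> \<le> real a * P + 32 * real K * P + real a * P + 2 * (C * P) + 21 * P"
      using 1 2 3 4 5 by linarith
    also have "\<dots> = (2 * real a + 32 * real K + 2 * C + 21) * P" by (simp add: algebra_simps)
    finally have "real (a + cost n 0 c + calls n c * (a + 2 * T n + 21 * (n * n))) \<le> (2 * real a + 32 * real K + 2 * C + 21) * P" .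
    moreover have "0 \<le> P" by (simp add: P_def)
    ultimately show ?case unfolding P_def[symmetric] real_norm_def abs_of_nat by (simp only: abs_of_nonneg)
  qed
  then show ?thesis by (rule bigoI)
qed

section \<open>Reasoning about structured programs\<close>

lemma size_less_limit: "j \<le> 4 ==> n ^ j < word_limit n"
proof -
  assume j: "j \<le> 4"
  have "n ^ j < (n + 2) ^ j | j = 0" using power_strict_mono[of n "n + 2" j] by auto
  moreover have "(n + 2) ^ j \<le> word_limit n"
    unfolding word_limit_def using j by (intro power_increasing) auto
  moreover have "2 \<le> word_limit n" using self_le_power[of "n + 2" 4] by (simp add: word_limit_def)
  ultimately show ?thesis by auto
qed

primrec fmods :: "stmt => nat set" where
  "fmods Pass = {}"
| "fmods (Then c d) = fmods c \<union> fmods d"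
| "fmods (When b c) = fmods c"
| "fmods (For v j c) = fmods c"
| "fmods (PutW a x y) = {}"
| "fmods (PutF a x y) = {a}"
| "fmods (PutG a x b y) = {}"
| "fmods (MatMul a b c) = {c}"

primrec wmods :: "stmt => nat set" where
  "wmods Pass = {}"
| "wmods (Then c d) = wmods c \<union> wmods d"
| "wmods (When b c) = wmods c"
| "wmods (For v j c) = wmods c"
| "wmods (PutW a x y) = {a}"
| "wmods (PutF a x y) = {}"
| "wmods (PutG a x b y) = {}"
| "wmods (MatMul a b c) = {}"

primrec gmods :: "stmt => nat set" where
  "gmods Pass = {}"
| "gmods (Then c d) = gmods c \<union> gmods d"
| "gmods (When b c) = gmods c"
| "gmods (For v j c) = gmods c"
| "gmods (PutW a x y) = {}"
| "gmods (PutF a x y) = {}"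
| "gmods (PutG a x b y) = {a}"
| "gmods (MatMul a b c) = {}"

lemma fold_invariant':
  assumes "P 0 h" "!!k h. k < N ==> P k h ==> P (Suc k) (f k h)"
  shows "P N (fold f [0..<N] h)"
  using assms(2)
proof (induction N)
  case 0
  then show ?case using assms(1) by simp
next
  case (Suc N)
  then have "P N (fold f [0..<N] h)" by simp
  then show ?case using Suc.prems[of N] by simp
qed

lemma run_For_rule:
  assumes "P 0 h" "!!k h. k < n ^ j ==> P k h ==> P (Suc k) (run n c (e(v := k)) h)"
  shows "P (n ^ j) (run n (For v j c) e h)"
  using fold_invariant'[of P h "n ^ j" "%k. run n c (e(v := k))"] assms by simp

lemma fmem_frame: "a \<notin> fmods c ==> fmem (run n c e h) a = fmem h a"
proof (induction c arbitrary: e h)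
  case (For v j c)
  then show ?case using run_For_rule[of "%_ h'. fmem h' a = fmem h a" h n j c e v] by simp
qed (auto simp: array_write_def)

lemma wmem_frame: "a \<notin> wmods c ==> wmem (run n c e h) a = wmem h a"
proof (induction c arbitrary: e h)
  case (For v j c)
  then show ?case using run_For_rule[of "%_ h'. wmem h' a = wmem h a" h n j c e v] by simp
qed (auto simp: array_write_def)

lemma gmem_frame: "a \<notin> gmods c ==> gmem (run n c e h) a = gmem h a"
proof (induction c arbitrary: e h)
  case (For v j c)
  then show ?case using run_For_rule[of "%_ h'. gmem h' a = gmem h a" h n j c e v] by simp
qed (auto simp: array_write_def)

lemma weval_fmem [simp]: "weval n e (h(|fmem := g|)) x = weval n e h x"
  by (induction x) auto

lemma run_cells:
  assumes "!!k g. k < n ^ j ==> (!!i. \<not> (c \<le> i & i < c + k) ==> g i = fmem h a i) ==>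
    run n b (e(v := k)) (h(|fmem := (fmem h)(a := g)|)) = h(|fmem := (fmem h)(a := g(c + k := E k))|)"
  shows "run n (For v j b) e h =
    h(|fmem := (fmem h)(a := %i. if c \<le> i & i < c + n ^ j then E (i - c) else fmem h a i)|)"
proof -
  let ?g = "%k i. if c \<le> i & i < c + k then E (i - c) else fmem h a i"
  have g0: "?g 0 = fmem h a" by (intro ext) auto
  have "run n (For v j b) e h = h(|fmem := (fmem h)(a := ?g (n ^ j))|)"
  proof (rule run_For_rule[of "%k h'. h' = h(|fmem := (fmem h)(a := ?g k)|)"])
    show "h = h(|fmem := (fmem h)(a := ?g 0)|)" unfolding g0 by simp
    fix k h' assume k: "k < n ^ j" and h': "h' = h(|fmem := (fmem h)(a := ?g k)|)"
    have g: "(?g k)(c + k := E k) = ?g (Suc k)" by (intro ext) auto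
    show "run n b (e(v := k)) h' = h(|fmem := (fmem h)(a := ?g (Suc k))|)"
      unfolding h' g[symmetric] by (rule assms[OF k]) auto
  qed
  then show ?thesis .
qed

lemma run_map:
  assumes "!!k. k < n ^ j ==> weval n (e(v := k)) h x = c + k"
    and "!!k g. k < n ^ j ==> g (c + k) = fmem h a (c + k) ==>
      feval n (e(v := k)) (h(|fmem := (fmem h)(a := g)|)) y = E k"
  shows "run n (For v j (PutF a x y)) e h =
    h(|fmem := (fmem h)(a := %i. if c \<le> i & i < c + n ^ j then E (i - c) else fmem h a i)|)"
  by (rule run_cells) (use assms in \<open>simp add: array_write_def fun_upd_same del: fun_upd_apply\<close>)

definition SumTo :: "nat => wexp => nat => nat => fexp => stmt" where
  "SumTo a x v j y = Then (PutF a x (FLit 0)) (For v j (PutF a x (FBin FAdd (FGet a x) y)))"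

lemma run_SumTo:
  assumes "weval n e h x = c" "!!k. k < n ^ j ==> weval n (e(v := k)) h x = c"
    and y: "!!k g. k < n ^ j ==> feval n (e(v := k)) (h(|fmem := (fmem h)(a := g)|)) y = E k"
  shows "run n (SumTo a x v j y) e h =
    h(|fmem := (fmem h)(a := (fmem h a)(c := \<Sum>k<n ^ j. E k))|)"
proof -
  let ?h = "h(|fmem := (fmem h)(a := (fmem h a)(c := 0))|)"
  have "run n (For v j (PutF a x (FBin FAdd (FGet a x) y))) e ?h =
      h(|fmem := (fmem h)(a := (fmem h a)(c := \<Sum>k<n ^ j. E k))|)"
  proof (rule run_For_rule[of "%k h'. h' = h(|fmem := (fmem h)(a := (fmem h a)(c := \<Sum>k<k. E k))|)"])
    fix k h' assume k: "k < n ^ j" and h': "h' = h(|fmem := (fmem h)(a := (fmem h a)(c := \<Sum>k<k. E k))|)"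
    show "run n (PutF a x (FBin FAdd (FGet a x) y)) (e(v := k)) h' =
        h(|fmem := (fmem h)(a := (fmem h a)(c := \<Sum>k<Suc k. E k))|)"
      unfolding h' using assms(2)[OF k] y[OF k]
      by (simp add: array_write_def fun_upd_same del: fun_upd_apply)
  qed (simp del: fun_upd_apply)
  moreover have "run n (PutF a x (FLit 0)) e h = ?h"
    using assms(1) by (simp add: array_write_def del: fun_upd_apply)
  ultimately show ?thesis by (simp add: SumTo_def del: run.simps(4) fun_upd_apply)
qed

lemma run_For_SumTo:
  assumes "u ~= v"
    and y: "!!i k g. i < n ^ j' ==> k < n ^ j ==> feval n (e(u := i, v := k)) (h(|fmem := (fmem h)(a := g)|)) y = E i k"
  shows "run n (For u j' (SumTo a (WVar u) v j y)) e h =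
    h(|fmem := (fmem h)(a := %i. if i < n ^ j' then \<Sum>k<n ^ j. E i k else fmem h a i)|)"
proof -
  have "run n (For u j' (SumTo a (WVar u) v j y)) e h =
    h(|fmem := (fmem h)(a := %i. if 0 \<le> i & i < 0 + n ^ j' then \<Sum>k<n ^ j. E (i - 0) k else fmem h a i)|)"
  proof (rule run_cells)
    fix i g assume i: "i < n ^ j'"
    let ?h = "h(|fmem := (fmem h)(a := g)|)"
    have "run n (SumTo a (WVar u) v j y) (e(u := i)) ?h =
      ?h(|fmem := (fmem ?h)(a := (fmem ?h a)(i := \<Sum>k<n ^ j. E i k))|)"
      by (rule run_SumTo) (use assms(1) y[OF i] in \<open>auto simp del: fun_upd_apply simp: fun_upd_same fun_upd_other\<close>)
    then show "run n (SumTo a (WVar u) v j y) (e(u := i)) ?h = h(|fmem := (fmem h)(a := g(0 + i := \<Sum>k<n ^ j. E i k))|)"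
      by (simp del: fun_upd_apply add: fun_upd_same)
  qed
  then show ?thesis by (simp cong: if_cong)
qed

definition OrTo :: "nat => wexp => nat => nat => fexp => stmt" where
  "OrTo a x v j y = Then (PutF a x (FLit 0)) (For v j (When y (PutF a x (FLit 1))))"

lemma run_OrTo:
  assumes "weval n e h x = c" "!!k. k < n ^ j ==> weval n (e(v := k)) h x = c"
    and y: "!!k g. k < n ^ j ==> feval n (e(v := k)) (h(|fmem := (fmem h)(a := g)|)) y = E k"
  shows "run n (OrTo a x v j y) e h =
    h(|fmem := (fmem h)(a := (fmem h a)(c := of_bool (\<exists>k<n ^ j. E k = 1)))|)"
proof -
  let ?h = "h(|fmem := (fmem h)(a := (fmem h a)(c := 0))|)"
  have "run n (For v j (When y (PutF a x (FLit 1)))) e ?h =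
      h(|fmem := (fmem h)(a := (fmem h a)(c := of_bool (\<exists>k<n ^ j. E k = 1)))|)"
  proof (rule run_For_rule[of "%k h'. h' = h(|fmem := (fmem h)(a := (fmem h a)(c := of_bool (\<exists>i<k. E i = 1)))|)"])
    fix k h' assume k: "k < n ^ j" and h': "h' = h(|fmem := (fmem h)(a := (fmem h a)(c := of_bool (\<exists>i<k. E i = 1)))|)"
    have "(\<exists>i<Suc k. E i = 1) \<longleftrightarrow> E k = 1 | (\<exists>i<k. E i = 1)" using less_Suc_eq by auto
    then show "run n (When y (PutF a x (FLit 1))) (e(v := k)) h' =
        h(|fmem := (fmem h)(a := (fmem h a)(c := of_bool (\<exists>i<Suc k. E i = 1)))|)"
      unfolding h' using assms(2)[OF k] y[OF k]
      by (cases "E k = 1") (simp_all add: array_write_def del: fun_upd_apply add: fun_upd_same)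
  qed (simp del: fun_upd_apply)
  moreover have "run n (PutF a x (FLit 0)) e h = ?h"
    using assms(1) by (simp add: array_write_def del: fun_upd_apply)
  ultimately show ?thesis by (simp add: OrTo_def del: run.simps(3,4) fun_upd_apply)
qed

lemma run_For_OrTo:
  assumes "u ~= v"
    and y: "!!i k g. i < n ^ j' ==> k < n ^ j ==> feval n (e(u := i, v := k)) (h(|fmem := (fmem h)(a := g)|)) y = E i k"
  shows "run n (For u j' (OrTo a (WVar u) v j y)) e h =
    h(|fmem := (fmem h)(a := %i. if i < n ^ j' then of_bool (\<exists>k<n ^ j. E i k = 1) else fmem h a i)|)"
proof -
  have "run n (For u j' (OrTo a (WVar u) v j y)) e h =
    h(|fmem := (fmem h)(a := %i. if 0 \<le> i & i < 0 + n ^ j' then of_bool (\<exists>k<n ^ j. E (i - 0) k = 1) else fmem h a i)|)"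
  proof (rule run_cells)
    fix i g assume i: "i < n ^ j'"
    let ?h = "h(|fmem := (fmem h)(a := g)|)"
    have "run n (OrTo a (WVar u) v j y) (e(u := i)) ?h =
      ?h(|fmem := (fmem ?h)(a := (fmem ?h a)(i := of_bool (\<exists>k<n ^ j. E i k = 1)))|)"
      by (rule run_OrTo) (use assms(1) y[OF i] in \<open>auto simp del: fun_upd_apply simp: fun_upd_same fun_upd_other\<close>)
    then show "run n (OrTo a (WVar u) v j y) (e(u := i)) ?h = h(|fmem := (fmem h)(a := g(0 + i := of_bool (\<exists>k<n ^ j. E i k = 1)))|)"
      by (simp del: fun_upd_apply add: fun_upd_same)
  qed
  then show ?thesis by (simp cong: if_cong)
qed

primrec last_true :: "(nat => bit) => nat => nat" where
  "last_true E 0 = 0"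
| "last_true E (Suc N) = (if E N = 1 then N else last_true E N)"

lemma last_true: "k < N ==> E k = 1 ==> last_true E N < N & E (last_true E N) = 1"
  by (induction N) (auto simp: less_Suc_eq)

lemma last_true_less: "0 < N ==> last_true E N < N"
proof (induction N)
  case (Suc N)
  then show ?case by (cases "N = 0") auto
qed simp

abbreviation wzero :: wexp where "wzero \<equiv> WBin WSub (WSize 0) (WSize 0)"

definition FindTo :: "nat => wexp => nat => nat => fexp => stmt" where
  "FindTo a x v j y = Then (PutW a x wzero) (For v j (When y (PutW a x (WVar v))))"

lemma run_FindTo:
  assumes "j \<le> 4" "!!g. weval n e (h(|wmem := (wmem h)(a := g)|)) x = c" 
    "!!k g. k < n ^ j ==> weval n (e(v := k)) (h(|wmem := (wmem h)(a := g)|)) x = c"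
    and y: "!!k g. k < n ^ j ==> feval n (e(v := k)) (h(|wmem := (wmem h)(a := g)|)) y = E k"
  shows "run n (FindTo a x v j y) e h =
    h(|wmem := (wmem h)(a := (wmem h a)(c := last_true E (n ^ j)))|)"
proof -
  let ?h = "h(|wmem := (wmem h)(a := (wmem h a)(c := 0))|)"
  have "run n (For v j (When y (PutW a x (WVar v)))) e ?h =
      h(|wmem := (wmem h)(a := (wmem h a)(c := last_true E (n ^ j)))|)"
  proof (rule run_For_rule[of "%k h'. h' = h(|wmem := (wmem h)(a := (wmem h a)(c := last_true E k))|)"])
    fix k h' assume k: "k < n ^ j" and h': "h' = h(|wmem := (wmem h)(a := (wmem h a)(c := last_true E k))|)"
    have "k mod word_limit n = k" using k size_less_limit[OF assms(1), of n] by simp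
    then show "run n (When y (PutW a x (WVar v))) (e(v := k)) h' =
        h(|wmem := (wmem h)(a := (wmem h a)(c := last_true E (Suc k)))|)"
      unfolding h' using assms(3)[OF k] y[OF k]
      by (cases "E k = 1") (simp_all add: array_write_def del: fun_upd_apply add: fun_upd_same)
  qed (simp del: fun_upd_apply)
  moreover have "weval n e h x = c" using assms(2)[of "wmem h a"] by (simp del: fun_upd_apply add: fun_upd_triv)
  then have "run n (PutW a x wzero) e h = ?h"
    by (simp add: array_write_def del: fun_upd_apply)
  ultimately show ?thesis by (simp add: FindTo_def del: run.simps(3,4) fun_upd_apply)
qed

section \<open>The decomposition program\<close>

abbreviation wplus :: "wexp => wexp => wexp" (infixl "+." 65) where "x +. y \<equiv> WBin WAdd x y"
abbreviation wtimes :: "wexp => wexp => wexp" (infixl "*." 70) where "x *. y \<equiv> WBin WMul x y"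
abbreviation wdiv :: "wexp => wexp => wexp" (infixl "div." 70) where "x div. y \<equiv> WBin WDiv x y"
abbreviation wmod :: "wexp => wexp => wexp" (infixl "mod." 70) where "x mod. y \<equiv> WBin WMod x y"
abbreviation fplus :: "fexp => fexp => fexp" (infixl "+\<^sub>f" 65) where "x +\<^sub>f y \<equiv> FBin FAdd x y"
abbreviation ftimes :: "fexp => fexp => fexp" (infixl "*\<^sub>f" 70) where "x *\<^sub>f y \<equiv> FBin FMul x y"
abbreviation then_abbrev :: "stmt => stmt => stmt" (infixr ";;;" 60) where "c ;;; d \<equiv> Then c d"

abbreviation wone :: wexp where "wone \<equiv> WSize 0"
abbreviation wtwo :: wexp where "wtwo \<equiv> wone +. wone"
abbreviation wthree :: wexp where "wthree \<equiv> wtwo +. wone"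
abbreviation wn :: wexp where "wn \<equiv> WSize 1"
abbreviation wn2 :: wexp where "wn2 \<equiv> WSize 2"

abbreviation is_vertex :: "wexp => fexp" where "is_vertex i \<equiv> FIsEq (WGet 0 i) wone"
abbreviation is_edge :: "wexp => fexp" where "is_edge i \<equiv> FIsEq (WGet 0 i) wtwo"
abbreviation end1 :: "wexp => wexp" where "end1 i \<equiv> WGet 1 (i *. wn)"
abbreviation end2 :: "wexp => wexp" where "end2 i \<equiv> WGet 1 (i *. wn +. wone)"

definition init_rows :: stmt where
  "init_rows = For 0 4 (PutF 5 (WVar 0)
     (FIsEq (WVar 0 div. wn2) (WVar 0 mod. wn2) *\<^sub>f
      (is_vertex (WVar 0 mod. wn2 div. wn) *\<^sub>f is_vertex (WVar 0 mod. wn) *\<^sub>f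
       FIsLe (WVar 0 mod. wn2 div. wn) (WVar 0 mod. wn))))"

definition label_components :: stmt where
  "label_components =
     For 1 1 (PutW 5 (WVar 1) (WVar 1)) ;;;
     For 1 1 (When (is_edge (WVar 1) *\<^sub>f FIsLe (WVar 1) (WVar 0))
       (PutW 7 wzero (WGet 5 (end1 (WVar 1))) ;;;
        PutW 7 wone (WGet 5 (end2 (WVar 1))) ;;;
        For 2 1 (When (FIsEq (WGet 5 (WVar 2)) (WGet 7 wone)) (PutW 5 (WVar 2) (WGet 7 wzero)))))"

definition eval_functionals :: stmt where
  "eval_functionals =
     For 1 3 (SumTo 6 (WVar 1) 2 1 (FIsEq (WGet 5 (WVar 2)) (WVar 1 mod. wn) *\<^sub>f
       (FGet 5 (WVar 1 div. wn *. wn2 +. (WVar 2 *. wn +. end1 (WVar 0))) +\<^sub>f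
        FGet 5 (WVar 1 div. wn *. wn2 +. (WVar 2 *. wn +. end2 (WVar 0)))))) ;;;
     For 1 3 (PutF 7 (WVar 1) (FLit 0))"

definition eliminate_column :: stmt where
  "eliminate_column =
     FindTo 6 (WVar 1) 2 2 (FGet 6 (WVar 2 *. wn +. WVar 1)) ;;;
     For 2 2 (PutF 12 (WVar 2) (FGet 6 (WVar 2 *. wn +. WVar 1))) ;;;
     For 2 1 (PutF 13 (WVar 2) (FGet 6 (WGet 6 (WVar 1) *. wn +. WVar 2))) ;;;
     For 2 1 (PutF 14 (WVar 2) (FGet 7 (WGet 6 (WVar 1) *. wn +. WVar 2) +\<^sub>f FIsEq (WVar 2) (WVar 1))) ;;;
     For 2 3 (PutF 6 (WVar 2) (FGet 6 (WVar 2) +\<^sub>f FGet 12 (WVar 2 div. wn) *\<^sub>f FGet 13 (WVar 2 mod. wn))) ;;;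
     For 2 3 (PutF 7 (WVar 2) (FGet 7 (WVar 2) +\<^sub>f FGet 12 (WVar 2 div. wn) *\<^sub>f FGet 14 (WVar 2 mod. wn)))"

definition multiply_blocks :: stmt where
  "multiply_blocks =
     For 1 3 (PutF 8 (WVar 1) (FGet 5 (WGet 6 (WVar 1 div. wn2) *. wn2 +. WVar 1 mod. wn2))) ;;;
     For 1 1 (For 2 1 (
       For 3 2 (PutF 9 (WVar 3) (FGet 7 (WVar 1 *. wn2 +. WVar 3))) ;;;
       For 3 2 (PutF 10 (WVar 3) (FGet 8 (WVar 3 div. wn *. wn2 +. (WVar 2 *. wn +. WVar 3 mod. wn)))) ;;;
       MatMul 9 10 11 ;;;
       For 3 2 (PutF 15 ((WVar 1 *. wn +. WVar 2) *. wn2 +. WVar 3) (FGet 11 (WVar 3))))) ;;;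
     For 1 4 (PutF 5 (WVar 1) (FGet 5 (WVar 1) +\<^sub>f
       FGet 15 ((WVar 1 div. wn2 div. wn *. wn +. WVar 1 mod. wn2 div. wn) *. wn2 +.
         (WVar 1 div. wn2 mod. wn *. wn +. WVar 1 mod. wn))))"

definition impose_edge :: stmt where
  "impose_edge = label_components ;;; eval_functionals ;;; For 1 1 eliminate_column ;;; multiply_blocks"

definition endomorphisms :: stmt where
  "endomorphisms = init_rows ;;; For 0 1 (When (is_edge (WVar 0)) impose_edge)"

definition init_idempotents :: stmt where
  "init_idempotents =
     For 0 2 (PutF 16 (WVar 0) (FIsEq (WVar 0 div. wn) (WVar 0 mod. wn) *\<^sub>f is_vertex (WVar 0 mod. wn))) ;;;
     PutW 7 wtwo wzero ;;; For 0 1 (PutW 7 wtwo wone)"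

definition find_splitting :: stmt where
  "find_splitting =
     For 1 3 (OrTo 18 (WVar 1) 2 1 (FIsLess (WVar 1 mod. wn) (WGet 7 wtwo) *\<^sub>f
       FGet 16 (WVar 1 mod. wn *. wn2 +. (WVar 2 *. wn +. WVar 2)) *\<^sub>f
       FGet 5 (WVar 1 div. wn *. wn2 +. (WVar 2 *. wn +. WVar 2)))) ;;;
     For 1 3 (OrTo 19 (WVar 1) 2 1 (FIsLess (WVar 1 mod. wn) (WGet 7 wtwo) *\<^sub>f
       FGet 16 (WVar 1 mod. wn *. wn2 +. (WVar 2 *. wn +. WVar 2)) *\<^sub>f
       (FLit 1 +\<^sub>f FGet 5 (WVar 1 div. wn *. wn2 +. (WVar 2 *. wn +. WVar 2))))) ;;;
     For 1 3 (PutF 17 (WVar 1) (FGet 18 (WVar 1) *\<^sub>f FGet 19 (WVar 1))) ;;;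
     FindTo 7 wthree 1 3 (FGet 17 (WVar 1))"

definition compress :: stmt where
  "compress =
     For 1 2 (SumTo 22 (WVar 1) 2 1
       (FGet 16 (WGet 7 wthree mod. wn *. wn2 +. (WVar 1 div. wn *. wn +. WVar 2)) *\<^sub>f
        FGet 5 (WGet 7 wthree div. wn *. wn2 +. (WVar 2 *. wn +. WVar 1 mod. wn)))) ;;;
     For 1 2 (SumTo 20 (WVar 1) 2 1 (FGet 22 (WVar 1 div. wn *. wn +. WVar 2) *\<^sub>f
        FGet 16 (WGet 7 wthree mod. wn *. wn2 +. (WVar 2 *. wn +. WVar 1 mod. wn))))"

definition square_repeatedly :: stmt where
  "square_repeatedly =
     For 1 1 (For 2 2 (SumTo 21 (WVar 2) 3 1 (FGet 20 (WVar 2 div. wn *. wn +. WVar 3) *\<^sub>f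
        FGet 20 (WVar 3 *. wn +. WVar 2 mod. wn))) ;;;
       For 2 2 (PutF 20 (WVar 2) (FGet 21 (WVar 2))))"

definition store_splitting :: stmt where
  "store_splitting =
     For 1 2 (PutF 16 (WGet 7 wtwo *. wn2 +. WVar 1)
       (FGet 16 (WGet 7 wthree mod. wn *. wn2 +. WVar 1) +\<^sub>f FGet 20 (WVar 1))) ;;;
     For 1 2 (PutF 16 (WGet 7 wthree mod. wn *. wn2 +. WVar 1) (FGet 20 (WVar 1))) ;;;
     PutW 7 wtwo (WGet 7 wtwo +. wone)"

definition refine_idempotents :: stmt where
  "refine_idempotents = For 0 1 (find_splitting ;;;
     When (FGet 17 (WGet 7 wthree)) (compress ;;; square_repeatedly ;;; store_splitting))"

definition write_output :: stmt where
  "write_output =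
     For 0 3 (
       PutF 0 (WVar 0 div. wn2 *. (wn2 +. wn2) +. (WVar 0 mod. wn2 div. wn *. (wn +. wn) +. WVar 0 mod. wn))
         (is_edge (WVar 0 mod. wn) *\<^sub>f (FIsEq (WVar 0 mod. wn2 div. wn) (end1 (WVar 0 mod. wn)) +\<^sub>f
          FIsEq (WVar 0 mod. wn2 div. wn) (end2 (WVar 0 mod. wn)))) ;;;
       PutF 0 (WVar 0 div. wn2 *. (wn2 +. wn2) +. (WVar 0 mod. wn2 div. wn *. (wn +. wn) +. (wn +. WVar 0 mod. wn)))
         (FIsEq (WVar 0 mod. wn2 div. wn) (WVar 0 mod. wn) +\<^sub>f FGet 16 (WVar 0))) ;;;
     For 0 1 (PutG 1 (WVar 0) 0 (WVar 0) ;;; PutG 1 (wn +. WVar 0) 0 (WVar 0)) ;;;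
     For 0 1 (PutW 0 (WVar 0) wn ;;; PutW 1 (WVar 0) (wn +. wn) ;;;
       PutW 4 (WVar 0) (WVar 0 *. (wn2 +. wn2)))"

definition decompose :: stmt where
  "decompose = endomorphisms ;;; init_idempotents ;;; refine_idempotents ;;; write_output"

lemmas decompose_defs = decompose_def endomorphisms_def init_idempotents_def refine_idempotents_def
  write_output_def init_rows_def impose_edge_def label_components_def eval_functionals_def
  eliminate_column_def multiply_blocks_def find_splitting_def compress_def square_repeatedly_def
  store_splitting_def SumTo_def OrTo_def FindTo_def

lemma decompose_bounded: "bounded_program 20 (WGet 7 wtwo) decompose"
  and decompose_calls: "calls n decompose = n ^ 3"
  and decompose_degree: "loop_degree decompose = 5"
proof -
  show c: "calls n decompose = n ^ 3" for n
    by (simp add: decompose_defs power3_eq_cube)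
  have "n ^ 3 \<le> (n + 2) ^ 3" for n :: nat by (rule power_mono) auto
  then show "bounded_program 20 (WGet 7 wtwo) decompose"
    by (simp add: bounded_program_def c) (simp add: decompose_defs wexp_ok_def)
  show "loop_degree decompose = 5" by (simp add: decompose_defs)
qed

section \<open>Linear algebra over the field with two elements\<close>

declare add_bit_eq_xor [simp del] mult_bit_eq_and [simp del] bit_not_zero_iff [simp del]
  bit_not_one_iff [simp del] sum_of_bool_eq [simp del] sum_mult_of_bool_eq [simp del]
  sum_of_bool_mult_eq [simp del] plus_fun_apply [simp del] zero_fun_apply [simp del]

lemmas fun_simps = plus_fun_apply zero_fun_apply

lemma bit_add_self [simp]: "(x::bit) + x = 0"
  by (cases x) (auto simp: add_bit_eq_xor)

lemma bit_add_eq_0: "(x::bit) + y = 0 \<longleftrightarrow> x = y"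
  by (cases x; cases y) (auto simp: add_bit_eq_xor)

lemma bit_mult_self: "(x::bit) * x = x"
  by (cases x) auto

lemma bit_neq_0: "(x::bit) ~= 0 \<longleftrightarrow> x = 1"
  by (cases x) auto

definition mm :: "nat => (nat => nat => bit) => (nat => nat => bit) => nat => nat => bit" where
  "mm n A B = (%i j. \<Sum>l<n. A i l * B l j)"

definition app :: "nat => (nat => nat => bit) => (nat => bit) => nat => bit" where
  "app n A x = (%i. \<Sum>j<n. A i j * x j)"

lemma sum_fun_apply: "(sum f S) i = (\<Sum>x\<in>S. f x i)"
  by (induction S rule: infinite_finite_induct) (auto simp: fun_simps)

lemma app_add: "app n A (x + y) = app n A x + app n A y"
  by (simp add: app_def fun_eq_iff fun_simps distrib_left sum.distrib)

lemma app_plus: "app n (A + B) x = app n A x + app n B x"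
  by (simp add: app_def fun_eq_iff fun_simps distrib_right sum.distrib)

lemma app_zero [simp]: "app n A 0 = 0" "app n 0 x = 0"
  by (simp_all add: app_def fun_eq_iff fun_simps)

lemma app_mm: "app n (mm n A B) x = app n A (app n B x)"
proof
  fix i
  have "app n (mm n A B) x i = (\<Sum>j<n. \<Sum>l<n. A i l * B l j * x j)"
    by (simp add: app_def mm_def sum_distrib_right)
  also have "\<dots> = (\<Sum>l<n. \<Sum>j<n. A i l * B l j * x j)" by (rule sum.swap)
  also have "\<dots> = app n A (app n B x) i" by (simp add: app_def sum_distrib_left mult.assoc)
  finally show "app n (mm n A B) x i = app n A (app n B x) i" .
qed

lemma mm_column: "(%i. mm n A B i j) = app n A (%i. B i j)"
  by (simp add: mm_def app_def)

lemma mm_assoc: "mm n (mm n A B) C = mm n A (mm n B C)"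
proof (intro ext)
  fix i j
  have "(%i. mm n (mm n A B) C i j) = (%i. mm n A (mm n B C) i j)"
    by (simp only: mm_column app_mm)
  then show "mm n (mm n A B) C i j = mm n A (mm n B C) i j" by (rule fun_cong)
qed

lemma mm_add: "mm n A (B + C) = mm n A B + mm n A C" "mm n (A + B) C = mm n A C + mm n B C"
  by (simp_all add: mm_def fun_eq_iff fun_simps distrib_left distrib_right sum.distrib)

lemma mm_zero [simp]: "mm n A 0 = 0" "mm n 0 A = 0"
  by (simp_all add: mm_def fun_eq_iff fun_simps)

lemma mat_add_self [simp]: "(A :: nat => nat => bit) + A = 0"
  by (simp add: fun_eq_iff fun_simps)

lemma vec_add_self [simp]: "(x :: nat => bit) + x = 0"
  by (simp add: fun_eq_iff fun_simps)

lemma mat_add_cancel [simp]: "(A :: nat => nat => bit) + (A + B) = B"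
  by (simp add: fun_eq_iff fun_simps flip: add.assoc)

primrec sqs :: "nat => nat => (nat => nat => bit) => nat => nat => bit" where
  "sqs n 0 A = A"
| "sqs n (Suc k) A = mm n (sqs n k A) (sqs n k A)"

text \<open>Squaring is additive on commuting matrices in characteristic 2.\<close>

lemma sqs_char2: "sqs n k (mm n A A + A) = sqs n (Suc k) A + sqs n k A"
proof (induction k)
  case (Suc k)
  let ?T = "sqs n k A"
  have "mm n (mm n ?T ?T + ?T) (mm n ?T ?T + ?T) =
      mm n (mm n ?T ?T) (mm n ?T ?T) + (mm n ?T (mm n ?T ?T) + (mm n ?T (mm n ?T ?T) + mm n ?T ?T))"
    by (simp add: mm_add mm_assoc add.assoc)
  also have "\<dots> = mm n (mm n ?T ?T) (mm n ?T ?T) + mm n ?T ?T" by simp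
  finally show ?case using Suc.IH by simp
qed simp

lemma sqs_absorb:
  assumes "mm n P A = A" "mm n A P = A"
  shows "mm n P (sqs n k A) = sqs n k A & mm n (sqs n k A) P = sqs n k A"
  using assms by (induction k) (auto simp: mm_assoc, metis mm_assoc)

subsection \<open>Kernels by delayed elimination\<close>

definition spans :: "nat => (nat => nat => bit) => (nat => bit) => bool" where
  "spans N K \<phi> \<longleftrightarrow> (\<exists>c. \<forall>q<N. \<phi> q = (\<Sum>k<N. c k * K k q))"

text \<open>Instead of updating a long row after each pivot, only its coefficients \<open>C\<close> with respect to the original pivot rows \<open>P\<close> are maintained; the row itself is recovered by one matrix product.\<close>

definition delayed_row :: "nat => (nat => nat => bit) => (nat => nat => bit) => (nat => nat) => nat => nat => bit" where
  "delayed_row n K C P k q = K k q + (\<Sum>y<n. C k y * K (P y) q)"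

locale functionals =
  fixes n N :: nat and lam :: "nat => (nat => bit) => bit"
  assumes lam_add: "lam y (%q. \<phi> q + a * \<psi> q) = lam y \<phi> + a * lam y \<psi>"
    and lam_cong: "(!!q. q < N ==> \<phi> q = \<psi> q) ==> lam y \<phi> = lam y \<psi>"
begin

lemma lam_zero: "lam y (%q. 0) = 0"
  using lam_add[of y "%q. 0" 1 "%q. 0"] by simp

lemma lam_sum: "lam y (%q. \<Sum>k<M. c k * R k q) = (\<Sum>k<M. c k * lam y (R k))" for M :: nat
  by (induction M) (auto simp: lam_zero lam_add)

definition elim_state where
  "elim_state K x A C P \<longleftrightarrow> (\<forall>k<N. \<forall>y<n. A k y = lam y (delayed_row n K C P k)) &
     (\<forall>k<N. \<forall>y<n. x \<le> y --> C k y = 0) & (\<forall>y<x. P y < N) &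
     (\<forall>\<phi>. spans N (delayed_row n K C P) \<phi> \<longleftrightarrow> spans N K \<phi> & (\<forall>y<x. lam y \<phi> = 0))"

text \<open>Clearing one functional against a pivot row turns a spanning set into a spanning set of the kernel of that functional; if no row has a nonzero value, nothing has to change.\<close>

lemma spans_kernel_step:
  assumes R': "!!k q. k < N ==> R' k q = R k q + lam x (R k) * R p q"
    and p: "p < N" "(\<exists>k<N. lam x (R k) = 1) --> lam x (R p) = 1"
  shows "spans N R' \<phi> \<longleftrightarrow> spans N R \<phi> & lam x \<phi> = 0"
proof
  assume "spans N R' \<phi>"
  then obtain c where c: "!!q. q < N ==> \<phi> q = (\<Sum>k<N. c k * R' k q)" by (auto simp: spans_def)
  let ?s = "\<Sum>k<N. c k * lam x (R k)"
  have "\<phi> q = (\<Sum>k<N. (c k + of_bool (k = p) * ?s) * R k q)" if "q < N" for q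
  proof -
    have "\<phi> q = (\<Sum>k<N. c k * R k q) + (\<Sum>k<N. c k * lam x (R k)) * R p q"
      using c[OF that] R' by (simp add: distrib_left sum.distrib sum_distrib_right mult.assoc)
    also have "?s * R p q = (\<Sum>k<N. of_bool (k = p) * ?s * R k q)"
      using p(1) by (simp add: of_bool_def if_distrib[of "%z. z * _"] sum.delta cong: if_cong)
    finally show ?thesis by (simp add: distrib_right sum.distrib)
  qed
  then have "spans N R \<phi>" unfolding spans_def by (intro exI[of _ "%k. c k + of_bool (k = p) * ?s"]) blast
  moreover have "lam x \<phi> = 0"
  proof -
    have "lam x (R' k) = 0" if k: "k < N" for k
    proof -
      have "lam x (R' k) = lam x (%q. R k q + lam x (R k) * R p q)"
        by (rule lam_cong) (rule R'[OF k])
      also have "\<dots> = lam x (R k) + lam x (R k) * lam x (R p)" by (rule lam_add)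
      finally have "lam x (R' k) = lam x (R k) + lam x (R k) * lam x (R p)" .
      then show ?thesis using p(2) k by (cases "lam x (R k)") auto
    qed
    moreover have "lam x \<phi> = (\<Sum>k<N. c k * lam x (R' k))"
      using lam_cong[of \<phi> "%q. \<Sum>k<N. c k * R' k q" x] c lam_sum by simp
    ultimately show ?thesis by simp
  qed
  ultimately show "spans N R \<phi> & lam x \<phi> = 0" ..
next
  assume a: "spans N R \<phi> & lam x \<phi> = 0"
  then obtain c where c: "!!q. q < N ==> \<phi> q = (\<Sum>k<N. c k * R k q)" by (auto simp: spans_def)
  have "lam x \<phi> = (\<Sum>k<N. c k * lam x (R k))"
    using lam_cong[of \<phi> "%q. \<Sum>k<N. c k * R k q" x] c lam_sum by simp
  then have z: "(\<Sum>k<N. c k * lam x (R k)) = 0" using a by simp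
  have "\<phi> q = (\<Sum>k<N. c k * R' k q)" if "q < N" for q
  proof -
    have "(\<Sum>k<N. c k * R' k q) = (\<Sum>k<N. c k * R k q) + (\<Sum>k<N. c k * lam x (R k)) * R p q"
      using R' by (simp add: distrib_left sum.distrib sum_distrib_right mult.assoc)
    then show ?thesis using c[OF that] z by simp
  qed
  then show "spans N R' \<phi>" unfolding spans_def by blast
qed

lemma elim_step:
  assumes st: "elim_state K x A C P" and x: "x < n" and p: "p < N" "(\<exists>k<N. A k x = 1) --> A p x = 1"
    and P': "P' x = p" "!!y. y < x ==> P' y = P y"
    and A': "!!k y. k < N ==> y < n ==> A' k y = A k y + A k x * A p y"
    and C': "!!k y. k < N ==> y < n ==> C' k y = C k y + A k x * (C p y + of_bool (y = x))"
  shows "elim_state K (Suc x) A' C' P'"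
proof -
  let ?R = "delayed_row n K C P" and ?R' = "delayed_row n K C' P'"
  have A: "A k y = lam y (?R k)" if "k < N" "y < n" for k y using st that by (simp add: elim_state_def)
  have C0: "C k y = 0" if "k < N" "x \<le> y" "y < n" for k y using st that by (simp add: elim_state_def)
  have CP: "(\<Sum>y<n. C k y * K (P' y) q) = (\<Sum>y<n. C k y * K (P y) q)" if "k < N" for k q
  proof (rule sum.cong)
    fix y assume "y \<in> {..<n}"
    then show "C k y * K (P' y) q = C k y * K (P y) q"
      using C0[OF that, of y] P'(2)[of y] by (cases "y < x") auto
  qed simp
  have R': "?R' k q = ?R k q + lam x (?R k) * ?R p q" if k: "k < N" for k q
  proof -
    have "(\<Sum>y<n. C' k y * K (P' y) q) =
        (\<Sum>y<n. C k y * K (P' y) q) + A k x * (\<Sum>y<n. C p y * K (P' y) q) + A k x * (\<Sum>y<n. of_bool (y = x) * K (P' y) q)"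
      using C' k by (simp add: distrib_left distrib_right sum.distrib sum_distrib_left mult.assoc)
    also have "(\<Sum>y<n. of_bool (y = x) * K (P' y) q) = K p q"
      using x P'(1) by (simp add: of_bool_def if_distrib[of "%z. z * _"] sum.delta cong: if_cong)
    finally show ?thesis using CP[OF k] CP[OF p(1)] A[OF k x] by (simp add: delayed_row_def algebra_simps)
  qed
  have "A' k y = lam y (?R' k)" if "k < N" "y < n" for k y
  proof -
    have "?R' k = (%q. ?R k q + lam x (?R k) * ?R p q)" using R'[OF that(1)] by auto
    then have "lam y (?R' k) = lam y (?R k) + lam x (?R k) * lam y (?R p)" using lam_add by simp
    then show ?thesis using A'[OF that] A that p(1) x by simp
  qed
  moreover have "C' k y = 0" if "k < N" "y < n" "Suc x \<le> y" for k y
    using C'[OF that(1,2)] C0[of k y] C0[of p y] p(1) that by simp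
  moreover have "P' y < N" if "y < Suc x" for y
    using that st P' p(1) by (cases "y = x") (auto simp: elim_state_def)
  moreover have "spans N ?R' \<phi> \<longleftrightarrow> spans N K \<phi> & (\<forall>y<Suc x. lam y \<phi> = 0)" for \<phi>
  proof -
    have "spans N ?R' \<phi> \<longleftrightarrow> spans N ?R \<phi> & lam x \<phi> = 0"
      by (rule spans_kernel_step[where R = ?R and R' = ?R' and p = p and x = x])
        (use R' p A x in auto)
    then show ?thesis using st by (auto simp: elim_state_def less_Suc_eq)
  qed
  ultimately show ?thesis by (simp add: elim_state_def)
qed

lemma elim_start:
  assumes "!!k y. k < N ==> y < n ==> A k y = lam y (K k)" "!!k y. k < N ==> y < n ==> C k y = 0"
  shows "elim_state K 0 A C P"
proof -
  have d: "delayed_row n K C P k q = K k q" if "k < N" for k q using assms(2) that by (simp add: delayed_row_def)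
  then have "spans N (delayed_row n K C P) \<phi> \<longleftrightarrow> spans N K \<phi>" for \<phi> by (simp add: spans_def)
  moreover have "lam y (delayed_row n K C P k) = lam y (K k)" if "k < N" for k y
    using d[OF that] by (intro lam_cong) auto
  ultimately show ?thesis using assms by (simp add: elim_state_def)
qed

end

subsection \<open>Graded graphs\<close>

locale graded_graph =
  fixes n :: nat and vert edge :: "nat => bool" and src tgt :: "nat => nat" and f :: "nat => 'g::order"
  assumes inj: "inj_on f {..<n}"
    and ends: "!!e. e < n ==> edge e ==> src e < n & tgt e < n & vert (src e) & vert (tgt e) & src e ~= tgt e &
      f (src e) \<le> f e & f (tgt e) \<le> f e"
    and vert_edge: "!!i. vert i ==> \<not> edge i"
begin

definition rel :: "nat => nat => bit" where
  "rel e i = of_bool (i = src e) + of_bool (i = tgt e)"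

definition F :: "'g => (nat => bit) set" where
  "F u = {x. \<forall>i. x i ~= 0 --> i < n & vert i & f i \<le> u}"

definition combos :: "nat => 'g => (nat => bit) set" where
  "combos k u = {%i. \<Sum>e<n. c e * rel e i | c. \<forall>e. c e ~= 0 --> e < k & edge e & f e \<le> u}"

definition B :: "'g => (nat => bit) set" where
  "B u = combos n u"

definition tri :: "(nat => nat => bit) => bool" where
  "tri M \<longleftrightarrow> (\<forall>i j. M i j ~= 0 --> i < n & j < n & vert i & vert j & f i \<le> f j)"

definition endo :: "(nat => nat => bit) => bool" where
  "endo M \<longleftrightarrow> tri M & (\<forall>e<n. edge e --> app n M (rel e) \<in> B (f e))"

definition idm :: "nat => nat => bit" where
  "idm i j = of_bool (i = j & i < n & vert i)"

lemma combos_zero: "0 \<in> combos k u"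
  unfolding combos_def by (rule CollectI, rule exI[of _ "%e. 0"]) (auto simp: fun_eq_iff fun_simps)

lemma combos_add: "x \<in> combos k u ==> y \<in> combos k u ==> x + y \<in> combos k u"
proof -
  assume "x \<in> combos k u" "y \<in> combos k u"
  then obtain c d where c: "x = (%i. \<Sum>e<n. c e * rel e i)" "\<forall>e. c e ~= 0 --> e < k & edge e & f e \<le> u"
    and d: "y = (%i. \<Sum>e<n. d e * rel e i)" "\<forall>e. d e ~= 0 --> e < k & edge e & f e \<le> u"
    by (auto simp: combos_def)
  show ?thesis unfolding combos_def
  proof (rule CollectI, rule exI[of _ "%e. c e + d e"], intro conjI allI impI)
    show "x + y = (%i. \<Sum>e<n. (c e + d e) * rel e i)"
      by (simp add: c(1) d(1) fun_eq_iff fun_simps distrib_right sum.distrib)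
    fix e assume "c e + d e ~= 0"
    then have "c e ~= 0 | d e ~= 0" by auto
    then show "e < k" "edge e" "f e \<le> u" using c(2) d(2) by auto
  qed
qed

lemma combos_rel: "e < n ==> e < k ==> edge e ==> f e \<le> u ==> rel e \<in> combos k u"
  unfolding combos_def
  by (rule CollectI, rule exI[of _ "%e'. of_bool (e' = e)"])
    (auto simp: fun_eq_iff fun_simps of_bool_def if_distrib[of "%z. z * _"] sum.delta cong: if_cong)

lemma combos_mono: "x \<in> combos k u ==> u \<le> u' ==> x \<in> combos k u'"
  unfolding combos_def by (auto intro: order_trans)

lemma combos_induct:
  assumes "x \<in> combos k u" "Q 0" "!!y z. Q y ==> Q z ==> Q (y + z)"
    "!!e. e < n ==> e < k ==> edge e ==> f e \<le> u ==> Q (rel e)"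
  shows "Q x"
proof -
  obtain c where c: "x = (%i. \<Sum>e<n. c e * rel e i)" "!!e. c e ~= 0 ==> e < k & edge e & f e \<le> u"
    using assms(1) by (auto simp: combos_def)
  have "M \<le> n ==> Q (%i. \<Sum>e<M. c e * rel e i)" for M
  proof (induction M)
    case 0
    then show ?case using assms(2) by (simp add: zero_fun_def)
  next
    case (Suc M)
    have "Q (%i. c M * rel M i)"
    proof (cases "c M = 0")
      case True
      then show ?thesis using assms(2) by (simp add: zero_fun_def)
    next
      case False
      then show ?thesis using assms(4)[of M] c(2)[of M] Suc.prems by (simp add: bit_neq_0)
    qed
    from assms(3)[OF Suc.IH this] Suc.prems show ?case by (simp add: plus_fun_def)
  qed
  from this[of n] show ?thesis using c(1) by simp
qed

lemma B_zero: "0 \<in> B u" and B_add: "x \<in> B u ==> y \<in> B u ==> x + y \<in> B u"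
  and B_mono: "x \<in> B u ==> u \<le> u' ==> x \<in> B u'"
  and B_rel: "e < n ==> edge e ==> f e \<le> u ==> rel e \<in> B u"
  using combos_zero combos_add combos_mono combos_rel unfolding B_def by blast+

lemma F_zero: "0 \<in> F u" and F_add: "x \<in> F u ==> y \<in> F u ==> x + y \<in> F u"
  and F_mono: "x \<in> F u ==> u \<le> u' ==> x \<in> F u'"
proof -
  show "0 \<in> F u" by (simp add: F_def fun_simps)
  show "x + y \<in> F u" if "x \<in> F u" "y \<in> F u"
    using that unfolding F_def plus_fun_apply by (auto, (metis add.right_neutral add.left_neutral)+)
  show "x \<in> F u'" if "x \<in> F u" "u \<le> u'"
    using that unfolding F_def by (auto intro: order_trans)
qed

lemma rel_F: "e < n ==> edge e ==> f e \<le> u ==> rel e \<in> F u"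
  using ends[of e] unfolding F_def rel_def by (auto intro: order_trans split: if_splits)

lemma B_F: "x \<in> B u ==> x \<in> F u"
  unfolding B_def
proof (erule combos_induct)
  show "y + z \<in> F u" if "y \<in> F u" "z \<in> F u" for y z using that by (rule F_add)
qed (rule F_zero, rule rel_F)

lemma tri_zero: "tri 0" and tri_add: "tri A ==> tri C ==> tri (A + C)" and tri_idm: "tri idm"
proof -
  show "tri 0" by (simp add: tri_def fun_simps)
  show "tri (A + C)" if "tri A" "tri C"
    using that unfolding tri_def plus_fun_apply by (metis add.right_neutral add.left_neutral)
  show "tri idm" by (simp add: tri_def idm_def)
qed

lemma tri_mm: "tri A ==> tri C ==> tri (mm n A C)"
  unfolding tri_def
proof (intro allI impI)
  fix i j assume A: "\<forall>i j. A i j ~= 0 --> i < n & j < n & vert i & vert j & f i \<le> f j"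
    and C: "\<forall>i j. C i j ~= 0 --> i < n & j < n & vert i & vert j & f i \<le> f j" and "mm n A C i j ~= 0"
  then obtain l where "A i l * C l j ~= 0" unfolding mm_def by (meson sum.not_neutral_contains_not_neutral)
  then have "A i l ~= 0" "C l j ~= 0" by auto
  then show "i < n & j < n & vert i & vert j & f i \<le> f j" using A C by (meson order_trans)
qed

lemma tri_app: "tri A ==> x \<in> F u ==> app n A x \<in> F u"
  unfolding F_def
proof (intro CollectI allI impI)
  fix i assume A: "tri A" and x: "x \<in> {x. \<forall>i. x i ~= 0 --> i < n & vert i & f i \<le> u}" and "app n A x i ~= 0"
  then obtain l where "A i l * x l ~= 0" unfolding app_def by (meson sum.not_neutral_contains_not_neutral)
  then have "A i l ~= 0" "x l ~= 0" by auto
  then show "i < n & vert i & f i \<le> u" using A x unfolding tri_def by (blast intro: order_trans)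
qed

lemma app_idm: "x \<in> F u ==> app n idm x = x"
proof
  fix i assume x: "x \<in> F u"
  have "app n idm x i = (\<Sum>j<n. if j = i then of_bool (vert i) * x i else 0)"
    unfolding app_def idm_def by (intro sum.cong) auto
  also have "\<dots> = x i" using x by (auto simp: F_def)
  finally show "app n idm x i = x i" .
qed

lemma idm_mm: "tri A ==> mm n idm A = A"
proof (intro ext)
  fix i j assume A: "tri A"
  have "mm n idm A i j = (\<Sum>l<n. if l = i then of_bool (vert i) * A i j else 0)"
    unfolding mm_def idm_def by (intro sum.cong) auto
  also have "\<dots> = A i j" using A by (auto simp: tri_def)
  finally show "mm n idm A i j = A i j" .
qed

lemma mm_idm: "tri A ==> mm n A idm = A"
proof (intro ext)
  fix i j assume A: "tri A"
  have "mm n A idm i j = (\<Sum>l<n. if l = j then A i j * of_bool (vert j) else 0)"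
    unfolding mm_def idm_def by (intro sum.cong) auto
  also have "\<dots> = A i j" using A by (auto simp: tri_def)
  finally show "mm n A idm i j = A i j" .
qed

lemma endo_B: "endo M ==> x \<in> B u ==> app n M x \<in> B u"
proof -
  assume M: "endo M" and x: "x \<in> B u"
  have "x \<in> combos n u" using x by (simp only: B_def)
  then show "app n M x \<in> B u"
  proof (rule combos_induct)
    show "app n M 0 \<in> B u" by (simp only: app_zero B_zero)
    show "app n M (y + z) \<in> B u" if "app n M y \<in> B u" "app n M z \<in> B u" for y z
      unfolding app_add using that by (rule B_add)
    fix e assume e: "e < n" "edge e" "f e \<le> u"
    then have "app n M (rel e) \<in> B (f e)" using M by (simp add: endo_def)
    then show "app n M (rel e) \<in> B u" using e(3) by (rule B_mono)
  qed
qed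

lemma endo_mm: "endo A ==> endo C ==> endo (mm n A C)"
  using tri_mm endo_B by (simp add: endo_def app_mm)

lemma endo_add: "endo A ==> endo C ==> endo (A + C)"
  using tri_add B_add by (simp add: endo_def app_plus)

lemma endo_idm: "endo idm"
  using tri_idm app_idm[OF rel_F[OF _ _ order_refl]] B_rel by (simp add: endo_def)

lemma endo_sqs: "endo A ==> endo (sqs n k A)"
  by (induction k) (auto intro: endo_mm)

lemma endo_tri: "endo A ==> tri A"
  by (simp add: endo_def)

lemma tri_sqs: "tri A ==> tri (sqs n k A)"
  by (induction k) (auto intro: tri_mm)

text \<open>A nonzero term \<open>A i l * C l i\<close> needs \<open>f i \<le> f l \<le> f i\<close>, and births are distinct.\<close>

lemma diag_mm:
  assumes "tri A" "tri C"
  shows "mm n A C i i = A i i * C i i"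
proof (cases "i < n")
  case True
  have "A i l * C l i = (if l = i then A i i * C i i else 0)" if "l < n" for l
  proof (cases "A i l ~= 0 & C l i ~= 0")
    case nz: True
    then have "f i = f l" using assms unfolding tri_def by (meson order_antisym)
    then have "l = i" using inj True that by (auto simp: inj_on_def)
    then show ?thesis by simp
  qed auto
  then have "mm n A C i i = (\<Sum>l<n. if l = i then A i i * C i i else 0)"
    unfolding mm_def by (intro sum.cong) auto
  then show ?thesis using True by simp
next
  case False
  then show ?thesis using assms tri_mm[OF assms] unfolding tri_def by (metis mult_zero_left)
qed

lemma diag_sqs: "tri A ==> sqs n k A i i = A i i"
  by (induction k) (auto simp: diag_mm tri_sqs bit_mult_self)

definition height :: "nat => nat" where
  "height i = card {j. j < n & f j < f i}"

text \<open>Every factor strictly decreases the birth grade, hence the height, which is less than \<open>n\<close>; \<open>n\<close> squarings form a power of exponent \<open>2 ^ n\<close>.\<close>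

lemma strict_nilpotent:
  assumes M: "tri M" "!!i. M i i = 0"
  shows "sqs n n M = 0"
proof -
  have h: "height i + 2 ^ k \<le> height j" if "sqs n k M i j ~= 0" for k i j
    using that
  proof (induction k arbitrary: i j)
    case 0
    then have ij: "i < n" "j < n" "f i \<le> f j" "M i j ~= 0" using M(1) by (auto simp: tri_def)
    then have "i ~= j" using M(2) by auto
    then have "f i ~= f j" using inj ij by (auto simp: inj_on_def)
    then have lt: "f i < f j" using ij by simp
    then have "{l. l < n & f l < f i} \<subset> {l. l < n & f l < f j}" using ij by auto
    then have "height i < height j" unfolding height_def by (intro psubset_card_mono) auto
    then show ?case by simp
  next
    case (Suc k)
    then have "mm n (sqs n k M) (sqs n k M) i j ~= 0" by simp
    then obtain l where "sqs n k M i l * sqs n k M l j ~= 0"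
      unfolding mm_def by (meson sum.not_neutral_contains_not_neutral)
    then have "sqs n k M i l ~= 0" "sqs n k M l j ~= 0" by auto
    then show ?case using Suc.IH[of i l] Suc.IH[of l j] by simp
  qed
  have "height j \<le> n" for j unfolding height_def using card_mono[of "{..<n}" "{l. l < n & f l < f j}"] by auto
  then have "sqs n n M i j = 0" for i j using h[of n i j] less_exp[of n]
    by (metis add_leD2 le_trans not_less)
  then show ?thesis by (simp add: fun_eq_iff fun_simps)
qed

text \<open>By characteristic 2 the error \<open>A\<^sup>2 + A\<close> is squared along with \<open>A\<close>; its diagonal vanishes, so it becomes 0.\<close>

lemma sqs_idempotent:
  assumes "tri A"
  shows "mm n (sqs n n A) (sqs n n A) = sqs n n A"
proof -
  have "sqs n n (mm n A A + A) = 0"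
    by (rule strict_nilpotent) (use assms in \<open>auto simp: tri_add tri_mm diag_mm bit_mult_self fun_simps\<close>)
  then have "sqs n (Suc n) A + sqs n n A = 0" using sqs_char2 by metis
  then have "sqs n (Suc n) A i j + sqs n n A i j = 0" for i j by (metis plus_fun_apply zero_fun_apply)
  then have "sqs n (Suc n) A i j = sqs n n A i j" for i j
    by (simp only: bit_add_eq_0)
  then show ?thesis by (simp add: fun_eq_iff fun_simps)
qed

subsection \<open>Systems of orthogonal idempotents\<close>

definition idems :: "nat => (nat => nat => nat => bit) => bool" where
  "idems L E \<longleftrightarrow> (\<forall>l<L. endo (E l) & mm n (E l) (E l) = E l & (\<exists>v<n. E l v v = 1)) &
     (\<forall>l<L. \<forall>m<L. l ~= m --> mm n (E l) (E m) = 0) & (\<Sum>l<L. E l) = idm"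

definition separates :: "(nat => nat => bit) => (nat => nat => bit) => bool" where
  "separates K P \<longleftrightarrow> (\<exists>v<n. P v v = 1 & K v v = 1) & (\<exists>v<n. P v v = 1 & K v v = 0)"

text \<open>Both new idempotents keep a nonzero diagonal entry, at the positions where \<open>K\<close> is 1 and 0 respectively.\<close>

lemma idems_split:
  assumes E: "idems L E" and l: "l < L" and K: "endo K" and sep: "separates K (E l)"
    and \<psi>: "\<psi> = sqs n n (mm n (mm n (E l) K) (E l))"
    and E': "!!m. m < Suc L ==> E' m = (if m = l then \<psi> else if m = L then E l + \<psi> else E m)"
  shows "idems (Suc L) E'"
proof -
  let ?e = "E l" and ?T = "mm n (mm n (E l) K) (E l)"
  have e: "endo (E m)" "mm n (E m) (E m) = E m" "\<exists>v<n. E m v v = 1" if "m < L" for m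
    using E that by (auto simp: idems_def)
  have orth: "mm n (E m) (E m') = 0" if "m < L" "m' < L" "m ~= m'" for m m'
    using E that by (auto simp: idems_def)
  have sum: "(\<Sum>l<L. E l) = idm" using E by (simp add: idems_def)
  have T: "endo ?T" using e[OF l] K by (intro endo_mm)
  have "mm n ?e ?T = ?T" "mm n ?T ?e = ?T" using e(2)[OF l] by (simp_all add: mm_assoc) (simp add: mm_assoc[symmetric])
  then have ab: "mm n ?e \<psi> = \<psi>" "mm n \<psi> ?e = \<psi>" using sqs_absorb[of n ?e ?T n] \<psi> by auto
  have \<psi>e: "endo \<psi>" using endo_sqs[OF T] \<psi> by simp
  have \<psi>i: "mm n \<psi> \<psi> = \<psi>" using sqs_idempotent[OF endo_tri[OF T]] \<psi> by simp
  have diag: "\<psi> v v = ?e v v * K v v" for v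
  proof -
    have t: "tri ?e" "tri K" using e(1)[OF l] K by (auto intro: endo_tri)
    have "\<psi> v v = ?T v v" unfolding \<psi> by (rule diag_sqs[OF endo_tri[OF T]])
    also have "\<dots> = (?e v v * K v v) * ?e v v" by (simp only: diag_mm tri_mm t)
    finally show ?thesis by (cases "?e v v") auto
  qed
  have o1: "mm n (E m) \<psi> = 0" "mm n \<psi> (E m) = 0" if "m < L" "m ~= l" for m
  proof -
    have "mm n (E m) (mm n ?e \<psi>) = 0" using orth[OF that(1) l that(2)] by (simp add: mm_assoc[symmetric])
    then show "mm n (E m) \<psi> = 0" using ab by simp
    have "mm n (mm n \<psi> ?e) (E m) = 0" using orth[OF l that(1)] that(2) by (simp add: mm_assoc)
    then show "mm n \<psi> (E m) = 0" using ab by simp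
  qed
  have o2: "mm n (E m) (?e + \<psi>) = 0" "mm n (?e + \<psi>) (E m) = 0" if "m < L" "m ~= l" for m
    using o1[OF that] orth[OF that(1) l that(2)] orth[OF l that(1)] that(2) by (simp_all add: mm_add)
  have o3: "mm n \<psi> (?e + \<psi>) = 0" "mm n (?e + \<psi>) \<psi> = 0"
    using ab \<psi>i by (simp_all add: mm_add)
  have i2: "mm n (?e + \<psi>) (?e + \<psi>) = ?e + \<psi>"
    using ab \<psi>i e(2)[OF l] by (simp add: mm_add add.assoc)
  obtain v w where v: "v < n" "?e v v = 1" "K v v = 1" and w: "w < n" "?e w w = 1" "K w w = 0"
    using sep by (auto simp: separates_def)
  have nz: "\<exists>v<n. \<psi> v v = 1" "\<exists>v<n. (?e + \<psi>) v v = 1"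
    using diag v w by (intro exI[of _ v] exI[of _ w]; simp add: fun_simps)+
  have cancel: "(A + C) + A = C" for A C :: "nat => nat => bit"
    by (subst add.commute) (rule mat_add_cancel)
  have Lsum: "(\<Sum>m<Suc L. E' m) = idm"
  proof -
    have "(\<Sum>m<L. E' m) = (\<Sum>m<L. (if m = l then ?e + \<psi> else 0) + E m)"
    proof (rule sum.cong)
      fix m assume "m \<in> {..<L}"
      then show "E' m = (if m = l then ?e + \<psi> else 0) + E m" using E'[of m] cancel[of ?e \<psi>] by auto
    qed simp
    also have "\<dots> = (?e + \<psi>) + idm" using l sum by (simp add: sum.distrib)
    finally have "(\<Sum>m<Suc L. E' m) = ((?e + \<psi>) + idm) + (?e + \<psi>)" using E'[of L] l by simp
    then show ?thesis using cancel[of "?e + \<psi>" idm] by simp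
  qed
  have "endo (E' m) & mm n (E' m) (E' m) = E' m & (\<exists>v<n. E' m v v = 1)" if "m < Suc L" for m
    using that E'[OF that] e[of m] \<psi>e \<psi>i nz i2 endo_add[OF e(1)[OF l] \<psi>e] by (cases "m = l"; cases "m = L") auto
  moreover have "mm n (E' m) (E' m') = 0" if "m < Suc L" "m' < Suc L" "m ~= m'" for m m'
    using that E'[OF that(1)] E'[OF that(2)] o1 o2 o3 orth[of m m'] l by (auto simp: less_Suc_eq)
  ultimately show ?thesis using Lsum by (simp add: idems_def)
qed

text \<open>Orthogonal idempotents have disjoint diagonals.\<close>

lemma idems_le:
  assumes E: "idems L E"
  shows "L \<le> n"
proof -
  have "\<forall>l\<in>{..<L}. \<exists>v. v < n & E l v v = 1" using E by (auto simp: idems_def)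
  then obtain v where v: "!!l. l < L ==> v l < n & E l (v l) (v l) = 1" by (auto dest!: bchoice)
  have "inj_on v {..<L}"
  proof (rule inj_onI, rule ccontr)
    fix l m assume lm: "l \<in> {..<L}" "m \<in> {..<L}" "v l = v m" "l ~= m"
    then have "mm n (E l) (E m) = 0" "tri (E l)" "tri (E m)" using E by (auto simp: idems_def endo_tri)
    then have "E l (v l) (v l) * E m (v l) (v l) = 0" using diag_mm by (metis zero_fun_apply)
    moreover have "E l (v l) (v l) = 1" "E m (v l) (v l) = 1" using v[of l] v[of m] lm by auto
    ultimately show False by simp
  qed
  then have "card {..<L} \<le> card {..<n}" using v by (intro card_inj_on_le[of v]) auto
  then show ?thesis by simp
qed

lemma unseparated:
  assumes "!!k. k < N ==> \<not> separates (K k) P" "!!v. v < n ==> M v v = (\<Sum>k<N. c k * K k v v)"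
  shows "\<not> separates M P"
proof
  assume "separates M P"
  then obtain v w where v: "v < n" "P v v = 1" "M v v = 1" and w: "w < n" "P w w = 1" "M w w = 0"
    by (auto simp: separates_def)
  have "K k v v = K k w w" if "k < N" for k
  proof (rule ccontr)
    assume "K k v v ~= K k w w"
    then have "(K k v v = 1 & K k w w = 0) | (K k v v = 0 & K k w w = 1)"
      by (cases "K k v v"; cases "K k w w") auto
    then show False using assms(1)[OF that] v w unfolding separates_def by blast
  qed
  then have "M v v = M w w" using assms(2) v(1) w(1) by simp
  then show False using v w by simp
qed

subsection \<open>Components as labels\<close>

primrec label :: "'g => nat => nat => nat" where
  "label u 0 w = w"
| "label u (Suc k) w = (if edge k & f k \<le> u & label u k w = label u k (tgt k) then label u k (src k) else label u k w)"

lemma label_less: "k \<le> n ==> w < n ==> label u k w < n"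
proof (induction k arbitrary: w)
  case (Suc k)
  then have k: "k < n" by simp
  show ?case
  proof (cases "edge k")
    case True
    then show ?thesis using Suc.IH[of w] Suc.IH[of "src k"] Suc.prems ends[OF k True] by simp
  next
    case False
    then show ?thesis using Suc.IH[of w] Suc.prems by simp
  qed
qed simp

definition class_sum :: "(nat => nat) => (nat => bit) => nat => bit" where
  "class_sum l y x = (\<Sum>w<n. of_bool (l w = x) * y w)"

lemma class_sum_add: "class_sum l (%w. y w + a * z w) x = class_sum l y x + a * class_sum l z x"
  by (simp add: class_sum_def distrib_left sum.distrib sum_distrib_left mult.left_commute)

lemma class_sum_rel:
  assumes "e < n" "edge e"
  shows "class_sum l (rel e) x = of_bool (l (src e) = x) + of_bool (l (tgt e) = x)"
proof -
  have d: "(\<Sum>w<n. of_bool (l w = x) * of_bool (w = a)) = (of_bool (l a = x) :: bit)" if "a < n" for a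
  proof -
    have "(\<Sum>w<n. of_bool (l w = x) * of_bool (w = a)) = (\<Sum>w<n. if w = a then of_bool (l a = x) else (0::bit))"
      by (intro sum.cong) auto
    then show ?thesis using that by simp
  qed
  have "class_sum l (rel e) x = (\<Sum>w<n. of_bool (l w = x) * of_bool (w = src e)) + (\<Sum>w<n. of_bool (l w = x) * of_bool (w = tgt e))"
    unfolding class_sum_def rel_def by (simp only: distrib_left sum.distrib)
  then show ?thesis using d ends[OF assms] by (simp only:)
qed

lemma cancel_pair:
  fixes S :: "nat => bit"
  assumes "x ~= a ==> x ~= b ==> S x = 0" "a = b ==> S a = 0" "S a = S b"
  shows "S x + S a * (of_bool (a = x) + of_bool (b = x)) = 0"
proof (cases "a = b")
  case True
  then have "S a = 0" by (rule assms(2))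
  then show ?thesis using assms(1) True by (cases "x = a") auto
next
  case ab: False
  consider "x = a" | "x = b" | "x ~= a" "x ~= b" by blast
  then show ?thesis
  proof cases
    case 1
    then show ?thesis using ab by simp
  next
    case 2
    then show ?thesis using ab by (simp add: assms(3))
  next
    case 3
    then show ?thesis using assms(1) by simp
  qed
qed

text \<open>Labels are computed by merging components edge by edge; a vector is a sum of boundaries exactly if its entries over each component sum to 0.\<close>

lemma label_combos:
  "k \<le> n ==> (\<forall>x<n. class_sum (label u k) y x = 0) \<longleftrightarrow> (\<exists>z\<in>combos k u. \<forall>w<n. y w = z w)"
proof (induction k arbitrary: y)
  case 0
  have "class_sum (label u 0) y x = y x" if "x < n" for x
  proof -
    have "class_sum (label u 0) y x = (\<Sum>w<n. if w = x then y x else 0)" unfolding class_sum_def by (intro sum.cong) auto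
    then show ?thesis using that by simp
  qed
  moreover have "x = 0" if x0: "x \<in> combos 0 u" for x
  proof -
    obtain c :: "nat => bit" where c: "x = (%i. \<Sum>e<n. c e * rel e i)"
        "\<forall>e. c e ~= 0 --> e < 0 & edge e & f e \<le> u"
      using x0 unfolding combos_def by blast
    then have "c e = 0" for e by auto
    then show ?thesis using c(1) by (simp add: fun_eq_iff fun_simps)
  qed
  then have "combos 0 u = {0}" using combos_zero[of 0 u] by blast
  ultimately show ?case by (auto simp del: label.simps simp: fun_simps)
next
  case (Suc k)
  then have k: "k < n" by simp
  let ?l = "label u k" and ?l' = "label u (Suc k)"
  note IH = Suc.IH[OF less_imp_le[OF k]]
  have sub: "combos k u \<subseteq> combos (Suc k) u" unfolding combos_def by (auto simp: less_Suc_eq)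
  show ?case
  proof (cases "edge k & f k \<le> u")
    case False
    have "combos (Suc k) u \<subseteq> combos k u" using False unfolding combos_def by (auto simp: less_Suc_eq)
    then have "combos (Suc k) u = combos k u" using sub by auto
    moreover have "?l' = ?l" using False by (auto simp: fun_eq_iff fun_simps)
    ultimately show ?thesis using IH by simp
  next
    case True
    let ?a = "?l (src k)" and ?b = "?l (tgt k)"
    have ab: "?a < n" "?b < n" using label_less ends[OF k] True k by auto
    have l': "?l' w = (if ?l w = ?b then ?a else ?l w)" for w using True by simp
    have cs: "class_sum ?l' y x = (if x = ?a then if ?a = ?b then class_sum ?l y x else class_sum ?l y ?a + class_sum ?l y ?b
        else if x = ?b then 0 else class_sum ?l y x)" for y x
      unfolding class_sum_def sum.distrib[symmetric] l'
      by (auto intro!: sum.cong sum.neutral simp: distrib_right[symmetric])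
    have relk: "class_sum ?l (rel k) x = of_bool (?a = x) + of_bool (?b = x)" for x
      using class_sum_rel[OF k] True by simp
    show ?thesis
    proof
      assume zero: "\<forall>x<n. class_sum ?l' y x = 0"
      let ?s = "class_sum ?l y ?a"
      have "class_sum ?l (%w. y w + ?s * rel k w) x = 0" if "x < n" for x
      proof -
        have eq: "?s = class_sum ?l y ?b"
        proof (cases "?a = ?b")
          case False
          then have "?s + class_sum ?l y ?b = 0" using zero cs[of y ?a] ab by auto
          then show ?thesis by (simp only: bit_add_eq_0)
        qed simp
        have "class_sum ?l y x = 0" if "x ~= ?a" "x ~= ?b" using zero cs[of y x] that \<open>x < n\<close> by auto
        moreover have "?s = 0" if "?a = ?b" using zero cs[of y ?a] ab that by auto
        ultimately show ?thesis using eq unfolding class_sum_add relk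
          by (intro cancel_pair)
      qed
      then have "\<forall>x<n. class_sum ?l (%w. y w + ?s * rel k w) x = 0" by simp
      from IH[THEN iffD1, OF this] obtain z where z: "z \<in> combos k u" "\<forall>w<n. y w + ?s * rel k w = z w"
        by (rule bexE)
      have "(%w. ?s * rel k w) \<in> combos (Suc k) u"
        using combos_rel[of k "Suc k" u] combos_zero True k by (cases "?s") (auto simp: zero_fun_def)
      then have "z + (%w. ?s * rel k w) \<in> combos (Suc k) u" using combos_add[OF subsetD[OF sub z(1)]] by simp
      moreover have "y w = (z + (%w. ?s * rel k w)) w" if "w < n" for w
      proof -
        have "z w = y w + ?s * rel k w" using z(2) that by simp
        then show ?thesis by (simp add: fun_simps add.assoc)
      qed
      ultimately show "\<exists>z\<in>combos (Suc k) u. \<forall>w<n. y w = z w" by (intro bexI allI impI)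
    next
      assume "\<exists>z\<in>combos (Suc k) u. \<forall>w<n. y w = z w"
      then obtain z where z: "z \<in> combos (Suc k) u" "\<forall>w<n. y w = z w" by (rule bexE)
      have "\<forall>x. class_sum ?l' z x = 0" using z(1)
      proof (rule combos_induct)
        show "\<forall>x. class_sum ?l' 0 x = 0" by (simp add: class_sum_def fun_simps)
        show "\<forall>x. class_sum ?l' (y + z) x = 0" if "\<forall>x. class_sum ?l' y x = 0" "\<forall>x. class_sum ?l' z x = 0" for y z
          using that class_sum_add[of ?l' y 1 z] by (simp add: plus_fun_def)
        fix e assume e: "e < n" "e < Suc k" "edge e" "f e \<le> u"
        show "\<forall>x. class_sum ?l' (rel e) x = 0"
        proof (cases "e = k")
          case True
          then show ?thesis unfolding cs using relk by (auto simp del: label.simps)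
        next
          case False
          then have "rel e \<in> combos k u" using e by (intro combos_rel) auto
          then have "\<forall>x<n. class_sum ?l (rel e) x = 0" using IH[of "rel e"] by metis
          moreover have "class_sum ?l (rel e) x = 0" if "\<not> x < n" for x
            using class_sum_rel[of e ?l x] e label_less[of k _ u] k that ends[of e] by auto
          ultimately have "class_sum ?l (rel e) x = 0" for x by (cases "x < n") simp_all
          then show ?thesis unfolding cs by simp
        qed
      qed
      then show "\<forall>x<n. class_sum ?l' y x = 0" using z(2) by (simp add: class_sum_def)
    qed
  qed
qed

end

section \<open>Correctness of the program\<close>

primrec freads :: "fexp => nat set" where
  "freads (FLit b) = {}"
| "freads (FGet a x) = {a}"
| "freads (FBin g x y) = freads x \<union> freads y"
| "freads (FIsEq x y) = {}"
| "freads (FIsLess x y) = {}"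
| "freads (FIsLe x y) = {}"

lemma feval_frame: "a \<notin> freads y ==> feval n e (h(|fmem := (fmem h)(a := g)|)) y = feval n e h y"
  by (induction y) auto

lemma run_map_set:
  "a \<notin> freads y ==> run n (For v j (PutF a (WVar v) y)) e h =
    h(|fmem := (fmem h)(a := %i. if i < n ^ j then feval n (e(v := i)) h y else fmem h a i)|)"
  using run_map[of n j e v h "WVar v" 0 a y "%i. feval n (e(v := i)) h y"]
  by (simp add: feval_frame fun_upd_same del: fun_upd_apply run.simps cong: if_cong)

lemma run_map_add:
  "a \<notin> freads y ==> run n (For v j (PutF a (WVar v) (FGet a (WVar v) +\<^sub>f y))) e h =
    h(|fmem := (fmem h)(a := %i. if i < n ^ j then fmem h a i + feval n (e(v := i)) h y else fmem h a i)|)"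
  using run_map[of n j e v h "WVar v" 0 a "FGet a (WVar v) +\<^sub>f y" "%i. fmem h a i + feval n (e(v := i)) h y"]
  by (simp add: feval_frame fun_upd_same del: fun_upd_apply run.simps cong: if_cong)

lemma run_map_sum:
  "a \<notin> freads y ==> u ~= v ==> run n (For u j' (SumTo a (WVar u) v j y)) e h =
    h(|fmem := (fmem h)(a := %i. if i < n ^ j' then \<Sum>k<n ^ j. feval n (e(u := i, v := k)) h y else fmem h a i)|)"
  by (rule run_For_SumTo) (simp_all add: feval_frame del: fun_upd_apply)

lemma run_map_or:
  "a \<notin> freads y ==> u ~= v ==> run n (For u j' (OrTo a (WVar u) v j y)) e h =
    h(|fmem := (fmem h)(a := %i. if i < n ^ j' then of_bool (\<exists>k<n ^ j. feval n (e(u := i, v := k)) h y = 1) else fmem h a i)|)"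
  by (rule run_For_OrTo) (simp_all add: feval_frame del: fun_upd_apply)

lemma run_When_true: "run n (When (FLit 1) c) e = run n c e"
  by (rule ext) simp

lemma run_map_offset:
  "a \<notin> freads y ==> (!!k. weval n (e(v := k)) h x = c) ==> run n (For v j (PutF a (x +. WVar v) y)) e h =
    h(|fmem := (fmem h)(a := %i. if c \<le> i & i < c + n ^ j then feval n (e(v := i - c)) h y else fmem h a i)|)"
  by (rule run_map) (simp_all add: feval_frame fun_upd_same del: fun_upd_apply)

lemma pair_less:
  fixes M N :: nat
  assumes "k < M" "r < N"
  shows "k * N + r < M * N"
proof -
  have "k * N + r < Suc k * N" using assms(2) by simp
  also have "\<dots> \<le> M * N" using assms(1) by (intro mult_le_mono1) simp
  finally show ?thesis .
qed

lemma pair_div_mod: "r < N ==> (k * N + r) div N = k" "r < N ==> (k * N + r) mod N = r" for r N k :: nat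
  by auto

context graded_graph begin

definition input_mem :: "'g mem => bool" where
  "input_mem h \<longleftrightarrow> (\<forall>i<n. (wmem h 0 i = 1 \<longleftrightarrow> vert i) & (wmem h 0 i = 2 \<longleftrightarrow> edge i) & gmem h 0 i = f i &
     (edge i --> wmem h 1 (i * n) = src i & wmem h 1 (i * n + 1) = tgt i))"

lemma input_mem_frame:
  "input_mem h ==> 0 \<notin> wmods c ==> 1 \<notin> wmods c ==> 0 \<notin> gmods c ==> input_mem (run n c e h)"
  by (simp add: input_mem_def wmem_frame gmem_frame)

definition row_of :: "'g mem => nat => nat => bit" where
  "row_of h k q = fmem h 5 (k * n ^ 2 + q)"

definition order_supported :: "(nat => bit) => bool" where
  "order_supported \<phi> \<longleftrightarrow> (\<forall>q<n ^ 2. \<phi> q ~= 0 --> vert (q div n) & vert (q mod n) & f (q div n) \<le> f (q mod n))"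

lemma quot2: "q < n ^ 2 ==> q div n < n" "q < n ^ 2 ==> q mod n < n"
  by (cases "n = 0"; simp add: less_mult_imp_div_less power2_eq_square)+

lemma quot3: "q < n ^ 3 ==> q div n < n ^ 2" "q < n ^ 3 ==> q mod n < n"
    "q < n ^ 3 ==> q div n ^ 2 < n" "q < n ^ 3 ==> q mod n ^ 2 < n ^ 2"
  by (cases "n = 0"; simp add: less_mult_imp_div_less power2_eq_square power3_eq_cube mult.assoc)+

lemma quot4: "q < n ^ 4 ==> q div n ^ 2 < n ^ 2" "q < n ^ 4 ==> q mod n ^ 2 < n ^ 2"
  by (cases "n = 0"; simp add: less_mult_imp_div_less power2_eq_square power4_eq_xxxx mult.assoc)+

lemma init_rows_correct:
  assumes "input_mem h"
  shows "spans (n ^ 2) (row_of (run n init_rows e h)) \<phi> \<longleftrightarrow> order_supported \<phi>"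
proof -
  let ?g = "%q. of_bool (vert (q div n)) * of_bool (vert (q mod n)) * of_bool (f (q div n) \<le> f (q mod n)) :: bit"
  let ?K = "row_of (run n init_rows e h)"
  have K: "?K k q = of_bool (k = q) * ?g q" if "k < n ^ 2" "q < n ^ 2" for k q
  proof -
    have i: "k * n ^ 2 + q < n ^ 4" using pair_less[OF that] by (simp add: numeral_eq_Suc)
    have "n ^ 2 = n * n" by (simp add: power2_eq_square)
    then have m: "(k * n ^ 2 + q) mod n = q mod n" by (metis mod_mult_self3 mult.assoc)
    show ?thesis
      unfolding row_of_def init_rows_def
      by (subst run_map_set) (use i m that quot2[OF that(2)] assms in \<open>simp_all add: pair_div_mod input_mem_def mult.assoc\<close>)
  qed
  have s: "(\<Sum>k<n ^ 2. c k * ?K k q) = c q * ?g q" if "q < n ^ 2" for c q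
  proof -
    have "(\<Sum>k<n ^ 2. c k * ?K k q) = (\<Sum>k<n ^ 2. if k = q then c q * ?g q else 0)"
      using K that by (intro sum.cong) auto
    then show ?thesis using that by simp
  qed
  show ?thesis
  proof
    assume "spans (n ^ 2) ?K \<phi>"
    then obtain c where "\<forall>q<n ^ 2. \<phi> q = (\<Sum>k<n ^ 2. c k * ?K k q)" unfolding spans_def by blast
    then have c: "\<phi> q = c q * ?g q" if "q < n ^ 2" for q using s[OF that, of c] that by simp
    show "order_supported \<phi>" unfolding order_supported_def
    proof (intro allI impI)
      fix q assume "q < n ^ 2" "\<phi> q ~= 0"
      then have "?g q ~= 0" using c[of q] by auto
      then show "vert (q div n) & vert (q mod n) & f (q div n) \<le> f (q mod n)" by auto
    qed
  next
    assume "order_supported \<phi>"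
    then have g: "\<phi> q = \<phi> q * ?g q" if "q < n ^ 2" for q using that by (cases "\<phi> q = 0") (auto simp: order_supported_def)
    show "spans (n ^ 2) ?K \<phi>" unfolding spans_def
    proof (intro exI[of _ \<phi>] allI impI)
      fix q assume q: "q < n ^ 2"
      show "\<phi> q = (\<Sum>k<n ^ 2. \<phi> k * ?K k q)" unfolding s[OF q] by (rule g[OF q])
    qed
  qed
qed

lemma vertex_limit: "w < n ==> w mod word_limit n = w"
  using size_less_limit[of 1 n] by simp

lemma run_map_words:
  assumes "!!k g. k < n ==> g k = wmem h a k ==>
      feval n (e(v := k)) (h(|wmem := (wmem h)(a := g)|)) b = of_bool (Q k) &
      weval n (e(v := k)) (h(|wmem := (wmem h)(a := g)|)) y = E k"
    and "!!k. k < n ==> E k < n"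
  shows "run n (For v 1 (When b (PutW a (WVar v) y))) e h =
    h(|wmem := (wmem h)(a := %i. if i < n & Q i then E i else wmem h a i)|)"
proof -
  let ?g = "%k i. if i < k & Q i then E i else wmem h a i"
  have "run n (For v 1 (When b (PutW a (WVar v) y))) e h = h(|wmem := (wmem h)(a := ?g (n ^ 1))|)"
  proof (rule run_For_rule[of "%k h'. h' = h(|wmem := (wmem h)(a := ?g k)|)"])
    have "?g 0 = wmem h a" by (intro ext) auto
    then show "h = h(|wmem := (wmem h)(a := ?g 0)|)" by simp
    fix k h' assume k: "k < n ^ 1" and h': "h' = h(|wmem := (wmem h)(a := ?g k)|)"
    have ev: "feval n (e(v := k)) h' b = of_bool (Q k)" "weval n (e(v := k)) h' y = E k"
      using assms(1)[of k "?g k"] k by (simp_all add: h')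
    have "?g (Suc k) = (if Q k then (?g k)(k := E k) else ?g k)" by (intro ext) (auto simp: less_Suc_eq)
    then show "run n (When b (PutW a (WVar v) y)) (e(v := k)) h' = h(|wmem := (wmem h)(a := ?g (Suc k))|)"
      using ev assms(2)[of k] k vertex_limit[of "E k"]
      by (cases "Q k") (simp_all add: h' array_write_def fun_upd_same del: fun_upd_apply)
  qed
  then show ?thesis by simp
qed

lemma label_components_correct:
  assumes inp: "input_mem h" and e: "e 0 < n" and w: "w < n"
  shows "wmem (run n label_components e h) 5 w = label (f (e 0)) n w"
proof -
  let ?u = "f (e 0)"
  let ?h0 = "run n (For 1 1 (PutW 5 (WVar 1) (WVar 1))) e h"
  have h0: "?h0 = h(|wmem := (wmem h)(5 := %i. if i < n then i else wmem h 5 i)|)"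
  proof -
    have "run n (For 1 1 (When (FLit 1) (PutW 5 (WVar 1) (WVar 1)))) e h =
        h(|wmem := (wmem h)(5 := %i. if i < n & True then i else wmem h 5 i)|)"
      by (rule run_map_words) simp_all
    then show ?thesis by (simp only: run.simps(4) run_When_true simp_thms)
  qed
  let ?b = "When (is_edge (WVar 1) *\<^sub>f FIsLe (WVar 1) (WVar 0))
       (PutW 7 wzero (WGet 5 (end1 (WVar 1))) ;;;
        PutW 7 wone (WGet 5 (end2 (WVar 1))) ;;;
        For 2 1 (When (FIsEq (WGet 5 (WVar 2)) (WGet 7 wone)) (PutW 5 (WVar 2) (WGet 7 wzero))))"
  have "input_mem (run n (For 1 1 ?b) e ?h0) & (\<forall>w<n. wmem (run n (For 1 1 ?b) e ?h0) 5 w = label ?u (n ^ 1) w)"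
  proof (rule run_For_rule[of "%k h'. input_mem h' & (\<forall>w<n. wmem h' 5 w = label ?u k w)"])
    show "input_mem ?h0 & (\<forall>w<n. wmem ?h0 5 w = label ?u 0 w)"
      using inp unfolding h0 by (simp add: input_mem_def)
    fix k h' assume k: "k < n ^ 1" and h': "input_mem h' & (\<forall>w<n. wmem h' 5 w = label ?u k w)"
    have inp': "input_mem (run n ?b (e(1 := k)) h')" using h' by (intro input_mem_frame) auto
    have kn: "k < n" using k by simp
    have b: "feval n (e(1 := k)) h' (is_edge (WVar 1) *\<^sub>f FIsLe (WVar 1) (WVar 0)) = of_bool (edge k & f k \<le> ?u)"
      using h' kn e by (auto simp: input_mem_def numeral_2_eq_2)
    show "input_mem (run n ?b (e(1 := k)) h') & (\<forall>w<n. wmem (run n ?b (e(1 := k)) h') 5 w = label ?u (Suc k) w)"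
    proof (cases "edge k & f k \<le> ?u")
      case False
      then have "feval n (e(1 := k)) h' (is_edge (WVar 1) *\<^sub>f FIsLe (WVar 1) (WVar 0)) ~= 1" using b by auto
      then have "run n ?b (e(1 := k)) h' = h'" by (simp only: run.simps(3) if_False)
      moreover have "label ?u (Suc k) w = label ?u k w" for w using False by auto
      ultimately show ?thesis using h' by simp
    next
      case True
      let ?a = "label ?u k (src k)" and ?c = "label ?u k (tgt k)"
      have st: "src k < n" "tgt k < n" using ends[OF kn] True by auto
      have ac: "?a < n" "?c < n" using label_less kn st by auto
      have we: "wmem h' 5 (src k) = ?a" "wmem h' 5 (tgt k) = ?c" "wmem h' 1 (k * n) = src k" "wmem h' 1 (Suc (k * n)) = tgt k"
        using h' st kn True by (auto simp: input_mem_def)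
      let ?h1 = "h'(|wmem := (wmem h')(7 := (wmem h' 7)(0 := ?a, 1 := ?c))|)"
      have one: "feval n (e(1 := k)) h' (is_edge (WVar 1) *\<^sub>f FIsLe (WVar 1) (WVar 0)) = 1" using b True by auto
      have "run n (PutW 7 wone (WGet 5 (end2 (WVar 1)))) (e(1 := k)) (run n (PutW 7 wzero (WGet 5 (end1 (WVar 1)))) (e(1 := k)) h') = ?h1"
        using we ac vertex_limit by (simp add: array_write_def)
      then have r: "run n ?b (e(1 := k)) h' = run n (For 2 1 (When (FIsEq (WGet 5 (WVar 2)) (WGet 7 wone)) (PutW 5 (WVar 2) (WGet 7 wzero)))) (e(1 := k)) ?h1"
        by (simp only: run.simps(2,3) one if_True simp_thms)
      note r
      also have "\<dots> = ?h1(|wmem := (wmem ?h1)(5 := %i. if i < n & wmem h' 5 i = ?c then ?a else wmem ?h1 5 i)|)"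
        by (rule run_map_words) (use ac in auto)
      finally have "wmem (run n ?b (e(1 := k)) h') 5 w = label ?u (Suc k) w" if "w < n" for w
        using that h' True by simp
      then show ?thesis using inp' by blast
    qed
  qed
  then show ?thesis using w by (simp add: label_components_def del: run.simps(3,4))
qed

end

context graded_graph begin

definition lam :: "nat => nat => (nat => bit) => bit" where
  "lam e y \<phi> = class_sum (label (f e) n) (%w. \<phi> (w * n + src e) + \<phi> (w * n + tgt e)) y"

lemma entry_less: "i < n ==> j < n ==> i * n + j < n ^ 2"
  using pair_less[of i n j n] by (simp add: power2_eq_square)

lemma functionals_lam:
  assumes "e < n" "edge e"
  shows "functionals (n ^ 2) (lam e)"
proof
  fix y a and \<phi> \<psi> :: "nat => bit"
  have "(%w. (\<phi> (w * n + src e) + a * \<psi> (w * n + src e)) + (\<phi> (w * n + tgt e) + a * \<psi> (w * n + tgt e)))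
     = (%w. (\<phi> (w * n + src e) + \<phi> (w * n + tgt e)) + a * (\<psi> (w * n + src e) + \<psi> (w * n + tgt e)))"
    by (simp add: algebra_simps)
  then show "lam e y (%q. \<phi> q + a * \<psi> q) = lam e y \<phi> + a * lam e y \<psi>"
    unfolding lam_def using class_sum_add by simp
next
  fix y and \<phi> \<psi> :: "nat => bit"
  assume eq: "!!q. q < n ^ 2 ==> \<phi> q = \<psi> q"
  have "\<phi> (w * n + src e) = \<psi> (w * n + src e)" "\<phi> (w * n + tgt e) = \<psi> (w * n + tgt e)" if "w < n" for w
    using eq entry_less[OF that] ends[OF assms] by auto
  then show "lam e y \<phi> = lam e y \<psi>" unfolding lam_def class_sum_def by (intro sum.cong) auto
qed

lemma eval_functionals_correct:
  fixes h :: "'g mem"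
  assumes inp: "input_mem h" and e: "e 0 < n" "edge (e 0)" and lb: "!!w. w < n ==> wmem h 5 w = label (f (e 0)) n w"
    and h': "h' = run n eval_functionals e h"
  shows "k < n ^ 2 ==> y < n ==> fmem h' 6 (k * n + y) = lam (e 0) y (row_of h k)"
    and "k < n ^ 2 ==> y < n ==> fmem h' 7 (k * n + y) = 0"
    and "row_of h' = row_of h"
proof -
  have st: "wmem h 1 (e 0 * n) = src (e 0)" "wmem h 1 (Suc (e 0 * n)) = tgt (e 0)"
    using inp e by (auto simp: input_mem_def)
  have 5: "fmem h' 5 = fmem h 5" unfolding h' by (rule fmem_frame) (simp add: eval_functionals_def SumTo_def)
  then show "row_of h' = row_of h" by (simp add: row_of_def fun_eq_iff)
  have h'': "h' = run n (For 1 3 (PutF 7 (WVar 1) (FLit 0))) e (run n (For 1 3 (SumTo 6 (WVar 1) 2 1 (FIsEq (WGet 5 (WVar 2)) (WVar 1 mod. wn) *\<^sub>f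
       (FGet 5 (WVar 1 div. wn *. wn2 +. (WVar 2 *. wn +. end1 (WVar 0))) +\<^sub>f
        FGet 5 (WVar 1 div. wn *. wn2 +. (WVar 2 *. wn +. end2 (WVar 0))))))) e h)"
    unfolding h' eval_functionals_def by (simp only: run.simps(2))
  assume ky: "k < n ^ 2" "y < n"
  have i: "k * n + y < n ^ 3" using pair_less[OF ky] by (simp add: power2_eq_square power3_eq_cube)
  show "fmem h' 7 (k * n + y) = 0" unfolding h'' by (subst run_map_set) (use i in simp_all)
  show "fmem h' 6 (k * n + y) = lam (e 0) y (row_of h k)"
    unfolding h''
    by (subst run_map_set, simp, subst run_map_sum)
      (use i ky st lb in \<open>simp_all add: pair_div_mod lam_def class_sum_def row_of_def mult.assoc\<close>)
qed

lemma eliminate_column_correct: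
  fixes h :: "'g mem"
  assumes x: "e 1 < n" and h': "h' = run n eliminate_column e h"
    and p: "p = last_true (%k. fmem h 6 (k * n + e 1)) (n ^ 2)"
  shows "wmem h' 6 (e 1) = p" "!!y. y ~= e 1 ==> wmem h' 6 y = wmem h 6 y"
    and "!!k y. k < n ^ 2 ==> y < n ==> fmem h' 6 (k * n + y) = fmem h 6 (k * n + y) + fmem h 6 (k * n + e 1) * fmem h 6 (p * n + y)"
    and "!!k y. k < n ^ 2 ==> y < n ==> fmem h' 7 (k * n + y) = fmem h 7 (k * n + y) + fmem h 6 (k * n + e 1) * (fmem h 7 (p * n + y) + of_bool (y = e 1))"
    and "fmem h' 5 = fmem h 5"
proof -
  let ?h1 = "h(|wmem := (wmem h)(6 := (wmem h 6)(e 1 := p))|)"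
  have h1: "run n (FindTo 6 (WVar 1) 2 2 (FGet 6 (WVar 2 *. wn +. WVar 1))) e h = ?h1"
    unfolding p by (rule run_FindTo) simp_all
  let ?h2 = "?h1(|fmem := (fmem ?h1)(12 := %i. if i < n ^ 2 then fmem h 6 (i * n + e 1) else fmem h 12 i)|)"
  have h2: "run n (For 2 2 (PutF 12 (WVar 2) (FGet 6 (WVar 2 *. wn +. WVar 1)))) e ?h1 = ?h2"
    by (subst run_map_set) (simp_all cong: if_cong)
  let ?h3 = "?h2(|fmem := (fmem ?h2)(13 := %i. if i < n ^ 1 then fmem h 6 (p * n + i) else fmem h 13 i)|)"
  have h3: "run n (For 2 1 (PutF 13 (WVar 2) (FGet 6 (WGet 6 (WVar 1) *. wn +. WVar 2)))) e ?h2 = ?h3"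
    by (subst run_map_set) (simp_all cong: if_cong)
  let ?h4 = "?h3(|fmem := (fmem ?h3)(14 := %i. if i < n ^ 1 then fmem h 7 (p * n + i) + of_bool (i = e 1) else fmem h 14 i)|)"
  have h4: "run n (For 2 1 (PutF 14 (WVar 2) (FGet 7 (WGet 6 (WVar 1) *. wn +. WVar 2) +\<^sub>f FIsEq (WVar 2) (WVar 1)))) e ?h3 = ?h4"
    by (subst run_map_set) (simp_all cong: if_cong)
  let ?h5 = "?h4(|fmem := (fmem ?h4)(6 := %i. if i < n ^ 3 then fmem h 6 i + fmem ?h4 12 (i div n) * fmem ?h4 13 (i mod n) else fmem h 6 i)|)"
  have h5: "run n (For 2 3 (PutF 6 (WVar 2) (FGet 6 (WVar 2) +\<^sub>f FGet 12 (WVar 2 div. wn) *\<^sub>f FGet 13 (WVar 2 mod. wn)))) e ?h4 = ?h5"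
    by (subst run_map_add) (simp_all cong: if_cong)
  let ?h6 = "?h5(|fmem := (fmem ?h5)(7 := %i. if i < n ^ 3 then fmem h 7 i + fmem ?h4 12 (i div n) * fmem ?h4 14 (i mod n) else fmem h 7 i)|)"
  have h6: "run n (For 2 3 (PutF 7 (WVar 2) (FGet 7 (WVar 2) +\<^sub>f FGet 12 (WVar 2 div. wn) *\<^sub>f FGet 14 (WVar 2 mod. wn)))) e ?h5 = ?h6"
    by (subst run_map_add) (simp_all cong: if_cong)
  have h'6: "h' = ?h6"
    unfolding h' eliminate_column_def by (simp only: run.simps(2) h1 h2 h3 h4 h5 h6)
  show "wmem h' 6 (e 1) = p" "!!y. y ~= e 1 ==> wmem h' 6 y = wmem h 6 y" "fmem h' 5 = fmem h 5"
    unfolding h'6 by simp_all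
  fix k y assume ky: "k < n ^ 2" "y < n"
  have i: "k * n + y < n ^ 3" using pair_less[OF ky] by (simp add: power2_eq_square power3_eq_cube)
  show "fmem h' 6 (k * n + y) = fmem h 6 (k * n + y) + fmem h 6 (k * n + e 1) * fmem h 6 (p * n + y)"
    "fmem h' 7 (k * n + y) = fmem h 7 (k * n + y) + fmem h 6 (k * n + e 1) * (fmem h 7 (p * n + y) + of_bool (y = e 1))"
    unfolding h'6 using i ky by (simp_all add: pair_div_mod)
qed

lemma multiply_blocks_correct:
  fixes h :: "'g mem"
  assumes P: "!!y. y < n ==> wmem h 6 y < n ^ 2" and h': "h' = run n multiply_blocks e h"
    and kq: "k < n ^ 2" "q < n ^ 2"
  shows "row_of h' k q = delayed_row n (row_of h) (%k y. fmem h 7 (k * n + y)) (wmem h 6) k q"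
proof -
  let ?C = "%k y. fmem h 7 (k * n + y)"
  let ?f8 = "%i. if i < n ^ 3 then fmem h 5 (wmem h 6 (i div n ^ 2) * n ^ 2 + i mod n ^ 2) else fmem h 8 i"
  let ?h1 = "h(|fmem := (fmem h)(8 := ?f8)|)"
  have h1: "run n (For 1 3 (PutF 8 (WVar 1) (FGet 5 (WGet 6 (WVar 1 div. wn2) *. wn2 +. WVar 1 mod. wn2)))) e h = ?h1"
    by (subst run_map_set) (simp_all cong: if_cong)
  let ?b = "For 3 2 (PutF 9 (WVar 3) (FGet 7 (WVar 1 *. wn2 +. WVar 3))) ;;;
       For 3 2 (PutF 10 (WVar 3) (FGet 8 (WVar 3 div. wn *. wn2 +. (WVar 2 *. wn +. WVar 3 mod. wn)))) ;;;
       MatMul 9 10 11 ;;;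
       For 3 2 (PutF 15 ((WVar 1 *. wn +. WVar 2) *. wn2 +. WVar 3) (FGet 11 (WVar 3)))"
  define Q where "Q I J r = (\<Sum>l<n. fmem h 7 (I * n ^ 2 + (r div n * n + l)) * ?f8 (l * n ^ 2 + (J * n + r mod n)))" for I J r
  have body: "fmem (run n ?b e' g) 15 i = (if (I * n + J) * n ^ 2 \<le> i & i < (I * n + J) * n ^ 2 + n ^ 2
       then Q I J (i - (I * n + J) * n ^ 2) else fmem g 15 i)"
    if g: "fmem g 7 = fmem h 7" "fmem g 8 = ?f8" and e': "e' 1 = I" "e' 2 = J" and n0: "0 < n" for g e' I J i
  proof -
    have e1: "e' (Suc 0) = I" using e' by simp
    let ?g1 = "g(|fmem := (fmem g)(9 := %i. if i < n ^ 2 then fmem h 7 (I * n ^ 2 + i) else fmem g 9 i)|)"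
    have g1: "run n (For 3 2 (PutF 9 (WVar 3) (FGet 7 (WVar 1 *. wn2 +. WVar 3)))) e' g = ?g1"
      by (subst run_map_set) (simp_all add: g e' e1 cong: if_cong)
    let ?g2 = "?g1(|fmem := (fmem ?g1)(10 := %i. if i < n ^ 2 then ?f8 (i div n * n ^ 2 + (J * n + i mod n)) else fmem g 10 i)|)"
    have g2: "run n (For 3 2 (PutF 10 (WVar 3) (FGet 8 (WVar 3 div. wn *. wn2 +. (WVar 2 *. wn +. WVar 3 mod. wn))))) e' ?g1 = ?g2"
      by (subst run_map_set) (simp_all add: g e' e1 cong: if_cong)
    let ?g3 = "run n (MatMul 9 10 11) e' ?g2"
    have m11: "fmem ?g3 11 r = Q I J r" if r: "r < n ^ 2" for r
    proof -
      have *: "r div n * n + l < n ^ 2" "l * n + r mod n < n ^ 2" "(l * n + r mod n) div n = l" "(l * n + r mod n) mod n = r mod n" if "l < n" for l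
        using entry_less that quot2[OF r] by (auto simp: pair_div_mod)
      have "fmem ?g3 11 r = (\<Sum>l<n. fmem ?g2 9 (r div n * n + l) * fmem ?g2 10 (l * n + r mod n))"
        using r by (simp add: power2_eq_square)
      also have "\<dots> = Q I J r" unfolding Q_def using * by (intro sum.cong) simp_all
      finally show ?thesis .
    qed
    have m15: "fmem ?g3 15 = fmem g 15" by simp
    have "fmem (run n ?b e' g) 15 i = fmem (run n (For 3 2 (PutF 15 ((WVar 1 *. wn +. WVar 2) *. wn2 +. WVar 3) (FGet 11 (WVar 3)))) e' ?g3) 15 i"
      by (simp only: run.simps(2) g1 g2)
    also have "\<dots> = (if (I * n + J) * n ^ 2 \<le> i & i < (I * n + J) * n ^ 2 + n ^ 2 then fmem ?g3 11 (i - (I * n + J) * n ^ 2) else fmem ?g3 15 i)"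
      by (subst run_map_offset[where c = "(I * n + J) * n ^ 2"]) (simp_all add: e' e1 del: run.simps)
    finally have E: "fmem (run n ?b e' g) 15 i = (if (I * n + J) * n ^ 2 \<le> i & i < (I * n + J) * n ^ 2 + n ^ 2
       then fmem ?g3 11 (i - (I * n + J) * n ^ 2) else fmem ?g3 15 i)" .
    show ?thesis
    proof (cases "(I * n + J) * n ^ 2 \<le> i & i < (I * n + J) * n ^ 2 + n ^ 2")
      case True
      then have "i - (I * n + J) * n ^ 2 < n ^ 2" by linarith
      then show ?thesis unfolding E using True by (simp only: m11 if_True simp_thms)
    next
      case False
      then show ?thesis unfolding E m15 by (simp only: if_False)
    qed
  qed
  have frame: "fmem (run n ?b e' g) a = fmem g a" if "a \<in> {5, 7, 8}" for e' g a
    by (rule fmem_frame) (use that in auto)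
  define filled where "filled I J g \<longleftrightarrow> fmem g 5 = fmem h 5 & fmem g 7 = fmem h 7 & fmem g 8 = ?f8 &
     (\<forall>I' J' r. J' < n --> (I' < I | (I' = I & J' < J)) --> r < n ^ 2 --> fmem g 15 ((I' * n + J') * n ^ 2 + r) = Q I' J' r)" for I J and g :: "'g mem"
  let ?h2 = "run n (For 1 1 (For 2 1 ?b)) e ?h1"
  have "filled (n ^ 1) 0 ?h2"
  proof (rule run_For_rule[of "%I. filled I 0"])
    show "filled 0 0 ?h1" by (simp add: filled_def)
    fix I and g :: "'g mem" assume I: "I < n ^ 1" and g: "filled I 0 g"
    have n0: "0 < n" using I by simp
    have "filled I (n ^ 1) (run n (For 2 1 ?b) (e(1 := I)) g)"
    proof (rule run_For_rule[of "filled I"])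
      fix J and g :: "'g mem" assume J: "J < n ^ 1" and g: "filled I J g"
      let ?e = "(e(1 := I))(2 := J)"
      have q: "fmem (run n ?b ?e g) 15 ((I' * n + J') * n ^ 2 + r) = Q I' J' r"
        if J': "J' < n" "I' < I | (I' = I & J' < Suc J)" and r: "r < n ^ 2" for I' J' r
      proof -
        let ?i = "(I' * n + J') * n ^ 2 + r" and ?c = "(I * n + J) * n ^ 2"
        have b: "fmem (run n ?b ?e g) 15 ?i = (if ?c \<le> ?i & ?i < ?c + n ^ 2 then Q I J (?i - ?c) else fmem g 15 ?i)"
          by (rule body) (use g n0 in \<open>simp_all add: filled_def\<close>)
        show ?thesis
        proof (cases "I' = I & J' = J")
          case True
          then show ?thesis using b r by simp
        next
          case False
          have "I' * n + J' < I * n + J"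
          proof (cases "I' < I")
            case True
            have "I' * n + J' < I * n" using pair_less[OF True J'(1)] .
            then show ?thesis by linarith
          next
            case False': False
            then show ?thesis using J' False by auto
          qed
          then have "?i < ?c" using pair_less r by blast
          then have "fmem (run n ?b ?e g) 15 ?i = fmem g 15 ?i" using b by simp
          also have "\<dots> = Q I' J' r" using g J' False r by (auto simp: filled_def less_Suc_eq)
          finally show ?thesis .
        qed
      qed
      have fr: "fmem (run n ?b ?e g) 5 = fmem g 5" "fmem (run n ?b ?e g) 7 = fmem g 7" "fmem (run n ?b ?e g) 8 = fmem g 8"
        by (rule frame, simp)+
      show "filled I (Suc J) (run n ?b ?e g)"
      proof (unfold filled_def, intro conjI allI impI)
        show "fmem (run n ?b ?e g) 5 = fmem h 5" "fmem (run n ?b ?e g) 7 = fmem h 7" "fmem (run n ?b ?e g) 8 = ?f8"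
          using g unfolding fr filled_def by blast+
      qed (rule q)
    qed (rule g)
    then show "filled (Suc I) 0 (run n (For 2 1 ?b) (e(1 := I)) g)"
      by (auto simp: filled_def less_Suc_eq)
  qed
  then have i2: "filled n 0 ?h2" by simp
  let ?U = "For 1 4 (PutF 5 (WVar 1) (FGet 5 (WVar 1) +\<^sub>f
       FGet 15 ((WVar 1 div. wn2 div. wn *. wn +. WVar 1 mod. wn2 div. wn) *. wn2 +.
         (WVar 1 div. wn2 mod. wn *. wn +. WVar 1 mod. wn))))"
  have h'2: "h' = run n ?U e ?h2"
    unfolding h' multiply_blocks_def by (simp only: run.simps(2) h1)
  have idx: "k * n ^ 2 + q < n ^ 4" using pair_less[OF kq] by (simp add: numeral_eq_Suc)
  have "n ^ 2 = n * n" by (simp add: power2_eq_square)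
  then have md: "(k * n ^ 2 + q) mod n = q mod n" by (metis mod_mult_self3 mult.assoc)
  have dv: "(k * n ^ 2 + q) div n ^ 2 = k" "(k * n ^ 2 + q) mod n ^ 2 = q" using kq(2) by (simp_all add: pair_div_mod)
  note kd = quot2[OF kq(1)] and qd = quot2[OF kq(2)]
  have "row_of h' k q = fmem ?h2 5 (k * n ^ 2 + q) + fmem ?h2 15 ((k div n * n + q div n) * n ^ 2 + (k mod n * n + q mod n))"
    unfolding row_of_def h'2 by (subst run_map_add) (use idx md dv in \<open>simp_all del: run.simps\<close>)
  also have "fmem ?h2 5 (k * n ^ 2 + q) = row_of h k q" using i2 by (simp add: filled_def row_of_def)
  also have "fmem ?h2 15 ((k div n * n + q div n) * n ^ 2 + (k mod n * n + q mod n)) = Q (k div n) (q div n) (k mod n * n + q mod n)"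
    using i2 kd qd entry_less unfolding filled_def by blast
  also have "\<dots> = (\<Sum>l<n. ?C k l * row_of h (wmem h 6 l) q)"
    unfolding Q_def
  proof (rule sum.cong)
    fix l assume l: "l \<in> {..<n}"
    have a: "k div n * n ^ 2 + ((k mod n * n + q mod n) div n * n + l) = k * n + l"
    proof -
      have "(k mod n * n + q mod n) div n = k mod n" using qd by (simp add: pair_div_mod)
      moreover have "k div n * n ^ 2 + k mod n * n = (k div n * n + k mod n) * n" by (simp only: power2_eq_square distrib_right mult.assoc)
      ultimately show ?thesis by simp
    qed
    have m: "(k mod n * n + q mod n) mod n = q mod n" using qd by simp
    have c: "q div n * n + q mod n = q" by simp
    have "l * n ^ 2 + q < n * n ^ 2" using pair_less l kq(2) by blast
    then have l3: "l * n ^ 2 + q < n ^ 3" by (simp add: numeral_eq_Suc)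
    have "?f8 (l * n ^ 2 + (q div n * n + (k mod n * n + q mod n) mod n)) = row_of h (wmem h 6 l) q"
      unfolding m c using l3 kq(2) by (simp add: row_of_def pair_div_mod)
    then show "fmem h 7 (k div n * n ^ 2 + ((k mod n * n + q mod n) div n * n + l)) *
       ?f8 (l * n ^ 2 + (q div n * n + (k mod n * n + q mod n) mod n)) = ?C k l * row_of h (wmem h 6 l) q"
      unfolding a by (simp only:)
  qed simp
  finally show ?thesis by (simp add: delayed_row_def)
qed

lemma impose_edge_correct:
  fixes h :: "'g mem"
  assumes inp: "input_mem h" and e: "e 0 < n" "edge (e 0)"
  shows "spans (n ^ 2) (row_of (run n impose_edge e h)) \<phi> \<longleftrightarrow>
    spans (n ^ 2) (row_of h) \<phi> & (\<forall>y<n. lam (e 0) y \<phi> = 0)"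
proof -
  interpret L: functionals n "n ^ 2" "lam (e 0)" using functionals_lam[OF e] .
  let ?h1 = "run n label_components e h"
  let ?h2 = "run n eval_functionals e ?h1"
  let ?h3 = "run n (For 1 1 eliminate_column) e ?h2"
  let ?A = "%h k y. fmem h 6 (k * n + y)" and ?C = "%h k y. fmem h 7 (k * n + y)"
  have i1: "input_mem ?h1" using inp by (rule input_mem_frame) (auto simp: label_components_def)
  have "fmem ?h1 5 = fmem h 5" by (rule fmem_frame) (simp add: label_components_def)
  then have r1: "row_of ?h1 = row_of h" by (simp add: row_of_def fun_eq_iff)
  note ev = eval_functionals_correct[where h = ?h1 and e = e, OF i1 e label_components_correct[where h = h and e = e, OF inp e(1)] refl]
  have "L.elim_state (row_of h) (n ^ 1) (?A ?h3) (?C ?h3) (wmem ?h3 6) & fmem ?h3 5 = fmem ?h2 5"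
  proof (rule run_For_rule[of "%x g. L.elim_state (row_of h) x (?A g) (?C g) (wmem g 6) & fmem g 5 = fmem ?h2 5"])
    show "L.elim_state (row_of h) 0 (?A ?h2) (?C ?h2) (wmem ?h2 6) & fmem ?h2 5 = fmem ?h2 5"
      using ev(1,2) r1 by (intro conjI L.elim_start) auto
    fix x and g :: "'g mem" assume x: "x < n ^ 1" and g: "L.elim_state (row_of h) x (?A g) (?C g) (wmem g 6) & fmem g 5 = fmem ?h2 5"
    define p where "p = last_true (%k. fmem g 6 (k * n + x)) (n ^ 2)"
    have xn: "x < n" "0 < n ^ 2" using x by auto
    have p: "p < n ^ 2" unfolding p_def by (rule last_true_less[OF xn(2)])
    have pp: "(\<exists>k<n ^ 2. ?A g k x = 1) --> ?A g p x = 1"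
      using last_true[of _ "n ^ 2" "%k. fmem g 6 (k * n + x)"] unfolding p_def by blast
    have x1: "(e(1 := x)) 1 < n" using xn by simp
    note st = eliminate_column_correct[where e = "e(1 := x)" and h = g, OF x1 refl refl, unfolded fun_upd_same p_def[symmetric]]
    have "L.elim_state (row_of h) (Suc x) (?A (run n eliminate_column (e(1 := x)) g))
        (?C (run n eliminate_column (e(1 := x)) g)) (wmem (run n eliminate_column (e(1 := x)) g) 6)"
      by (rule L.elim_step[where p = p and P' = "wmem (run n eliminate_column (e(1 := x)) g) 6", OF conjunct1[OF g] xn(1) p pp st(1)]) (use st(2,3,4) in simp_all)
    then show "L.elim_state (row_of h) (Suc x) (?A (run n eliminate_column (e(1 := x)) g))
        (?C (run n eliminate_column (e(1 := x)) g)) (wmem (run n eliminate_column (e(1 := x)) g) 6) &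
        fmem (run n eliminate_column (e(1 := x)) g) 5 = fmem ?h2 5"
      using g st(5) by simp
  qed
  then have st: "L.elim_state (row_of h) n (?A ?h3) (?C ?h3) (wmem ?h3 6)" and f5: "fmem ?h3 5 = fmem ?h2 5" by simp_all
  have r3: "row_of ?h3 = row_of h" using f5 ev(3) r1 by (simp add: row_of_def fun_eq_iff)
  have "wmem ?h3 6 y < n ^ 2" if "y < n" for y using st that unfolding L.elim_state_def by blast
  note mb = multiply_blocks_correct[OF this refl, of _ _ e, unfolded r3]
  have "run n impose_edge e h = run n multiply_blocks e ?h3"
    unfolding impose_edge_def by (simp only: run.simps(2))
  then have "spans (n ^ 2) (row_of (run n impose_edge e h)) \<phi> \<longleftrightarrow> spans (n ^ 2) (delayed_row n (row_of h) (?C ?h3) (wmem ?h3 6)) \<phi>"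
    unfolding spans_def using mb by simp
  then show ?thesis using st unfolding L.elim_state_def by blast
qed

lemma endomorphisms_correct:
  fixes h :: "'g mem"
  assumes inp: "input_mem h"
  shows "spans (n ^ 2) (row_of (run n endomorphisms e h)) \<phi> \<longleftrightarrow>
    order_supported \<phi> & (\<forall>e<n. edge e --> (\<forall>y<n. lam e y \<phi> = 0))"
    and "input_mem (run n endomorphisms e h)"
proof -
  let ?h1 = "run n init_rows e h"
  let ?h2 = "run n (For 0 1 (When (is_edge (WVar 0)) impose_edge)) e ?h1"
  have i1: "input_mem ?h1" using inp by (rule input_mem_frame) (auto simp: init_rows_def)
  have "input_mem ?h2 & (\<forall>\<phi>. spans (n ^ 2) (row_of ?h2) \<phi> \<longleftrightarrow>
     order_supported \<phi> & (\<forall>e<n ^ 1. edge e --> (\<forall>y<n. lam e y \<phi> = 0)))"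
  proof (rule run_For_rule[of "%k g. input_mem g & (\<forall>\<phi>. spans (n ^ 2) (row_of g) \<phi> \<longleftrightarrow>
     order_supported \<phi> & (\<forall>e<k. edge e --> (\<forall>y<n. lam e y \<phi> = 0)))"])
    show "input_mem ?h1 & (\<forall>\<phi>. spans (n ^ 2) (row_of ?h1) \<phi> \<longleftrightarrow>
     order_supported \<phi> & (\<forall>e<0. edge e --> (\<forall>y<n. lam e y \<phi> = 0)))"
      using i1 init_rows_correct[OF inp, of e] by blast
    fix k and g :: "'g mem" assume k: "k < n ^ 1" and g: "input_mem g & (\<forall>\<phi>. spans (n ^ 2) (row_of g) \<phi> \<longleftrightarrow>
     order_supported \<phi> & (\<forall>e<k. edge e --> (\<forall>y<n. lam e y \<phi> = 0)))"
    let ?e = "e(0 := k)" and ?c = "When (is_edge (WVar 0)) impose_edge"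
    have kn: "k < n" using k by simp
    have b: "feval n ?e g (is_edge (WVar 0)) = of_bool (edge k)" using g kn by (simp add: input_mem_def numeral_2_eq_2)
    have i: "input_mem (run n ?c ?e g)" using conjunct1[OF g]
      by (rule input_mem_frame) (simp_all add: decompose_defs)
    have s: "spans (n ^ 2) (row_of (run n ?c ?e g)) \<phi> \<longleftrightarrow> spans (n ^ 2) (row_of g) \<phi> & (edge k --> (\<forall>y<n. lam k y \<phi> = 0))" for \<phi>
    proof (cases "edge k")
      case True
      then have "run n ?c ?e g = run n impose_edge ?e g" using b by (simp only: run.simps(3) of_bool_eq if_True simp_thms)
      then show ?thesis using impose_edge_correct[of g ?e \<phi>] g kn True by simp
    next
      case False
      then have "run n ?c ?e g = g" using b by (simp only: run.simps(3) of_bool_eq) simp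
      then show ?thesis using False by simp
    qed
    show "input_mem (run n ?c ?e g) & (\<forall>\<phi>. spans (n ^ 2) (row_of (run n ?c ?e g)) \<phi> \<longleftrightarrow>
     order_supported \<phi> & (\<forall>e<Suc k. edge e --> (\<forall>y<n. lam e y \<phi> = 0)))"
      using i s g by (auto simp: less_Suc_eq)
  qed
  moreover have "run n endomorphisms e h = ?h2" unfolding endomorphisms_def by (simp only: run.simps(2))
  ultimately show "input_mem (run n endomorphisms e h)" "spans (n ^ 2) (row_of (run n endomorphisms e h)) \<phi> \<longleftrightarrow>
    order_supported \<phi> & (\<forall>e<n. edge e --> (\<forall>y<n. lam e y \<phi> = 0))" by simp_all
qed

end

context graded_graph begin

definition good :: "(nat => bit) => bool" where
  "good \<phi> \<longleftrightarrow> order_supported \<phi> & (\<forall>e<n. edge e --> (\<forall>y<n. lam e y \<phi> = 0))"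

definition mat :: "(nat => bit) => nat => nat => bit" where
  "mat \<phi> = (%i j. if i < n & j < n then \<phi> (i * n + j) else 0)"

lemma app_rel:
  assumes "e < n" "edge e"
  shows "app n M (rel e) w = M w (src e) + M w (tgt e)"
proof -
  have d: "(\<Sum>j<n. M w j * of_bool (j = a)) = M w a" if "a < n" for a
  proof -
    have "(\<Sum>j<n. M w j * of_bool (j = a)) = (\<Sum>j<n. if j = a then M w a else 0)" by (intro sum.cong) auto
    then show ?thesis using that by simp
  qed
  show ?thesis unfolding app_def rel_def using d ends[OF assms] by (simp only: distrib_left sum.distrib)
qed

lemma lam_zero_iff:
  assumes e: "e < n" "edge e" and M: "!!i j. i < n ==> j < n ==> M i j = \<phi> (i * n + j)" "!!i j. \<not> i < n ==> M i j = 0"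
  shows "(\<forall>y<n. lam e y \<phi> = 0) \<longleftrightarrow> app n M (rel e) \<in> B (f e)"
proof -
  let ?y = "%w. \<phi> (w * n + src e) + \<phi> (w * n + tgt e)"
  have y: "?y w = app n M (rel e) w" if "w < n" for w
    using M(1)[OF that] ends[OF e] app_rel[OF e] by simp
  have "(\<forall>y<n. lam e y \<phi> = 0) \<longleftrightarrow> (\<exists>z\<in>combos n (f e). \<forall>w<n. ?y w = z w)"
    unfolding lam_def by (rule label_combos) simp
  also have "\<dots> \<longleftrightarrow> app n M (rel e) \<in> B (f e)"
  proof
    assume "\<exists>z\<in>combos n (f e). \<forall>w<n. ?y w = z w"
    then obtain z where z: "z \<in> combos n (f e)" "\<forall>w<n. ?y w = z w" by (rule bexE)
    have "app n M (rel e) w = z w" for w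
    proof (cases "w < n")
      case True
      then show ?thesis using y z(2) by simp
    next
      case False
      have "z \<in> F (f e)" using z(1) B_F by (simp add: B_def)
      then have "z w = 0" using False by (auto simp: F_def)
      moreover have "app n M (rel e) w = 0" using app_rel[OF e] M(2)[OF False] by simp
      ultimately show ?thesis by simp
    qed
    then have "app n M (rel e) = z" by (rule ext)
    then show "app n M (rel e) \<in> B (f e)" using z(1) by (simp add: B_def)
  next
    assume "app n M (rel e) \<in> B (f e)"
    then show "\<exists>z\<in>combos n (f e). \<forall>w<n. ?y w = z w" unfolding B_def using y by blast
  qed
  finally show ?thesis .
qed

lemma good_endo: "good \<phi> ==> endo (mat \<phi>)"
proof -
  assume g: "good \<phi>"
  have "tri (mat \<phi>)" unfolding tri_def
  proof (intro allI impI)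
    fix i j assume nz: "mat \<phi> i j ~= 0"
    then have ij: "i < n" "j < n" by (auto simp: mat_def split: if_splits)
    then have "\<phi> (i * n + j) ~= 0" using nz by (simp add: mat_def)
    then have "vert ((i * n + j) div n) & vert ((i * n + j) mod n) & f ((i * n + j) div n) \<le> f ((i * n + j) mod n)"
      using g entry_less[OF ij] unfolding good_def order_supported_def by blast
    then show "i < n & j < n & vert i & vert j & f i \<le> f j" using ij by (simp only: pair_div_mod)
  qed
  moreover have "app n (mat \<phi>) (rel e) \<in> B (f e)" if "e < n" "edge e" for e
    using g lam_zero_iff[OF that, of "mat \<phi>" \<phi>] that by (simp add: good_def mat_def)
  ultimately show ?thesis by (simp add: endo_def)
qed

lemma endo_good: "endo M ==> good (%q. M (q div n) (q mod n))"
proof -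
  assume M: "endo M"
  then have t: "tri M" by (rule endo_tri)
  have "order_supported (%q. M (q div n) (q mod n))" using t unfolding order_supported_def tri_def by blast
  moreover have "\<forall>y<n. lam e y (%q. M (q div n) (q mod n)) = 0" if "e < n" "edge e" for e
  proof (subst lam_zero_iff[OF that, of M])
    show "M i j = M ((i * n + j) div n) ((i * n + j) mod n)" if "j < n" for i j using that by (simp only: pair_div_mod)
    show "M i j = 0" if "\<not> i < n" for i j using t that unfolding tri_def by blast
    show "app n M (rel e) \<in> B (f e)" using M that by (simp add: endo_def)
  qed
  ultimately show ?thesis by (simp add: good_def)
qed

definition mat_at :: "nat => nat => 'g mem => nat => nat => bit" where
  "mat_at a c h = (%i j. if i < n & j < n then fmem h a (c + (i * n + j)) else 0)"

lemma mat_row: "mat (row_of h k) = mat_at 5 (k * n ^ 2) h"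
  by (simp add: mat_def mat_at_def row_of_def cong: if_cong)

lemma mat_at_eqI:
  assumes "!!q. q < n ^ 2 ==> fmem h a (c + q) = M (q div n) (q mod n)" "!!i j. \<not> (i < n & j < n) ==> M i j = 0"
  shows "mat_at a c h = M"
proof (intro ext)
  fix i j
  show "mat_at a c h i j = M i j"
  proof (cases "i < n & j < n")
    case True
    then show ?thesis using assms(1)[OF entry_less[of i j]] by (simp add: mat_at_def pair_div_mod)
  next
    case False
    then show ?thesis using assms(2)[OF False] by (auto simp: mat_at_def)
  qed
qed

lemma mat_at_mm:
  assumes "!!q. q < n ^ 2 ==> fmem h a (c + q) = (\<Sum>s<n. P (q div n) s * Q s (q mod n))"
    "!!i j. \<not> i < n ==> P i j = 0" "!!i j. \<not> j < n ==> Q i j = 0"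
  shows "mat_at a c h = mm n P Q"
proof (rule mat_at_eqI)
  show "fmem h a (c + q) = mm n P Q (q div n) (q mod n)" if "q < n ^ 2" for q
    using assms(1)[OF that] by (simp add: mm_def)
  show "mm n P Q i j = 0" if "\<not> (i < n & j < n)" for i j
    unfolding mm_def using that assms(2)[of i] assms(3)[of j] by (cases "i < n") auto
qed

lemma mat_at_apply: "i < n ==> j < n ==> mat_at a c h i j = fmem h a (c + (i * n + j))"
  by (simp add: mat_at_def)

lemma mat_at_outside: "\<not> i < n ==> mat_at a c h i j = 0" "\<not> j < n ==> mat_at a c h i j = 0"
  by (simp_all add: mat_at_def)

lemma bit_mult_eq_1: "(x::bit) * y = 1 \<longleftrightarrow> x = 1 & y = 1"
  by (cases x; cases y) auto

lemma bit_add_one_eq: "1 + (x::bit) = 1 \<longleftrightarrow> x = 0"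
  by (cases x) auto

abbreviation count :: "'g mem => nat" where "count h \<equiv> wmem h 7 2"

abbreviation idem_of :: "'g mem => nat => nat => nat => bit" where "idem_of h l \<equiv> mat_at 16 (l * n ^ 2) h"

abbreviation endo_row :: "'g mem => nat => nat => nat => bit" where "endo_row h k \<equiv> mat_at 5 (k * n ^ 2) h"

lemma find_splitting_correct:
  fixes h :: "'g mem"
  assumes h': "h' = run n find_splitting e h"
  shows "q < n ^ 3 ==> fmem h' 17 q = of_bool (q mod n < count h & separates (endo_row h (q div n)) (idem_of h (q mod n)))"
    and "wmem h' = (wmem h)(7 := (wmem h 7)(3 := last_true (fmem h' 17) (n ^ 3)))"
    and "fmem h' 5 = fmem h 5" "fmem h' 16 = fmem h 16"
proof -
  let ?E1 = "%q v. of_bool (q mod n < count h) * fmem h 16 (q mod n * n ^ 2 + (v * n + v)) * fmem h 5 (q div n * n ^ 2 + (v * n + v)) :: bit"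
  let ?E0 = "%q v. of_bool (q mod n < count h) * fmem h 16 (q mod n * n ^ 2 + (v * n + v)) * (1 + fmem h 5 (q div n * n ^ 2 + (v * n + v))) :: bit"
  let ?h1 = "h(|fmem := (fmem h)(18 := %q. if q < n ^ 3 then of_bool (\<exists>v<n ^ 1. ?E1 q v = 1) else fmem h 18 q)|)"
  have h1: "run n (For 1 3 (OrTo 18 (WVar 1) 2 1 (FIsLess (WVar 1 mod. wn) (WGet 7 wtwo) *\<^sub>f
       FGet 16 (WVar 1 mod. wn *. wn2 +. (WVar 2 *. wn +. WVar 2)) *\<^sub>f
       FGet 5 (WVar 1 div. wn *. wn2 +. (WVar 2 *. wn +. WVar 2))))) e h = ?h1"
    by (subst run_map_or) (simp_all add: numeral_2_eq_2 cong: if_cong)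
  let ?h2 = "?h1(|fmem := (fmem ?h1)(19 := %q. if q < n ^ 3 then of_bool (\<exists>v<n ^ 1. ?E0 q v = 1) else fmem h 19 q)|)"
  have h2: "run n (For 1 3 (OrTo 19 (WVar 1) 2 1 (FIsLess (WVar 1 mod. wn) (WGet 7 wtwo) *\<^sub>f
       FGet 16 (WVar 1 mod. wn *. wn2 +. (WVar 2 *. wn +. WVar 2)) *\<^sub>f
       (FLit 1 +\<^sub>f FGet 5 (WVar 1 div. wn *. wn2 +. (WVar 2 *. wn +. WVar 2)))))) e ?h1 = ?h2"
    by (subst run_map_or) (simp_all add: numeral_2_eq_2 cong: if_cong)
  let ?h3 = "?h2(|fmem := (fmem ?h2)(17 := %q. if q < n ^ 3 then fmem ?h2 18 q * fmem ?h2 19 q else fmem h 17 q)|)"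
  have h3: "run n (For 1 3 (PutF 17 (WVar 1) (FGet 18 (WVar 1) *\<^sub>f FGet 19 (WVar 1)))) e ?h2 = ?h3"
    by (subst run_map_set) (simp_all cong: if_cong)
  let ?h4 = "?h3(|wmem := (wmem ?h3)(7 := (wmem ?h3 7)(3 := last_true (fmem ?h3 17) (n ^ 3)))|)"
  have h4: "run n (FindTo 7 wthree 1 3 (FGet 17 (WVar 1))) e ?h3 = ?h4"
    by (rule run_FindTo) (simp_all add: numeral_3_eq_3)
  have h'4: "h' = ?h4" unfolding h' find_splitting_def by (simp only: run.simps(2) h1 h2 h3 h4)
  show "wmem h' = (wmem h)(7 := (wmem h 7)(3 := last_true (fmem h' 17) (n ^ 3)))" "fmem h' 5 = fmem h 5" "fmem h' 16 = fmem h 16"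
    unfolding h'4 by simp_all
  assume q: "q < n ^ 3"
  have s: "separates (endo_row h (q div n)) (idem_of h (q mod n)) \<longleftrightarrow>
     (\<exists>v<n. fmem h 16 (q mod n * n ^ 2 + (v * n + v)) = 1 & fmem h 5 (q div n * n ^ 2 + (v * n + v)) = 1) &
     (\<exists>v<n. fmem h 16 (q mod n * n ^ 2 + (v * n + v)) = 1 & fmem h 5 (q div n * n ^ 2 + (v * n + v)) = 0)"
    unfolding separates_def using mat_at_apply by (intro arg_cong2[where f = "(&)"] ex_cong1 conj_cong) auto
  have "fmem h' 17 q = of_bool (\<exists>v<n. ?E1 q v = 1) * of_bool (\<exists>v<n. ?E0 q v = 1)"
    unfolding h'4 using q by simp
  also have "\<dots> = of_bool (q mod n < count h & separates (endo_row h (q div n)) (idem_of h (q mod n)))"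
    unfolding s bit_mult_eq_1 bit_add_one_eq by (auto simp: of_bool_def)
  finally show "fmem h' 17 q = of_bool (q mod n < count h & separates (endo_row h (q div n)) (idem_of h (q mod n)))" .
qed

lemma compress_correct:
  fixes h :: "'g mem"
  assumes h': "h' = run n compress e h" and p: "wmem h 7 3 = p"
  shows "mat_at 20 0 h' = mm n (mm n (idem_of h (p mod n)) (endo_row h (p div n))) (idem_of h (p mod n))"
    and "fmem h' 16 = fmem h 16" "fmem h' 5 = fmem h 5"
proof -
  let ?U = "%q. \<Sum>s<n ^ 1. fmem h 16 (p mod n * n ^ 2 + (q div n * n + s)) * fmem h 5 (p div n * n ^ 2 + (s * n + q mod n))"
  let ?h1 = "h(|fmem := (fmem h)(22 := %q. if q < n ^ 2 then ?U q else fmem h 22 q)|)"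
  have p': "wmem h 7 (Suc (Suc (Suc 0))) = p" using p by (simp add: numeral_3_eq_3)
  have h1: "run n (For 1 2 (SumTo 22 (WVar 1) 2 1
       (FGet 16 (WGet 7 wthree mod. wn *. wn2 +. (WVar 1 div. wn *. wn +. WVar 2)) *\<^sub>f
        FGet 5 (WGet 7 wthree div. wn *. wn2 +. (WVar 2 *. wn +. WVar 1 mod. wn))))) e h = ?h1"
    by (subst run_map_sum) (simp_all add: p' cong: if_cong)
  let ?V = "%q. \<Sum>s<n ^ 1. fmem ?h1 22 (q div n * n + s) * fmem h 16 (p mod n * n ^ 2 + (s * n + q mod n))"
  let ?h2 = "?h1(|fmem := (fmem ?h1)(20 := %q. if q < n ^ 2 then ?V q else fmem h 20 q)|)"
  have h2: "run n (For 1 2 (SumTo 20 (WVar 1) 2 1 (FGet 22 (WVar 1 div. wn *. wn +. WVar 2) *\<^sub>f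
        FGet 16 (WGet 7 wthree mod. wn *. wn2 +. (WVar 2 *. wn +. WVar 1 mod. wn))))) e ?h1 = ?h2"
    by (subst run_map_sum) (simp_all add: p' cong: if_cong)
  have h'2: "h' = ?h2" unfolding h' compress_def by (simp only: run.simps(2) h1 h2)
  show "fmem h' 16 = fmem h 16" "fmem h' 5 = fmem h 5" unfolding h'2 by simp_all
  have 22: "mat_at 22 0 h' = mm n (idem_of h (p mod n)) (endo_row h (p div n))"
  proof (rule mat_at_mm)
    fix q assume q: "q < n ^ 2"
    have "fmem h' 22 (0 + q) = ?U q" unfolding h'2 using q by simp
    also have "\<dots> = (\<Sum>s<n. idem_of h (p mod n) (q div n) s * endo_row h (p div n) s (q mod n))"
      using quot2[OF q] by (intro sum.cong) (auto simp: mat_at_apply)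
    finally show "fmem h' 22 (0 + q) = (\<Sum>s<n. idem_of h (p mod n) (q div n) s * endo_row h (p div n) s (q mod n))" .
  qed (simp_all add: mat_at_outside)
  show "mat_at 20 0 h' = mm n (mm n (idem_of h (p mod n)) (endo_row h (p div n))) (idem_of h (p mod n))"
    unfolding 22[symmetric]
  proof (rule mat_at_mm)
    fix q assume q: "q < n ^ 2"
    have 22: "fmem ?h1 22 = fmem h' 22" unfolding h'2 by simp
    have "fmem h' 20 (0 + q) = (\<Sum>s<n. fmem ?h1 22 (q div n * n + s) * fmem h 16 (p mod n * n ^ 2 + (s * n + q mod n)))" unfolding h'2 using q by simp
    also have "\<dots> = (\<Sum>s<n. mat_at 22 0 h' (q div n) s * idem_of h (p mod n) s (q mod n))"
      unfolding 22 using quot2[OF q] by (intro sum.cong) (auto simp: mat_at_apply)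
    finally show "fmem h' 20 (0 + q) = (\<Sum>s<n. mat_at 22 0 h' (q div n) s * idem_of h (p mod n) s (q mod n))" .
  qed (simp_all add: mat_at_outside)
qed

lemma square_repeatedly_correct:
  fixes h :: "'g mem"
  shows "mat_at 20 0 (run n square_repeatedly e h) = sqs n n (mat_at 20 0 h)"
proof -
  let ?c = "For 2 2 (SumTo 21 (WVar 2) 3 1 (FGet 20 (WVar 2 div. wn *. wn +. WVar 3) *\<^sub>f
        FGet 20 (WVar 3 *. wn +. WVar 2 mod. wn))) ;;;
       For 2 2 (PutF 20 (WVar 2) (FGet 21 (WVar 2)))"
  have "mat_at 20 0 (run n (For 1 1 ?c) e h) = sqs n (n ^ 1) (mat_at 20 0 h)"
  proof (rule run_For_rule[of "%r g. mat_at 20 0 g = sqs n r (mat_at 20 0 h)"])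
    fix r and g :: "'g mem" assume g: "mat_at 20 0 g = sqs n r (mat_at 20 0 h)"
    let ?e = "e(1 := r)"
    let ?V = "%q. \<Sum>s<n ^ 1. fmem g 20 (q div n * n + s) * fmem g 20 (s * n + q mod n)"
    let ?g1 = "g(|fmem := (fmem g)(21 := %q. if q < n ^ 2 then ?V q else fmem g 21 q)|)"
    have g1: "run n (For 2 2 (SumTo 21 (WVar 2) 3 1 (FGet 20 (WVar 2 div. wn *. wn +. WVar 3) *\<^sub>f
        FGet 20 (WVar 3 *. wn +. WVar 2 mod. wn)))) ?e g = ?g1"
      by (subst run_map_sum) (simp_all cong: if_cong)
    let ?g2 = "?g1(|fmem := (fmem ?g1)(20 := %q. if q < n ^ 2 then fmem ?g1 21 q else fmem g 20 q)|)"
    have g2: "run n (For 2 2 (PutF 20 (WVar 2) (FGet 21 (WVar 2)))) ?e ?g1 = ?g2"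
      by (subst run_map_set) (simp_all cong: if_cong)
    have r: "run n ?c ?e g = ?g2" by (simp only: run.simps(2) g1 g2)
    show "mat_at 20 0 (run n ?c ?e g) = sqs n (Suc r) (mat_at 20 0 h)"
      unfolding sqs.simps g[symmetric] r
    proof (rule mat_at_mm)
      fix q assume q: "q < n ^ 2"
      have "fmem ?g2 20 (0 + q) = (\<Sum>s<n. fmem g 20 (q div n * n + s) * fmem g 20 (s * n + q mod n))" using q by simp
      also have "\<dots> = (\<Sum>s<n. mat_at 20 0 g (q div n) s * mat_at 20 0 g s (q mod n))"
        using quot2[OF q] by (intro sum.cong) (auto simp: mat_at_apply)
      finally show "fmem ?g2 20 (0 + q) = (\<Sum>s<n. mat_at 20 0 g (q div n) s * mat_at 20 0 g s (q mod n))" .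
    qed (simp_all add: mat_at_outside)
  qed simp
  then show ?thesis by (simp add: square_repeatedly_def del: run.simps)
qed

lemma run_increment: "wmem g 7 2 < word_limit n - 1 ==> run n (PutW 7 wtwo (WGet 7 wtwo +. wone)) e g =
    g(|wmem := (wmem g)(7 := (wmem g 7)(2 := Suc (wmem g 7 2)))|)"
  by (simp add: array_write_def numeral_2_eq_2)

lemma store_splitting_correct:
  fixes h :: "'g mem"
  assumes h': "h' = run n store_splitting e h" and p: "wmem h 7 3 = p" and l: "p mod n < count h" and L: "count h < word_limit n - 1"
  shows "count h' = Suc (count h)"
    and "m < Suc (count h) ==> idem_of h' m = (if m = p mod n then mat_at 20 0 h
      else if m = count h then idem_of h (p mod n) + mat_at 20 0 h else idem_of h m)"
    and "fmem h' 5 = fmem h 5"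
proof -
  have p': "wmem h 7 (Suc (Suc (Suc 0))) = p" using p by (simp add: numeral_3_eq_3)
  let ?L = "count h" and ?l = "p mod n"
  have L': "wmem h 7 (Suc (Suc 0)) = ?L" by (simp add: numeral_2_eq_2)
  let ?h1 = "h(|fmem := (fmem h)(16 := %i. if ?L * n ^ 2 \<le> i & i < ?L * n ^ 2 + n ^ 2
     then fmem h 16 (?l * n ^ 2 + (i - ?L * n ^ 2)) + fmem h 20 (i - ?L * n ^ 2) else fmem h 16 i)|)"
  let ?E = "%k. fmem h 16 (?l * n ^ 2 + k) + fmem h 20 k"
  have h1: "run n (For 1 2 (PutF 16 (WGet 7 wtwo *. wn2 +. WVar 1)
       (FGet 16 (WGet 7 wthree mod. wn *. wn2 +. WVar 1) +\<^sub>f FGet 20 (WVar 1)))) e h = ?h1"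
  proof (rule run_cells[where E = ?E])
    fix k g assume k: "k < n ^ 2" and g: "!!i. \<not> (?L * n ^ 2 \<le> i & i < ?L * n ^ 2 + k) ==> g i = fmem h 16 i"
    have "?l * n ^ 2 + k < ?L * n ^ 2" using pair_less[OF l k] .
    then have "g (?l * n ^ 2 + k) = fmem h 16 (?l * n ^ 2 + k)" using g by simp
    then show "run n (PutF 16 (WGet 7 wtwo *. wn2 +. WVar 1)
       (FGet 16 (WGet 7 wthree mod. wn *. wn2 +. WVar 1) +\<^sub>f FGet 20 (WVar 1))) (e(1 := k)) (h(|fmem := (fmem h)(16 := g)|)) =
       h(|fmem := (fmem h)(16 := g(?L * n ^ 2 + k := fmem h 16 (?l * n ^ 2 + k) + fmem h 20 k))|)"
      by (simp add: L' p' array_write_def)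
  qed
  let ?h2 = "?h1(|fmem := (fmem ?h1)(16 := %i. if ?l * n ^ 2 \<le> i & i < ?l * n ^ 2 + n ^ 2
     then fmem h 20 (i - ?l * n ^ 2) else fmem ?h1 16 i)|)"
  have h2: "run n (For 1 2 (PutF 16 (WGet 7 wthree mod. wn *. wn2 +. WVar 1) (FGet 20 (WVar 1)))) e ?h1 = ?h2"
    by (subst run_map_offset[where c = "?l * n ^ 2"]) (simp_all add: p' cong: if_cong)
  let ?h3 = "?h2(|wmem := (wmem ?h2)(7 := (wmem ?h2 7)(2 := Suc ?L))|)"
  have h3: "run n (PutW 7 wtwo (WGet 7 wtwo +. wone)) e ?h2 = ?h3"
    by (subst run_increment) (use L in simp_all)
  have h'3: "h' = ?h3" unfolding h' store_splitting_def by (simp only: run.simps(2) h1 h2 h3)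
  show "count h' = Suc (count h)" "fmem h' 5 = fmem h 5" unfolding h'3 by simp_all
  assume m: "m < Suc ?L"
  have reg: "(k * n ^ 2 \<le> m * n ^ 2 + q & m * n ^ 2 + q < k * n ^ 2 + n ^ 2) \<longleftrightarrow> k = m" if "q < n ^ 2" for k q
  proof
    assume a: "k * n ^ 2 \<le> m * n ^ 2 + q & m * n ^ 2 + q < k * n ^ 2 + n ^ 2"
    then obtain r where r: "m * n ^ 2 + q = k * n ^ 2 + r" using le_Suc_ex by blast
    then have "r < n ^ 2" using a by simp
    then show "k = m" using pair_div_mod(1)[of r "n ^ 2" k] pair_div_mod(1)[OF that, of m] r by simp
  qed (use that in auto)
  show "idem_of h' m = (if m = ?l then mat_at 20 0 h else if m = ?L then idem_of h ?l + mat_at 20 0 h else idem_of h m)"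
  proof (rule mat_at_eqI)
    fix q assume q: "q < n ^ 2"
    have qq: "q div n * n + q mod n = q" by simp
    show "fmem h' 16 (m * n ^ 2 + q) = (if m = ?l then mat_at 20 0 h else if m = ?L then idem_of h ?l + mat_at 20 0 h else idem_of h m) (q div n) (q mod n)"
      unfolding h'3 using reg[OF q, of ?l] reg[OF q, of ?L] quot2[OF q] l qq by (simp add: mat_at_apply fun_simps)
  qed (auto simp: mat_at_def fun_simps)
qed


definition unsplittable :: "'g mem => bool" where
  "unsplittable h \<longleftrightarrow> (\<forall>k<n ^ 2. \<forall>l<count h. \<not> separates (endo_row h k) (idem_of h l))"

lemma idems_cong: "(!!l. l < L ==> E l = E' l) ==> idems L E ==> idems L E'"
proof -
  assume eq: "!!l. l < L ==> E l = E' l" and E: "idems L E"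
  have "(\<Sum>l<L. E' l) = (\<Sum>l<L. E l)" using eq by (intro sum.cong) auto
  then show ?thesis using E eq unfolding idems_def by simp
qed

lemma init_idempotents_correct:
  fixes h :: "'g mem"
  assumes inp: "input_mem h" and v: "n = 0 | (\<exists>v<n. vert v)" and h': "h' = run n init_idempotents e h"
  shows "idems (count h') (idem_of h')" "count h' = of_bool (0 < n)" "fmem h' 5 = fmem h 5"
proof -
  let ?h1 = "h(|fmem := (fmem h)(16 := %i. if i < n ^ 2 then of_bool (i div n = i mod n) * of_bool (wmem h 0 (i mod n) = 1) else fmem h 16 i)|)"
  have h1: "run n (For 0 2 (PutF 16 (WVar 0) (FIsEq (WVar 0 div. wn) (WVar 0 mod. wn) *\<^sub>f is_vertex (WVar 0 mod. wn)))) e h = ?h1"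
    by (subst run_map_set) (simp_all cong: if_cong)
  let ?h2 = "?h1(|wmem := (wmem ?h1)(7 := (wmem ?h1 7)(2 := 0))|)"
  have h2: "run n (PutW 7 wtwo wzero) e ?h1 = ?h2" by (simp add: array_write_def numeral_2_eq_2)
  have lim: "1 mod word_limit n = 1" using size_less_limit[of 0 n] by simp
  have h3: "run n (For 0 1 (PutW 7 wtwo wone)) e ?h2 = ?h2(|wmem := (wmem ?h2)(7 := (wmem ?h2 7)(2 := of_bool (0 < n ^ 1)))|)"
  proof (rule run_For_rule[of "%k g. g = ?h2(|wmem := (wmem ?h2)(7 := (wmem ?h2 7)(2 := of_bool (0 < k)))|)"])
    fix k :: nat and g :: "'g mem" assume "g = ?h2(|wmem := (wmem ?h2)(7 := (wmem ?h2 7)(2 := of_bool (0 < k)))|)"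
    then show "run n (PutW 7 wtwo wone) (e(0 := k)) g = ?h2(|wmem := (wmem ?h2)(7 := (wmem ?h2 7)(2 := of_bool (0 < Suc k)))|)"
      using lim by (simp add: array_write_def numeral_2_eq_2)
  qed simp
  have h'3: "h' = ?h2(|wmem := (wmem ?h2)(7 := (wmem ?h2 7)(2 := of_bool (0 < n ^ 1)))|)"
    unfolding h' init_idempotents_def by (simp only: run.simps(2) h1 h2 h3)
  show c: "count h' = of_bool (0 < n)" and "fmem h' 5 = fmem h 5" unfolding h'3 by simp_all
  have i0: "idem_of h' 0 = idm"
  proof (rule mat_at_eqI)
    fix q assume q: "q < n ^ 2"
    show "fmem h' 16 (0 * n ^ 2 + q) = idm (q div n) (q mod n)"
      unfolding h'3 idm_def using q quot2[OF q] inp by (auto simp: input_mem_def)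
  qed (auto simp: idm_def)
  show "idems (count h') (idem_of h')"
  proof (cases "n = 0")
    case True
    have "idm = 0" by (intro ext) (unfold idm_def fun_simps, use True in simp)
    moreover have "count h' = 0" using True c by simp
    ultimately show ?thesis unfolding idems_def by simp
  next
    case False
    then obtain w where w: "w < n" "vert w" using v by blast
    have "mm n idm idm = idm" by (rule idm_mm[OF tri_idm])
    then show ?thesis using False c i0 w endo_idm by (auto simp: idems_def idm_def)
  qed
qed

lemma refine_round_correct:
  fixes h :: "'g mem"
  assumes E: "idems (count h) (idem_of h)" and K: "!!k. k < n ^ 2 ==> endo (endo_row h k)" and n0: "0 < n"
    and h': "h' = run n (find_splitting ;;; When (FGet 17 (WGet 7 wthree)) (compress ;;; square_repeatedly ;;; store_splitting)) e h"
  shows "idems (count h') (idem_of h')" "fmem h' 5 = fmem h 5"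
    "(unsplittable h & unsplittable h') | (\<not> unsplittable h & count h' = Suc (count h))"
proof -
  let ?h1 = "run n find_splitting e h"
  note fs = find_splitting_correct[where h = h and e = e, OF refl]
  define p where "p = last_true (fmem ?h1 17) (n ^ 3)"
  have p3: "p < n ^ 3" unfolding p_def using n0 by (intro last_true_less) simp
  have c1: "count ?h1 = count h" "wmem ?h1 7 3 = p" unfolding fs(2) p_def by simp_all
  have m1: "mat_at 16 c ?h1 = mat_at 16 c h" "mat_at 5 c ?h1 = mat_at 5 c h" for c
    by (simp_all only: mat_at_def fs(3,4))
  have b: "feval n e ?h1 (FGet 17 (WGet 7 wthree)) = fmem ?h1 17 p"
    using c1(2) by (simp add: numeral_3_eq_3)
  have "idems (count h') (idem_of h') & fmem h' 5 = fmem h 5 &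
    ((unsplittable h & unsplittable h') | (\<not> unsplittable h & count h' = Suc (count h)))"
  proof (cases "fmem ?h1 17 p = 1")
    case False
    have h'1: "h' = ?h1" unfolding h' using False by (simp only: run.simps(2,3) b if_False)
    have "unsplittable h" unfolding unsplittable_def
    proof (intro allI impI notI)
      fix k l assume kl: "k < n ^ 2" "l < count h" and s: "separates (endo_row h k) (idem_of h l)"
      have l: "l < n" using idems_le[OF E] kl(2) by simp
      have q: "k * n + l < n ^ 3" using pair_less[OF kl(1) l] by (simp add: power2_eq_square power3_eq_cube)
      have "fmem ?h1 17 (k * n + l) = 1" using fs(1)[OF q] kl l s by (simp add: pair_div_mod)
      then show False using last_true[OF q] False unfolding p_def by blast
    qed
    moreover from this have "unsplittable h'" by (simp only: unsplittable_def h'1 m1 c1(1))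
    ultimately show ?thesis using E fs(3) c1 m1 by (simp add: h'1)
  next
    case True
    let ?h2 = "run n compress e ?h1" and ?l = "p mod n" and ?k = "p div n"
    let ?h3 = "run n square_repeatedly e ?h2"
    have h'4: "h' = run n store_splitting e ?h3"
      unfolding h' by (simp only: run.simps(2,3) b True if_True simp_thms)
    have l: "?l < count h" and sep: "separates (endo_row h ?k) (idem_of h ?l)" using fs(1)[OF p3] True by auto
    have k: "?k < n ^ 2" using quot3(1)[OF p3] .
    note cp = compress_correct[where h = ?h1 and e = e, OF refl c1(2)]
    have w2: "wmem ?h2 7 = wmem ?h1 7" by (rule wmem_frame) (simp add: compress_def SumTo_def)
    have w3: "wmem ?h3 7 = wmem ?h2 7" by (rule wmem_frame) (simp add: square_repeatedly_def SumTo_def)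
    have f3: "fmem ?h3 16 = fmem ?h2 16" "fmem ?h3 5 = fmem ?h2 5" by (rule fmem_frame, simp add: square_repeatedly_def SumTo_def)+
    have c3: "count ?h3 = count h" "wmem ?h3 7 3 = p" using w2 w3 c1 by simp_all
    define \<psi> where "\<psi> = sqs n n (mm n (mm n (idem_of h ?l) (endo_row h ?k)) (idem_of h ?l))"
    have T3: "mat_at 20 0 ?h3 = \<psi>"
      unfolding square_repeatedly_correct cp(1) m1 \<psi>_def by (rule refl)
    have m3: "mat_at 16 c ?h3 = mat_at 16 c h" for c by (simp only: mat_at_def fs(4) cp(2) f3(1))
    have "count h \<le> n" using idems_le[OF E] .
    also have "n < word_limit n - 1"
    proof -
      have "n + 2 \<le> word_limit n" unfolding word_limit_def by (rule self_le_power) auto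
      then show ?thesis by linarith
    qed
    finally have lim: "count ?h3 < word_limit n - 1" using c3 by simp
    have l3: "p mod n < count ?h3" using l c3 by simp
    note ss = store_splitting_correct[where h = ?h3 and e = e, OF refl c3(2) l3 lim, folded h'4, unfolded c3(1) T3 m3]
    have "idems (count h') (idem_of h')"
      unfolding ss(1) by (rule idems_split[OF E l K[OF k] sep \<psi>_def]) (rule ss(2))
    moreover have "fmem h' 5 = fmem h 5" using ss(3) f3(2) cp(3) fs(3) by simp
    moreover have "\<not> unsplittable h" using k l sep unfolding unsplittable_def by blast
    ultimately show ?thesis using ss(1) by blast
  qed
  then show "idems (count h') (idem_of h')" "fmem h' 5 = fmem h 5"
    "(unsplittable h & unsplittable h') | (\<not> unsplittable h & count h' = Suc (count h))"
    by blast+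
qed

lemma refine_idempotents_correct:
  fixes h :: "'g mem"
  assumes E: "idems (count h) (idem_of h)" and K: "!!k. k < n ^ 2 ==> endo (endo_row h k)"
    and c: "count h = of_bool (0 < n)" and h': "h' = run n refine_idempotents e h"
  shows "idems (count h') (idem_of h')" "fmem h' 5 = fmem h 5" "unsplittable h'"
proof -
  let ?c = "find_splitting ;;; When (FGet 17 (WGet 7 wthree)) (compress ;;; square_repeatedly ;;; store_splitting)"
  have h'1: "h' = run n (For 0 1 ?c) e h" unfolding h' refine_idempotents_def by (rule refl)
  have I: "idems (count h') (idem_of h') & fmem h' 5 = fmem h 5 & (unsplittable h' | count h' = n ^ 1 + of_bool (0 < n))"
    unfolding h'1
  proof (rule run_For_rule[of "%r g. idems (count g) (idem_of g) & fmem g 5 = fmem h 5 & (unsplittable g | count g = r + of_bool (0 < n))"])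
    show "idems (count h) (idem_of h) & fmem h 5 = fmem h 5 & (unsplittable h | count h = 0 + of_bool (0 < n))"
      using E c by simp
    fix r and g :: "'g mem"
    assume r: "r < n ^ 1" and g: "idems (count g) (idem_of g) & fmem g 5 = fmem h 5 & (unsplittable g | count g = r + of_bool (0 < n))"
    have n0: "0 < n" using r by simp
    have "fmem g 5 = fmem h 5" using g by blast
    then have K': "endo (endo_row g k)" if "k < n ^ 2" for k using K[OF that] by (simp only: mat_at_def)
    let ?g = "run n ?c (e(0 := r)) g"
    note rr = refine_round_correct[OF conjunct1[OF g] K' n0 refl, of "e(0 := r)"]
    have "fmem ?g 5 = fmem h 5" using rr(2) g by simp
    moreover have "unsplittable ?g | count ?g = Suc r + of_bool (0 < n)"
      using rr(3) g by auto
    ultimately show "idems (count ?g) (idem_of ?g) & fmem ?g 5 = fmem h 5 & (unsplittable ?g | count ?g = Suc r + of_bool (0 < n))"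
      using rr(1) by blast
  qed
  have "count h' ~= n ^ 1 + of_bool (0 < n) | n = 0" using idems_le[of "count h'" "idem_of h'"] I by auto
  moreover have "unsplittable h'" if "n = 0" unfolding unsplittable_def using that by simp
  ultimately show "idems (count h') (idem_of h')" "fmem h' 5 = fmem h 5" "unsplittable h'" using I by blast+
qed

end

context graded_graph begin

definition address :: "nat => nat => nat => nat" where
  "address l i j = l * (n ^ 2 + n ^ 2) + (i * (n + n) + j)"

lemma address_inj:
  assumes "i < n" "j < n + n" "i' < n" "j' < n + n" "address l i j = address l' i' j'"
  shows "l = l' & i = i' & j = j'"
proof -
  have b: "i * (n + n) + j < n ^ 2 + n ^ 2" "i' * (n + n) + j' < n ^ 2 + n ^ 2"
    using pair_less[OF assms(1,2)] pair_less[OF assms(3,4)] by (simp_all add: power2_eq_square distrib_left)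
  have "l = l'" using pair_div_mod(1)[OF b(1), of l] pair_div_mod(1)[OF b(2), of l'] assms(5) by (simp add: address_def)
  moreover have eq: "i * (n + n) + j = i' * (n + n) + j'"
    using \<open>l = l'\<close> assms(5) by (simp add: address_def)
  moreover have "i = i'" using pair_div_mod(1)[OF assms(2), of i] pair_div_mod(1)[OF assms(4), of i'] eq by simp
  ultimately show ?thesis by simp
qed

lemma write_entries_correct:
  fixes h :: "'g mem"
  assumes inp: "input_mem h"
    and h': "h' = run n (For 0 3 (
       PutF 0 (WVar 0 div. wn2 *. (wn2 +. wn2) +. (WVar 0 mod. wn2 div. wn *. (wn +. wn) +. WVar 0 mod. wn))
         (is_edge (WVar 0 mod. wn) *\<^sub>f (FIsEq (WVar 0 mod. wn2 div. wn) (end1 (WVar 0 mod. wn)) +\<^sub>f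
          FIsEq (WVar 0 mod. wn2 div. wn) (end2 (WVar 0 mod. wn)))) ;;;
       PutF 0 (WVar 0 div. wn2 *. (wn2 +. wn2) +. (WVar 0 mod. wn2 div. wn *. (wn +. wn) +. (wn +. WVar 0 mod. wn)))
         (FIsEq (WVar 0 mod. wn2 div. wn) (WVar 0 mod. wn) +\<^sub>f FGet 16 (WVar 0)))) e h"
    and l: "l < n" "i < n" "j < n"
  shows "fmem h' 0 (address l i j) = of_bool (edge j) * rel j i"
    "fmem h' 0 (address l i (n + j)) = of_bool (i = j) + idem_of h l i j"
proof -
  let ?c = "PutF 0 (WVar 0 div. wn2 *. (wn2 +. wn2) +. (WVar 0 mod. wn2 div. wn *. (wn +. wn) +. WVar 0 mod. wn))
         (is_edge (WVar 0 mod. wn) *\<^sub>f (FIsEq (WVar 0 mod. wn2 div. wn) (end1 (WVar 0 mod. wn)) +\<^sub>f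
          FIsEq (WVar 0 mod. wn2 div. wn) (end2 (WVar 0 mod. wn)))) ;;;
       PutF 0 (WVar 0 div. wn2 *. (wn2 +. wn2) +. (WVar 0 mod. wn2 div. wn *. (wn +. wn) +. (wn +. WVar 0 mod. wn)))
         (FIsEq (WVar 0 mod. wn2 div. wn) (WVar 0 mod. wn) +\<^sub>f FGet 16 (WVar 0))"
  let ?l = "%q. q div n ^ 2" and ?i = "%q. q mod n ^ 2 div n" and ?j = "%q. q mod n"
  let ?v1 = "%q. of_bool (edge (?j q)) * rel (?j q) (?i q)" and ?v2 = "%q. of_bool (?i q = ?j q) + fmem h 16 q"
  define written where "written k g \<longleftrightarrow> fmem g 16 = fmem h 16 & wmem g = wmem h &
     (\<forall>q<k. fmem g 0 (address (?l q) (?i q) (?j q)) = ?v1 q & fmem g 0 (address (?l q) (?i q) (n + ?j q)) = ?v2 q)" for k and g :: "'g mem"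
  have W: "written (n ^ 3) (run n (For 0 3 ?c) e h)"
  proof (rule run_For_rule[of written])
    show "written 0 h" by (simp add: written_def)
    fix k and g :: "'g mem" assume k: "k < n ^ 3" and g: "written k g"
    let ?e = "e(0 := k)"
    have g': "fmem g 16 = fmem h 16" "wmem g = wmem h" using g by (simp_all add: written_def)
    have ijk: "?i k < n" "?j k < n" using quot2(1)[OF quot3(4)[OF k]] quot3(2)[OF k] by auto
    have we: "edge (?j k) ==> wmem h 1 (?j k * n) = src (?j k) & wmem h 1 (?j k * n + 1) = tgt (?j k)"
      "wmem h 0 (?j k) = 2 \<longleftrightarrow> edge (?j k)" using inp ijk(2) unfolding input_mem_def by blast+
    have v1: "feval n ?e g (is_edge (WVar 0 mod. wn) *\<^sub>f (FIsEq (WVar 0 mod. wn2 div. wn) (end1 (WVar 0 mod. wn)) +\<^sub>f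
          FIsEq (WVar 0 mod. wn2 div. wn) (end2 (WVar 0 mod. wn)))) = ?v1 k"
      using we by (cases "edge (?j k)") (simp_all add: g' rel_def numeral_2_eq_2[symmetric])
    let ?g1 = "g(|fmem := array_write (fmem g) 0 (address (?l k) (?i k) (?j k)) (?v1 k)|)"
    let ?g2 = "?g1(|fmem := array_write (fmem ?g1) 0 (address (?l k) (?i k) (n + ?j k)) (?v2 k)|)"
    have r1: "run n (PutF 0 (WVar 0 div. wn2 *. (wn2 +. wn2) +. (WVar 0 mod. wn2 div. wn *. (wn +. wn) +. WVar 0 mod. wn))
         (is_edge (WVar 0 mod. wn) *\<^sub>f (FIsEq (WVar 0 mod. wn2 div. wn) (end1 (WVar 0 mod. wn)) +\<^sub>f
          FIsEq (WVar 0 mod. wn2 div. wn) (end2 (WVar 0 mod. wn))))) ?e g = ?g1"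
      unfolding run.simps(6) v1 by (simp add: address_def)
    have r2: "run n (PutF 0 (WVar 0 div. wn2 *. (wn2 +. wn2) +. (WVar 0 mod. wn2 div. wn *. (wn +. wn) +. (wn +. WVar 0 mod. wn)))
         (FIsEq (WVar 0 mod. wn2 div. wn) (WVar 0 mod. wn) +\<^sub>f FGet 16 (WVar 0))) ?e ?g1 = ?g2"
      unfolding run.simps(6) by (simp add: address_def array_write_def g')
    have r: "run n ?c ?e g = ?g2" by (simp only: run.simps(2) r1 r2)
    have ne: "address (?l k) (?i k) (?j k) ~= address (?l k) (?i k) (n + ?j k)"
      using address_inj[of "?i k" "?j k" "?i k" "n + ?j k" "?l k" "?l k"] ijk by auto
    have "fmem ?g2 0 (address (?l q) (?i q) (?j q)) = ?v1 q & fmem ?g2 0 (address (?l q) (?i q) (n + ?j q)) = ?v2 q" if q: "q < Suc k" for q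
    proof (cases "q = k")
      case True
      then show ?thesis using ne by (simp add: array_write_def)
    next
      case False
      then have qk: "q < k" using q by simp
      then have q3: "q < n ^ 3" using k by simp
      have ijq: "?i q < n" "?j q < n" using quot2(1)[OF quot3(4)[OF q3]] quot3(2)[OF q3] by auto
      have dec: "x = ?l x * n ^ 2 + (?i x * n + ?j x)" for x
      proof -
        have "x mod n ^ 2 mod n = x mod n" by (simp add: power2_eq_square mod_mult2_eq)
        then have "x mod n ^ 2 = ?i x * n + ?j x" using div_mult_mod_eq[of "x mod n ^ 2" n] by simp
        then show ?thesis using div_mult_mod_eq[of x "n ^ 2"] by simp
      qed
      have ne: "\<not> (?l q = ?l k & ?i q = ?i k & ?j q = ?j k)" using dec[of q] dec[of k] False by auto
      have A: "address (?l q) (?i q) a ~= address (?l k) (?i k) b"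
        if "a < n + n" "b < n + n" "\<not> (?l q = ?l k & ?i q = ?i k & a = b)" for a b
        using address_inj[OF ijq(1) that(1) ijk(1) that(2)] that(3) by blast
      have lt: "?j q < n + n" "?j k < n + n" "n + ?j q < n + n" "n + ?j k < n + n" "?j q ~= n + ?j k" "n + ?j q ~= ?j k"
        using ijk(2) ijq(2) by linarith+
      have ne': "\<not> (?l q = ?l k & ?i q = ?i k & n + ?j q = n + ?j k)" using ne by simp
      have "address (?l q) (?i q) (?j q) ~= address (?l k) (?i k) (?j k)" by (rule A[OF lt(1,2) ne])
      moreover have "address (?l q) (?i q) (?j q) ~= address (?l k) (?i k) (n + ?j k)" by (rule A[OF lt(1,4)]) (use lt(5) in blast)
      moreover have "address (?l q) (?i q) (n + ?j q) ~= address (?l k) (?i k) (?j k)" by (rule A[OF lt(3,2)]) (use lt(6) in blast)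
      moreover have "address (?l q) (?i q) (n + ?j q) ~= address (?l k) (?i k) (n + ?j k)" by (rule A[OF lt(3,4) ne'])
      moreover have "fmem g 0 (address (?l q) (?i q) (?j q)) = ?v1 q" "fmem g 0 (address (?l q) (?i q) (n + ?j q)) = ?v2 q"
        using g qk unfolding written_def by blast+
      ultimately show ?thesis by (simp add: array_write_def)
    qed
    then show "written (Suc k) (run n ?c ?e g)" unfolding r written_def using g' by (auto simp: array_write_def)
  qed
  let ?q = "l * n ^ 2 + (i * n + j)"
  have ij: "i * n + j < n ^ 2" using entry_less l by blast
  have q: "?q < n ^ 3" using pair_less[OF l(1) ij] by (simp add: power2_eq_square power3_eq_cube)
  have d: "?l ?q = l" "?i ?q = i" using pair_div_mod[OF ij, of l] pair_div_mod[OF l(3), of i] by simp_all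
  have eq: "?q = (l * n + i) * n + j" by (simp add: power2_eq_square algebra_simps)
  have d3: "?j ?q = j" by (subst eq) (rule pair_div_mod(2)[OF l(3)])
  have "fmem h' 0 (address (?l ?q) (?i ?q) (?j ?q)) = ?v1 ?q & fmem h' 0 (address (?l ?q) (?i ?q) (n + ?j ?q)) = ?v2 ?q"
    using W q unfolding written_def h' by blast
  then show "fmem h' 0 (address l i j) = of_bool (edge j) * rel j i"
    "fmem h' 0 (address l i (n + j)) = of_bool (i = j) + idem_of h l i j"
    unfolding d d3 using l by (simp_all add: mat_at_apply)
qed

lemma write_output_correct:
  fixes h :: "'g mem"
  assumes inp: "input_mem h" and h': "h' = run n write_output e h"
  shows "l < n ==> i < n ==> j < n ==> fmem h' 0 (address l i j) = of_bool (edge j) * rel j i"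
    "l < n ==> i < n ==> j < n ==> fmem h' 0 (address l i (n + j)) = of_bool (i = j) + idem_of h l i j"
    "j < n ==> gmem h' 0 j = f j" "j < n ==> gmem h' 1 j = f j & gmem h' 1 (n + j) = f j"
    "l < n ==> wmem h' 0 l = n & wmem h' 1 l = n + n & wmem h' 4 l = l * (n ^ 2 + n ^ 2)"
    "wmem h' 2 = wmem h 2" "wmem h' 3 = wmem h 3" "wmem h' 7 = wmem h 7"
proof -
  let ?c1 = "For 0 3 (
       PutF 0 (WVar 0 div. wn2 *. (wn2 +. wn2) +. (WVar 0 mod. wn2 div. wn *. (wn +. wn) +. WVar 0 mod. wn))
         (is_edge (WVar 0 mod. wn) *\<^sub>f (FIsEq (WVar 0 mod. wn2 div. wn) (end1 (WVar 0 mod. wn)) +\<^sub>f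
          FIsEq (WVar 0 mod. wn2 div. wn) (end2 (WVar 0 mod. wn)))) ;;;
       PutF 0 (WVar 0 div. wn2 *. (wn2 +. wn2) +. (WVar 0 mod. wn2 div. wn *. (wn +. wn) +. (wn +. WVar 0 mod. wn)))
         (FIsEq (WVar 0 mod. wn2 div. wn) (WVar 0 mod. wn) +\<^sub>f FGet 16 (WVar 0)))"
  let ?c2 = "For 0 1 (PutG 1 (WVar 0) 0 (WVar 0) ;;; PutG 1 (wn +. WVar 0) 0 (WVar 0))"
  let ?c3 = "For 0 1 (PutW 0 (WVar 0) wn ;;; PutW 1 (WVar 0) (wn +. wn) ;;;
       PutW 4 (WVar 0) (WVar 0 *. (wn2 +. wn2)))"
  define h1 where "h1 = run n ?c1 e h"
  define h2 where "h2 = run n ?c2 e h1"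
  have h'3: "h' = run n ?c3 e h2" unfolding h' h1_def h2_def write_output_def by (simp only: run.simps(2))
  have f: "fmem h' 0 = fmem h1 0"
    unfolding h'3 h2_def by (subst fmem_frame, simp, subst fmem_frame, simp, rule refl)
  show "l < n ==> i < n ==> j < n ==> fmem h' 0 (address l i j) = of_bool (edge j) * rel j i"
    "l < n ==> i < n ==> j < n ==> fmem h' 0 (address l i (n + j)) = of_bool (i = j) + idem_of h l i j"
    unfolding f using write_entries_correct[OF inp h1_def] by blast+
  have g0: "gmem h1 0 j = f j" if "j < n" for j
  proof -
    have "gmem h1 0 = gmem h 0" unfolding h1_def by (rule gmem_frame) simp
    then show ?thesis using inp that by (simp add: input_mem_def)
  qed
  have G: "gmem h2 0 = gmem h1 0 & (\<forall>j<n ^ 1. gmem h2 1 j = gmem h1 0 j & gmem h2 1 (n + j) = gmem h1 0 j)"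
    unfolding h2_def
  proof (rule run_For_rule[of "%k g. gmem g 0 = gmem h1 0 & (\<forall>j<k. gmem g 1 j = gmem h1 0 j & gmem g 1 (n + j) = gmem h1 0 j)"])
    fix k and g :: "'g mem"
    assume k: "k < n ^ 1" and g: "gmem g 0 = gmem h1 0 & (\<forall>j<k. gmem g 1 j = gmem h1 0 j & gmem g 1 (n + j) = gmem h1 0 j)"
    let ?g = "run n (PutG 1 (WVar 0) 0 (WVar 0) ;;; PutG 1 (wn +. WVar 0) 0 (WVar 0)) (e(0 := k)) g"
    have g1: "gmem ?g = (gmem g)(1 := (gmem g 1)(k := gmem g 0 k, n + k := gmem g 0 k))"
      by (simp add: array_write_def)
    show "gmem ?g 0 = gmem h1 0 & (\<forall>j<Suc k. gmem ?g 1 j = gmem h1 0 j & gmem ?g 1 (n + j) = gmem h1 0 j)"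
      unfolding g1 using g k by (auto simp: less_Suc_eq)
  qed simp
  have g': "gmem h' a = gmem h2 a" for a unfolding h'3 by (rule gmem_frame) simp
  show "j < n ==> gmem h' 0 j = f j" "j < n ==> gmem h' 1 j = f j & gmem h' 1 (n + j) = f j"
    unfolding g' using G g0 by auto
  have w2: "wmem h2 a = wmem h a" for a unfolding h2_def h1_def by (subst wmem_frame, simp, subst wmem_frame, simp, rule refl)
  have w: "wmem h' a = wmem h a" if "a \<notin> {0, 1, 4}" for a
    unfolding h'3 by (subst wmem_frame) (use that w2 in auto)
  show "wmem h' 2 = wmem h 2" "wmem h' 3 = wmem h 3" "wmem h' 7 = wmem h 7" by (rule w, simp)+
  have lim: "n mod word_limit n = n" "(n + n) mod word_limit n = n + n" and liml: "k < n ==> (k * (n ^ 2 + n ^ 2)) mod word_limit n = k * (n ^ 2 + n ^ 2)" for k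
  proof -
    have a: "n + n < word_limit n"
    proof -
      have "n + n < (n + 2) ^ 2" by (simp add: power2_eq_square)
      also have "\<dots> \<le> word_limit n" unfolding word_limit_def by (rule power_increasing) auto
      finally show ?thesis .
    qed
    then show "n mod word_limit n = n" "(n + n) mod word_limit n = n + n" by simp_all
    assume k: "k < n"
    have "k * (n ^ 2 + n ^ 2) \<le> n * (n ^ 2 + n ^ 2)" using k by (intro mult_le_mono1) simp
    also have "\<dots> = 2 * n ^ 3" by (simp add: numeral_eq_Suc algebra_simps)
    also have "\<dots> \<le> (n + 2) * n ^ 3" by (intro mult_le_mono1) simp
    also have "\<dots> \<le> (n + 2) * (n + 2) ^ 3" by (intro mult_le_mono2 power_mono) auto
    also have "\<dots> = word_limit n" by (simp add: word_limit_def numeral_eq_Suc)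
    finally have "k * (n ^ 2 + n ^ 2) \<le> word_limit n" .
    moreover have "k * (n ^ 2 + n ^ 2) < n * (n ^ 2 + n ^ 2)" using k by (intro mult_strict_right_mono) auto
    ultimately have "k * (n ^ 2 + n ^ 2) < word_limit n"
      using \<open>n * (n ^ 2 + n ^ 2) = 2 * n ^ 3\<close> \<open>2 * n ^ 3 \<le> (n + 2) * n ^ 3\<close> \<open>(n + 2) * n ^ 3 \<le> (n + 2) * (n + 2) ^ 3\<close>
        \<open>(n + 2) * (n + 2) ^ 3 = word_limit n\<close> by linarith
    then show "(k * (n ^ 2 + n ^ 2)) mod word_limit n = k * (n ^ 2 + n ^ 2)" by simp
  qed
  have "\<forall>l<n ^ 1. wmem h' 0 l = n & wmem h' 1 l = n + n & wmem h' 4 l = l * (n ^ 2 + n ^ 2)"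
    unfolding h'3
  proof (rule run_For_rule[of "%k g. \<forall>l<k. wmem g 0 l = n & wmem g 1 l = n + n & wmem g 4 l = l * (n ^ 2 + n ^ 2)"])
    fix k and g :: "'g mem"
    assume k: "k < n ^ 1" and g: "\<forall>l<k. wmem g 0 l = n & wmem g 1 l = n + n & wmem g 4 l = l * (n ^ 2 + n ^ 2)"
    let ?g = "run n (PutW 0 (WVar 0) wn ;;; PutW 1 (WVar 0) (wn +. wn) ;;; PutW 4 (WVar 0) (WVar 0 *. (wn2 +. wn2))) (e(0 := k)) g"
    have g1: "wmem ?g = (wmem g)(0 := (wmem g 0)(k := n), 1 := (wmem g 1)(k := n + n), 4 := (wmem g 4)(k := k * (n ^ 2 + n ^ 2)))"
      using lim liml[of k] k by (simp add: array_write_def)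
    show "\<forall>l<Suc k. wmem ?g 0 l = n & wmem ?g 1 l = n + n & wmem ?g 4 l = l * (n ^ 2 + n ^ 2)"
      unfolding g1 using g by (auto simp: less_Suc_eq)
  qed simp
  then show "l < n ==> wmem h' 0 l = n & wmem h' 1 l = n + n & wmem h' 4 l = l * (n ^ 2 + n ^ 2)" by simp
qed

lemma decompose_correct:
  fixes h :: "'g mem"
  assumes inp: "input_mem h" and v: "n = 0 | (\<exists>v<n. vert v)" and z: "!!i. wmem h 2 i = 0" "!!i. wmem h 3 i = 0"
    and h': "h' = run n decompose e h"
  obtains E where "idems (count h') E"
    and "!!M l. endo M ==> l < count h' ==> \<not> separates M (E l)"
    and "!!l i j. l < count h' ==> i < n ==> j < n ==> fmem h' 0 (address l i j) = of_bool (edge j) * rel j i"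
    and "!!l i j. l < count h' ==> i < n ==> j < n ==> fmem h' 0 (address l i (n + j)) = of_bool (i = j) + E l i j"
    and "!!j. j < n ==> gmem h' 0 j = f j & gmem h' 1 j = f j & gmem h' 1 (n + j) = f j"
    and "!!l. l < count h' ==> wmem h' 0 l = n & wmem h' 1 l = n + n & wmem h' 2 l = 0 & wmem h' 3 l = 0 & wmem h' 4 l = l * (n ^ 2 + n ^ 2)"
proof -
  let ?h1 = "run n endomorphisms e h"
  let ?h2 = "run n init_idempotents e ?h1"
  let ?h3 = "run n refine_idempotents e ?h2"
  have h'4: "h' = run n write_output e ?h3" unfolding h' decompose_def by (simp only: run.simps(2))
  have sp: "spans (n ^ 2) (row_of ?h1) \<phi> \<longleftrightarrow> good \<phi>" for \<phi>
    unfolding good_def by (rule endomorphisms_correct(1)[OF inp])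
  have i1: "input_mem ?h1" by (rule endomorphisms_correct(2)[OF inp])
  note ii = init_idempotents_correct[OF i1 v refl, of e]
  have i2: "input_mem ?h2" using i1 by (rule input_mem_frame) (simp_all add: init_idempotents_def)
  have rows: "endo_row ?h2 k = mat (row_of ?h1 k)" for k unfolding mat_row by (simp only: mat_at_def ii(3))
  have K: "endo (endo_row ?h2 k)" if "k < n ^ 2" for k
  proof -
    have "row_of ?h1 k q = (\<Sum>k'<n ^ 2. of_bool (k' = k) * row_of ?h1 k' q)" for q
    proof -
      have "(\<Sum>k'<n ^ 2. of_bool (k' = k) * row_of ?h1 k' q) = (\<Sum>k'<n ^ 2. if k' = k then row_of ?h1 k q else 0)" by (intro sum.cong) auto
      also have "\<dots> = row_of ?h1 k q" using that by simp
      finally show ?thesis by (rule sym)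
    qed
    then have "spans (n ^ 2) (row_of ?h1) (row_of ?h1 k)"
      unfolding spans_def by (intro exI[of _ "%k'. of_bool (k' = k)"] allI impI)
    then show ?thesis unfolding rows sp by (rule good_endo)
  qed
  note rf = refine_idempotents_correct[OF ii(1) K ii(2) refl, of e]
  have i3: "input_mem ?h3" using i2 by (rule input_mem_frame) (simp_all add: decompose_defs)
  note wo = write_output_correct[OF i3 h'4]
  have c: "count h' = count ?h3" using wo(8) by simp
  have cn: "count h' \<le> n" unfolding c by (rule idems_le[OF rf(1)])
  have z3: "wmem ?h3 a = wmem h a" if "a \<in> {2, 3}" for a
    by (subst wmem_frame, use that in \<open>force simp: decompose_defs\<close>)+ (rule refl)
  show thesis
  proof (rule that)
    show "idems (count h') (idem_of ?h3)" unfolding c by (rule rf(1))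
    show "\<not> separates M (idem_of ?h3 l)" if M: "endo M" and l: "l < count h'" for M l
    proof -
      have "spans (n ^ 2) (row_of ?h1) (%q. M (q div n) (q mod n))" unfolding sp by (rule endo_good[OF M])
      then obtain cc where cc: "\<forall>q<n ^ 2. M (q div n) (q mod n) = (\<Sum>k<n ^ 2. cc k * row_of ?h1 k q)" unfolding spans_def by blast
      show ?thesis
      proof (rule unseparated[of "n ^ 2" "endo_row ?h3" _ _ cc])
        show "\<not> separates (endo_row ?h3 k) (idem_of ?h3 l)" if "k < n ^ 2" for k
          using rf(3) that l unfolding unsplittable_def c by blast
        fix v assume v: "v < n"
        have "M v v = (\<Sum>k<n ^ 2. cc k * row_of ?h1 k (v * n + v))"
          using cc entry_less[OF v v] v by (metis pair_div_mod)
        also have "\<dots> = (\<Sum>k<n ^ 2. cc k * endo_row ?h3 k v v)"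
          using v by (simp add: mat_at_apply row_of_def rf(2) ii(3))
        finally show "M v v = (\<Sum>k<n ^ 2. cc k * endo_row ?h3 k v v)" .
      qed
    qed
  qed (use wo cn z z3 in auto)
qed

end

section \<open>Graded modules from families of quotients\<close>

abbreviation (input) single where "single == Poly_Mapping.single"
abbreviation (input) lookup where "lookup == Poly_Mapping.lookup"
abbreviation (input) keys where "keys == Poly_Mapping.keys"

lemma exponent_grade_add: "exponent_grade (\<alpha> + \<beta>) = exponent_grade \<alpha> + exponent_grade \<beta>"
  by (simp add: exponent_grade_def vec_eq_iff lookup_add)

lemma exponent_grade_zero [simp]: "exponent_grade 0 = 0"
  by (simp add: exponent_grade_def vec_eq_iff)

lemma exponent_grade_nonneg: "0 \<le> exponent_grade \<alpha>"
  by (simp add: exponent_grade_def less_eq_vec_def)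

lemma exponent_grade_single: "exponent_grade (single i 1) = axis i 1"
  by (simp add: exponent_grade_def vec_eq_iff axis_def lookup_single when_def)

lemma grade_sub_le: "v - exponent_grade \<alpha> \<le> v"
  by (simp add: exponent_grade_def less_eq_vec_def)

lemma exponent_grade_inj: "exponent_grade \<alpha> = exponent_grade \<beta> \<longleftrightarrow> \<alpha> = \<beta>"
  by (auto simp: exponent_grade_def vec_eq_iff intro!: poly_mapping_eqI)

lemma exponent_grade_grade_exponent: "0 \<le> u ==> exponent_grade (grade_exponent u) = u"
  by (simp add: exponent_grade_def grade_exponent_def vec_eq_iff less_eq_vec_def)

text \<open>Over the two-element field a polynomial is the set of its monomials, and a monomial acts by a shift of grades.\<close>

definition act :: "'d::finite polynomial => ('d grade => 'a::comm_monoid_add) => 'd grade => 'a" where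
  "act p \<zeta> = (%v. \<Sum>\<alpha>\<in>keys p. \<zeta> (v - exponent_grade \<alpha>))"

lemma bit_1I: "(x::bit) ~= 0 ==> x = 1"
  by (cases x) auto

lemma act_add_right: "act p (\<zeta> + \<eta>) = act p \<zeta> + act p \<eta>"
  by (simp add: act_def fun_eq_iff fun_simps sum.distrib)

lemma act_zero_right: "act p 0 = 0"
  by (simp add: act_def fun_eq_iff fun_simps)

lemma act_sum_right: "act p (sum g S) = (\<Sum>s\<in>S. act p (g s))"
  by (induction S rule: infinite_finite_induct) (auto simp: act_add_right act_zero_right)

lemma act_superset:
  assumes "finite A" "keys p \<subseteq> A"
  shows "act p \<zeta> v = (\<Sum>\<alpha>\<in>A. if lookup p \<alpha> = 1 then \<zeta> (v - exponent_grade \<alpha>) else 0)"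
  unfolding act_def using assms by (intro sum.mono_neutral_cong_left) (auto simp: in_keys_iff dest: bit_1I)

lemma act_add_left:
  fixes \<zeta> :: "'d::finite grade => 'a::comm_monoid_add"
  assumes two: "!!x::'a. x + x = 0"
  shows "act (p + q) \<zeta> = act p \<zeta> + act q \<zeta>"
proof
  fix v
  let ?A = "keys p \<union> keys q"
  have A: "finite ?A" "keys (p + q) \<subseteq> ?A" "keys p \<subseteq> ?A" "keys q \<subseteq> ?A"
    using keys_add[of p q] by auto
  have b: "(if a + b = 1 then x else 0) = (if a = 1 then x else 0) + (if b = 1 then x else 0)" for a b :: bit and x :: 'a
    using two by (cases a; cases b) auto
  show "act (p + q) \<zeta> v = (act p \<zeta> + act q \<zeta>) v"
    unfolding fun_simps act_superset[OF A(1,2)] act_superset[OF A(1,3)] act_superset[OF A(1,4)] lookup_add b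
    by (rule sum.distrib)
qed

lemma act_zero_left: "act 0 \<zeta> = 0"
  by (simp add: act_def fun_eq_iff fun_simps)

lemma act_sum_left:
  fixes \<zeta> :: "'d::finite grade => 'a::comm_monoid_add"
  assumes two: "!!x::'a. x + x = 0"
  shows "act (sum g S) \<zeta> = (\<Sum>s\<in>S. act (g s) \<zeta>)"
  by (induction S rule: infinite_finite_induct) (auto simp: act_add_left[OF two] act_zero_left)

lemma act_monomial: "act (single \<alpha> 1) \<zeta> = (%v. \<zeta> (v - exponent_grade \<alpha>))"
  by (simp add: act_def)

lemma act_one: "act 1 \<zeta> = \<zeta>"
  using act_monomial[of 0 \<zeta>] by simp

lemma polynomial_sum: "(p :: 'd polynomial) = (\<Sum>\<alpha>\<in>keys p. single \<alpha> 1)"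
proof (rule poly_mapping_eqI)
  fix \<beta>
  have "lookup (\<Sum>\<alpha>\<in>keys p. single \<alpha> (1::bit)) \<beta> =
      (\<Sum>\<alpha>\<in>keys p. if \<alpha> = \<beta> then 1 else 0)"
    by (simp add: lookup_sum lookup_single when_def)
  also have "\<dots> = lookup p \<beta>"
    by (simp add: in_keys_iff) (metis bit_1I)
  finally show "lookup p \<beta> = lookup (\<Sum>\<alpha>\<in>keys p. single \<alpha> 1) \<beta>" ..
qed

lemma act_mult:
  fixes \<zeta> :: "'d::finite grade => 'a::comm_monoid_add"
  assumes two: "!!x::'a. x + x = 0"
  shows "act (p * q) \<zeta> = act p (act q \<zeta>)"
proof -
  have mono: "act (single \<alpha> 1 * single \<beta> 1) \<zeta> = act (single \<alpha> 1) (act (single \<beta> 1) \<zeta>)" for \<alpha> \<beta>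
    by (simp add: mult_single act_monomial exponent_grade_add diff_diff_eq)
  have "p * q = (\<Sum>\<alpha>\<in>keys p. single \<alpha> 1) * (\<Sum>\<beta>\<in>keys q. single \<beta> 1)"
    by (simp only: polynomial_sum[symmetric])
  also have "\<dots> = (\<Sum>\<alpha>\<in>keys p. \<Sum>\<beta>\<in>keys q. single \<alpha> 1 * single \<beta> 1)"
    by (rule sum_product)
  finally have "act (p * q) \<zeta> = (\<Sum>\<alpha>\<in>keys p. \<Sum>\<beta>\<in>keys q.
      act (single \<alpha> 1) (act (single \<beta> 1) \<zeta>))"
    by (simp only: act_sum_left[OF two] mono)
  also have "\<dots> = act (\<Sum>\<alpha>\<in>keys p. single \<alpha> 1) (act (\<Sum>\<beta>\<in>keys q. single \<beta> 1) \<zeta>)"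
    by (simp only: act_sum_left[OF two] act_sum_right) (rule sum.swap)
  also have "\<dots> = act p (act q \<zeta>)"
    by (simp only: polynomial_sum[symmetric])
  finally show ?thesis .
qed

lemma cring_poly_ring: "cring (ring_of_class :: 'r::comm_ring_1 ring)"
proof (rule cringI)
  show "abelian_group (ring_of_class :: 'r ring)"
  proof (rule abelian_groupI)
    fix x :: 'r
    have "- x + x = 0" by simp
    then show "\<exists>y\<in>carrier ring_of_class. y \<oplus>\<^bsub>ring_of_class\<^esub> x = \<zero>\<^bsub>ring_of_class\<^esub>"
      unfolding ring_of_class_def by (intro bexI[of _ "- x"]) simp_all
  qed (simp_all add: ring_of_class_def add.assoc add.commute)
  show "comm_monoid (ring_of_class :: 'r ring)"
    by (rule comm_monoidI) (simp_all add: ring_of_class_def mult.assoc mult.commute)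
qed (simp add: ring_of_class_def distrib_right)

definition coset :: "'a::ab_group_add set => 'a => 'a set" where
  "coset H x = (%b. x + b) ` H"

definition conc :: "'g => 'a::zero => 'g => 'a" where
  "conc u x = (%v. if v = u then x else 0)"

definition families :: "('g => 'a::zero set) => ('g => 'a) set" where
  "families F = {\<zeta>. (\<forall>u. \<zeta> u \<in> F u) & finite {u. \<zeta> u ~= 0}}"

lemma families_decompose: "\<zeta> \<in> families F ==> \<zeta> = (\<Sum>u\<in>{u. \<zeta> u ~= 0}. conc u (\<zeta> u))"
proof
  fix v assume "\<zeta> \<in> families F"
  then have "finite {u. \<zeta> u ~= 0}" by (simp add: families_def)
  then show "\<zeta> v = (\<Sum>u\<in>{u. \<zeta> u ~= 0}. conc u (\<zeta> u)) v" by (simp add: sum_fun_apply[of _ _ v] conc_def)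
qed

lemma conc_zero: "conc w 0 = 0"
  by (auto simp: conc_def fun_eq_iff fun_simps)

lemma conc_add: "conc w (x + y) = conc w x + conc w y"
  for x :: "'a::monoid_add"
  by (auto simp: conc_def fun_eq_iff fun_simps)

lemma act_conc: "act (single \<alpha> 1) (conc w x) = conc (w + exponent_grade \<alpha>) x"
  unfolding act_monomial by (auto simp: conc_def fun_eq_iff diff_eq_eq)

definition cosets :: "('g => 'a::ab_group_add set) => ('g => 'a) => 'g => 'a set" where
  "cosets B \<zeta> = (%u. coset (B u) (\<zeta> u))"

text \<open>The representative 0 is chosen for the zero coset so that the lifted family has finite support.\<close>

definition lift_family :: "('g => 'a::zero set) => ('g => 'a set) => 'g => 'a" where
  "lift_family B z = (%u. if z u = B u then 0 else SOME x. x \<in> z u)"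

text \<open>The graded module with component \<open>F u / B u\<close> at \<open>u\<close>, its elements being finitely supported families of cosets. Persistent homology has the same carrier, which makes the comparison with it an identity map.\<close>

definition qmod :: "('d::finite grade => 'a::ab_group_add set) => ('d grade => 'a set) => ('d grade => 'a set, 'd) gmod" where
  "qmod F B =
     (|carrier = cosets B ` families F, monoid.mult = undefined, one = undefined, ring.zero = B,
      add = (%y z u. {a + b | a b. a \<in> y u & b \<in> z u}),
      smult = (%p z. cosets B (act p (lift_family B z))),
      component = (%u. {z \<in> cosets B ` families F. \<forall>v. v ~= u --> z v = B v})|)"

locale filtered_quotient =
  fixes F B :: "'d::finite grade => 'a::ab_group_add set"
  assumes two: "!!x::'a. x + x = 0"
    and F_zero: "0 \<in> F u" and F_add: "x \<in> F u ==> y \<in> F u ==> x + y \<in> F u" and F_mono: "x \<in> F u ==> u \<le> v ==> x \<in> F v"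
    and B_zero: "0 \<in> B u" and B_add: "x \<in> B u ==> y \<in> B u ==> x + y \<in> B u" and B_mono: "x \<in> B u ==> u \<le> v ==> x \<in> B v"
    and B_F: "x \<in> B u ==> x \<in> F u"
begin

lemma add_cancel: "x + (x + y) = (y::'a)"
  using two[of x] by (simp add: add.assoc[symmetric])

lemma coset_eq_iff: "coset (B u) x = coset (B u) y \<longleftrightarrow> x + y \<in> B u"
proof
  assume "coset (B u) x = coset (B u) y"
  moreover have "x \<in> coset (B u) x" unfolding coset_def using B_zero by (intro image_eqI[of _ _ 0]) auto
  ultimately obtain b where "x = y + b" "b \<in> B u" by (auto simp: coset_def)
  moreover have "(y + b) + y = b" using add_cancel[of y b] by (simp only: add.commute)
  ultimately show "x + y \<in> B u" by metis
next
  have sub: "coset (B u) x \<subseteq> coset (B u) y" if "x + y \<in> B u" for x y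
  proof
    fix z assume "z \<in> coset (B u) x"
    then obtain b where b: "z = x + b" "b \<in> B u" by (auto simp: coset_def)
    have "z = y + ((x + y) + b)" using add_cancel[of y "x + b"] b(1) by (simp add: ac_simps)
    then show "z \<in> coset (B u) y" unfolding coset_def using B_add[OF that b(2)] by blast
  qed
  assume xy: "x + y \<in> B u"
  then have "y + x \<in> B u" by (simp add: add.commute)
  then show "coset (B u) x = coset (B u) y" using sub xy by blast
qed

lemma coset_zero: "coset (B u) 0 = B u"
  by (simp add: coset_def)

lemma coset_eq_B: "coset (B u) x = B u \<longleftrightarrow> x \<in> B u"
  using coset_eq_iff[of u x 0] by (simp add: coset_zero)

lemma cosets_eq_iff: "cosets B \<zeta> = cosets B \<eta> \<longleftrightarrow> (\<forall>u. \<zeta> u + \<eta> u \<in> B u)"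
  by (simp add: cosets_def fun_eq_iff coset_eq_iff)

lemma cosets_eq_zero: "cosets B \<zeta> = B \<longleftrightarrow> (\<forall>u. \<zeta> u \<in> B u)"
  by (simp add: cosets_def fun_eq_iff coset_eq_B)

lemma families_zero: "0 \<in> families F"
  by (simp add: families_def fun_simps F_zero)

lemma families_add: "\<zeta> \<in> families F ==> \<eta> \<in> families F ==> \<zeta> + \<eta> \<in> families F"
proof -
  assume a: "\<zeta> \<in> families F" "\<eta> \<in> families F"
  have "{u. (\<zeta> + \<eta>) u ~= 0} \<subseteq> {u. \<zeta> u ~= 0} \<union> {u. \<eta> u ~= 0}" by (auto simp: fun_simps)
  then show ?thesis using a unfolding families_def by (auto simp: fun_simps intro: F_add finite_subset)
qed

lemma families_sum: "(!!s. s \<in> S ==> g s \<in> families F) ==> sum g S \<in> families F"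
  by (induction S rule: infinite_finite_induct) (auto intro: families_zero families_add)

lemma F_sum: "(!!s. s \<in> S ==> g s \<in> F u) ==> sum g S \<in> F u"
  by (induction S rule: infinite_finite_induct) (auto intro: F_zero F_add)

lemma B_sum: "(!!s. s \<in> S ==> g s \<in> B u) ==> sum g S \<in> B u"
  by (induction S rule: infinite_finite_induct) (auto intro: B_zero B_add)

lemma act_F: "(!!u. \<zeta> u \<in> F u) ==> act p \<zeta> v \<in> F v"
  unfolding act_def by (intro F_sum) (blast intro: F_mono grade_sub_le)

lemma act_B: "(!!u. \<zeta> u \<in> B u) ==> act p \<zeta> v \<in> B v"
  unfolding act_def by (intro B_sum) (blast intro: B_mono grade_sub_le)

lemma act_families: "\<zeta> \<in> families F ==> act p \<zeta> \<in> families F"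
proof -
  assume z: "\<zeta> \<in> families F"
  have "{v. act p \<zeta> v ~= 0} \<subseteq> (%(u, \<alpha>). u + exponent_grade \<alpha>) ` ({u. \<zeta> u ~= 0} \<times> keys p)"
  proof
    fix v assume "v \<in> {v. act p \<zeta> v ~= 0}"
    then obtain \<alpha> where a: "\<alpha> \<in> keys p" "\<zeta> (v - exponent_grade \<alpha>) ~= 0"
      unfolding act_def by (auto elim: sum.not_neutral_contains_not_neutral)
    then show "v \<in> (%(u, \<alpha>). u + exponent_grade \<alpha>) ` ({u. \<zeta> u ~= 0} \<times> keys p)"
      by (intro image_eqI[of _ _ "(v - exponent_grade \<alpha>, \<alpha>)"]) auto
  qed
  moreover have "finite ({u. \<zeta> u ~= 0} \<times> keys p)" using z by (auto simp: families_def)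
  ultimately have "finite {v. act p \<zeta> v ~= 0}" by (rule finite_surj[rotated])
  then show ?thesis using z act_F by (auto simp: families_def)
qed

lemma lift_correct:
  assumes "z \<in> cosets B ` families F"
  shows "lift_family B z \<in> families F" "cosets B (lift_family B z) = z"
proof -
  obtain \<zeta> where \<zeta>: "z = cosets B \<zeta>" "\<zeta> \<in> families F" using assms by blast
  have l: "lift_family B z u \<in> F u & coset (B u) (lift_family B z u) = z u" for u
  proof (cases "z u = B u")
    case True
    then show ?thesis by (simp add: lift_family_def F_zero coset_zero)
  next
    case False
    have "\<zeta> u \<in> z u" unfolding \<zeta>(1) cosets_def coset_def using B_zero[of u] by (intro image_eqI[of _ _ 0]) auto
    then have "lift_family B z u \<in> z u" using False by (simp add: lift_family_def) (rule someI)
    then obtain b where b: "lift_family B z u = \<zeta> u + b" "b \<in> B u" by (auto simp: \<zeta>(1) cosets_def coset_def)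
    have "lift_family B z u \<in> F u" using b \<zeta>(2) B_F F_add by (simp add: families_def)
    moreover have "coset (B u) (lift_family B z u) = coset (B u) (\<zeta> u)"
      using add_cancel[of "\<zeta> u" b] b by (simp add: coset_eq_iff ac_simps)
    ultimately show ?thesis by (simp add: \<zeta>(1) cosets_def)
  qed
  have "{u. lift_family B z u ~= 0} \<subseteq> {u. \<zeta> u ~= 0}"
    by (auto simp: lift_family_def \<zeta>(1) cosets_def coset_zero)
  then have "finite {u. lift_family B z u ~= 0}" using \<zeta>(2) by (auto simp: families_def intro: finite_subset)
  then show "lift_family B z \<in> families F" using l by (simp add: families_def)
  show "cosets B (lift_family B z) = z" using l by (simp add: cosets_def fun_eq_iff)
qed

abbreviation Q where "Q \<equiv> qmod F B"

lemma carrier_Q: "carrier Q = cosets B ` families F" and zero_Q: "\<zero>\<^bsub>Q\<^esub> = B"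
  by (simp_all add: qmod_def)

lemma carrierI: "\<zeta> \<in> families F ==> cosets B \<zeta> \<in> carrier Q"
  by (simp add: carrier_Q)

lemma carrierE: "z \<in> carrier Q ==> (!!\<zeta>. z = cosets B \<zeta> ==> \<zeta> \<in> families F ==> R) ==> R"
  by (auto simp: carrier_Q)

lemma cosets_zero: "cosets B 0 = B"
  by (simp add: cosets_eq_zero fun_simps B_zero)

lemma add_cosets: "cosets B \<zeta> \<oplus>\<^bsub>Q\<^esub> cosets B \<eta> = cosets B (\<zeta> + \<eta>)"
proof
  fix u
  have "{a + b |a b. a \<in> coset (B u) x & b \<in> coset (B u) y} = coset (B u) (x + y)" for x y
  proof (intro equalityI subsetI)
    fix c assume "c \<in> {a + b |a b. a \<in> coset (B u) x & b \<in> coset (B u) y}"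
    then obtain b b' where "c = (x + b) + (y + b')" "b \<in> B u" "b' \<in> B u" by (auto simp: coset_def)
    then show "c \<in> coset (B u) (x + y)" unfolding coset_def
      by (intro image_eqI[of _ _ "b + b'"]) (auto simp: ac_simps intro: B_add)
  next
    fix c assume "c \<in> coset (B u) (x + y)"
    then obtain b where "c = x + (y + b)" "b \<in> B u" by (auto simp: coset_def ac_simps)
    moreover have "x \<in> coset (B u) x" unfolding coset_def using B_zero by (intro image_eqI[of _ _ 0]) auto
    ultimately show "c \<in> {a + b |a b. a \<in> coset (B u) x & b \<in> coset (B u) y}" by (auto simp: coset_def)
  qed
  then show "(cosets B \<zeta> \<oplus>\<^bsub>Q\<^esub> cosets B \<eta>) u = cosets B (\<zeta> + \<eta>) u"
    by (simp add: qmod_def cosets_def fun_simps)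
qed

lemma smult_cosets: "\<zeta> \<in> families F ==> p \<odot>\<^bsub>Q\<^esub> cosets B \<zeta> = cosets B (act p \<zeta>)"
proof -
  assume z: "\<zeta> \<in> families F"
  have "cosets B (lift_family B (cosets B \<zeta>)) = cosets B \<zeta>" using lift_correct(2) z by blast
  then have d: "!!u. (lift_family B (cosets B \<zeta>) + \<zeta>) u \<in> B u" unfolding cosets_eq_iff by (simp add: fun_simps)
  have "act p (lift_family B (cosets B \<zeta>)) u + act p \<zeta> u \<in> B u" for u
    using act_B[OF d, of p u, unfolded act_add_right, unfolded fun_simps] .
  then show ?thesis by (simp add: qmod_def cosets_eq_iff)
qed

lemma abelian_group_Q: "abelian_group Q"
proof (rule abelian_groupI)
  fix x assume x: "x \<in> carrier Q"
  then obtain \<zeta> where \<zeta>: "x = cosets B \<zeta>" "\<zeta> \<in> families F" by (rule carrierE)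
  have "\<zeta> + \<zeta> = 0" by (simp add: fun_eq_iff fun_simps two)
  then show "\<exists>y\<in>carrier Q. y \<oplus>\<^bsub>Q\<^esub> x = \<zero>\<^bsub>Q\<^esub>"
    using x by (intro bexI[of _ x]) (simp_all add: \<zeta>(1) add_cosets zero_Q cosets_zero)
  show "\<zero>\<^bsub>Q\<^esub> \<oplus>\<^bsub>Q\<^esub> x = x"
    using add_cosets[of 0 \<zeta>] by (simp add: zero_Q cosets_zero \<zeta>(1))
next
  show "\<zero>\<^bsub>Q\<^esub> \<in> carrier Q" using carrierI[OF families_zero] by (simp add: zero_Q cosets_zero)
next
  fix x y assume "x \<in> carrier Q" "y \<in> carrier Q"
  then obtain \<zeta> \<eta> where z: "x = cosets B \<zeta>" "\<zeta> \<in> families F" "y = cosets B \<eta>" "\<eta> \<in> families F"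
    by (auto simp: carrier_Q)
  show "x \<oplus>\<^bsub>Q\<^esub> y \<in> carrier Q" unfolding z add_cosets by (intro carrierI families_add z)
  show "x \<oplus>\<^bsub>Q\<^esub> y = y \<oplus>\<^bsub>Q\<^esub> x" unfolding z add_cosets by (simp only: add.commute)
next
  fix x y z assume "x \<in> carrier Q" "y \<in> carrier Q" "z \<in> carrier Q"
  then show "x \<oplus>\<^bsub>Q\<^esub> y \<oplus>\<^bsub>Q\<^esub> z = x \<oplus>\<^bsub>Q\<^esub> (y \<oplus>\<^bsub>Q\<^esub> z)"
    by (auto elim!: carrierE simp: add_cosets add.assoc)
qed

lemma module_Q: "Module.module poly_ring Q"
proof (rule moduleI)
  show "cring poly_ring" by (rule cring_poly_ring)
  show "abelian_group Q" by (rule abelian_group_Q)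
  fix p q :: "'d polynomial" and x assume "x \<in> carrier Q"
  then obtain \<zeta> where \<zeta>: "x = cosets B \<zeta>" "\<zeta> \<in> families F" by (rule carrierE)
  show "p \<odot>\<^bsub>Q\<^esub> x \<in> carrier Q" using \<zeta> by (simp add: smult_cosets carrierI act_families)
  show "(p \<oplus>\<^bsub>poly_ring\<^esub> q) \<odot>\<^bsub>Q\<^esub> x = p \<odot>\<^bsub>Q\<^esub> x \<oplus>\<^bsub>Q\<^esub> q \<odot>\<^bsub>Q\<^esub> x"
    using \<zeta> by (simp add: smult_cosets add_cosets act_add_left[OF two] ring_of_class_def)
  show "(p \<otimes>\<^bsub>poly_ring\<^esub> q) \<odot>\<^bsub>Q\<^esub> x = p \<odot>\<^bsub>Q\<^esub> (q \<odot>\<^bsub>Q\<^esub> x)"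
    using \<zeta> by (simp add: smult_cosets act_families act_mult[OF two] ring_of_class_def)
  show "\<one>\<^bsub>poly_ring\<^esub> \<odot>\<^bsub>Q\<^esub> x = x" using \<zeta> by (simp add: smult_cosets act_one ring_of_class_def)
  fix y assume "y \<in> carrier Q"
  then obtain \<eta> where \<eta>: "y = cosets B \<eta>" "\<eta> \<in> families F" by (rule carrierE)
  show "p \<odot>\<^bsub>Q\<^esub> (x \<oplus>\<^bsub>Q\<^esub> y) = p \<odot>\<^bsub>Q\<^esub> x \<oplus>\<^bsub>Q\<^esub> p \<odot>\<^bsub>Q\<^esub> y"
    using \<zeta> \<eta> by (simp add: smult_cosets add_cosets families_add act_add_right)
qed

lemma finsum_cosets:
  "finite S ==> (!!s. s \<in> S ==> g s \<in> families F) ==> (\<Oplus>\<^bsub>Q\<^esub>s\<in>S. cosets B (g s)) = cosets B (sum g S)"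
proof (induction S rule: finite_induct)
  case empty
  interpret abelian_group Q by (rule abelian_group_Q)
  show ?case by (simp add: zero_Q cosets_zero)
next
  case (insert s S)
  interpret abelian_group Q by (rule abelian_group_Q)
  have "(%s. cosets B (g s)) \<in> S \<rightarrow> carrier Q" using insert.prems by (auto intro: carrierI)
  then have "(\<Oplus>\<^bsub>Q\<^esub>s\<in>insert s S. cosets B (g s)) = cosets B (g s) \<oplus>\<^bsub>Q\<^esub> (\<Oplus>\<^bsub>Q\<^esub>s\<in>S. cosets B (g s))"
    using insert.hyps insert.prems by (intro finsum_insert) (auto intro: carrierI)
  then show ?case using insert by (simp add: add_cosets)
qed

lemma conc_families: "x \<in> F u ==> conc u x \<in> families F"
proof -
  assume "x \<in> F u"
  moreover have "{v. conc u x v ~= 0} \<subseteq> {u}" by (auto simp: conc_def)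
  ultimately show ?thesis unfolding families_def by (auto simp: conc_def F_zero intro: finite_subset)
qed

lemma cosets_conc: "cosets B (conc u x) v = (if v = u then coset (B u) x else B v)"
  by (simp add: cosets_def conc_def coset_zero)

lemma component_Q: "component Q u = (%x. cosets B (conc u x)) ` F u"
proof (intro equalityI subsetI)
  fix z assume "z \<in> component Q u"
  then obtain \<zeta> where \<zeta>: "z = cosets B \<zeta>" "\<zeta> \<in> families F" "!!v. v ~= u ==> z v = B v"
    by (auto simp: qmod_def)
  have "z v = cosets B (conc u (\<zeta> u)) v" for v using \<zeta>(1,3) unfolding cosets_conc by (simp add: cosets_def)
  then have "z = cosets B (conc u (\<zeta> u))" by (rule ext)
  then show "z \<in> (%x. cosets B (conc u x)) ` F u" using \<zeta>(2) by (auto simp: families_def)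
next
  fix z assume "z \<in> (%x. cosets B (conc u x)) ` F u"
  then show "z \<in> component Q u" by (auto simp: qmod_def cosets_conc intro: conc_families)
qed

lemma is_graded_module_Q: "is_graded_module Q"
  unfolding is_graded_module_def
proof (intro conjI allI ballI)
  interpret Q: abelian_group Q by (rule abelian_group_Q)
  show "Module.module poly_ring Q" by (rule module_Q)
  show "additive_subgroup (component Q u) Q" for u
  proof (intro additive_subgroupI subgroup.intro)
    show "component Q u \<subseteq> carrier (add_monoid Q)" by (auto simp: component_Q intro: carrierI conc_families)
    show "\<one>\<^bsub>add_monoid Q\<^esub> \<in> component Q u"
      using conc_families[OF F_zero, of u] unfolding component_Q
      by (intro image_eqI[of _ _ 0]) (auto simp: zero_Q cosets_eq_zero conc_def B_zero F_zero intro!: sym[of "cosets B _"])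
    fix x assume x: "x \<in> component Q u"
    then obtain a where a: "x = cosets B (conc u a)" "a \<in> F u" by (auto simp: component_Q)
    have "cosets B (conc u a) \<oplus>\<^bsub>Q\<^esub> cosets B (conc u a) = \<zero>\<^bsub>Q\<^esub>"
      by (simp only: add_cosets conc_add[symmetric] two zero_Q cosets_eq_zero) (simp add: conc_def B_zero)
    then have "\<ominus>\<^bsub>Q\<^esub> x = x" using a by (intro Q.minus_equality) (auto intro: carrierI conc_families)
    then show "inv\<^bsub>add_monoid Q\<^esub> x \<in> component Q u" using x by (simp add: a_inv_def)
    fix y assume y: "y \<in> component Q u"
    then obtain b where b: "y = cosets B (conc u b)" "b \<in> F u" by (auto simp: component_Q)
    show "x \<otimes>\<^bsub>add_monoid Q\<^esub> y \<in> component Q u"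
      using a b by (auto simp: add_cosets conc_add[symmetric] component_Q intro: F_add)
  qed
  show "variable_poly i \<odot>\<^bsub>Q\<^esub> x \<in> component Q (u + axis i 1)" if "x \<in> component Q u" for u i x
  proof -
    obtain a where a: "x = cosets B (conc u a)" "a \<in> F u" using \<open>x \<in> component Q u\<close> by (auto simp: component_Q)
    have "act (variable_poly i) (conc u a) = conc (u + axis i 1) a"
      unfolding variable_poly_def act_monomial exponent_grade_single by (auto simp: conc_def fun_eq_iff diff_eq_eq)
    moreover have "u \<le> u + axis i 1" by (simp add: less_eq_vec_def axis_def)
    ultimately show ?thesis using a F_mono by (auto simp: smult_cosets conc_families component_Q)
  qed
  fix x assume "x \<in> carrier Q"
  then obtain \<zeta> where \<zeta>: "x = cosets B \<zeta>" "\<zeta> \<in> families F" by (rule carrierE)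
  define z where "z u = cosets B (conc u (\<zeta> u))" for u
  have zu: "z u = \<zero>\<^bsub>Q\<^esub> \<longleftrightarrow> \<zeta> u \<in> B u" for u by (auto simp: z_def zero_Q cosets_eq_zero conc_def B_zero)
  have fin: "finite {u. z u ~= \<zero>\<^bsub>Q\<^esub>}"
    using \<zeta>(2) zu B_zero by (auto simp: families_def intro: rev_finite_subset)
  have F: "\<zeta> u \<in> F u" for u using \<zeta>(2) by (simp add: families_def)
  show "\<exists>!z. (\<forall>u. z u \<in> component Q u) & finite {u. z u ~= \<zero>\<^bsub>Q\<^esub>} & x = (\<Oplus>\<^bsub>Q\<^esub>u\<in>{u. z u ~= \<zero>\<^bsub>Q\<^esub>}. z u)"
  proof (rule ex1I[of _ z], intro conjI allI)
    show "z u \<in> component Q u" for u using F by (auto simp: z_def component_Q)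
    show "finite {u. z u ~= \<zero>\<^bsub>Q\<^esub>}" by (rule fin)
    have "(\<Oplus>\<^bsub>Q\<^esub>u\<in>{u. z u ~= \<zero>\<^bsub>Q\<^esub>}. z u) = cosets B (\<Sum>u\<in>{u. z u ~= \<zero>\<^bsub>Q\<^esub>}. conc u (\<zeta> u))"
      unfolding z_def using fin[unfolded z_def] by (intro finsum_cosets) (auto intro: conc_families F)
    also have "\<dots> = cosets B \<zeta>" unfolding cosets_eq_iff
    proof
      fix v
      have "(\<Sum>u\<in>{u. z u ~= \<zero>\<^bsub>Q\<^esub>}. conc u (\<zeta> u)) v = (if z v ~= \<zero>\<^bsub>Q\<^esub> then \<zeta> v else 0)"
        using fin by (simp add: sum_fun_apply conc_def)
      then show "(\<Sum>u\<in>{u. z u ~= \<zero>\<^bsub>Q\<^esub>}. conc u (\<zeta> u)) v + \<zeta> v \<in> B v" using zu[of v] B_zero two by auto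
    qed
    finally show "x = (\<Oplus>\<^bsub>Q\<^esub>u\<in>{u. z u ~= \<zero>\<^bsub>Q\<^esub>}. z u)" using \<zeta>(1) by simp
    fix z' assume z': "(\<forall>u. z' u \<in> component Q u) & finite {u. z' u ~= \<zero>\<^bsub>Q\<^esub>} & x = (\<Oplus>\<^bsub>Q\<^esub>u\<in>{u. z' u ~= \<zero>\<^bsub>Q\<^esub>}. z' u)"
    then have "\<forall>u. \<exists>a. a \<in> F u & z' u = cosets B (conc u a)" by (auto simp: component_Q)
    then obtain a where a: "!!u. a u \<in> F u" "!!u. z' u = cosets B (conc u (a u))" by metis
    have fin': "finite {u. z' u ~= \<zero>\<^bsub>Q\<^esub>}" using z' by blast
    have zu': "z' u = \<zero>\<^bsub>Q\<^esub> \<longleftrightarrow> a u \<in> B u" for u by (auto simp: a(2) zero_Q cosets_eq_zero conc_def B_zero)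
    have "x = (\<Oplus>\<^bsub>Q\<^esub>u\<in>{u. z' u ~= \<zero>\<^bsub>Q\<^esub>}. cosets B (conc u (a u)))" using z' a(2) by simp
    also have "\<dots> = cosets B (\<Sum>u\<in>{u. z' u ~= \<zero>\<^bsub>Q\<^esub>}. conc u (a u))"
      using fin' by (intro finsum_cosets) (auto intro: conc_families a(1))
    finally have eq: "\<zeta> v + (\<Sum>u\<in>{u. z' u ~= \<zero>\<^bsub>Q\<^esub>}. conc u (a u)) v \<in> B v" for v
      unfolding \<zeta>(1) cosets_eq_iff by blast
    have "\<zeta> v + a v \<in> B v" for v
    proof -
      have "(\<Sum>u\<in>{u. z' u ~= \<zero>\<^bsub>Q\<^esub>}. conc u (a u)) v = (if z' v ~= \<zero>\<^bsub>Q\<^esub> then a v else 0)"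
        using fin' by (simp add: sum_fun_apply conc_def)
      then show ?thesis using eq[of v] zu'[of v] B_add[of "\<zeta> v" v "a v"] by (auto split: if_splits)
    qed
    then have "z' v w = z v w" for v w
      unfolding a(2) z_def cosets_conc using coset_eq_iff[of v "a v" "\<zeta> v"] by (simp add: add.commute)
    then show "z' = z" by (simp add: fun_eq_iff)
  qed
qed

end

section \<open>Maps between quotients and their direct sums\<close>

lemma graded_homI:
  assumes "!!x. x \<in> carrier M ==> h x \<in> carrier N"
    and "!!x y. x \<in> carrier M ==> y \<in> carrier M ==> h (x \<oplus>\<^bsub>M\<^esub> y) = h x \<oplus>\<^bsub>N\<^esub> h y"
    and "!!p x. x \<in> carrier M ==> h (p \<odot>\<^bsub>M\<^esub> x) = p \<odot>\<^bsub>N\<^esub> h x"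
    and "!!u x. x \<in> component M u ==> h x \<in> component N u"
  shows "h \<in> graded_hom M N"
  using assms by (simp add: graded_hom_def)

lemma graded_hom_comp: "h \<in> graded_hom M N ==> k \<in> graded_hom N P ==> (%x. k (h x)) \<in> graded_hom M P"
  unfolding graded_hom_def by (auto simp: Pi_iff)

lemma graded_iso_trans: "graded_iso M N ==> graded_iso N P ==> graded_iso M P"
proof -
  assume "graded_iso M N" "graded_iso N P"
  then obtain h k where hk: "h \<in> graded_hom M N" "bij_betw h (carrier M) (carrier N)" "k \<in> graded_hom N P" "bij_betw k (carrier N) (carrier P)"
    unfolding graded_iso_def by blast
  then show ?thesis unfolding graded_iso_def
    using graded_hom_comp[OF hk(1,3)] bij_betw_trans[OF hk(2,4)] by (intro bexI[of _ "%x. k (h x)"]) (auto simp: comp_def)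
qed

definition induced :: "('g => 'a::ab_group_add set) => ('g => 'b::ab_group_add set) => ('a => 'b) => ('g => 'a set) => 'g => 'b set" where
  "induced B B' h z = cosets B' (%u. h (lift_family B z u))"

locale quotient_map = Q: filtered_quotient F B + Q': filtered_quotient F' B'
  for F B :: "'d::finite grade => 'a::ab_group_add set" and F' B' :: "'d grade => 'b::ab_group_add set" +
  fixes h :: "'a => 'b"
  assumes h_add: "h (x + y) = h x + h y"
    and h_F: "x \<in> F u ==> h x \<in> F' u" and h_B: "x \<in> B u ==> h x \<in> B' u"
begin

lemma h_zero: "h 0 = 0"
  using h_add[of 0 0] by simp

lemma h_sum: "h (sum g S) = (\<Sum>s\<in>S. h (g s))"
  by (induction S rule: infinite_finite_induct) (auto simp: h_add h_zero)

lemma h_families: "\<zeta> \<in> families F ==> (%u. h (\<zeta> u)) \<in> families F'"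
proof -
  assume "\<zeta> \<in> families F"
  moreover have "{u. h (\<zeta> u) ~= 0} \<subseteq> {u. \<zeta> u ~= 0}" using h_zero by auto
  ultimately show ?thesis unfolding families_def using h_F by (auto intro: finite_subset)
qed

lemma induced_eq: "\<zeta> \<in> families F ==> induced B B' h (cosets B \<zeta>) = cosets B' (%u. h (\<zeta> u))"
proof -
  assume z: "\<zeta> \<in> families F"
  have "cosets B (lift_family B (cosets B \<zeta>)) = cosets B \<zeta>" using Q.lift_correct(2) z by blast
  then have "lift_family B (cosets B \<zeta>) u + \<zeta> u \<in> B u" for u unfolding Q.cosets_eq_iff by blast
  then show ?thesis unfolding induced_def Q'.cosets_eq_iff by (metis h_B h_add)
qed

lemma act_h: "act p (%u. h (\<zeta> u)) = (%u. h (act p \<zeta> u))"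
  by (simp add: act_def h_sum)

lemma induced_hom: "induced B B' h \<in> graded_hom (qmod F B) (qmod F' B')"
  unfolding graded_hom_def
proof (intro CollectI conjI allI ballI funcsetI)
  fix x assume "x \<in> carrier (qmod F B)"
  then obtain \<zeta> where \<zeta>: "x = cosets B \<zeta>" "\<zeta> \<in> families F" by (rule Q.carrierE)
  show "induced B B' h x \<in> carrier (qmod F' B')" using \<zeta> by (simp add: induced_eq Q'.carrierI h_families)
  show "induced B B' h (p \<odot>\<^bsub>qmod F B\<^esub> x) = p \<odot>\<^bsub>qmod F' B'\<^esub> induced B B' h x" for p
    using \<zeta> by (simp add: induced_eq Q.smult_cosets Q'.smult_cosets h_families Q.act_families act_h)
  fix y assume "y \<in> carrier (qmod F B)"
  then obtain \<eta> where \<eta>: "y = cosets B \<eta>" "\<eta> \<in> families F" by (rule Q.carrierE)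
  have "(%u. h ((\<zeta> + \<eta>) u)) = (%u. h (\<zeta> u)) + (%u. h (\<eta> u))" by (rule ext) (simp only: plus_fun_apply h_add)
  then show "induced B B' h (x \<oplus>\<^bsub>qmod F B\<^esub> y) = induced B B' h x \<oplus>\<^bsub>qmod F' B'\<^esub> induced B B' h y"
    using \<zeta> \<eta> by (simp only: induced_eq Q.add_cosets Q'.add_cosets Q.families_add)
next
  fix u x assume "x \<in> component (qmod F B) u"
  then obtain a where a: "x = cosets B (conc u a)" "a \<in> F u" by (auto simp: Q.component_Q)
  have "(%v. h (conc u a v)) = conc u (h a)" by (auto simp: conc_def h_zero)
  then show "induced B B' h x \<in> component (qmod F' B') u"
    using a by (auto simp: induced_eq Q.conc_families Q'.component_Q intro: h_F)
qed

lemma induced_iso: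
  assumes i: "!!u x. x \<in> F u ==> h x \<in> B' u ==> x \<in> B u"
    and s: "!!u y. y \<in> F' u ==> \<exists>x\<in>F u. y + h x \<in> B' u"
  shows "graded_iso (qmod F B) (qmod F' B')"
  unfolding graded_iso_def
proof (intro bexI[of _ "induced B B' h"] induced_hom bij_betw_imageI inj_onI equalityI subsetI)
  fix x y assume "x \<in> carrier (qmod F B)" "y \<in> carrier (qmod F B)" and eq: "induced B B' h x = induced B B' h y"
  then obtain \<zeta> \<eta> where z: "x = cosets B \<zeta>" "\<zeta> \<in> families F" "y = cosets B \<eta>" "\<eta> \<in> families F"
    by (auto simp: Q.carrier_Q)
  have "h (\<zeta> u) + h (\<eta> u) \<in> B' u" for u
    using eq unfolding z induced_eq[OF z(2)] induced_eq[OF z(4)] Q'.cosets_eq_iff by blast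
  moreover have "\<zeta> u + \<eta> u \<in> F u" for u using z by (auto simp: families_def intro: Q.F_add)
  ultimately have "\<zeta> u + \<eta> u \<in> B u" for u using i[of "\<zeta> u + \<eta> u" u] by (simp only: h_add)
  then show "x = y" unfolding z Q.cosets_eq_iff by blast
next
  fix y assume "y \<in> induced B B' h ` carrier (qmod F B)"
  then show "y \<in> carrier (qmod F' B')" using induced_hom by (auto simp: graded_hom_def)
next
  fix y assume "y \<in> carrier (qmod F' B')"
  then obtain \<eta> where \<eta>: "y = cosets B' \<eta>" "\<eta> \<in> families F'" by (rule Q'.carrierE)
  have "\<forall>u. \<exists>x. x \<in> F u & \<eta> u + h x \<in> B' u" using s \<eta>(2) unfolding families_def by blast
  then obtain \<xi> where \<xi>: "!!u. \<xi> u \<in> F u" "!!u. \<eta> u + h (\<xi> u) \<in> B' u" by metis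
  define \<zeta> where "\<zeta> = (%u. if \<eta> u = 0 then 0 else \<xi> u)"
  have "{u. \<zeta> u ~= 0} \<subseteq> {u. \<eta> u ~= 0}" by (auto simp: \<zeta>_def)
  then have z: "\<zeta> \<in> families F"
    using \<eta>(2) \<xi>(1) Q.F_zero unfolding families_def by (auto simp: \<zeta>_def intro: finite_subset)
  have "h (\<zeta> u) + \<eta> u \<in> B' u" for u using \<xi>(2)[of u] Q'.B_zero[of u] by (simp add: \<zeta>_def h_zero add.commute)
  then have "induced B B' h (cosets B \<zeta>) = y" unfolding induced_eq[OF z] \<eta>(1) Q'.cosets_eq_iff by blast
  then show "y \<in> induced B B' h ` carrier (qmod F B)" using Q.carrierI[OF z] by blast
qed

end

context filtered_quotient
begin

text \<open>The summand cut out by \<open>e l\<close> is obtained from the same filtration \<open>F\<close> by enlarging the relations to the kernel of \<open>e l\<close> modulo \<open>B\<close>, so that all summands live on one type.\<close>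

lemma direct_sum_iso:
  fixes e :: "nat => 'a => 'a"
  assumes e_add: "!!l x y. l < L ==> e l (x + y) = e l x + e l y"
    and e_F: "!!l x u. l < L ==> x \<in> F u ==> e l x \<in> F u"
    and e_B: "!!l x u. l < L ==> x \<in> B u ==> e l x \<in> B u"
    and e_sum: "!!x u. x \<in> F u ==> (\<Sum>l<L. e l x) = x"
    and orth: "!!l m x u. l < L ==> m < L ==> x \<in> F u ==> e l (e m x) = (if l = m then e l x else 0)"
    and Bl: "!!l u. Bl l u = {x \<in> F u. e l x \<in> B u}"
  shows "!!l. l < L ==> filtered_quotient F (Bl l)"
    and "graded_iso (qmod F B) (direct_sum (map (%l. qmod F (Bl l)) [0..<L]))"
proof -
  have e0: "e l 0 = 0" if "l < L" for l using e_add[OF that, of 0 0] by simp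
  have es: "e l (sum g S) = (\<Sum>s\<in>S. e l (g s))" if "l < L" for l and g :: "nat => 'a" and S
    by (induction S rule: infinite_finite_induct) (auto simp: e_add e0 that)
  show fq: "filtered_quotient F (Bl l)" if "l < L" for l
    by unfold_locales (auto simp: Bl e_add e0 that F_zero B_zero two intro: F_add B_add F_mono B_mono)
  have "quotient_map F B F (Bl l) id" if "l < L" for l
  proof -
    interpret Ql: filtered_quotient F "Bl l" by (rule fq[OF that])
    show ?thesis by unfold_locales (auto simp: Bl B_F intro: e_B that)
  qed
  note qm = this
  have ind: "induced B (Bl l) id (cosets B \<zeta>) = cosets (Bl l) \<zeta>" if "l < L" "\<zeta> \<in> families F" for l \<zeta>
    using quotient_map.induced_eq[OF qm[OF that(1)] that(2)] by simp
  have hom: "induced B (Bl l) id \<in> graded_hom (qmod F B) (qmod F (Bl l))" if "l < L" for l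
    by (rule quotient_map.induced_hom[OF qm[OF that]])
  let ?k = "%z. map (%l. induced B (Bl l) id z) [0..<L]" and ?D = "direct_sum (map (%l. qmod F (Bl l)) [0..<L])"
  have k: "?k \<in> graded_hom (qmod F B) ?D"
    unfolding graded_hom_def
  proof (intro CollectI conjI allI ballI funcsetI)
    fix x assume x: "x \<in> carrier (qmod F B)"
    then show "?k x \<in> carrier ?D"
      using hom by (auto simp: direct_sum_def list_all2_conv_all_nth graded_hom_def Pi_iff)
    show "?k (p \<odot>\<^bsub>qmod F B\<^esub> x) = p \<odot>\<^bsub>?D\<^esub> ?k x" for p
      using hom x by (auto simp: direct_sum_def graded_hom_def)
    fix y assume "y \<in> carrier (qmod F B)"
    then show "?k (x \<oplus>\<^bsub>qmod F B\<^esub> y) = ?k x \<oplus>\<^bsub>?D\<^esub> ?k y"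
      using hom x by (auto simp: direct_sum_def graded_hom_def)
  next
    fix u x assume "x \<in> component (qmod F B) u"
    then show "?k x \<in> component ?D u"
      using hom by (auto simp: direct_sum_def list_all2_conv_all_nth graded_hom_def Pi_iff)
  qed
  moreover have "bij_betw ?k (carrier (qmod F B)) (carrier ?D)"
  proof (intro bij_betw_imageI inj_onI equalityI subsetI)
    fix x y assume "x \<in> carrier (qmod F B)" "y \<in> carrier (qmod F B)" and eq: "?k x = ?k y"
    then obtain \<zeta> \<eta> where z: "x = cosets B \<zeta>" "\<zeta> \<in> families F" "y = cosets B \<eta>" "\<eta> \<in> families F"
      by (auto simp: carrier_Q)
    have "\<zeta> u + \<eta> u \<in> B u" for u
    proof -
      have "e l (\<zeta> u + \<eta> u) \<in> B u" if l: "l < L" for l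
      proof -
        have "?k x ! l = ?k y ! l" by (simp only: eq)
        then have "cosets (Bl l) \<zeta> = cosets (Bl l) \<eta>" using l by (simp add: z(1,3) ind[OF l] z(2,4))
        then show ?thesis unfolding filtered_quotient.cosets_eq_iff[OF fq[OF l]] by (simp add: Bl)
      qed
      then have "(\<Sum>l<L. e l (\<zeta> u + \<eta> u)) \<in> B u" by (intro B_sum) auto
      moreover have "\<zeta> u + \<eta> u \<in> F u" using z by (auto simp: families_def intro: F_add)
      ultimately show ?thesis using e_sum by simp
    qed
    then show "x = y" unfolding z cosets_eq_iff by blast
  next
    fix y assume "y \<in> ?k ` carrier (qmod F B)"
    then show "y \<in> carrier ?D" using k by (auto simp: graded_hom_def)
  next
    fix y assume y: "y \<in> carrier ?D"
    then have len: "length y = L" by (auto simp: direct_sum_def dest: list_all2_lengthD)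
    have "y ! l \<in> carrier (qmod F (Bl l))" if "l < L" for l
      using y that by (auto simp: direct_sum_def list_all2_conv_all_nth)
    then have "\<forall>l. \<exists>\<zeta>. l < L --> \<zeta> \<in> families F & y ! l = cosets (Bl l) \<zeta>"
      using filtered_quotient.carrier_Q[OF fq] by blast
    then obtain \<zeta> where \<zeta>: "!!l. l < L ==> \<zeta> l \<in> families F" "!!l. l < L ==> y ! l = cosets (Bl l) (\<zeta> l)" by metis
    define \<xi> where "\<xi> = (\<Sum>l<L. (%u. e l (\<zeta> l u)))"
    have "(%u. e l (\<zeta> l u)) \<in> families F" if l: "l < L" for l
    proof -
      have "{u. e l (\<zeta> l u) ~= 0} \<subseteq> {u. \<zeta> l u ~= 0}" using e0[OF l] by auto
      then show ?thesis using \<zeta>(1)[OF l] e_F[OF l] unfolding families_def by (auto intro: finite_subset)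
    qed
    then have x: "\<xi> \<in> families F" unfolding \<xi>_def by (intro families_sum) auto
    have "cosets (Bl l) \<xi> = y ! l" if l: "l < L" for l
    proof -
      have F: "\<zeta> m u \<in> F u" if "m < L" for m u using \<zeta>(1)[OF that] by (simp add: families_def)
      have "e l (\<xi> u + \<zeta> l u) = 0" for u
      proof -
        have o: "e l (e m (\<zeta> m u)) = (if l = m then e l (\<zeta> l u) else 0)" if "m < L" for m
          using orth[OF l that F[OF that]] by auto
        have "e l (\<xi> u) = (\<Sum>m<L. e l (e m (\<zeta> m u)))" unfolding \<xi>_def sum_fun_apply by (rule es[OF l])
        also have "\<dots> = (\<Sum>m<L. if l = m then e l (\<zeta> l u) else 0)"
          by (intro sum.cong refl o) simp
        finally show ?thesis using l by (simp add: e_add two)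
      qed
      moreover have "\<xi> u + \<zeta> l u \<in> F u" for u using x F[OF l] by (auto simp: families_def intro: F_add)
      ultimately show ?thesis
        unfolding \<zeta>(2)[OF l] filtered_quotient.cosets_eq_iff[OF fq[OF l]] by (simp add: Bl B_zero)
    qed
    then have "?k (cosets B \<xi>) = y" using len by (intro nth_equalityI) (auto simp: ind x)
    then show "y \<in> ?k ` carrier (qmod F B)" using carrierI[OF x] by blast
  qed
  ultimately show "graded_iso (qmod F B) ?D" unfolding graded_iso_def by blast
qed

end

section \<open>A criterion for indecomposability\<close>

lemma graded_abelian_group: "is_graded_module A ==> abelian_group A"
  unfolding is_graded_module_def using Module.module.axioms(2) by blast

lemma component_carrier: "is_graded_module A ==> x \<in> component A u ==> x \<in> carrier A"
  using additive_subgroup.a_subset by (fastforce simp: is_graded_module_def)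

lemma zero_component: "is_graded_module A ==> \<zero>\<^bsub>A\<^esub> \<in> component A u"
  using additive_subgroup.zero_closed by (fastforce simp: is_graded_module_def)

text \<open>Uniqueness of the decomposition into homogeneous components, in the form needed for components of a homogeneous element.\<close>

lemma homogeneous_components_vanish:
  assumes A: "is_graded_module A" and S: "finite S" "!!v. v \<in> S ==> z v \<in> component A v"
    and w: "w \<in> component A u" "w = (\<Oplus>\<^bsub>A\<^esub>v\<in>S. z v)" and v: "v \<in> S" "v ~= u"
  shows "z v = \<zero>\<^bsub>A\<^esub>"
proof -
  interpret abelian_group A by (rule graded_abelian_group[OF A])
  define P where "P = (%z. (\<forall>u. z u \<in> component A u) & finite {u. z u ~= \<zero>\<^bsub>A\<^esub>} & w = (\<Oplus>\<^bsub>A\<^esub>u\<in>{u. z u ~= \<zero>\<^bsub>A\<^esub>}. z u))"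
  define z1 where "z1 v = (if v \<in> S then z v else \<zero>\<^bsub>A\<^esub>)" for v
  define z2 where "z2 v = (if v = u then w else \<zero>\<^bsub>A\<^esub>)" for v
  have wc: "w \<in> carrier A" by (rule component_carrier[OF A w(1)])
  have sub: "{v. z1 v ~= \<zero>\<^bsub>A\<^esub>} \<subseteq> S" by (auto simp: z1_def)
  have "(\<Oplus>\<^bsub>A\<^esub>u\<in>{u. z1 u ~= \<zero>\<^bsub>A\<^esub>}. z1 u) = (\<Oplus>\<^bsub>A\<^esub>v\<in>S. z v)"
    using S sub component_carrier[OF A] by (intro add.finprod_mono_neutral_cong_left) (auto simp: z1_def)
  moreover have "\<forall>u. z1 u \<in> component A u" using S(2) zero_component[OF A] by (simp add: z1_def)
  ultimately have P1: "P z1" unfolding P_def using w(2) finite_subset[OF sub S(1)] by metis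
  have sup: "{v. z2 v ~= \<zero>\<^bsub>A\<^esub>} = (if w = \<zero>\<^bsub>A\<^esub> then {} else {u})" by (auto simp: z2_def)
  have "z2 u = w" by (simp add: z2_def)
  then have "(\<Oplus>\<^bsub>A\<^esub>u\<in>(if w = \<zero>\<^bsub>A\<^esub> then {} else {u}). z2 u) = w" using wc by simp
  moreover have "\<forall>u. z2 u \<in> component A u" using w(1) zero_component[OF A] by (simp add: z2_def)
  moreover have "finite (if w = \<zero>\<^bsub>A\<^esub> then {} else {u})" by simp
  ultimately have P2: "P z2" unfolding P_def sup by metis
  have "\<exists>!z. P z" unfolding P_def using A wc by (simp add: is_graded_module_def)
  then have "z1 = z2" using P1 P2 by blast
  then show ?thesis using v by (metis z1_def z2_def)
qed

lemma graded_hom_zero: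
  assumes "is_graded_module M" "is_graded_module N" "h \<in> graded_hom M N"
  shows "h \<zero>\<^bsub>M\<^esub> = \<zero>\<^bsub>N\<^esub>"
proof -
  interpret M: abelian_group M by (rule graded_abelian_group[OF assms(1)])
  interpret N: abelian_group N by (rule graded_abelian_group[OF assms(2)])
  have c: "h \<zero>\<^bsub>M\<^esub> \<in> carrier N" using assms(3) by (auto simp: graded_hom_def)
  have "h (\<zero>\<^bsub>M\<^esub> \<oplus>\<^bsub>M\<^esub> \<zero>\<^bsub>M\<^esub>) = h \<zero>\<^bsub>M\<^esub> \<oplus>\<^bsub>N\<^esub> h \<zero>\<^bsub>M\<^esub>" using assms(3) unfolding graded_hom_def by blast
  then show ?thesis using c by simp
qed

lemma graded_hom_finsum:
  assumes "is_graded_module M" "is_graded_module N" "h \<in> graded_hom M N"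
  shows "finite S ==> (!!s. s \<in> S ==> z s \<in> carrier M) ==> h (\<Oplus>\<^bsub>M\<^esub>s\<in>S. z s) = (\<Oplus>\<^bsub>N\<^esub>s\<in>S. h (z s))"
proof (induction S rule: finite_induct)
  case empty
  interpret M: abelian_group M by (rule graded_abelian_group[OF assms(1)])
  interpret N: abelian_group N by (rule graded_abelian_group[OF assms(2)])
  show ?case by (simp add: graded_hom_zero[OF assms])
next
  case (insert s S)
  interpret M: abelian_group M by (rule graded_abelian_group[OF assms(1)])
  interpret N: abelian_group N by (rule graded_abelian_group[OF assms(2)])
  have h: "h x \<in> carrier N" if "x \<in> carrier M" for x using assms(3) that by (auto simp: graded_hom_def)
  have a: "h (x \<oplus>\<^bsub>M\<^esub> y) = h x \<oplus>\<^bsub>N\<^esub> h y" if "x \<in> carrier M" "y \<in> carrier M" for x y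
    using assms(3) that unfolding graded_hom_def by blast
  have z: "z \<in> S \<rightarrow> carrier M" "z s \<in> carrier M" using insert.prems by auto
  have "(\<Oplus>\<^bsub>M\<^esub>t\<in>insert s S. z t) = z s \<oplus>\<^bsub>M\<^esub> (\<Oplus>\<^bsub>M\<^esub>t\<in>S. z t)" using insert.hyps z by (intro M.finsum_insert) auto
  moreover have "(\<Oplus>\<^bsub>N\<^esub>t\<in>insert s S. h (z t)) = h (z s) \<oplus>\<^bsub>N\<^esub> (\<Oplus>\<^bsub>N\<^esub>t\<in>S. h (z t))"
    using insert.hyps z h by (intro N.finsum_insert) auto
  ultimately show ?case using insert.IH insert.prems a[OF z(2) M.finsum_closed[OF z(1)]] by simp
qed

definition trivial_idempotents :: "('m, 'd::finite) gmod => bool" where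
  "trivial_idempotents M \<longleftrightarrow> (\<forall>\<phi>\<in>graded_hom M M. (\<forall>x\<in>carrier M. \<phi> (\<phi> x) = \<phi> x) -->
     (\<forall>x\<in>carrier M. \<phi> x = \<zero>\<^bsub>M\<^esub>) | (\<forall>x\<in>carrier M. \<phi> x = x))"

text \<open>A splitting into \<open>A\<close> and \<open>C\<close> yields the projection to \<open>A\<close>, an idempotent that is neither 0 nor the identity. It preserves grades because the components of its value at a homogeneous element map to 0 in both summands except in the right grade.\<close>

lemma (in filtered_quotient) indecomposable_criterion:
  assumes nz: "nonzero_module Q" and triv: "trivial_idempotents Q"
  shows "indecomposable Q"
  unfolding indecomposable_def
proof (intro conjI notI is_graded_module_Q nz)
  assume "\<exists>A C :: ('d grade => 'a set, 'd) gmod. is_graded_module A & nonzero_module A & is_graded_module C & nonzero_module C &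
    graded_iso Q (direct_sum [A, C])"
  then obtain A C :: "('d grade => 'a set, 'd) gmod" where
    A: "is_graded_module A" "nonzero_module A" and C: "is_graded_module C" "nonzero_module C" and iso: "graded_iso Q (direct_sum [A, C])"
    by blast
  let ?D = "direct_sum [A, C]"
  obtain k where k: "k \<in> graded_hom Q ?D" "bij_betw k (carrier Q) (carrier ?D)" using iso by (auto simp: graded_iso_def)
  interpret A: abelian_group A by (rule graded_abelian_group[OF A(1)])
  interpret C: abelian_group C by (rule graded_abelian_group[OF C(1)])
  interpret Q: abelian_group Q by (rule abelian_group_Q)
  interpret Qm: Module.module poly_ring Q by (rule module_Q)
  have Cm: "Module.module poly_ring C" using C(1) by (simp add: is_graded_module_def)
  interpret Cm: Module.module poly_ring C by (rule Cm)
  have upt2: "[0..<Suc (Suc 0)] = [0, 1]" by (simp add: upt_rec)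
  have cD: "carrier ?D = {[x, y] | x y. x \<in> carrier A & y \<in> carrier C}"
    by (auto simp: direct_sum_def list_all2_Cons2)
  define a c where "a x = k x ! 0" and "c x = k x ! 1" for x
  have kx: "k x = [a x, c x]" "a x \<in> carrier A" "c x \<in> carrier C" if "x \<in> carrier Q" for x
  proof -
    have "k x \<in> carrier ?D" using k(1) that unfolding graded_hom_def by blast
    then obtain y z where "k x = [y, z]" "y \<in> carrier A" "z \<in> carrier C" unfolding cD by blast
    then show "k x = [a x, c x]" "a x \<in> carrier A" "c x \<in> carrier C" by (simp_all add: a_def c_def)
  qed
  have add: "k (x \<oplus>\<^bsub>Q\<^esub> y) = [a x \<oplus>\<^bsub>A\<^esub> a y, c x \<oplus>\<^bsub>C\<^esub> c y]" if "x \<in> carrier Q" "y \<in> carrier Q" for x y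
  proof -
    have "k (x \<oplus>\<^bsub>Q\<^esub> y) = k x \<oplus>\<^bsub>?D\<^esub> k y" using k(1) that unfolding graded_hom_def by blast
    then show ?thesis using kx[OF that(1)] kx[OF that(2)] by (simp add: direct_sum_def upt2)
  qed
  have aadd: "a (x \<oplus>\<^bsub>Q\<^esub> y) = a x \<oplus>\<^bsub>A\<^esub> a y" "c (x \<oplus>\<^bsub>Q\<^esub> y) = c x \<oplus>\<^bsub>C\<^esub> c y" if "x \<in> carrier Q" "y \<in> carrier Q" for x y
    unfolding a_def[of "x \<oplus>\<^bsub>Q\<^esub> y"] c_def[of "x \<oplus>\<^bsub>Q\<^esub> y"] add[OF that] by simp_all
  have smult: "k (p \<odot>\<^bsub>Q\<^esub> x) = [p \<odot>\<^bsub>A\<^esub> a x, p \<odot>\<^bsub>C\<^esub> c x]" if "x \<in> carrier Q" for p x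
  proof -
    have "k (p \<odot>\<^bsub>Q\<^esub> x) = p \<odot>\<^bsub>?D\<^esub> k x" using k(1) that unfolding graded_hom_def by blast
    then show ?thesis using kx[OF that(1)] by (simp add: direct_sum_def upt2)
  qed
  have asm: "a (p \<odot>\<^bsub>Q\<^esub> x) = p \<odot>\<^bsub>A\<^esub> a x" "c (p \<odot>\<^bsub>Q\<^esub> x) = p \<odot>\<^bsub>C\<^esub> c x" if "x \<in> carrier Q" for x p
    unfolding a_def[of "p \<odot>\<^bsub>Q\<^esub> x"] c_def[of "p \<odot>\<^bsub>Q\<^esub> x"] smult[OF that] by simp_all
  have comp: "a x \<in> component A u" "c x \<in> component C u" if x: "x \<in> component Q u" for u x
  proof -
    have "k x \<in> component ?D u" using k(1) x unfolding graded_hom_def by blast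
    then have "[a x, c x] \<in> component ?D u" by (simp only: kx(1)[OF component_carrier[OF is_graded_module_Q x]])
    then show "a x \<in> component A u" "c x \<in> component C u"
      by (simp_all only: direct_sum_def graded_module.simps mem_Collect_eq list.rel_inject)
  qed
  have hom: "a \<in> graded_hom Q A" "c \<in> graded_hom Q C"
    by (rule graded_homI; (rule kx aadd asm comp; assumption))+
  have ext: "x = y" if "x \<in> carrier Q" "y \<in> carrier Q" "a x = a y" "c x = c y" for x y
    using k(2) that kx(1) unfolding bij_betw_def inj_on_def by metis
  have pre: "\<exists>x\<in>carrier Q. a x = y & c x = z" if "y \<in> carrier A" "z \<in> carrier C" for y z
  proof -
    have "[y, z] \<in> k ` carrier Q" using k(2) that by (simp add: bij_betw_def cD)
    then obtain x where "x \<in> carrier Q" "k x = [y, z]" by auto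
    then show ?thesis using kx(1) by (intro bexI[of _ x]) auto
  qed
  define \<phi> where "\<phi> x = (SOME y. y \<in> carrier Q & a y = a x & c y = \<zero>\<^bsub>C\<^esub>)" for x
  have \<phi>: "\<phi> x \<in> carrier Q" "a (\<phi> x) = a x" "c (\<phi> x) = \<zero>\<^bsub>C\<^esub>" if "x \<in> carrier Q" for x
  proof -
    have "\<exists>y. y \<in> carrier Q & a y = a x & c y = \<zero>\<^bsub>C\<^esub>" using pre[OF kx(2)[OF that] C.zero_closed] by blast
    from someI_ex[OF this] show "\<phi> x \<in> carrier Q" "a (\<phi> x) = a x" "c (\<phi> x) = \<zero>\<^bsub>C\<^esub>" by (simp_all add: \<phi>_def)
  qed
  have a0: "a \<zero>\<^bsub>Q\<^esub> = \<zero>\<^bsub>A\<^esub>" "c \<zero>\<^bsub>Q\<^esub> = \<zero>\<^bsub>C\<^esub>"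
    using graded_hom_zero[OF is_graded_module_Q A(1) hom(1)] graded_hom_zero[OF is_graded_module_Q C(1) hom(2)] by auto
  have homog: "\<phi> x \<in> component Q u" if x: "x \<in> component Q u" for x u
  proof -
    have xc: "x \<in> carrier Q" by (rule component_carrier[OF is_graded_module_Q x])
    obtain \<zeta> where \<zeta>: "\<phi> x = cosets B \<zeta>" "\<zeta> \<in> families F" using \<phi>(1)[OF xc] by (rule carrierE)
    let ?S = "{v. \<zeta> v ~= 0}" and ?y = "%v. cosets B (conc v (\<zeta> v))"
    have S: "finite ?S" and F: "!!v. \<zeta> v \<in> F v" using \<zeta>(2) by (auto simp: families_def)
    have yc: "?y v \<in> component Q v" "?y v \<in> carrier Q" for v
      using F by (auto simp: component_Q intro: carrierI conc_families)
    have "\<phi> x = cosets B (\<Sum>v\<in>?S. conc v (\<zeta> v))" using \<zeta>(1) families_decompose[OF \<zeta>(2)] by simp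
    also have "\<dots> = (\<Oplus>\<^bsub>Q\<^esub>v\<in>?S. ?y v)" using S F by (intro finsum_cosets[symmetric]) (auto intro: conc_families)
    finally have sum: "\<phi> x = (\<Oplus>\<^bsub>Q\<^esub>v\<in>?S. ?y v)" .
    have "\<zeta> v \<in> B v" if v: "v ~= u" for v
    proof (cases "v \<in> ?S")
      case True
      have "a (\<phi> x) = (\<Oplus>\<^bsub>A\<^esub>v\<in>?S. a (?y v))" unfolding sum by (rule graded_hom_finsum[OF is_graded_module_Q A(1) hom(1) S yc(2)])
      moreover have "a (\<phi> x) \<in> component A u" unfolding \<phi>(2)[OF xc] using hom(1) x by (simp add: graded_hom_def)
      moreover have "a (?y v) \<in> component A v" for v using hom(1) yc(1) unfolding graded_hom_def by blast
      ultimately have "a (?y v) = \<zero>\<^bsub>A\<^esub>"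
        using homogeneous_components_vanish[OF A(1) S, of "%v. a (?y v)"] True v by blast
      moreover
      have "c (\<phi> x) = (\<Oplus>\<^bsub>C\<^esub>v\<in>?S. c (?y v))" unfolding sum by (rule graded_hom_finsum[OF is_graded_module_Q C(1) hom(2) S yc(2)])
      moreover have "c (\<phi> x) \<in> component C u" unfolding \<phi>(3)[OF xc] by (rule zero_component[OF C(1)])
      moreover have "c (?y v) \<in> component C v" for v using hom(2) yc(1) unfolding graded_hom_def by blast
      ultimately have "a (?y v) = \<zero>\<^bsub>A\<^esub>" "c (?y v) = \<zero>\<^bsub>C\<^esub>"
        using homogeneous_components_vanish[OF C(1) S, of "%v. c (?y v)"] True v by blast+
      then have "?y v = B" using ext[OF yc(2) Q.zero_closed] a0 by (simp add: zero_Q)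
      then show ?thesis unfolding cosets_eq_zero by (metis conc_def)
    qed (simp add: B_zero)
    then have "\<forall>v. v ~= u --> \<phi> x v = B v" unfolding \<zeta>(1) by (simp add: cosets_def coset_eq_B)
    then show ?thesis using \<phi>(1)[OF xc] by (simp add: qmod_def)
  qed
  have "\<phi> \<in> graded_hom Q Q"
    proof (rule graded_homI)
    fix x assume x: "x \<in> carrier Q"
    show "\<phi> x \<in> carrier Q" by (rule \<phi>(1)[OF x])
    show "\<phi> (p \<odot>\<^bsub>Q\<^esub> x) = p \<odot>\<^bsub>Q\<^esub> \<phi> x" for p
      by (rule ext) (use x \<phi> asm Cm.smult_r_null[of p] in \<open>simp_all add: ring_of_class_def\<close>)
    fix y assume y: "y \<in> carrier Q"
    show "\<phi> (x \<oplus>\<^bsub>Q\<^esub> y) = \<phi> x \<oplus>\<^bsub>Q\<^esub> \<phi> y" by (rule ext) (use x y \<phi> aadd in simp_all)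
  qed (rule homog)
  moreover have "\<phi> (\<phi> x) = \<phi> x" if "x \<in> carrier Q" for x by (rule ext) (use that \<phi> in simp_all)
  ultimately have "(\<forall>x\<in>carrier Q. \<phi> x = \<zero>\<^bsub>Q\<^esub>) | (\<forall>x\<in>carrier Q. \<phi> x = x)"
    using triv unfolding trivial_idempotents_def by blast
  then show False
  proof
    assume z: "\<forall>x\<in>carrier Q. \<phi> x = \<zero>\<^bsub>Q\<^esub>"
    have "y = \<zero>\<^bsub>A\<^esub>" if "y \<in> carrier A" for y using pre[OF that C.zero_closed] \<phi>(2) z a0 by metis
    then show False using A(2) A.zero_closed unfolding nonzero_module_def by blast
  next
    assume z: "\<forall>x\<in>carrier Q. \<phi> x = x"
    have "y = \<zero>\<^bsub>C\<^esub>" if "y \<in> carrier C" for y using pre[OF A.zero_closed that] \<phi>(3) z a0 by metis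
    then show False using C(2) C.zero_closed unfolding nonzero_module_def by blast
  qed
qed

lemma trivial_idempotents_transfer:
  assumes gr: "is_graded_module M" "is_graded_module N" and ij: "i \<in> graded_hom M N" "j \<in> graded_hom N M"
    and jij: "!!x. x \<in> carrier M ==> j (i x) = x" "!!y. y \<in> carrier N ==> i (j y) = y"
    and triv: "trivial_idempotents M"
  shows "trivial_idempotents N"
  unfolding trivial_idempotents_def
proof (intro ballI impI)
  fix \<phi> assume \<phi>: "\<phi> \<in> graded_hom N N" "\<forall>x\<in>carrier N. \<phi> (\<phi> x) = \<phi> x"
  have ic: "i x \<in> carrier N" if "x \<in> carrier M" for x using ij(1) that by (auto simp: graded_hom_def)
  have jc: "j x \<in> carrier M" if "x \<in> carrier N" for x using ij(2) that by (auto simp: graded_hom_def)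
  have pc: "\<phi> x \<in> carrier N" if "x \<in> carrier N" for x using \<phi>(1) that by (auto simp: graded_hom_def)
  have "(%x. j (\<phi> (i x))) \<in> graded_hom M M"
    using graded_hom_comp[OF ij(1) graded_hom_comp[OF \<phi>(1) ij(2)]] by simp
  moreover have "\<forall>x\<in>carrier M. j (\<phi> (i (j (\<phi> (i x))))) = j (\<phi> (i x))" using jij(2) \<phi>(2) ic pc by simp
  ultimately have "(\<forall>x\<in>carrier M. j (\<phi> (i x)) = \<zero>\<^bsub>M\<^esub>) | (\<forall>x\<in>carrier M. j (\<phi> (i x)) = x)"
    using bspec[OF triv[unfolded trivial_idempotents_def]] by blast
  then show "(\<forall>x\<in>carrier N. \<phi> x = \<zero>\<^bsub>N\<^esub>) | (\<forall>x\<in>carrier N. \<phi> x = x)"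
  proof
    assume z: "\<forall>x\<in>carrier M. j (\<phi> (i x)) = \<zero>\<^bsub>M\<^esub>"
    have "\<phi> y = \<zero>\<^bsub>N\<^esub>" if y: "y \<in> carrier N" for y
    proof -
      have "\<phi> y = i (j (\<phi> (i (j y))))" using jij(2) y pc by simp
      then show ?thesis using z jc[OF y] graded_hom_zero[OF gr ij(1)] by simp
    qed
    then show ?thesis by blast
  next
    assume z: "\<forall>x\<in>carrier M. j (\<phi> (i x)) = x"
    have "\<phi> y = y" if y: "y \<in> carrier N" for y
    proof -
      have "\<phi> y = i (j (\<phi> (i (j y))))" using jij(2) y pc by simp
      moreover have "j (\<phi> (i (j y))) = j y" using z jc[OF y] by blast
      ultimately show ?thesis using jij(2)[OF y] by metis
    qed
    then show ?thesis by blast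
  qed
qed

section \<open>Idempotents cut out indecomposable summands\<close>

definition unit :: "nat => nat => bit" where
  "unit v = (%i. of_bool (i = v))"

lemma sum_units: "finite {v. x v ~= 0} ==> (\<Sum>v\<in>{v. x v ~= 0}. unit v) = x"
proof
  fix i assume fin: "finite {v. x v ~= 0}"
  have "(\<Sum>v\<in>{v. x v ~= 0}. unit v) i = (\<Sum>v\<in>{v. x v ~= 0}. if v = i then 1 else 0)"
    unfolding sum_fun_apply unit_def by (intro sum.cong) auto
  also have "\<dots> = x i" using fin bit_neq_0[of "x i"] by auto
  finally show "(\<Sum>v\<in>{v. x v ~= 0}. unit v) i = x i" .
qed

locale grade_graph = graded_graph n vert edge src tgt f
  for n vert edge src tgt and f :: "nat => 'd::finite grade"
begin

definition part :: "(nat => nat => bit) => 'd grade => (nat => bit) set" where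
  "part E u = {x \<in> F u. app n E x \<in> B u}"

lemma part_quotient: "filtered_quotient F (part E)"
  by unfold_locales (auto simp: part_def app_add intro: F_zero F_add F_mono B_zero B_add B_mono)

lemma app_unit: "v < n ==> app n M (unit v) = (%i. M i v)"
proof
  fix i assume v: "v < n"
  have "(\<Sum>j<n. M i j * of_bool (j = v)) = (\<Sum>j<n. if j = v then M i v else 0)" by (intro sum.cong) auto
  then show "app n M (unit v) i = M i v" using v by (simp add: app_def unit_def)
qed

lemma unit_F: "v < n ==> vert v ==> f v \<le> u ==> unit v \<in> F u"
  by (auto simp: F_def unit_def)

lemma B_F_part: "endo E ==> x \<in> B u ==> x \<in> part E u"
  by (simp add: part_def B_F endo_B)

text \<open>An edge at an endpoint \<open>v\<close> is born strictly after \<open>v\<close>, so no boundary born by \<open>f v\<close> involves \<open>v\<close>.\<close>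

lemma boundary_avoids_birth: "x \<in> B (f v) ==> vert v ==> v < n ==> x v = 0"
proof -
  assume x: "x \<in> B (f v)" and v: "vert v" "v < n"
  show "x v = 0"
  proof (rule combos_induct[OF x[unfolded B_def]])
    fix e assume e: "e < n" "edge e" "f e \<le> f v"
    have "v ~= src e & v ~= tgt e"
    proof (rule ccontr)
      assume "\<not> (v ~= src e & v ~= tgt e)"
      then have "f e = f v" using ends[OF e(1,2)] e(3) by auto
      then have "e = v" using inj e(1) v(2) by (auto dest: inj_onD)
      then show False using vert_edge v e by blast
    qed
    then show "rel e v = 0" by (simp add: rel_def)
  qed (simp_all add: fun_simps)
qed

lemma summand_nonzero:
  assumes E: "endo E" and v: "v < n" "E v v = 1"
  shows "nonzero_module (qmod F (part E))"
  unfolding nonzero_module_def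
proof
  interpret P: filtered_quotient F "part E" by (rule part_quotient)
  assume z: "carrier P.Q = {\<zero>\<^bsub>P.Q\<^esub>}"
  have vv: "vert v" using endo_tri[OF E] v(2) unfolding tri_def by (metis zero_neq_one)
  then have "cosets (part E) (conc (f v) (unit v)) \<in> carrier P.Q"
    using v(1) by (intro P.carrierI P.conc_families unit_F) auto
  then have "\<forall>u. conc (f v) (unit v) u \<in> part E u" using z by (simp add: P.zero_Q P.cosets_eq_zero)
  then have "unit v \<in> part E (f v)" by (metis conc_def)
  then have "app n E (unit v) \<in> B (f v)" by (simp add: part_def)
  from boundary_avoids_birth[OF this vv v(1)] show False using v by (simp add: app_unit)
qed

text \<open>An endomorphism that is idempotent modulo the relations agrees there with all its iterated squares, one of which is 0.\<close>

lemma nilpotent_representative: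
  assumes K: "tri K" "!!i. K i i = 0"
    and resp: "!!u x. x \<in> part E u ==> app n K x \<in> part E u"
    and idem: "!!u x. x \<in> F u ==> app n K (app n K x) + app n K x \<in> part E u"
    and x: "x \<in> F u"
  shows "app n K x \<in> part E u"
proof -
  interpret P: filtered_quotient F "part E" by (rule part_quotient)
  have "\<forall>x\<in>F u. app n (sqs n k K) x + app n K x \<in> part E u" for k
  proof (induction k)
    case 0
    then show ?case using P.B_zero by simp
  next
    case (Suc k)
    let ?S = "sqs n k K"
    show ?case
    proof
      fix x assume x: "x \<in> F u"
      have Sx: "app n ?S x \<in> F u" by (rule tri_app[OF tri_sqs[OF K(1)] x])
      have 1: "app n ?S (app n ?S x) + app n K (app n ?S x) \<in> part E u" using Suc Sx by blast
      have 2: "app n K (app n ?S x + app n K x) \<in> part E u" using Suc x resp by blast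
      have 3: "app n K (app n K x) + app n K x \<in> part E u" by (rule idem[OF x])
      have eq: "app n (sqs n (Suc k) K) x + app n K x = (app n ?S (app n ?S x) + app n K (app n ?S x)) +
          (app n K (app n ?S x + app n K x) + (app n K (app n K x) + app n K x))"
        using bit_add_self by (simp add: app_mm app_add fun_eq_iff fun_simps add.assoc add.left_commute[of _ "app n K (app n ?S x) _"])
      then show "app n (sqs n (Suc k) K) x + app n K x \<in> part E u" using P.B_add[OF 1 P.B_add[OF 2 3]] by (simp only: eq)
    qed
  qed
  from this[of n] show ?thesis using x by (simp add: strict_nilpotent[OF K])
qed

text \<open>An idempotent is represented by a matrix \<open>\<Psi>\<close> absorbed by \<open>E\<close>. As \<open>\<Psi>\<close> does not separate \<open>E\<close>, either \<open>\<Psi>\<close> or \<open>E + \<Psi>\<close> has zero diagonal; both represent idempotents, so one of them represents 0.\<close>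

lemma summand_idempotents:
  assumes E: "endo E" "mm n E E = E" and sep: "!!M. endo M ==> \<not> separates M E"
  shows "trivial_idempotents (qmod F (part E))"
  unfolding trivial_idempotents_def
proof (intro ballI impI)
  interpret P: filtered_quotient F "part E" by (rule part_quotient)
  fix \<phi> assume \<phi>: "\<phi> \<in> graded_hom P.Q P.Q" "\<forall>x\<in>carrier P.Q. \<phi> (\<phi> x) = \<phi> x"
  define cl where "cl u x = cosets (part E) (conc u x)" for u x
  have cl_comp: "cl u x \<in> component P.Q u" "cl u x \<in> carrier P.Q" if "x \<in> F u" for u x
    using that by (auto simp: cl_def P.component_Q intro: P.carrierI P.conc_families)
  have cl_add: "cl u x \<oplus>\<^bsub>P.Q\<^esub> cl u y = cl u (x + y)" for u x y
    by (simp only: cl_def P.add_cosets conc_add)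
  have cl_eq: "cl u x = cl u y \<longleftrightarrow> x + y \<in> part E u" for u x y
  proof -
    have "(\<forall>w. conc u x w + conc u y w \<in> part E w) \<longleftrightarrow> x + y \<in> part E u" by (auto simp: conc_def P.B_zero)
    then show ?thesis by (simp add: cl_def P.cosets_eq_iff)
  qed
  have cl_zero: "cl u 0 = \<zero>\<^bsub>P.Q\<^esub>" for u by (simp add: cl_def P.zero_Q P.cosets_eq_zero conc_def P.B_zero)
  have shift: "single (grade_exponent (w - u)) 1 \<odot>\<^bsub>P.Q\<^esub> cl u x = cl w x" if "x \<in> F u" "u \<le> w" for u w x
  proof -
    have "exponent_grade (grade_exponent (w - u)) = w - u" using that(2) by (intro exponent_grade_grade_exponent) (simp add: less_eq_vec_def)
    then have "act (single (grade_exponent (w - u)) 1) (conc u x) = conc w x"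
      unfolding act_monomial by (auto simp: conc_def fun_eq_iff)
    then show ?thesis using that(1) by (simp add: cl_def P.smult_cosets P.conc_families)
  qed
  have hom_add: "\<phi> (x \<oplus>\<^bsub>P.Q\<^esub> y) = \<phi> x \<oplus>\<^bsub>P.Q\<^esub> \<phi> y" if "x \<in> carrier P.Q" "y \<in> carrier P.Q" for x y
    using \<phi>(1) that unfolding graded_hom_def by blast
  have hom_smult: "\<phi> (p \<odot>\<^bsub>P.Q\<^esub> x) = p \<odot>\<^bsub>P.Q\<^esub> \<phi> x" if "x \<in> carrier P.Q" for p x
    using \<phi>(1) that unfolding graded_hom_def by blast
  have hom_comp: "\<phi> x \<in> component P.Q u" if "x \<in> component P.Q u" for u x
    using \<phi>(1) that unfolding graded_hom_def by blast
  have hom_zero: "\<phi> \<zero>\<^bsub>P.Q\<^esub> = \<zero>\<^bsub>P.Q\<^esub>" by (rule graded_hom_zero[OF P.is_graded_module_Q P.is_graded_module_Q \<phi>(1)])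
  have "\<forall>v. \<exists>y. v < n & vert v --> y \<in> F (f v) & \<phi> (cl (f v) (unit v)) = cl (f v) y"
  proof
    fix v
    show "\<exists>y. v < n & vert v --> y \<in> F (f v) & \<phi> (cl (f v) (unit v)) = cl (f v) y"
    proof (cases "v < n & vert v")
      case True
      then have "\<phi> (cl (f v) (unit v)) \<in> component P.Q (f v)" by (intro hom_comp cl_comp unit_F) auto
      then show ?thesis unfolding P.component_Q cl_def by blast
    qed blast
  qed
  then obtain y where y: "!!v. v < n ==> vert v ==> y v \<in> F (f v) & \<phi> (cl (f v) (unit v)) = cl (f v) (y v)" by metis
  define \<Phi> where "\<Phi> i v = (if v < n & vert v then y v i else 0)" for i v
  have tri\<Phi>: "tri \<Phi>"
    unfolding tri_def
  proof (intro allI impI)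
    fix i v assume iv: "\<Phi> i v ~= 0"
    then have v: "v < n" "vert v" by (metis \<Phi>_def)+
    then have "y v i ~= 0" using iv by (simp add: \<Phi>_def)
    moreover have "y v \<in> F (f v)" using y[OF v] by blast
    ultimately show "i < n & v < n & vert i & vert v & f i \<le> f v" using v by (simp add: F_def)
  qed
  have rep: "\<phi> (cl u x) = cl u (app n \<Phi> x)" if x: "x \<in> F u" for u x
  proof -
    have "finite S ==> S \<subseteq> {v. v < n & vert v & f v \<le> u} ==>
        \<phi> (cl u (\<Sum>v\<in>S. unit v)) = cl u (app n \<Phi> (\<Sum>v\<in>S. unit v))" for S
    proof (induction S rule: finite_induct)
      case empty
      then show ?case by (simp add: cl_zero hom_zero)
    next
      case (insert v S)
      then have v: "v < n" "vert v" "f v \<le> u" by auto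
      have \<Phi>v: "app n \<Phi> (unit v) = y v" using v by (simp add: app_unit \<Phi>_def)
      have "\<phi> (cl u (unit v)) = cl u (y v)"
        using shift[OF unit_F[OF v(1,2) order_refl] v(3)] shift[OF _ v(3), of "y v"] y[OF v(1,2)]
          hom_smult[OF cl_comp(2)[OF unit_F[OF v(1,2) order_refl]]] by metis
      moreover have "(\<Sum>w\<in>S. unit w) \<in> F u" using insert.prems by (intro P.F_sum unit_F) auto
      ultimately have "\<phi> (cl u (unit v + (\<Sum>w\<in>S. unit w))) = cl u (y v + app n \<Phi> (\<Sum>w\<in>S. unit w))"
        using insert by (simp only: cl_add[symmetric] hom_add cl_comp(2) unit_F[OF v]) simp
      then show ?case using insert.hyps by (simp add: app_add \<Phi>v)
    qed
    from this[of "{v. x v ~= 0}"] have "\<phi> (cl u (\<Sum>v\<in>{v. x v ~= 0}. unit v)) = cl u (app n \<Phi> (\<Sum>v\<in>{v. x v ~= 0}. unit v))"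
      using x finite_subset[of "{v. x v ~= 0}" "{..<n}"] by (force simp: F_def)
    moreover have "finite {v. x v ~= 0}" using x finite_subset[of "{v. x v ~= 0}" "{..<n}"] by (force simp: F_def)
    ultimately show ?thesis by (simp add: sum_units)
  qed
  have part_F: "x \<in> F u" if "x \<in> part E u" for x u using that by (simp add: part_def)
  have \<Phi>_resp: "app n \<Phi> x \<in> part E u" if "x \<in> part E u" for x u
  proof -
    have "cl u x = cl u 0" using that by (simp add: cl_eq)
    then have "cl u (app n \<Phi> x) = cl u 0" using rep[OF part_F[OF that]] by (simp add: cl_zero hom_zero)
    then show ?thesis by (simp add: cl_eq)
  qed
  define \<Psi> where "\<Psi> = mm n (mm n E \<Phi>) E"
  have app\<Psi>: "app n \<Psi> x = app n E (app n \<Phi> (app n E x))" for x by (simp add: \<Psi>_def app_mm)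
  have EE: "app n E (app n E x) = app n E x" for x using E(2) by (simp add: app_mm[symmetric])
  have tri\<Psi>: "tri \<Psi>" unfolding \<Psi>_def by (intro tri_mm tri\<Phi> endo_tri E)
  have E_resp: "app n E x \<in> part E u" if "x \<in> part E u" for x u
    using that tri_app[OF endo_tri[OF E(1)]] by (simp add: part_def EE)
  have E_id: "x + app n E x \<in> part E u" if "x \<in> F u" for x u
    using that tri_app[OF endo_tri[OF E(1)] that] by (simp add: part_def app_add EE F_add B_zero)
  have \<Psi>_resp: "app n \<Psi> x \<in> part E u" if "x \<in> part E u" for x u
    unfolding app\<Psi> by (intro E_resp \<Phi>_resp that)
  have endo\<Psi>: "endo \<Psi>"
    unfolding endo_def
  proof (intro conjI allI impI tri\<Psi>)
    fix e assume "e < n" "edge e"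
    then have "rel e \<in> B (f e)" by (intro B_rel) auto
    then have "app n \<Phi> (app n E (rel e)) \<in> part E (f e)" by (intro \<Phi>_resp B_F_part endo_B E)
    then show "app n \<Psi> (rel e) \<in> B (f e)" by (simp add: app\<Psi> part_def)
  qed
  have rep\<Psi>: "\<phi> (cl u x) = cl u (app n \<Psi> x)" if x: "x \<in> F u" for u x
  proof -
    have Ex: "app n E x \<in> F u" by (rule tri_app[OF endo_tri[OF E(1)] x])
    have "cl u x = cl u (app n E x)" using E_id[OF x] by (simp add: cl_eq)
    moreover have "cl u (app n \<Phi> (app n E x)) = cl u (app n \<Psi> x)"
      using E_id[OF tri_app[OF tri\<Phi> Ex]] by (simp add: cl_eq app\<Psi>)
    ultimately show ?thesis using rep[OF Ex] by simp
  qed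
  have idem\<Psi>: "app n \<Psi> (app n \<Psi> x) + app n \<Psi> x \<in> part E u" if x: "x \<in> F u" for u x
  proof -
    have \<Psi>x: "app n \<Psi> x \<in> F u" by (rule tri_app[OF tri\<Psi> x])
    have "\<phi> (\<phi> (cl u x)) = \<phi> (cl u x)" using \<phi>(2) cl_comp(2)[OF x] by blast
    then have "cl u (app n \<Psi> (app n \<Psi> x)) = cl u (app n \<Psi> x)" by (simp only: rep\<Psi>[OF x] rep\<Psi>[OF \<Psi>x])
    then show ?thesis by (simp only: cl_eq)
  qed
  have dec: "\<exists>S g. finite S & (\<forall>u\<in>S. g u \<in> F u) & z = (\<Oplus>\<^bsub>P.Q\<^esub>u\<in>S. cl u (g u))" if zc: "z \<in> carrier P.Q" for z
  proof -
    obtain \<zeta> where \<zeta>: "z = cosets (part E) \<zeta>" "\<zeta> \<in> families F" using zc by (rule P.carrierE)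
    have S: "finite {u. \<zeta> u ~= 0}" "!!u. \<zeta> u \<in> F u" using \<zeta>(2) by (auto simp: families_def)
    have "z = cosets (part E) (\<Sum>u\<in>{u. \<zeta> u ~= 0}. conc u (\<zeta> u))"
      using \<zeta>(1) families_decompose[OF \<zeta>(2)] by simp
    also have "\<dots> = (\<Oplus>\<^bsub>P.Q\<^esub>u\<in>{u. \<zeta> u ~= 0}. cl u (\<zeta> u))"
      unfolding cl_def using S by (intro P.finsum_cosets[symmetric]) (auto intro: P.conc_families)
    finally show ?thesis using S by blast
  qed
  interpret ab: abelian_group P.Q by (rule P.abelian_group_Q)
  have phi_sum: "\<phi> (\<Oplus>\<^bsub>P.Q\<^esub>u\<in>S. cl u (g u)) = (\<Oplus>\<^bsub>P.Q\<^esub>u\<in>S. \<phi> (cl u (g u)))" if "finite S" "\<forall>u\<in>S. g u \<in> F u" for S g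
    by (rule graded_hom_finsum[OF P.is_graded_module_Q P.is_graded_module_Q \<phi>(1) that(1)]) (use that(2) cl_comp(2) in blast)
  have diag0: "\<Psi> v v = 0" if "E v v = 0" for v
    using that by (simp add: \<Psi>_def diag_mm tri_mm endo_tri[OF E(1)] tri\<Phi>)
  have out: "\<Psi> v v = 0" "E v v = 0" if "\<not> v < n" for v
    using that tri\<Psi> endo_tri[OF E(1)] unfolding tri_def by blast+
  have "(\<forall>v<n. E v v = 1 --> \<Psi> v v = 0) | (\<forall>v<n. E v v = 1 --> \<Psi> v v = 1)"
    using sep[OF endo\<Psi>] unfolding separates_def by (metis bit_neq_0)
  then show "(\<forall>x\<in>carrier P.Q. \<phi> x = \<zero>\<^bsub>P.Q\<^esub>) | (\<forall>x\<in>carrier P.Q. \<phi> x = x)"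
  proof
    assume d: "\<forall>v<n. E v v = 1 --> \<Psi> v v = 0"
    then have "\<Psi> v v = 0" for v using diag0[of v] out[of v] bit_neq_0[of "E v v"] by metis
    then have nil: "app n \<Psi> x \<in> part E u" if "x \<in> F u" for x u
      using nilpotent_representative[OF tri\<Psi> _ \<Psi>_resp idem\<Psi> that] by blast
    have z: "\<phi> (cl u x) = \<zero>\<^bsub>P.Q\<^esub>" if "x \<in> F u" for x u
      using nil[OF that] rep\<Psi>[OF that] cl_eq[of u "app n \<Psi> x" 0] by (simp add: cl_zero)
    have "\<phi> x = \<zero>\<^bsub>P.Q\<^esub>" if x: "x \<in> carrier P.Q" for x
    proof -
      obtain S g where S: "finite S" "\<forall>u\<in>S. g u \<in> F u" "x = (\<Oplus>\<^bsub>P.Q\<^esub>u\<in>S. cl u (g u))" using dec[OF x] by blast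
      have "\<phi> x = (\<Oplus>\<^bsub>P.Q\<^esub>u\<in>S. \<phi> (cl u (g u)))" unfolding S(3) by (rule phi_sum[OF S(1,2)])
      also have "\<dots> = (\<Oplus>\<^bsub>P.Q\<^esub>u\<in>S. \<zero>\<^bsub>P.Q\<^esub>)" using S(2) z by (intro ab.finsum_cong') auto
      finally show ?thesis by (simp add: ab.finsum_zero)
    qed
    then show ?thesis by blast
  next
    assume d: "\<forall>v<n. E v v = 1 --> \<Psi> v v = 1"
    let ?K = "E + \<Psi>"
    have K0: "?K v v = 0" for v
      using d diag0[of v] out[of v] bit_neq_0[of "E v v"] unfolding fun_simps by (cases "v < n"; cases "E v v = 0") auto
    have triK: "tri ?K" by (intro tri_add endo_tri E tri\<Psi>)
    have respK: "app n ?K x \<in> part E u" if "x \<in> part E u" for x u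
      unfolding app_plus by (intro P.B_add E_resp \<Psi>_resp that)
    have E\<Psi>: "app n E (app n \<Psi> x) = app n \<Psi> x" "app n \<Psi> (app n E x) = app n \<Psi> x" for x by (simp_all add: app\<Psi> EE)
    have idemK: "app n ?K (app n ?K x) + app n ?K x \<in> part E u" if x: "x \<in> F u" for u x
    proof -
      have "app n ?K (app n ?K x) + app n ?K x = app n \<Psi> (app n \<Psi> x) + app n \<Psi> x"
        by (rule ext) (simp add: app_plus app_add E\<Psi> EE fun_simps ac_simps add.left_commute)
      then show ?thesis using idem\<Psi>[OF x] by simp
    qed
    have nil: "app n ?K x \<in> part E u" if "x \<in> F u" for x u
      using nilpotent_representative[OF triK K0 respK idemK that] by blast
    have z: "\<phi> (cl u x) = cl u x" if x: "x \<in> F u" for x u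
    proof -
      have eq: "app n \<Psi> x + x = app n ?K x + (x + app n E x)"
        by (rule ext) (simp add: app_plus fun_simps ac_simps)
      then have "app n \<Psi> x + x \<in> part E u" using P.B_add[OF nil[OF x] E_id[OF x]] by (simp only: eq)
      then show ?thesis unfolding rep\<Psi>[OF x] by (simp only: cl_eq)
    qed
    have "\<phi> x = x" if x: "x \<in> carrier P.Q" for x
    proof -
      obtain S g where S: "finite S" "\<forall>u\<in>S. g u \<in> F u" "x = (\<Oplus>\<^bsub>P.Q\<^esub>u\<in>S. cl u (g u))" using dec[OF x] by blast
      have "\<phi> x = (\<Oplus>\<^bsub>P.Q\<^esub>u\<in>S. \<phi> (cl u (g u)))" unfolding S(3) by (rule phi_sum[OF S(1,2)])
      also have "\<dots> = (\<Oplus>\<^bsub>P.Q\<^esub>u\<in>S. cl u (g u))" using S(2) z cl_comp(2) by (intro ab.finsum_cong') auto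
      finally show ?thesis by (simp add: S(3))
    qed
    then show ?thesis by blast
  qed
qed

end

section \<open>Cokernels of graded matrices\<close>

lemma grade_exponent_exponent_grade: "grade_exponent (exponent_grade \<alpha>) = \<alpha>"
  using exponent_grade_grade_exponent[OF exponent_grade_nonneg, of \<alpha>] by (simp only: exponent_grade_inj)

lemma poly_mapping_expand: "(v :: 'a \<Rightarrow>\<^sub>0 'b::comm_monoid_add) = (\<Sum>i\<in>keys v. single i (lookup v i))"
proof (rule poly_mapping_eqI)
  fix j
  have "lookup (\<Sum>i\<in>keys v. single i (lookup v i)) j =
      (\<Sum>i\<in>keys v. if i = j then lookup v j else 0)"
    unfolding lookup_sum by (intro sum.cong) (auto simp: lookup_single when_def)
  also have "\<dots> = lookup v j" by (simp add: in_keys_iff)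
  finally show "lookup v j = lookup (\<Sum>i\<in>keys v. single i (lookup v i)) j" ..
qed

lemma lookup_scale: "lookup (Poly_Mapping.map ((*) p) v) i = (p :: 'b::mult_zero) * lookup v i"
  by (simp add: Poly_Mapping.map.rep_eq when_def)

abbreviation free_carrier :: "'d::finite grade list => (nat \<Rightarrow>\<^sub>0 'd polynomial) set" where
  "free_carrier gs \<equiv> carrier (free_module gs)"

abbreviation basis_monomial :: "nat => 'd exponent => nat \<Rightarrow>\<^sub>0 'd polynomial" where
  "basis_monomial i \<beta> \<equiv> single i (single \<beta> 1)"

lemma free_induct:
  fixes gs :: "'d::finite grade list"
  assumes v: "v \<in> free_carrier gs" and 0: "Q 0" and add: "!!v w. Q v ==> Q w ==> Q (v + w)"
    and base: "!!i \<beta>. i < length gs ==> Q (basis_monomial i \<beta>)"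
  shows "Q v"
proof -
  have 1: "Q (single i p)" if i: "i < length gs" for i p
  proof -
    have "single i p = (\<Sum>\<beta>\<in>keys p. basis_monomial i \<beta>)"
    proof -
      have "single i (sum g T) = (\<Sum>\<beta>\<in>T. single i (g \<beta>))" for g :: "'d exponent => 'd polynomial" and T
        by (induction T rule: infinite_finite_induct) (auto simp: single_add)
      from this[of "%\<beta>. single \<beta> 1" "keys p"] show ?thesis by (simp only: polynomial_sum[symmetric])
    qed
    moreover have "finite T ==> Q (\<Sum>\<beta>\<in>T. basis_monomial i \<beta>)" for T
      by (induction T rule: finite_induct) (auto intro: 0 add base i)
    ultimately show ?thesis by simp
  qed
  have "finite T ==> T \<subseteq> {..<length gs} ==> Q (\<Sum>i\<in>T. single i (lookup v i))" for T
    by (induction T rule: finite_induct) (auto intro: 0 add 1)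
  from this[of "keys v"] show ?thesis
    using v poly_mapping_expand[of v] by (simp add: free_module_def)
qed

lemma free_zero: "0 \<in> free_carrier gs"
  by (simp add: free_module_def)

lemma free_add: "v \<in> free_carrier gs ==> w \<in> free_carrier gs ==> v + w \<in> free_carrier gs"
  using keys_add[of v w] by (auto simp: free_module_def)

lemma free_basis: "i < length gs ==> single i p \<in> free_carrier gs"
  by (simp add: free_module_def)

lemma free_scale: "v \<in> free_carrier gs ==> Poly_Mapping.map ((*) p) v \<in> free_carrier gs"
proof -
  have "keys (Poly_Mapping.map ((*) p) v) \<subseteq> keys v" by (auto simp: in_keys_iff lookup_scale)
  then show "v \<in> free_carrier gs ==> ?thesis" by (auto simp: free_module_def)
qed

definition rows :: "'d::finite grade list => 'd grade => (nat => bit) set" where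
  "rows gs u = {x. \<forall>i. x i ~= 0 --> i < length gs & gs ! i \<le> u}"

text \<open>At grade \<open>u\<close> a homogeneous element of a free module is a scalar vector, because the monomials are determined by the grades.\<close>

definition coordinates :: "'d::finite grade list => (nat \<Rightarrow>\<^sub>0 'd polynomial) => 'd grade => nat => bit" where
  "coordinates gs v = (%u i. if i < length gs & gs ! i \<le> u
     then lookup (lookup v i) (grade_exponent (u - gs ! i)) else 0)"

lemma zero_at: "(0 :: 'g => nat => bit) u = 0"
  by (simp only: zero_fun_apply)

lemma coordinates_add: "coordinates gs (v + w) = coordinates gs v + coordinates gs w"
  by (auto simp: coordinates_def fun_eq_iff fun_simps lookup_add)

lemma coordinates_zero: "coordinates gs 0 = 0"
  by (auto simp: coordinates_def fun_eq_iff fun_simps)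

lemma coordinates_basis:
  assumes "i < length gs"
  shows "coordinates gs (basis_monomial i \<beta>) = conc (gs ! i + exponent_grade \<beta>) (unit i)"
proof (intro ext)
  fix u j
  have "grade_exponent (u - gs ! i) = \<beta> \<longleftrightarrow> u = gs ! i + exponent_grade \<beta>" if "gs ! i \<le> u"
  proof -
    have "0 \<le> u - gs ! i" using that by (simp add: less_eq_vec_def)
    then have "exponent_grade (grade_exponent (u - gs ! i)) = u - gs ! i" by (rule exponent_grade_grade_exponent)
    then show ?thesis using exponent_grade_inj[of "grade_exponent (u - gs ! i)" \<beta>] by (metis add_diff_cancel_left' diff_add_cancel add.commute)
  qed
  moreover have "gs ! i \<le> gs ! i + exponent_grade \<beta>" by (simp add: less_eq_vec_def exponent_grade_def)
  ultimately show "coordinates gs (basis_monomial i \<beta>) u j = conc (gs ! i + exponent_grade \<beta>) (unit i) u j"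
    using assms by (auto simp: coordinates_def conc_def unit_def lookup_single when_def fun_simps grade_exponent_exponent_grade)
qed

lemma rows_quotient_laws: "0 \<in> rows gs u" "x \<in> rows gs u ==> y \<in> rows gs u ==> x + y \<in> rows gs u"
  "x \<in> rows gs u ==> u \<le> v ==> x \<in> rows gs v"
proof -
  show "0 \<in> rows gs u" by (simp add: rows_def fun_simps)
  show "x \<in> rows gs u ==> y \<in> rows gs u ==> x + y \<in> rows gs u" unfolding rows_def fun_simps by (auto) (metis add.right_neutral add.left_neutral)+
  show "x \<in> rows gs u ==> u \<le> v ==> x \<in> rows gs v" unfolding rows_def by (auto intro: order_trans)
qed

lemma families_rows_add: "\<zeta> \<in> families (rows gs) ==> \<eta> \<in> families (rows gs) ==> \<zeta> + \<eta> \<in> families (rows gs)"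
proof -
  assume a: "\<zeta> \<in> families (rows gs)" "\<eta> \<in> families (rows gs)"
  have "{u. (\<zeta> + \<eta>) u ~= 0} \<subseteq> {u. \<zeta> u ~= 0} \<union> {u. \<eta> u ~= 0}" by (auto simp: plus_fun_apply[of \<zeta> \<eta>])
  then have "finite {u. (\<zeta> + \<eta>) u ~= 0}" using a by (auto simp: families_def intro: finite_subset)
  then show ?thesis using a unfolding families_def by (auto simp: plus_fun_apply[of \<zeta> \<eta>] intro: rows_quotient_laws)
qed

lemma conc_families: "x \<in> rows gs w ==> conc w x \<in> families (rows gs)"
proof -
  assume "x \<in> rows gs w"
  moreover have "{u. conc w x u ~= 0} \<subseteq> {w}" by (auto simp: conc_def)
  ultimately show ?thesis unfolding families_def by (auto simp: conc_def rows_quotient_laws intro: finite_subset)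
qed

lemma coordinates_families: "v \<in> free_carrier gs ==> coordinates gs v \<in> families (rows gs)"
proof (erule free_induct)
  show "coordinates gs 0 \<in> families (rows gs)"
    by (simp add: coordinates_zero families_def fun_simps rows_quotient_laws(1)[unfolded zero_fun_def] zero_fun_def)
next
  fix i \<beta> assume i: "i < length gs"
  have "gs ! i \<le> gs ! i + exponent_grade \<beta>" by (simp add: less_eq_vec_def exponent_grade_def)
  then show "coordinates gs (basis_monomial i \<beta>) \<in> families (rows gs)"
    unfolding coordinates_basis[OF i] using i by (intro conc_families) (simp add: rows_def unit_def)
qed (simp add: coordinates_add families_rows_add)

lemma coordinates_scale:
  fixes gs :: "'d::finite grade list"
  assumes "v \<in> free_carrier gs"
  shows "coordinates gs (Poly_Mapping.map ((*) p) v) = act p (coordinates gs v)"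
proof -
  have two: "(x :: nat => bit) + x = 0" for x by simp
  have sum_c: "coordinates gs (sum g S) = (\<Sum>s\<in>S. coordinates gs (g s))" for g and S :: "'d exponent set"
    by (induction S rule: infinite_finite_induct) (auto simp: coordinates_add coordinates_zero)
  let ?m = "%\<alpha>. Poly_Mapping.map ((*) (single \<alpha> (1::bit)))"
  have mono: "coordinates gs (?m \<alpha> v) = act (single \<alpha> 1) (coordinates gs v)" for \<alpha>
    using assms
  proof (rule free_induct[where Q = "%v. coordinates gs (?m \<alpha> v) = act (single \<alpha> 1) (coordinates gs v)"])
    have "?m \<alpha> (0 :: nat \<Rightarrow>\<^sub>0 'd polynomial) = 0" by (rule poly_mapping_eqI) (simp add: lookup_scale)
    then show "coordinates gs (?m \<alpha> 0) = act (single \<alpha> 1) (coordinates gs 0)"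
      by (simp only: coordinates_zero act_zero_right)
  next
    fix v w :: "nat \<Rightarrow>\<^sub>0 'd polynomial"
    have "?m \<alpha> (v + w) = ?m \<alpha> v + ?m \<alpha> w"
      by (rule poly_mapping_eqI) (simp add: lookup_scale lookup_add distrib_left)
    moreover assume "coordinates gs (?m \<alpha> v) = act (single \<alpha> 1) (coordinates gs v)"
      "coordinates gs (?m \<alpha> w) = act (single \<alpha> 1) (coordinates gs w)"
    ultimately show "coordinates gs (?m \<alpha> (v + w)) = act (single \<alpha> 1) (coordinates gs (v + w))"
      by (simp only: coordinates_add act_add_right)
  next
    fix i \<beta> assume i: "i < length gs"
    have "?m \<alpha> (basis_monomial i \<beta>) = basis_monomial i (\<beta> + \<alpha>)"
      by (rule poly_mapping_eqI) (simp add: lookup_scale lookup_single when_def mult_single add.commute)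
    then show "coordinates gs (?m \<alpha> (basis_monomial i \<beta>)) = act (single \<alpha> 1) (coordinates gs (basis_monomial i \<beta>))"
      by (simp only: coordinates_basis[OF i] act_conc exponent_grade_add add.assoc)
  qed
  have "Poly_Mapping.map ((*) p) v = (\<Sum>\<alpha>\<in>keys p. Poly_Mapping.map ((*) (single \<alpha> 1)) v)"
  proof (rule poly_mapping_eqI)
    fix i
    have "p * lookup v i = (\<Sum>\<alpha>\<in>keys p. single \<alpha> 1 * lookup v i)"
      by (subst (1) polynomial_sum) (simp only: sum_distrib_right)
    then show "lookup (Poly_Mapping.map ((*) p) v) i = lookup (\<Sum>\<alpha>\<in>keys p. Poly_Mapping.map ((*) (single \<alpha> 1)) v) i"
      by (simp only: lookup_sum lookup_scale)
  qed
  then have "coordinates gs (Poly_Mapping.map ((*) p) v) = (\<Sum>\<alpha>\<in>keys p. act (single \<alpha> 1) (coordinates gs v))"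
    by (simp only: sum_c mono)
  also have "\<dots> = act (\<Sum>\<alpha>\<in>keys p. single \<alpha> 1) (coordinates gs v)" by (simp only: act_sum_left[OF two])
  finally show ?thesis by (simp only: polynomial_sum[symmetric])
qed

lemma coordinates_inj:
  assumes "v \<in> free_carrier gs" "w \<in> free_carrier gs" "coordinates gs v = coordinates gs w"
  shows "v = w"
proof (intro poly_mapping_eqI)
  fix i \<beta>
  show "lookup (lookup v i) \<beta> = lookup (lookup w i) \<beta>"
  proof (cases "i < length gs")
    case True
    have "gs ! i \<le> gs ! i + exponent_grade \<beta>" by (simp add: less_eq_vec_def exponent_grade_def)
    then have "coordinates gs x (gs ! i + exponent_grade \<beta>) i = lookup (lookup x i) \<beta>" for x
      using True by (simp add: coordinates_def grade_exponent_exponent_grade)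
    then show ?thesis using assms(3) by metis
  next
    case False
    then have "i \<notin> keys v" "i \<notin> keys w" using assms by (auto simp: free_module_def)
    then show ?thesis by (simp add: in_keys_iff)
  qed
qed

definition column :: "'d graded_matrix => nat => nat => bit" where
  "column P j = (%i. if i < length (row_grades P) then entry P i j else 0)"

definition col_span :: "'d::finite graded_matrix => 'd grade => (nat => bit) set" where
  "col_span P u = {%i. \<Sum>j<length (col_grades P). c j * column P j i | c. \<forall>j. c j ~= 0 --> j < length (col_grades P) & col_grades P ! j \<le> u}"

lemma col_span_zero: "0 \<in> col_span P u"
  unfolding col_span_def by (intro CollectI exI[of _ "%_. 0"]) (auto simp: fun_eq_iff fun_simps)

lemma col_span_add: "x \<in> col_span P u ==> y \<in> col_span P u ==> x + y \<in> col_span P u"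
proof -
  assume "x \<in> col_span P u" "y \<in> col_span P u"
  then obtain c d where c: "x = (%i. \<Sum>j<length (col_grades P). c j * column P j i)" "\<forall>j. c j ~= 0 --> j < length (col_grades P) & col_grades P ! j \<le> u"
    and d: "y = (%i. \<Sum>j<length (col_grades P). d j * column P j i)" "\<forall>j. d j ~= 0 --> j < length (col_grades P) & col_grades P ! j \<le> u"
    unfolding col_span_def by blast
  have "x + y = (%i. \<Sum>j<length (col_grades P). (c j + d j) * column P j i)"
    unfolding c d by (simp add: fun_eq_iff fun_simps distrib_right sum.distrib)
  moreover have "\<forall>j. c j + d j ~= 0 --> j < length (col_grades P) & col_grades P ! j \<le> u"
    using c(2) d(2) by (metis add.left_neutral)
  ultimately show ?thesis unfolding col_span_def by (intro CollectI exI[of _ "%j. c j + d j"]) auto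
qed

lemma col_span_mono: "x \<in> col_span P u ==> u \<le> v ==> x \<in> col_span P v"
proof -
  assume x: "x \<in> col_span P u" and uv: "u \<le> v"
  obtain c where c: "x = (%i. \<Sum>j<length (col_grades P). c j * column P j i)" "\<forall>j. c j ~= 0 --> j < length (col_grades P) & col_grades P ! j \<le> u"
    using x unfolding col_span_def by blast
  have "\<forall>j. c j ~= 0 --> j < length (col_grades P) & col_grades P ! j \<le> v" using c(2) uv order_trans by blast
  then show ?thesis unfolding col_span_def c(1) by (intro CollectI exI[of _ c]) auto
qed

lemma col_span_column: "j < length (col_grades P) ==> col_grades P ! j \<le> u ==> column P j \<in> col_span P u"
proof -
  assume j: "j < length (col_grades P)" "col_grades P ! j \<le> u"
  have "(\<Sum>k<length (col_grades P). of_bool (k = j) * column P k i) = (\<Sum>k<length (col_grades P). if k = j then column P j i else 0)" for i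
    by (intro sum.cong) auto
  then have "column P j = (%i. \<Sum>k<length (col_grades P). of_bool (k = j) * column P k i)" using j by (simp add: fun_eq_iff)
  then show ?thesis unfolding col_span_def using j by (intro CollectI exI[of _ "%k. of_bool (k = j)"]) auto
qed

lemma col_span_induct:
  assumes "x \<in> col_span P u" "Q 0" "!!y z. Q y ==> Q z ==> Q (y + z)"
    "!!j. j < length (col_grades P) ==> col_grades P ! j \<le> u ==> Q (column P j)"
  shows "Q x"
proof -
  obtain c where c: "x = (%i. \<Sum>j<length (col_grades P). c j * column P j i)" "\<forall>j. c j ~= 0 --> j < length (col_grades P) & col_grades P ! j \<le> u"
    using assms(1) unfolding col_span_def by blast
  have "finite T ==> Q (\<Sum>j\<in>T. if c j = 0 then 0 else column P j)" for T
    by (induction T rule: finite_induct) (use c(2) assms(2-) in auto)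
  moreover have "x = (\<Sum>j<length (col_grades P). if c j = 0 then 0 else column P j)"
  proof
    fix i
    have "c j * column P j i = (if c j = 0 then 0 else column P j) i" for j
      using bit_neq_0[of "c j"] by (auto simp: fun_simps)
    then show "x i = (\<Sum>j<length (col_grades P). if c j = 0 then 0 else column P j) i" unfolding c(1) by (simp only: sum_fun_apply)
  qed
  ultimately show ?thesis by simp
qed

lemma matrix_map_add: "matrix_map P (v + w) = matrix_map P v + matrix_map P w"
  by (simp add: matrix_map_def lookup_add distrib_left sum.distrib single_add)

lemma matrix_map_free: "matrix_map P v \<in> free_carrier (row_grades P)"
proof -
  have "finite T ==> T \<subseteq> {..<length (row_grades P)} ==> (\<Sum>i\<in>T. single i (g i)) \<in> free_carrier (row_grades P)" for T g
    by (induction T rule: finite_induct) (auto intro: free_zero free_add free_basis)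
  from this[OF finite_lessThan order_refl] show ?thesis unfolding matrix_map_def .
qed

lemma coordinates_matrix_map_basis:
  assumes P: "valid_graded_matrix P" and j: "j < length (col_grades P)"
  shows "coordinates (row_grades P) (matrix_map P (basis_monomial j \<beta>)) = conc (col_grades P ! j + exponent_grade \<beta>) (column P j)"
proof -
  let ?gs = "row_grades P" and ?w = "col_grades P ! j + exponent_grade \<beta>"
  have sum_c: "coordinates ?gs (sum g S) = (\<Sum>s\<in>S. coordinates ?gs (g s))" for g and S :: "nat set"
    by (induction S rule: infinite_finite_induct) (auto simp: coordinates_add coordinates_zero)
  have "(\<Sum>k<length (col_grades P). poly_entry P i k * lookup (basis_monomial j \<beta>) k) =
      (\<Sum>k<length (col_grades P). if k = j then poly_entry P i j * single \<beta> 1 else 0)" for i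
    by (intro sum.cong) (auto simp: lookup_single when_def)
  then have "matrix_map P (basis_monomial j \<beta>) = (\<Sum>i<length ?gs. single i (poly_entry P i j * single \<beta> 1))"
    using j by (simp add: matrix_map_def)
  then have "coordinates ?gs (matrix_map P (basis_monomial j \<beta>)) =
      (\<Sum>i<length ?gs. coordinates ?gs (single i (poly_entry P i j * single \<beta> 1)))"
    by (simp only: sum_c)
  also have "\<dots> = (\<Sum>i<length ?gs. conc ?w (%k. entry P i j * unit i k))"
  proof (intro sum.cong refl)
    fix i assume "i \<in> {..<length ?gs}"
    then have i: "i < length ?gs" by simp
    show "coordinates ?gs (single i (poly_entry P i j * single \<beta> 1)) = conc ?w (%k. entry P i j * unit i k)"
    proof (cases "entry P i j = 0")
      case True
      then show ?thesis by (simp add: poly_entry_def coordinates_zero zero_fun_def conc_def fun_eq_iff)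
    next
      case False
      then have e: "entry P i j = 1" and le: "?gs ! i \<le> col_grades P ! j"
        using bit_neq_0 P i j by (auto simp: valid_graded_matrix_def)
      have "0 \<le> col_grades P ! j - ?gs ! i" using le by (simp add: less_eq_vec_def)
      then have "?gs ! i + exponent_grade (grade_exponent (col_grades P ! j - ?gs ! i) + \<beta>) = ?w"
        by (simp add: exponent_grade_add exponent_grade_grade_exponent)
      then show ?thesis using coordinates_basis[OF i] by (simp add: poly_entry_def e mult_single)
    qed
  qed
  also have "\<dots> = conc ?w (\<Sum>i<length ?gs. (%k. entry P i j * unit i k))"
  proof -
    have "finite T ==> (\<Sum>i\<in>T. conc ?w (g i)) = conc ?w (\<Sum>i\<in>T. g i)" for T :: "nat set" and g
      by (induction T rule: finite_induct) (auto simp: conc_add conc_zero)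
    from this[OF finite_lessThan] show ?thesis .
  qed
  also have "(\<Sum>i<length ?gs. (%k. entry P i j * unit i k)) = column P j"
  proof
    fix k
    have "(\<Sum>i<length ?gs. entry P i j * unit i k) = (\<Sum>i<length ?gs. if i = k then entry P k j else 0)"
      by (intro sum.cong) (auto simp: unit_def)
    then show "(\<Sum>i<length ?gs. (%k. entry P i j * unit i k)) k = column P j k" by (simp add: sum_fun_apply column_def)
  qed
  finally show ?thesis .
qed

text \<open>Homogeneous components of an element of the image are images of homogeneous elements; in coordinates these are combinations of the columns already born.\<close>

lemma coordinates_image:
  assumes P: "valid_graded_matrix P" and v: "v \<in> free_carrier (row_grades P)"
  shows "v \<in> matrix_map P ` free_carrier (col_grades P) \<longleftrightarrow> (\<forall>u. coordinates (row_grades P) v u \<in> col_span P u)"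
proof
  let ?c = "coordinates (row_grades P)" and ?hs = "col_grades P"
  assume "v \<in> matrix_map P ` free_carrier ?hs"
  then obtain w where w: "v = matrix_map P w" "w \<in> free_carrier ?hs" by blast
  have "\<forall>u. ?c (matrix_map P w) u \<in> col_span P u"
  proof (rule free_induct[OF w(2), where Q = "%w. \<forall>u. ?c (matrix_map P w) u \<in> col_span P u"])
    have "matrix_map P 0 = 0" by (simp add: matrix_map_def)
    then show "\<forall>u. ?c (matrix_map P 0) u \<in> col_span P u" by (simp add: coordinates_zero zero_at col_span_zero)
  next
    fix j \<beta> assume j: "j < length ?hs"
    have "col_grades P ! j \<le> col_grades P ! j + exponent_grade \<beta>" by (simp add: less_eq_vec_def exponent_grade_def)
    then show "\<forall>u. ?c (matrix_map P (basis_monomial j \<beta>)) u \<in> col_span P u"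
      unfolding coordinates_matrix_map_basis[OF P j] by (auto simp: conc_def col_span_zero intro: col_span_column j)
  next
    fix x y assume "\<forall>u. ?c (matrix_map P x) u \<in> col_span P u" "\<forall>u. ?c (matrix_map P y) u \<in> col_span P u"
    then show "\<forall>u. ?c (matrix_map P (x + y)) u \<in> col_span P u"
      unfolding matrix_map_add coordinates_add plus_fun_apply[of "?c (matrix_map P x)"] by (blast intro: col_span_add)
  qed
  then show "\<forall>u. ?c v u \<in> col_span P u" unfolding w(1) .
next
  let ?c = "coordinates (row_grades P)" and ?hs = "col_grades P"
  assume im: "\<forall>u. ?c v u \<in> col_span P u"
  define R where "R \<zeta> \<longleftrightarrow> (\<exists>w\<in>free_carrier ?hs. ?c (matrix_map P w) = \<zeta>)" for \<zeta>
  have m0: "matrix_map P 0 = 0" by (simp add: matrix_map_def)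
  have R0: "R 0" unfolding R_def using m0 free_zero coordinates_zero by (intro bexI[of _ 0]) auto
  have Radd: "R (\<zeta> + \<eta>)" if R: "R \<zeta>" "R \<eta>" for \<zeta> \<eta>
  proof -
    obtain w w' where "w \<in> free_carrier ?hs" "?c (matrix_map P w) = \<zeta>" "w' \<in> free_carrier ?hs" "?c (matrix_map P w') = \<eta>"
      using R unfolding R_def by blast
    then show ?thesis unfolding R_def by (intro bexI[of _ "w + w'"]) (auto simp: matrix_map_add coordinates_add intro: free_add)
  qed
  have Rsp: "R (conc u x)" if "x \<in> col_span P u" for u x
    using that
  proof (rule col_span_induct[where Q = "%x. R (conc u x)"])
    show "R (conc u 0)" by (simp only: conc_zero R0)
    show "R (conc u (y + z))" if "R (conc u y)" "R (conc u z)" for y z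
      using Radd that by (simp only: conc_add)
    fix j assume j: "j < length ?hs" "?hs ! j \<le> u"
    have "0 \<le> u - ?hs ! j" using j(2) by (simp add: less_eq_vec_def)
    then have "?hs ! j + exponent_grade (grade_exponent (u - ?hs ! j)) = u" by (simp add: exponent_grade_grade_exponent)
    then have "?c (matrix_map P (basis_monomial j (grade_exponent (u - ?hs ! j)))) = conc u (column P j)"
      using coordinates_matrix_map_basis[OF P j(1)] by metis
    then show "R (conc u (column P j))" unfolding R_def using free_basis[OF j(1)] by blast
  qed
  have "finite T ==> R (\<Sum>u\<in>T. conc u (?c v u))" for T
    by (induction T rule: finite_induct) (auto intro: R0 Radd Rsp im[rule_format])
  moreover have fam: "?c v \<in> families (rows (row_grades P))" by (rule coordinates_families[OF v])
  moreover have "finite {u. ?c v u ~= 0}" using fam by (simp add: families_def)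
  ultimately have "R (\<Sum>u\<in>{u. ?c v u ~= 0}. conc u (?c v u))" by blast
  then have "R (?c v)" by (simp only: families_decompose[OF fam, symmetric])
  then obtain w where "w \<in> free_carrier ?hs" "?c (matrix_map P w) = ?c v" unfolding R_def by blast
  then show "v \<in> matrix_map P ` free_carrier ?hs" using coordinates_inj[OF matrix_map_free v] by blast
qed

lemma coordinates_surj:
  assumes "\<zeta> \<in> families (rows gs)"
  shows "\<exists>v\<in>free_carrier gs. coordinates gs v = \<zeta>"
proof -
  define R where "R \<zeta> \<longleftrightarrow> (\<exists>w\<in>free_carrier gs. coordinates gs w = \<zeta>)" for \<zeta>
  have R0: "R 0" unfolding R_def using free_zero coordinates_zero by blast
  have Radd: "R (\<zeta> + \<eta>)" if "R \<zeta>" "R \<eta>" for \<zeta> \<eta>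
    using that unfolding R_def by (metis coordinates_add free_add)
  have Runit: "R (conc u (unit i))" if i: "i < length gs" "gs ! i \<le> u" for i u
  proof -
    have "0 \<le> u - gs ! i" using i(2) by (simp add: less_eq_vec_def)
    then have "gs ! i + exponent_grade (grade_exponent (u - gs ! i)) = u" by (simp add: exponent_grade_grade_exponent)
    then show ?thesis unfolding R_def using coordinates_basis[OF i(1), of "grade_exponent (u - gs ! i)"] free_basis[OF i(1)] by metis
  qed
  have Rsp: "R (conc u x)" if x: "x \<in> rows gs u" for u x
  proof -
    have fin: "finite {i. x i ~= 0}" using x finite_subset[of "{i. x i ~= 0}" "{..<length gs}"] by (force simp: rows_def)
    have "finite T ==> T \<subseteq> {i. x i ~= 0} ==> R (conc u (\<Sum>i\<in>T. unit i))" for T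
      by (induction T rule: finite_induct) (use x in \<open>auto simp: conc_add conc_zero rows_def intro!: R0 Radd Runit\<close>)
    from this[OF fin order_refl] show ?thesis by (simp only: sum_units[OF fin])
  qed
  have row: "\<zeta> u \<in> rows gs u" for u using assms by (simp add: families_def)
  have "finite T ==> R (\<Sum>u\<in>T. conc u (\<zeta> u))" for T
    by (induction T rule: finite_induct) (auto intro: R0 Radd Rsp row)
  moreover have "finite {u. \<zeta> u ~= 0}" using assms by (simp add: families_def)
  ultimately have "R (\<Sum>u\<in>{u. \<zeta> u ~= 0}. conc u (\<zeta> u))" by blast
  then have "R \<zeta>" by (simp only: families_decompose[OF assms, symmetric])
  then show ?thesis by (simp add: R_def)
qed

lemma rows_image_quotient:
  assumes P: "valid_graded_matrix P"
  shows "filtered_quotient (rows (row_grades P)) (col_span P)"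
proof
  show "(x :: nat => bit) + x = 0" for x by simp
  fix x u assume "x \<in> col_span P u"
  then show "x \<in> rows (row_grades P) u"
  proof (rule col_span_induct)
    fix j assume j: "j < length (col_grades P)" "col_grades P ! j \<le> u"
    then show "column P j \<in> rows (row_grades P) u"
      using P order_trans unfolding rows_def column_def valid_graded_matrix_def by (fastforce split: if_splits)
  qed (auto intro: rows_quotient_laws)
qed (auto intro: rows_quotient_laws col_span_zero col_span_add col_span_mono)

lemma cokernel_iso:
  assumes P: "valid_graded_matrix P"
  shows "graded_iso (cokernel P) (qmod (rows (row_grades P)) (col_span P))"
proof -
  let ?gs = "row_grades P" and ?G = "free_module (row_grades P)"
  let ?c = "coordinates ?gs" and ?N = "matrix_map P ` free_carrier (col_grades P)" and ?I = "col_span P"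
  interpret I: filtered_quotient "rows ?gs" ?I by (rule rows_image_quotient[OF P])
  note in_N = coordinates_image[OF P]
  have NG: "v \<in> free_carrier ?gs" if "v \<in> ?N" for v using that matrix_map_free by blast
  have N0: "0 \<in> ?N" using in_N[OF free_zero] by (simp add: coordinates_zero zero_at col_span_zero)
  have Nadd: "v + w \<in> ?N" if "v \<in> ?N" "w \<in> ?N" for v w
    using that free_add[of _ "col_grades P"] by (auto simp: matrix_map_add[symmetric])
  have Nscale: "Poly_Mapping.map ((*) p) v \<in> ?N" if v: "v \<in> ?N" for v p
  proof -
    have "\<forall>u. ?c v u \<in> ?I u" using in_N[OF NG[OF v]] v by blast
    then have "\<forall>u. ?c (Poly_Mapping.map ((*) p) v) u \<in> ?I u" unfolding coordinates_scale[OF NG[OF v]] using I.act_B by blast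
    then show ?thesis using in_N[OF free_scale[OF NG[OF v]]] by blast
  qed
  define cs where "cs v = {n + v | n. n \<in> ?N}" for v
  have cs: "?N +>\<^bsub>?G\<^esub> v = cs v" for v by (auto simp: cs_def a_r_coset_def' free_module_def)
  have carr: "carrier (cokernel P) = cs ` free_carrier ?gs"
    by (auto simp: cokernel_def graded_quotient_def quotient_module_def Let_def A_RCOSETS_def' cs)
  define \<Omega> where "\<Omega> S = cosets ?I (?c (SOME v. v \<in> S))" for S
  have \<Omega>: "\<Omega> (cs v) = cosets ?I (?c v)" if v: "v \<in> free_carrier ?gs" for v
  proof -
    have "v \<in> cs v" unfolding cs_def using N0 by force
    then have "(SOME w. w \<in> cs v) \<in> cs v" by (rule someI)
    then obtain m where m: "(SOME w. w \<in> cs v) = m + v" "m \<in> ?N" unfolding cs_def by blast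
    have "?c (m + v) u + ?c v u = ?c m u" for u
      by (simp add: coordinates_add plus_fun_apply[of "?c m"] add.assoc)
    then have "?c (m + v) u + ?c v u \<in> ?I u" for u using in_N[OF NG[OF m(2)]] m(2) by simp
    then show ?thesis unfolding \<Omega>_def m(1) I.cosets_eq_iff by blast
  qed
  have ext: "cs v = cs w" if "v \<in> free_carrier ?gs" "w \<in> free_carrier ?gs" "cosets ?I (?c v) = cosets ?I (?c w)" for v w
  proof -
    have "\<forall>u. ?c (v + w) u \<in> ?I u"
      using that(3) by (simp add: coordinates_add plus_fun_apply[of "?c v"] I.cosets_eq_iff)
    then have vw: "v + w \<in> ?N" using in_N[OF free_add[OF that(1,2)]] by blast
    have two: "x + (x + y) = y" for x y :: "nat \<Rightarrow>\<^sub>0 'd polynomial"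
    proof (intro poly_mapping_eqI)
      fix i \<beta>
      show "lookup (lookup (x + (x + y)) i) \<beta> = lookup (lookup y i) \<beta>"
        unfolding lookup_add by (simp add: add.assoc[symmetric])
    qed
    have sub: "cs x \<subseteq> cs y" if xy: "x + y \<in> ?N" for x y
    proof
      fix z assume "z \<in> cs x"
      then obtain m where m: "z = m + x" "m \<in> ?N" unfolding cs_def by blast
      have "z = (m + (x + y)) + y" using two[of y "m + x"] m(1) by (simp add: ac_simps)
      then show "z \<in> cs y" unfolding cs_def using Nadd[OF m(2) xy] by blast
    qed
    show ?thesis using sub[OF vw] sub[of w v] vw by (simp add: add.commute)
  qed
  have add: "cs v \<oplus>\<^bsub>cokernel P\<^esub> cs w = cs (v + w)" for v w
  proof -
    have "cs v \<oplus>\<^bsub>cokernel P\<^esub> cs w = {x + y | x y. x \<in> cs v & y \<in> cs w}"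
      by (auto simp: cokernel_def graded_quotient_def quotient_module_def Let_def set_add_def' free_module_def)
    also have "\<dots> = cs (v + w)"
    proof (intro equalityI subsetI)
      fix z assume "z \<in> {x + y | x y. x \<in> cs v & y \<in> cs w}"
      then obtain m m' where "z = (m + v) + (m' + w)" "m \<in> ?N" "m' \<in> ?N" unfolding cs_def by blast
      then have "z = (m + m') + (v + w)" "m + m' \<in> ?N" using Nadd by (auto simp: ac_simps)
      then show "z \<in> cs (v + w)" unfolding cs_def by blast
    next
      fix z assume "z \<in> cs (v + w)"
      then obtain m where "z = (m + v) + (0 + w)" "m \<in> ?N" unfolding cs_def by (auto simp: add.assoc)
      then show "z \<in> {x + y | x y. x \<in> cs v & y \<in> cs w}" unfolding cs_def using N0 by blast
    qed
    finally show ?thesis .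
  qed
  have scale: "p \<odot>\<^bsub>cokernel P\<^esub> cs v = cs (Poly_Mapping.map ((*) p) v)" for p v
  proof -
    have map_add: "Poly_Mapping.map ((*) p) (x + y) = Poly_Mapping.map ((*) p) x + Poly_Mapping.map ((*) p) y" for x y
      by (rule poly_mapping_eqI) (simp add: lookup_scale lookup_add distrib_left)
    have "p \<odot>\<^bsub>cokernel P\<^esub> cs v = (\<Union>x\<in>cs v. cs (Poly_Mapping.map ((*) p) x))"
      by (simp add: cokernel_def graded_quotient_def quotient_module_def Let_def cs) (simp add: free_module_def)
    also have "\<dots> = cs (Poly_Mapping.map ((*) p) v)"
    proof (intro equalityI subsetI)
      fix z assume "z \<in> (\<Union>x\<in>cs v. cs (Poly_Mapping.map ((*) p) x))"
      then obtain m m' where "z = m' + Poly_Mapping.map ((*) p) (m + v)" "m \<in> ?N" "m' \<in> ?N" unfolding cs_def by blast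
      then have "z = (m' + Poly_Mapping.map ((*) p) m) + Poly_Mapping.map ((*) p) v" "m' + Poly_Mapping.map ((*) p) m \<in> ?N"
        using Nadd Nscale by (auto simp: map_add ac_simps)
      then show "z \<in> cs (Poly_Mapping.map ((*) p) v)" unfolding cs_def by blast
    next
      fix z assume z: "z \<in> cs (Poly_Mapping.map ((*) p) v)"
      have "v \<in> cs v" unfolding cs_def using N0 by force
      then show "z \<in> (\<Union>x\<in>cs v. cs (Poly_Mapping.map ((*) p) x))" using z by blast
    qed
    finally show ?thesis .
  qed
  have comp: "component (cokernel P) u = cs ` component ?G u" for u
    by (simp add: cokernel_def graded_quotient_def Let_def cs)
  have "\<Omega> \<in> graded_hom (cokernel P) (qmod (rows ?gs) ?I)"
  proof (rule graded_homI)
    fix x assume "x \<in> carrier (cokernel P)"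
    then obtain v where v: "x = cs v" "v \<in> free_carrier ?gs" using carr by blast
    show "\<Omega> x \<in> carrier (qmod (rows ?gs) ?I)" using v by (simp add: \<Omega> I.carrierI coordinates_families)
    show "\<Omega> (p \<odot>\<^bsub>cokernel P\<^esub> x) = p \<odot>\<^bsub>qmod (rows ?gs) ?I\<^esub> \<Omega> x" for p
      using v by (simp add: scale \<Omega> free_scale I.smult_cosets coordinates_families coordinates_scale)
    fix y assume "y \<in> carrier (cokernel P)"
    then obtain w where w: "y = cs w" "w \<in> free_carrier ?gs" using carr by blast
    show "\<Omega> (x \<oplus>\<^bsub>cokernel P\<^esub> y) = \<Omega> x \<oplus>\<^bsub>qmod (rows ?gs) ?I\<^esub> \<Omega> y"
      using v w by (simp add: add \<Omega> free_add I.add_cosets coordinates_add)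
  next
    fix u x assume "x \<in> component (cokernel P) u"
    then obtain v where v: "x = cs v" "v \<in> component ?G u" using comp by blast
    have vc: "v \<in> free_carrier ?gs" using v(2) by (simp add: free_module_def)
    have "?c v w = 0" if "w ~= u" for w
    proof
      fix i
      show "?c v w i = 0 i"
      proof (cases "i < length ?gs & ?gs ! i \<le> w")
        case True
        have "0 \<le> w - ?gs ! i" using True by (simp add: less_eq_vec_def)
        then have "?gs ! i + exponent_grade (grade_exponent (w - ?gs ! i)) ~= u" using that by (simp add: exponent_grade_grade_exponent)
        then have "grade_exponent (w - ?gs ! i) \<notin> keys (lookup v i)"
          using v(2) True unfolding free_module_def by fastforce
        then show ?thesis using True by (simp add: coordinates_def in_keys_iff fun_simps)
      qed (auto simp: coordinates_def fun_simps)
    qed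
    then have "?c v w = conc u (?c v u) w" for w by (cases "w = u") (simp_all only: conc_def if_True if_False refl)
    then have "?c v = conc u (?c v u)" by (rule HOL.ext)
    then have "cosets ?I (?c v) = cosets ?I (conc u (?c v u))" by (rule arg_cong)
    moreover have "?c v u \<in> rows ?gs u" using coordinates_families[OF vc] by (simp add: families_def)
    ultimately show "\<Omega> x \<in> component (qmod (rows ?gs) ?I) u"
      unfolding v(1) \<Omega>[OF vc] I.component_Q by (rule image_eqI)
  qed
  moreover have "bij_betw \<Omega> (carrier (cokernel P)) (carrier (qmod (rows ?gs) ?I))"
  proof (intro bij_betw_imageI inj_onI)
    fix x y assume "x \<in> carrier (cokernel P)" "y \<in> carrier (cokernel P)" "\<Omega> x = \<Omega> y"
    then obtain v w where v: "x = cs v" "v \<in> free_carrier ?gs" and w: "y = cs w" "w \<in> free_carrier ?gs" and eq: "\<Omega> (cs v) = \<Omega> (cs w)"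
      unfolding carr by blast
    show "x = y" unfolding v(1) w(1) by (rule ext[OF v(2) w(2)]) (use eq in \<open>simp only: \<Omega>[OF v(2)] \<Omega>[OF w(2)]\<close>)
  next
    have "\<Omega> ` carrier (cokernel P) = cosets ?I ` ?c ` free_carrier ?gs" unfolding carr image_image using \<Omega> by (intro image_cong) auto
    also have "?c ` free_carrier ?gs = families (rows ?gs)" using coordinates_surj coordinates_families by blast
    finally show "\<Omega> ` carrier (cokernel P) = carrier (qmod (rows ?gs) ?I)" by (simp add: I.carrier_Q)
  qed
  ultimately show ?thesis unfolding graded_iso_def by blast
qed

context grade_graph
begin

text \<open>The generators that are not vertices are killed by their own relations \<open>x + E x\<close>, as \<open>E\<close> vanishes on them. Padding with them keeps all output matrices of one size.\<close>

lemma part_presentation: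
  assumes E: "endo E" "mm n E E = E" and rows: "length (row_grades P) = n" "!!i. i < n ==> row_grades P ! i = f i"
    and cols: "length (col_grades P) = n + n" "!!j. j < n ==> col_grades P ! j = f j & col_grades P ! (n + j) = f j"
    and ent: "!!i j. i < n ==> j < n ==> entry P i j = of_bool (edge j) * rel j i"
      "!!i j. i < n ==> j < n ==> entry P i (n + j) = of_bool (i = j) + E i j"
  shows "valid_graded_matrix P" "graded_iso (qmod (rows (row_grades P)) (col_span P)) (qmod F (part E))"
proof -
  have EE: "app n E (app n E x) = app n E x" for x using E(2) by (simp add: app_mm[symmetric])
  have tri: "i < n & j < n & vert i & vert j & f i \<le> f j" if "E i j ~= 0" for i j
    using endo_tri[OF E(1)] that unfolding tri_def by blast
  have split: "j < n | (\<exists>k<n. j = n + k)" if "j < n + n" for j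
    using that by (cases "j < n") (auto intro!: exI[of _ "j - n"])
  show valid: "valid_graded_matrix P"
    unfolding valid_graded_matrix_def rows(1) cols(1)
  proof (intro allI impI)
    fix i j assume i: "i < n" and j: "j < n + n" and e: "entry P i j ~= 0"
    show "row_grades P ! i \<le> col_grades P ! j"
    proof (cases "j < n")
      case True
      then have "edge j" "rel j i ~= 0" using e i ent(1) by auto
      then have "i = src j | i = tgt j" by (auto simp: rel_def)
      then show ?thesis using ends[OF True \<open>edge j\<close>] rows(2)[OF i] cols(2)[OF True] by auto
    next
      case False
      then obtain k where k: "k < n" "j = n + k" using split[OF j] by blast
      then have "i = k | E i k ~= 0" using e i ent(2) by (auto split: if_splits)
      then show ?thesis using tri[of i k] rows(2)[OF i] cols(2)[OF k(1)] k(2) by auto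
    qed
  qed
  let ?R = "rows (row_grades P)" and ?h = "app n idm"
  interpret I: filtered_quotient ?R "col_span P" by (rule rows_image_quotient[OF valid])
  interpret P: filtered_quotient F "part E" by (rule part_quotient)
  have in_R: "x \<in> ?R u \<longleftrightarrow> (\<forall>i. x i ~= 0 --> i < n & f i \<le> u)" for x u
    unfolding rows_def rows(1) using rows(2) by (intro iffI CollectI) auto
  have F_R: "x \<in> ?R u" if "x \<in> F u" for x u using that unfolding in_R F_def by blast
  have h_apply: "?h x i = (if i < n & vert i then x i else 0)" for x i
  proof -
    have "(\<Sum>j<n. idm i j * x j) = (\<Sum>j<n. if j = i then (if vert i then x i else 0) else 0)"
      by (intro sum.cong) (auto simp: idm_def)
    then show ?thesis by (simp add: app_def)
  qed
  have E_h: "app n E (?h x) = app n E x" for x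
    using mm_idm[OF endo_tri[OF E(1)]] by (simp add: app_mm[symmetric])
  have col1: "column P j = rel j" if "j < n" "edge j" for j
    using that ent(1) ends[OF that] by (auto simp: column_def rows(1) fun_eq_iff rel_def)
  have col0: "column P j = 0" if "j < n" "\<not> edge j" for j
    using that ent(1) by (auto simp: column_def rows(1) fun_eq_iff fun_simps)
  have col2: "column P (n + j) = unit j + app n E (unit j)" if "j < n" for j
    unfolding app_unit[OF that] using that ent(2) tri[of _ j] by (auto simp: column_def rows(1) fun_eq_iff fun_simps unit_def)
  have h_col: "?h (column P j) \<in> part E u" if j: "j < n + n" "col_grades P ! j \<le> u" for j u
  proof (cases "j < n")
    case True
    show ?thesis
    proof (cases "edge j")
      case e: True
      have "rel j \<in> B u" using True e j(2) cols(2)[OF True] by (intro B_rel) auto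
      then show ?thesis unfolding col1[OF True e] using app_idm B_F B_F_part[OF E(1)] by metis
    next
      case False
      then show ?thesis using col0[OF True] P.B_zero by simp
    qed
  next
    case False
    then obtain k where k: "k < n" "j = n + k" using split[OF j(1)] by blast
    show ?thesis
    proof (cases "vert k")
      case True
      have U: "unit k \<in> F u" using k True j(2) cols(2)[OF k(1)] by (intro unit_F) auto
      then have "?h (column P j) = unit k + app n E (unit k)"
        unfolding k(2) col2[OF k(1)] by (intro app_idm F_add tri_app[OF endo_tri[OF E(1)]])
      moreover have "unit k + app n E (unit k) \<in> F u" using U by (intro F_add tri_app[OF endo_tri[OF E(1)]])
      moreover have "app n E (unit k + app n E (unit k)) = 0" by (simp add: app_add EE)
      ultimately show ?thesis by (simp add: part_def B_zero)
    next
      case False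
      have "?h (column P j) = 0"
        unfolding k(2) col2[OF k(1)] app_unit[OF k(1)] using False tri[of _ k] by (auto simp: fun_eq_iff h_apply fun_simps unit_def)
      then show ?thesis using P.B_zero by simp
    qed
  qed
  have h_span: "?h x \<in> part E u" if "x \<in> col_span P u" for x u
    using that by (rule col_span_induct) (use h_col cols(1) P.B_zero P.B_add in \<open>auto simp: app_add\<close>)
  have h_R: "?h x \<in> F u" if "x \<in> ?R u" for x u
    using that unfolding in_R F_def by (auto simp: h_apply split: if_splits)
  have B_span: "x \<in> col_span P u" if "x \<in> B u" for x u
    using that[unfolded B_def]
  proof (rule combos_induct)
    fix e assume e: "e < n" "edge e" "f e \<le> u"
    then show "rel e \<in> col_span P u" using col_span_column[of e P u] col1[OF e(1,2)] cols(1) cols(2)[OF e(1)] by auto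
  qed (auto intro: I.B_zero I.B_add)
  have x_span: "x + app n E x \<in> col_span P u" if x: "x \<in> ?R u" for x u
  proof -
    have fin: "finite {v. x v ~= 0}" using x finite_subset[of "{v. x v ~= 0}" "{..<n}"] unfolding in_R by blast
    have "finite T ==> T \<subseteq> {v. x v ~= 0} ==> (\<Sum>v\<in>T. unit v) + app n E (\<Sum>v\<in>T. unit v) \<in> col_span P u" for T
    proof (induction T rule: finite_induct)
      case empty
      then show ?case using I.B_zero by simp
    next
      case (insert v T)
      then have v: "v < n" "f v \<le> u" using x unfolding in_R by auto
      have "unit v + app n E (unit v) \<in> col_span P u"
        unfolding col2[OF v(1), symmetric] using v cols(1) cols(2)[OF v(1)] by (intro col_span_column) auto
      moreover have "(\<Sum>v\<in>T. unit v) + app n E (\<Sum>v\<in>T. unit v) \<in> col_span P u" using insert by blast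
      ultimately have "(unit v + app n E (unit v)) + ((\<Sum>v\<in>T. unit v) + app n E (\<Sum>v\<in>T. unit v)) \<in> col_span P u" by (rule I.B_add)
      then show ?case using insert.hyps by (simp add: app_add ac_simps)
    qed
    from this[OF fin order_refl] show ?thesis by (simp only: sum_units[OF fin])
  qed
  interpret h: quotient_map ?R "col_span P" F "part E" ?h
    by unfold_locales (auto simp: app_add intro: h_R h_span)
  show "graded_iso (qmod ?R (col_span P)) (qmod F (part E))"
  proof (rule h.induced_iso)
    fix u x assume x: "x \<in> ?R u" "?h x \<in> part E u"
    then have "app n E x \<in> col_span P u" by (intro B_span) (simp add: part_def E_h)
    then have "(x + app n E x) + app n E x \<in> col_span P u" by (rule I.B_add[OF x_span[OF x(1)]])
    moreover have "(x + app n E x) + app n E x = x" by (simp add: add.assoc)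
    ultimately show "x \<in> col_span P u" by metis
  next
    fix u y assume "y \<in> F u"
    then show "\<exists>x\<in>?R u. y + ?h x \<in> part E u"
      using F_R app_idm P.B_zero by (intro bexI[of _ y]) auto
  qed
qed

end

lemma nonzero_transfer:
  assumes "is_graded_module M" "is_graded_module N" "j \<in> graded_hom N M" "i \<in> graded_hom M N"
    and ji: "!!x. x \<in> carrier M ==> j (i x) = x" and nz: "nonzero_module M"
  shows "nonzero_module N"
  unfolding nonzero_module_def
proof
  assume N: "carrier N = {\<zero>\<^bsub>N\<^esub>}"
  have "x = \<zero>\<^bsub>M\<^esub>" if x: "x \<in> carrier M" for x
  proof -
    have "i x = \<zero>\<^bsub>N\<^esub>" using assms(4) x N unfolding graded_hom_def by blast
    then show ?thesis using ji[OF x] graded_hom_zero[OF assms(2,1,3)] by simp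
  qed
  moreover have "\<zero>\<^bsub>M\<^esub> \<in> carrier M" using component_carrier[OF assms(1) zero_component[OF assms(1)]] .
  ultimately show False using nz unfolding nonzero_module_def by blast
qed

section \<open>Connected components of a filtration\<close>

lemma boundary_superset:
  assumes "finite A" "keys c \<subseteq> A"
  shows "boundary c = (\<Sum>s\<in>A. \<Sum>v\<in>{v \<in> s. s - {v} ~= {}}. single (s - {v}) (lookup c s))"
  unfolding boundary_def using assms by (intro sum.mono_neutral_left) (auto simp: in_keys_iff)

lemma boundary_add: "boundary (c + d) = boundary c + boundary d"
proof -
  let ?A = "keys c \<union> keys d"
  have A: "finite ?A" "keys (c + d) \<subseteq> ?A" "keys c \<subseteq> ?A" "keys d \<subseteq> ?A"
    using keys_add[of c d] by auto
  show ?thesis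
    unfolding boundary_superset[OF A(1,2)] boundary_superset[OF A(1,3)] boundary_superset[OF A(1,4)]
    by (simp add: lookup_add single_add sum.distrib)
qed

lemma boundary_zero: "boundary 0 = 0"
  by (simp add: boundary_def)

lemma boundary_vertices: "c \<in> chains K 0 ==> boundary c = 0"
proof -
  assume c: "c \<in> chains K 0"
  have "(\<Sum>v\<in>{v \<in> s. s - {v} ~= {}}. single (s - {v}) (lookup c s)) = 0" if "s \<in> keys c" for s
  proof -
    have "card s = Suc 0" using c that by (auto simp: chains_def)
    then obtain a where "s = {a}" by (auto simp: card_Suc_eq)
    then have "{v \<in> s. s - {v} ~= {}} = {}" by auto
    then show ?thesis by (simp only: sum.empty)
  qed
  then show ?thesis unfolding boundary_def by (rule sum.neutral[OF ballI])
qed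

lemma boundary_edge: "a ~= b ==> boundary (single {a, b} 1) = single {a} 1 + single {b} 1"
proof -
  assume ab: "a ~= b"
  have "{v \<in> {a, b}. {a, b} - {v} ~= {}} = {a, b}" "{a, b} - {a} = {b}" "{a, b} - {b} = {a}" using ab by auto
  then show ?thesis using ab by (simp add: boundary_def add.commute)
qed

lemma chain_add_self: "(c :: 'v chain) + c = 0"
  by (rule poly_mapping_eqI) (simp only: lookup_add bit_add_self lookup_zero)

lemma chain_map_one: "Poly_Mapping.map ((*) (1::bit)) c = c"
  by (rule poly_mapping_eqI) (simp add: lookup_scale)

text \<open>In degree 0 every chain is a cycle.\<close>

lemma persistent_homology_iso:
  fixes X :: "'d::finite grade => 'v set set"
  defines "F' \<equiv> %u. chains (X u) 0" and "B' \<equiv> %u. boundaries (X u) 0"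
  assumes C: "filtered_quotient F' B'"
  shows "graded_iso (persistent_homology 0 X) (qmod F' B')"
proof -
  interpret C: filtered_quotient F' B' by (rule C)
  let ?H = "%u. homology 0 (X u)" and ?P = "persistent_homology 0 X" and ?Q = "qmod F' B'"
  have cyc: "{c \<in> chains (X u) 0. boundary c = 0} = F' u" for u using boundary_vertices by (auto simp: F'_def)
  have rc: "boundaries (X u) 0 +>\<^bsub>cycle_module (X u) 0\<^esub> c = coset (B' u) c" for u c
    by (auto simp: a_r_coset_def' cycle_module_def coset_def B'_def add.commute)
  have H_carrier: "carrier (?H u) = coset (B' u) ` F' u" for u
    unfolding homology_def quotient_module_def by (auto simp: A_RCOSETS_def' rc) (auto simp: cycle_module_def cyc)
  have H_zero: "\<zero>\<^bsub>?H u\<^esub> = B' u" for u by (simp add: homology_def quotient_module_def B'_def)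
  have H_add: "y \<oplus>\<^bsub>?H u\<^esub> z = {a + b | a b. a \<in> y & b \<in> z}" for u y z
    by (auto simp: homology_def quotient_module_def set_add_def' cycle_module_def)
  have H_add_coset: "coset (B' u) x \<oplus>\<^bsub>?H u\<^esub> coset (B' u) y = coset (B' u) (x + y)" for u x y
    using C.add_cosets[of "%_. x" "%_. y"] unfolding H_add by (simp add: qmod_def cosets_def fun_eq_iff fun_simps)
  have absorb: "coset (B' v) y = coset (B' v) x" if yx: "y \<in> coset (B' u) x" "u \<le> v" for u v x y
  proof -
    obtain b where b: "y = x + b" "b \<in> B' u" using yx(1) by (auto simp: coset_def)
    have "y + x = b" using C.add_cancel[of x b] b(1) by (simp only: add.commute)
    then show ?thesis using C.B_mono[OF b(2) yx(2)] C.coset_eq_iff[of v y x] by simp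
  qed
  have union: "(\<Union>y\<in>coset (B' u) x. coset (B' v) y) = coset (B' v) x" if uv: "u \<le> v" for u v x
  proof (intro equalityI UN_least)
    show "coset (B' v) y \<subseteq> coset (B' v) x" if "y \<in> coset (B' u) x" for y
      by (simp only: absorb[OF that uv] order_refl)
    have "x \<in> coset (B' u) x" unfolding coset_def using C.B_zero by (intro image_eqI[of _ _ 0]) auto
    from UN_upper[OF this, of "coset (B' v)"] show "coset (B' v) x \<subseteq> (\<Union>y\<in>coset (B' u) x. coset (B' v) y)" .
  qed
  have H_one: "1 \<odot>\<^bsub>?H u\<^esub> coset (B' u) x = coset (B' u) x" for u x
  proof -
    have "1 \<odot>\<^bsub>?H u\<^esub> coset (B' u) x = (\<Union>y\<in>coset (B' u) x. coset (B' u) y)"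
      by (simp add: homology_def quotient_module_def rc) (simp add: cycle_module_def chain_map_one)
    then show ?thesis by (simp only: union[OF order_refl])
  qed
  have incl: "inclusion_map 0 (X v) (coset (B' u) x) = coset (B' v) x" if "u \<le> v" for u v x
    unfolding inclusion_map_def rc by (rule union[OF that])
  have H_monoid: "abelian_monoid (?H u)" for u
  proof (rule abelian_monoidI)
    fix x y z assume x: "x \<in> carrier (?H u)"
    then obtain a where a: "x = coset (B' u) a" "a \<in> F' u" unfolding H_carrier by blast
    show "\<zero>\<^bsub>?H u\<^esub> \<oplus>\<^bsub>?H u\<^esub> x = x"
      using H_add_coset[of u 0 a] by (simp add: H_zero a(1) C.coset_zero)
    assume y: "y \<in> carrier (?H u)"
    then obtain b where b: "y = coset (B' u) b" "b \<in> F' u" unfolding H_carrier by blast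
    show "x \<oplus>\<^bsub>?H u\<^esub> y \<in> carrier (?H u)" unfolding a(1) b(1) H_add_coset H_carrier by (intro imageI C.F_add a b)
    show "x \<oplus>\<^bsub>?H u\<^esub> y = y \<oplus>\<^bsub>?H u\<^esub> x" unfolding a(1) b(1) H_add_coset by (simp only: add.commute)
    assume z: "z \<in> carrier (?H u)"
    then obtain c where c: "z = coset (B' u) c" "c \<in> F' u" unfolding H_carrier by blast
    show "x \<oplus>\<^bsub>?H u\<^esub> y \<oplus>\<^bsub>?H u\<^esub> z = x \<oplus>\<^bsub>?H u\<^esub> (y \<oplus>\<^bsub>?H u\<^esub> z)"
      unfolding a(1) b(1) c(1) H_add_coset by (simp only: add.assoc)
  next
    show "\<zero>\<^bsub>?H u\<^esub> \<in> carrier (?H u)" unfolding H_zero H_carrier using C.coset_zero[of u] C.F_zero[of u] by (metis imageI)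
  qed
  have H_sum: "finite T ==> (!!t. t \<in> T ==> g t \<in> F' u) ==>
      (\<Oplus>\<^bsub>?H u\<^esub>t\<in>T. coset (B' u) (g t)) = coset (B' u) (sum g T)" for T :: "'d exponent set" and g u
  proof (induction T rule: finite_induct)
    case empty
    interpret abelian_monoid "?H u" by (rule H_monoid)
    show ?case by (simp add: H_zero C.coset_zero)
  next
    case (insert t T)
    interpret abelian_monoid "?H u" by (rule H_monoid)
    have "(%t. coset (B' u) (g t)) \<in> T \<rightarrow> carrier (?H u)" "coset (B' u) (g t) \<in> carrier (?H u)"
      using insert.prems unfolding H_carrier by auto
    then have "(\<Oplus>\<^bsub>?H u\<^esub>t\<in>insert t T. coset (B' u) (g t)) = coset (B' u) (g t) \<oplus>\<^bsub>?H u\<^esub> (\<Oplus>\<^bsub>?H u\<^esub>t\<in>T. coset (B' u) (g t))"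
      using insert.hyps by (intro finsum_insert) auto
    then show ?case using insert by (simp add: H_add_coset)
  qed
  have carr: "carrier ?P = carrier ?Q"
  proof (intro equalityI subsetI)
    fix z assume z: "z \<in> carrier ?P"
    then have "\<forall>u. \<exists>c. c \<in> F' u & z u = coset (B' u) c" and fin: "finite {u. z u ~= B' u}"
      by (auto simp: persistent_homology_def Let_def H_zero H_carrier)
    then obtain c where c: "!!u. c u \<in> F' u" "!!u. z u = coset (B' u) (c u)" by metis
    define \<zeta> where "\<zeta> = (%u. if z u = B' u then 0 else c u)"
    have "{u. \<zeta> u ~= 0} \<subseteq> {u. z u ~= B' u}" by (auto simp: \<zeta>_def)
    then have "\<zeta> \<in> families F'" using fin c(1) C.F_zero unfolding families_def by (auto simp: \<zeta>_def intro: finite_subset)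
    moreover have "z = cosets B' \<zeta>" using c(2) C.coset_zero by (auto simp: fun_eq_iff cosets_def \<zeta>_def)
    ultimately show "z \<in> carrier ?Q" using C.carrierI by blast
  next
    fix z assume "z \<in> carrier ?Q"
    then obtain \<zeta> where \<zeta>: "z = cosets B' \<zeta>" "\<zeta> \<in> families F'" by (rule C.carrierE)
    have "{u. z u ~= B' u} \<subseteq> {u. \<zeta> u ~= 0}" using C.coset_zero by (auto simp: \<zeta>(1) cosets_def)
    then have "finite {u. z u ~= B' u}" using \<zeta>(2) by (auto simp: families_def intro: finite_subset)
    then show "z \<in> carrier ?P"
      using \<zeta> by (auto simp: persistent_homology_def Let_def H_zero H_carrier cosets_def families_def)
  qed
  have "(%x. x) \<in> graded_hom ?P ?Q"
  proof (rule graded_homI)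
    fix x assume x: "x \<in> carrier ?P"
    then show "x \<in> carrier ?Q" by (simp only: carr)
    then obtain \<zeta> where \<zeta>: "x = cosets B' \<zeta>" "\<zeta> \<in> families F'" by (rule C.carrierE)
    show "p \<odot>\<^bsub>?P\<^esub> x = p \<odot>\<^bsub>?Q\<^esub> x" for p
    proof
      fix v
      have Fz: "\<zeta> u \<in> F' u" for u using \<zeta>(2) by (simp add: families_def)
      have "(p \<odot>\<^bsub>?P\<^esub> x) v = (\<Oplus>\<^bsub>?H v\<^esub>\<alpha>\<in>keys p.
          lookup p \<alpha> \<odot>\<^bsub>?H v\<^esub> inclusion_map 0 (X v) (x (v - exponent_grade \<alpha>)))"
        by (simp add: persistent_homology_def Let_def)
      also have "\<dots> = (\<Oplus>\<^bsub>?H v\<^esub>\<alpha>\<in>keys p. coset (B' v) (\<zeta> (v - exponent_grade \<alpha>)))"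
      proof (rule abelian_monoid.finsum_cong'[OF H_monoid refl])
        show "(%\<alpha>. coset (B' v) (\<zeta> (v - exponent_grade \<alpha>))) \<in> keys p \<rightarrow> carrier (?H v)"
          unfolding H_carrier using C.F_mono[OF Fz grade_sub_le] by blast
        fix \<alpha> assume "\<alpha> \<in> keys p"
        then have "lookup p \<alpha> = 1" by (simp add: in_keys_iff bit_1I)
        then show "lookup p \<alpha> \<odot>\<^bsub>?H v\<^esub> inclusion_map 0 (X v) (x (v - exponent_grade \<alpha>)) = coset (B' v) (\<zeta> (v - exponent_grade \<alpha>))"
          by (simp only: \<zeta>(1) cosets_def incl[OF grade_sub_le] H_one)
      qed
      also have "\<dots> = coset (B' v) (act p \<zeta> v)"
        unfolding act_def by (rule H_sum) (auto intro: C.F_mono[OF Fz grade_sub_le])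
      also have "\<dots> = (p \<odot>\<^bsub>?Q\<^esub> x) v" unfolding \<zeta>(1) C.smult_cosets[OF \<zeta>(2)] by (simp add: cosets_def)
      finally show "(p \<odot>\<^bsub>?P\<^esub> x) v = (p \<odot>\<^bsub>?Q\<^esub> x) v" .
    qed
    fix y
    show "x \<oplus>\<^bsub>?P\<^esub> y = x \<oplus>\<^bsub>?Q\<^esub> y"
      by (simp add: persistent_homology_def Let_def H_add) (simp add: qmod_def)
  next
    fix u x assume "x \<in> component ?P u"
    then have "x \<in> carrier ?P" "\<forall>v. v ~= u --> x v = B' v" by (auto simp: persistent_homology_def Let_def H_zero)
    then show "x \<in> component ?Q u" unfolding carr by (simp add: qmod_def)
  qed
  moreover have "bij_betw (%x. x) (carrier ?P) (carrier ?Q)" unfolding carr by (simp add: bij_betw_def)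
  ultimately show ?thesis unfolding graded_iso_def by blast
qed

locale critical_filtration =
  fixes X :: "'d::finite grade => 'v set set" and ss :: "'v set list" and n :: nat
  assumes filtration: "simplicial_filtration X" and critical: "one_critical X"
    and distinct: "distinct ss" and set_ss: "set ss = simplices X" and length_ss: "length ss = n"
    and new: "card (new_simplices X u) \<le> 1"
begin

definition birth :: "nat => 'd grade" where "birth i = birth_grade X (ss ! i)"
definition vertex_at :: "nat => bool" where "vertex_at i \<longleftrightarrow> card (ss ! i) = 1"
definition edge_at :: "nat => bool" where "edge_at i \<longleftrightarrow> card (ss ! i) = 2"
definition source :: "nat => nat" where "source e = vertex_positions ss (ss ! e) ! 0"
definition target :: "nat => nat" where "target e = vertex_positions ss (ss ! e) ! 1"

lemma in_X: "s \<in> simplices X ==> s \<in> X u \<longleftrightarrow> birth_grade X s \<le> u"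
proof -
  assume "s \<in> simplices X"
  then have "\<exists>!g. \<forall>u. s \<in> X u \<longleftrightarrow> g \<le> u" using critical unfolding one_critical_def by blast
  from theI'[OF this] show ?thesis unfolding birth_grade_def by blast
qed

lemma X_simplices: "s \<in> X u ==> s \<in> simplices X"
  by (auto simp: simplices_def)

lemma complex: "simplicial_complex (X u)"
  using filtration by (simp add: simplicial_filtration_def)

lemma face: "s \<in> simplices X ==> t \<subseteq> s ==> t ~= {} ==> t \<in> simplices X & birth_grade X t \<le> birth_grade X s"
proof -
  assume s: "s \<in> simplices X" "t \<subseteq> s" "t ~= {}"
  have "s \<in> X (birth_grade X s)" using in_X[OF s(1)] by simp
  then have "t \<in> X (birth_grade X s)" using complex s unfolding simplicial_complex_def by blast
  then show ?thesis using X_simplices in_X by blast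
qed

lemma simplex_finite: "s \<in> simplices X ==> finite s & s ~= {}"
  using complex unfolding simplicial_complex_def simplices_def by blast

lemma simplex_at: "i < n ==> ss ! i \<in> simplices X"
  using set_ss length_ss nth_mem by metis

lemma position: "t \<in> simplices X ==> \<exists>i<n. ss ! i = t"
  using set_ss length_ss by (metis in_set_conv_nth)

lemma at_eq: "i < n ==> j < n ==> ss ! i = ss ! j \<longleftrightarrow> i = j"
  using distinct length_ss by (simp add: nth_eq_iff_index_eq)

lemma at_X: "i < n ==> ss ! i \<in> X u \<longleftrightarrow> birth i \<le> u"
  unfolding birth_def by (rule in_X[OF simplex_at])

text \<open>Endpoints are read off the list of vertex positions, which lists exactly the two vertices of the edge.\<close>

lemma edge_ends:
  assumes e: "e < n" "edge_at e"
  shows "\<exists>a b. a ~= b & ss ! e = {a, b} & source e < n & target e < n & ss ! source e = {a} & ss ! target e = {b} &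
    length (vertex_positions ss (ss ! e)) = 2"
proof -
  obtain p q where pq: "ss ! e = {p, q}" "p ~= q" using e(2) by (auto simp: edge_at_def card_2_iff)
  obtain i where i: "i < n" "ss ! i = {p}" using face[OF simplex_at[OF e(1)], of "{p}"] pq position[of "{p}"] by auto
  obtain j where j: "j < n" "ss ! j = {q}" using face[OF simplex_at[OF e(1)], of "{q}"] pq position[of "{q}"] by auto
  let ?L = "vertex_positions ss (ss ! e)"
  have "i ~= j" using i j pq(2) by auto
  have "set ?L = {i, j}"
  proof (intro equalityI subsetI)
    fix k assume "k \<in> set ?L"
    then have k: "k < n" "card (ss ! k) = 1" "ss ! k \<subseteq> {p, q}" using length_ss pq(1) by (auto simp: vertex_positions_def)
    then obtain a where "ss ! k = {a}" by (auto simp: card_1_singleton_iff)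
    then have "ss ! k = ss ! i | ss ! k = ss ! j" using k(3) i(2) j(2) by auto
    then show "k \<in> {i, j}" using at_eq k(1) i(1) j(1) by auto
  qed (use i j pq length_ss in \<open>auto simp: vertex_positions_def\<close>)
  moreover have "distinct ?L" by (simp add: vertex_positions_def)
  ultimately have len: "length ?L = 2" using \<open>i ~= j\<close> distinct_card[of ?L] by simp
  then obtain x y where L: "?L = [x, y]" by (auto simp: numeral_2_eq_2 length_Suc_conv)
  then have "x = i & y = j | x = j & y = i" using \<open>set ?L = {i, j}\<close> \<open>distinct ?L\<close> by (auto simp: doubleton_eq_iff)
  then show ?thesis
  proof
    assume "x = i & y = j"
    then show ?thesis using i j pq L len by (intro exI[of _ p] exI[of _ q]) (simp add: source_def target_def)
  next
    assume "x = j & y = i"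
    then show ?thesis using i j pq L len by (intro exI[of _ q] exI[of _ p]) (auto simp: source_def target_def)
  qed
qed

sublocale grade_graph n vertex_at edge_at source target birth
proof
  show "inj_on birth {..<n}"
  proof (rule inj_onI)
    fix i j assume ij: "i \<in> {..<n}" "j \<in> {..<n}" "birth i = birth j"
    have mem: "ss ! k \<in> new_simplices X (birth i)" if "k < n" "birth k = birth i" for k
      using that at_X[of k] unfolding new_simplices_def by auto
    have "new_simplices X (birth i) \<subseteq> set ss" unfolding set_ss by (auto simp: new_simplices_def simplices_def)
    then have "finite (new_simplices X (birth i))" by (rule finite_subset) simp
    then have "ss ! i = ss ! j" using new[of "birth i"] mem[of i] mem[of j] ij by (auto simp: card_le_Suc0_iff_eq)
    then show "i = j" using at_eq ij by auto
  qed
  show "\<not> edge_at i" if "vertex_at i" for i using that by (simp add: vertex_at_def edge_at_def)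
  fix e assume e: "e < n" "edge_at e"
  obtain a b where ab: "a ~= b" "ss ! e = {a, b}" "source e < n" "target e < n" "ss ! source e = {a}" "ss ! target e = {b}"
    using edge_ends[OF e] by blast
  then show "source e < n & target e < n & vertex_at (source e) & vertex_at (target e) & source e ~= target e &
      birth (source e) \<le> birth e & birth (target e) \<le> birth e"
    using face[OF simplex_at[OF e(1)], of "{a}"] face[OF simplex_at[OF e(1)], of "{b}"] by (auto simp: vertex_at_def birth_def)
qed

definition to_chain :: "(nat => bit) => 'v chain" where
  "to_chain x = (\<Sum>i<n. if vertex_at i then single (ss ! i) (x i) else 0)"

definition of_chain :: "'v chain => nat => bit" where
  "of_chain c = (%i. if i < n & vertex_at i then lookup c (ss ! i) else 0)"

lemma to_chain_add: "to_chain (x + y) = to_chain x + to_chain y"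
proof -
  have "(if vertex_at i then single (ss ! i) ((x + y) i) else 0) =
      (if vertex_at i then single (ss ! i) (x i) else 0) + (if vertex_at i then single (ss ! i) (y i) else 0)" for i
    by (simp add: single_add plus_fun_apply)
  then show ?thesis unfolding to_chain_def by (simp only: sum.distrib)
qed

lemma to_chain_zero: "to_chain 0 = 0"
  using to_chain_add[of 0 0] by (simp add: chain_add_self)

lemma to_chain_sum: "to_chain (sum g S) = (\<Sum>s\<in>S. to_chain (g s))"
  by (induction S rule: infinite_finite_induct) (auto simp: to_chain_add to_chain_zero)

lemma of_chain_add: "of_chain (c + d) = of_chain c + of_chain d"
  by (auto simp: of_chain_def fun_eq_iff fun_simps lookup_add)

lemma lookup_to_chain: "lookup (to_chain x) s = (\<Sum>i<n. if vertex_at i & ss ! i = s then x i else 0)"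
  unfolding to_chain_def lookup_sum by (intro sum.cong) (auto simp: lookup_single when_def)

lemma lookup_to_chain_at: "i < n ==> vertex_at i ==> lookup (to_chain x) (ss ! i) = x i"
proof -
  assume i: "i < n" "vertex_at i"
  have "(\<Sum>j<n. if vertex_at j & ss ! j = ss ! i then x j else 0) = (\<Sum>j<n. if j = i then x i else 0)"
    using i at_eq by (intro sum.cong) auto
  then show ?thesis using i by (simp add: lookup_to_chain)
qed

lemma to_chain_F: "x \<in> F u ==> to_chain x \<in> chains (X u) 0"
proof -
  assume x: "x \<in> F u"
  have "s \<in> X u & card s = Suc 0" if s: "s \<in> keys (to_chain x)" for s
  proof -
    have "(\<Sum>i<n. if vertex_at i & ss ! i = s then x i else 0) ~= 0" using s by (simp add: in_keys_iff lookup_to_chain)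
    then obtain i where "i < n" "(if vertex_at i & ss ! i = s then x i else 0) ~= 0"
      by (auto elim: sum.not_neutral_contains_not_neutral)
    then have i: "i < n" "vertex_at i" "ss ! i = s" "x i ~= 0" by (auto split: if_splits)
    then show ?thesis using x at_X[of i u] by (auto simp: F_def vertex_at_def)
  qed
  then show ?thesis by (auto simp: chains_def)
qed

lemma of_chain_F: "c \<in> chains (X u) 0 ==> of_chain c \<in> F u"
  unfolding F_def
proof (intro CollectI allI impI)
  fix i assume c: "c \<in> chains (X u) 0" and i: "of_chain c i ~= 0"
  then have "i < n" "vertex_at i" "ss ! i \<in> keys c" by (auto simp: of_chain_def in_keys_iff split: if_splits)
  then show "i < n & vertex_at i & birth i \<le> u" using c at_X by (auto simp: chains_def)
qed

lemma of_to_chain: "x \<in> F u ==> of_chain (to_chain x) = x"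
proof
  fix i assume "x \<in> F u"
  then show "of_chain (to_chain x) i = x i" by (auto simp: of_chain_def lookup_to_chain_at F_def)
qed

lemma to_of_chain: "c \<in> chains (X u) 0 ==> to_chain (of_chain c) = c"
proof (rule poly_mapping_eqI)
  fix s assume c: "c \<in> chains (X u) 0"
  show "lookup (to_chain (of_chain c)) s = lookup c s"
  proof (cases "\<exists>i<n. vertex_at i & ss ! i = s")
    case True
    then show ?thesis using lookup_to_chain_at by (auto simp: of_chain_def)
  next
    case False
    have "s \<notin> keys c"
    proof
      assume "s \<in> keys c"
      then have "s \<in> X u" "card s = 1" using c by (auto simp: chains_def)
      then show False using position[OF X_simplices[of s u]] False by (auto simp: vertex_at_def)
    qed
    moreover have "lookup (to_chain (of_chain c)) s = 0"
      unfolding lookup_to_chain using False by (intro sum.neutral) auto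
    ultimately show ?thesis by (simp add: in_keys_iff)
  qed
qed

lemma chains_eq: "chains (X u) 0 = to_chain ` F u"
proof (intro equalityI subsetI)
  fix c assume c: "c \<in> chains (X u) 0"
  then show "c \<in> to_chain ` F u" using of_chain_F[OF c] to_of_chain[OF c] by (metis imageI)
qed (auto intro: to_chain_F)

lemma to_chain_unit: "i < n ==> vertex_at i ==> to_chain (unit i) = single (ss ! i) 1"
proof -
  assume i: "i < n" "vertex_at i"
  have "to_chain (unit i) = (\<Sum>j<n. if j = i then single (ss ! i) 1 else 0)"
    unfolding to_chain_def using i by (intro sum.cong) (auto simp: unit_def)
  then show ?thesis using i by simp
qed

lemma to_chain_rel: "e < n ==> edge_at e ==> to_chain (rel e) = boundary (single (ss ! e) 1)"
proof -
  assume e: "e < n" "edge_at e"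
  obtain a b where ab: "a ~= b" "ss ! e = {a, b}" "ss ! source e = {a}" "ss ! target e = {b}"
    using edge_ends[OF e] by blast
  have "rel e = unit (source e) + unit (target e)" by (auto simp: rel_def unit_def fun_eq_iff fun_simps)
  then show ?thesis using ends[OF e] ab by (simp add: to_chain_add to_chain_unit boundary_edge)
qed

lemma chains_add: "c \<in> chains K k ==> d \<in> chains K k ==> c + d \<in> chains K k"
  using keys_add[of c d] by (auto simp: chains_def)

lemma boundaries_eq: "boundaries (X u) 0 = to_chain ` B u"
proof (intro equalityI subsetI)
  fix y assume "y \<in> boundaries (X u) 0"
  then obtain c where c: "y = boundary c" "c \<in> chains (X u) (Suc 0)" by (auto simp: boundaries_def)
  have key: "boundary (single s (lookup c s)) \<in> to_chain ` B u" if s: "s \<in> keys c" for s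
  proof -
    have sX: "s \<in> X u" "card s = 2" using c(2) s by (auto simp: chains_def)
    then obtain e where e: "e < n" "ss ! e = s" using position[OF X_simplices] by blast
    then have ee: "edge_at e" "birth e \<le> u" using sX at_X[of e u] by (auto simp: edge_at_def)
    have "lookup c s = 1" using s by (simp add: in_keys_iff bit_1I)
    then show ?thesis using to_chain_rel[OF e(1) ee(1)] B_rel[OF e(1) ee] e(2) by (metis imageI)
  qed
  have "finite T ==> T \<subseteq> keys c ==>
      boundary (\<Sum>s\<in>T. single s (lookup c s)) \<in> to_chain ` B u" for T
  proof (induction T rule: finite_induct)
    case empty
    then show ?case using B_zero[of u] to_chain_zero by (auto simp: boundary_zero intro: image_eqI[of _ _ 0])
  next
    case (insert s T)
    obtain x where x: "x \<in> B u" "boundary (single s (lookup c s)) = to_chain x" using key[of s] insert.prems by blast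
    obtain z where z: "z \<in> B u" "boundary (\<Sum>s\<in>T. single s (lookup c s)) = to_chain z" using insert by blast
    show ?case using insert.hyps B_add[OF x(1) z(1)] x(2) z(2) by (auto simp: boundary_add to_chain_add[symmetric])
  qed
  from this[of "keys c"] show "y \<in> to_chain ` B u" unfolding c(1) poly_mapping_expand[symmetric] by simp
next
  fix y assume "y \<in> to_chain ` B u"
  then obtain x where x: "y = to_chain x" "x \<in> combos n u" by (auto simp: B_def)
  have "to_chain x \<in> boundaries (X u) 0"
  proof (rule combos_induct[OF x(2), where Q = "%x. to_chain x \<in> boundaries (X u) 0"])
    have "0 \<in> chains (X u) (Suc 0)" by (simp add: chains_def)
    then show "to_chain 0 \<in> boundaries (X u) 0" unfolding boundaries_def to_chain_zero using boundary_zero by (metis imageI)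
  next
    fix y z assume "to_chain y \<in> boundaries (X u) 0" "to_chain z \<in> boundaries (X u) 0"
    then obtain c d where "to_chain y = boundary c" "c \<in> chains (X u) (Suc 0)" "to_chain z = boundary d" "d \<in> chains (X u) (Suc 0)"
      unfolding boundaries_def by blast
    then show "to_chain (y + z) \<in> boundaries (X u) 0"
      unfolding boundaries_def to_chain_add by (intro image_eqI[of _ _ "c + d"]) (auto simp: boundary_add intro: chains_add)
  next
    fix e assume e: "e < n" "edge_at e" "birth e \<le> u"
    then have "single (ss ! e) 1 \<in> chains (X u) (Suc 0)" using at_X[OF e(1)] by (simp add: chains_def edge_at_def)
    then show "to_chain (rel e) \<in> boundaries (X u) 0" unfolding boundaries_def using to_chain_rel[OF e(1,2)] by blast
  qed
  then show "y \<in> boundaries (X u) 0" by (simp only: x(1))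
qed

lemma chain_quotient: "filtered_quotient (%u. chains (X u) 0) (%u. boundaries (X u) 0)"
  unfolding chains_eq boundaries_eq
proof
  show "(c :: 'v chain) + c = 0" for c by (rule chain_add_self)
  show "0 \<in> to_chain ` F u" "0 \<in> to_chain ` B u" for u
    using imageI[OF F_zero, of to_chain u] imageI[OF B_zero, of to_chain u] by (simp_all only: to_chain_zero)
  show "c \<in> to_chain ` F v" if "c \<in> to_chain ` F u" "u \<le> v" for c u v using that F_mono by blast
  show "c \<in> to_chain ` B v" if "c \<in> to_chain ` B u" "u \<le> v" for c u v using that B_mono by blast
  show "c \<in> to_chain ` F u" if "c \<in> to_chain ` B u" for c u using that B_F by blast
  show "c + d \<in> to_chain ` F u" if cd: "c \<in> to_chain ` F u" "d \<in> to_chain ` F u" for c d u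
  proof -
    obtain x y where "c = to_chain x" "x \<in> F u" "d = to_chain y" "y \<in> F u" using cd by blast
    then show ?thesis using F_add by (intro image_eqI[of _ _ "x + y"]) (simp_all add: to_chain_add)
  qed
  show "c + d \<in> to_chain ` B u" if cd: "c \<in> to_chain ` B u" "d \<in> to_chain ` B u" for c d u
  proof -
    obtain x y where "c = to_chain x" "x \<in> B u" "d = to_chain y" "y \<in> B u" using cd by blast
    then show ?thesis using B_add by (intro image_eqI[of _ _ "x + y"]) (simp_all add: to_chain_add)
  qed
qed

theorem decomposition_of_homology:
  assumes E: "idems L E" and sep: "!!M l. endo M ==> l < L ==> \<not> separates M (E l)"
    and rows: "!!l. l < L ==> length (row_grades (P l)) = n" "!!l i. l < L ==> i < n ==> row_grades (P l) ! i = birth i"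
    and cols: "!!l. l < L ==> length (col_grades (P l)) = n + n"
      "!!l j. l < L ==> j < n ==> col_grades (P l) ! j = birth j & col_grades (P l) ! (n + j) = birth j"
    and ent: "!!l i j. l < L ==> i < n ==> j < n ==> entry (P l) i j = of_bool (edge_at j) * rel j i"
      "!!l i j. l < L ==> i < n ==> j < n ==> entry (P l) i (n + j) = of_bool (i = j) + E l i j"
  shows "\<exists>Ms :: ('d grade => 'v chain set, 'd) gmod list.
    total_decomposition (persistent_homology 0 X) Ms & list_all2 is_presentation_matrix (map P [0..<L]) Ms"
proof -
  let ?F = "%u. chains (X u) 0" and ?B = "%u. boundaries (X u) 0"
  define e where "e l c = to_chain (app n (E l) (of_chain c))" for l c
  define Bl where "Bl l u = {c \<in> ?F u. e l c \<in> ?B u}" for l u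
  interpret C: filtered_quotient ?F ?B by (rule chain_quotient)
  have El: "endo (E l)" "mm n (E l) (E l) = E l" "\<exists>v<n. E l v v = 1" if "l < L" for l
    using E that by (auto simp: idems_def)
  have orth: "mm n (E l) (E m) = 0" if "l < L" "m < L" "l ~= m" for l m using E that by (auto simp: idems_def)
  have E_sum: "(\<Sum>l<L. app n (E l) x) = app n idm x" for x
  proof -
    have "(\<Sum>l\<in>T. app n (E l) x) = app n (\<Sum>l\<in>T. E l) x" if "finite T" for T
      using that by (induction T rule: finite_induct) (auto simp: app_plus)
    moreover have "(\<Sum>l<L. E l) = idm" using E by (simp add: idems_def)
    ultimately show ?thesis by (metis finite_lessThan)
  qed
  have E_F: "app n (E l) x \<in> F u" if "l < L" "x \<in> F u" for l x u by (rule tri_app[OF endo_tri[OF El(1)[OF that(1)]] that(2)])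
  have in_B: "to_chain x \<in> ?B u \<longleftrightarrow> x \<in> B u" if x: "x \<in> F u" for x u
  proof
    assume "to_chain x \<in> ?B u"
    then obtain b where "b \<in> B u" "to_chain x = to_chain b" unfolding boundaries_eq by blast
    then show "x \<in> B u" using of_to_chain[OF x] of_to_chain[OF B_F] by metis
  qed (simp add: boundaries_eq)
  have e_to: "e l (to_chain x) = to_chain (app n (E l) x)" if "x \<in> F u" for l x u
    unfolding e_def of_to_chain[OF that] ..
  have a: "e l (c + d) = e l c + e l d" for l c d by (simp only: e_def of_chain_add app_add to_chain_add)
  have f: "e l c \<in> ?F u" if "l < L" "c \<in> ?F u" for l c u
    unfolding e_def by (intro to_chain_F E_F of_chain_F that)
  have b: "e l c \<in> ?B u" if l: "l < L" and c: "c \<in> ?B u" for l c u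
  proof -
    obtain x where x: "c = to_chain x" "x \<in> B u" using c unfolding boundaries_eq by blast
    show ?thesis unfolding x(1) e_to[OF B_F[OF x(2)]] boundaries_eq by (intro imageI endo_B El(1) l x(2))
  qed
  have s: "(\<Sum>l<L. e l c) = c" if c: "c \<in> ?F u" for c u
    unfolding e_def to_chain_sum[symmetric] E_sum app_idm[OF of_chain_F[OF c]] by (rule to_of_chain[OF c])
  have o: "e l (e m c) = (if l = m then e l c else 0)" if lm: "l < L" "m < L" and c: "c \<in> ?F u" for l m c u
  proof -
    have "e l (e m c) = to_chain (app n (mm n (E l) (E m)) (of_chain c))"
      unfolding e_def[of m] e_to[OF E_F[OF lm(2) of_chain_F[OF c]]] app_mm ..
    then show ?thesis using El(2)[OF lm(1)] orth[OF lm] by (auto simp: e_def to_chain_zero)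
  qed
  have fq: "filtered_quotient ?F (Bl l)" if "l < L" for l by (rule C.direct_sum_iso(1)[of L e, OF a f b s o Bl_def that])
  have iso: "graded_iso (qmod ?F ?B) (direct_sum (map (%l. qmod ?F (Bl l)) [0..<L]))"
    by (rule C.direct_sum_iso(2)[of L e, OF a f b s o Bl_def])
  have summand: "indecomposable (qmod ?F (Bl l)) & is_presentation_matrix (P l) (qmod ?F (Bl l))" if l: "l < L" for l
  proof -
    interpret Q: filtered_quotient ?F "Bl l" by (rule fq[OF l])
    interpret R: filtered_quotient F "part (E l)" by (rule part_quotient)
    have part_iff: "to_chain x \<in> Bl l u \<longleftrightarrow> x \<in> part (E l) u" if x: "x \<in> F u" for x u
      using x to_chain_F[OF x] in_B[OF E_F[OF l x]] by (simp add: Bl_def part_def e_to[OF x])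
    interpret i: quotient_map F "part (E l)" ?F "Bl l" to_chain
    proof
      show "to_chain (x + y) = to_chain x + to_chain y" for x y by (rule to_chain_add)
      show "to_chain x \<in> ?F u" if "x \<in> F u" for x u by (rule to_chain_F[OF that])
      show "to_chain x \<in> Bl l u" if "x \<in> part (E l) u" for x u using that part_iff by (simp add: part_def)
    qed
    interpret j: quotient_map ?F "Bl l" F "part (E l)" of_chain
    proof
      show "of_chain (x + y) = of_chain x + of_chain y" for x y by (rule of_chain_add)
      show "of_chain x \<in> F u" if "x \<in> ?F u" for x u by (rule of_chain_F[OF that])
      show "of_chain x \<in> part (E l) u" if "x \<in> Bl l u" for x u
      proof -
        have x: "x \<in> ?F u" using that by (simp add: Bl_def)
        show ?thesis using that part_iff[OF of_chain_F[OF x]] by (simp only: to_of_chain[OF x])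
      qed
    qed
    let ?M = "qmod F (part (E l))" and ?N = "qmod ?F (Bl l)"
    let ?i = "induced (part (E l)) (Bl l) to_chain" and ?j = "induced (Bl l) (part (E l)) of_chain"
    have ji: "?j (?i x) = x" if x: "x \<in> carrier ?M" for x
    proof -
      obtain \<zeta> where \<zeta>: "x = cosets (part (E l)) \<zeta>" "\<zeta> \<in> families F" using x by (rule R.carrierE)
      have "(%u. of_chain (to_chain (\<zeta> u))) = \<zeta>" using \<zeta>(2) of_to_chain by (auto simp: families_def)
      then show ?thesis unfolding \<zeta>(1) i.induced_eq[OF \<zeta>(2)] j.induced_eq[OF i.h_families[OF \<zeta>(2)]] by simp
    qed
    have ij: "?i (?j x) = x" if x: "x \<in> carrier ?N" for x
    proof -
      obtain \<zeta> where \<zeta>: "x = cosets (Bl l) \<zeta>" "\<zeta> \<in> families ?F" using x by (rule Q.carrierE)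
      have "(%u. to_chain (of_chain (\<zeta> u))) = \<zeta>" using \<zeta>(2) to_of_chain by (auto simp: families_def)
      then show ?thesis unfolding \<zeta>(1) j.induced_eq[OF \<zeta>(2)] i.induced_eq[OF j.h_families[OF \<zeta>(2)]] by simp
    qed
    obtain v where v: "v < n" "E l v v = 1" using El(3)[OF l] by blast
    have "nonzero_module ?N"
      by (rule nonzero_transfer[where i = ?i and j = ?j, OF R.is_graded_module_Q Q.is_graded_module_Q j.induced_hom i.induced_hom ji summand_nonzero[OF El(1)[OF l] v]])
    moreover have "trivial_idempotents ?N"
      by (rule trivial_idempotents_transfer[where i = ?i and j = ?j, OF R.is_graded_module_Q Q.is_graded_module_Q i.induced_hom j.induced_hom ji ij
        summand_idempotents[OF El(1)[OF l] El(2)[OF l] sep[OF _ l]]])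
    ultimately have "indecomposable ?N" by (rule Q.indecomposable_criterion)
    moreover have "bij_betw ?i (carrier ?M) (carrier ?N)"
      using ji ij i.induced_hom j.induced_hom by (intro bij_betw_byWitness[of _ ?j]) (auto simp: graded_hom_def)
    then have MN: "graded_iso ?M ?N" unfolding graded_iso_def using i.induced_hom by blast
    note pres = part_presentation[OF El(1,2)[OF l] rows(1)[OF l] rows(2)[OF l] cols(1)[OF l] cols(2)[OF l] ent(1)[OF l] ent(2)[OF l]]
    have "is_presentation_matrix (P l) ?N"
      unfolding is_presentation_matrix_def
      by (intro conjI pres(1) graded_iso_trans[OF cokernel_iso[OF pres(1)] graded_iso_trans[OF pres(2) MN]])
    ultimately show ?thesis by blast
  qed
  have "total_decomposition (persistent_homology 0 X) (map (%l. qmod ?F (Bl l)) [0..<L])"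
    unfolding total_decomposition_def
    using summand graded_iso_trans[OF persistent_homology_iso[OF chain_quotient] iso] by auto
  moreover have "list_all2 is_presentation_matrix (map P [0..<L]) (map (%l. qmod ?F (Bl l)) [0..<L])"
    using summand by (auto simp: list_all2_conv_all_nth)
  ultimately show ?thesis by blast
qed

section \<open>The input and output of the algorithm\<close>

lemma word_input: "warr (filtration_input X ss) a i = (if a = 0 then list_array (map card ss) i
    else if a = 1 then (if i < n * n then list_array (vertex_positions ss (ss ! (i div n))) (i mod n) else 0) else 0)"
  by (simp add: filtration_input_def blank_state_def length_ss)

lemma grade_input: "garr (filtration_input X ss) a i = (if a = 0 then list_array (map (birth_grade X) ss) i else 0)"
  by (simp add: filtration_input_def blank_state_def)

lemma card_le: "i < n ==> card (ss ! i) \<le> n"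
proof -
  assume i: "i < n"
  have "(%a. {a}) ` (ss ! i) \<subseteq> set ss" unfolding set_ss using face[OF simplex_at[OF i]] by blast
  then have "card ((%a. {a}) ` (ss ! i)) \<le> card (set ss)" by (intro card_mono) auto
  also have "card (set ss) = n" using distinct_card[OF distinct] length_ss by simp
  finally show ?thesis by (simp add: card_image)
qed

lemma input_clean: "clean_input n (filtration_input X ss)"
proof -
  have lim: "n < word_limit n" using power_increasing[of 1 4 "n + 2"] by (simp add: word_limit_def)
  have nn: "n \<le> n * n" by (cases n) auto
  have vp: "list_array (vertex_positions ss s) j < word_limit n" for s j
  proof (cases "j < length (vertex_positions ss s)")
    case True
    then have "vertex_positions ss s ! j < n" using nth_mem[OF True] length_ss by (auto simp: vertex_positions_def)
    then show ?thesis using True lim by (simp add: list_array_def)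
  qed (use lim in \<open>simp add: list_array_def\<close>)
  have "list_array (map card ss) i < word_limit n" for i
    using card_le[of i] lim length_ss by (auto simp: list_array_def)
  then have "warr (filtration_input X ss) a i < word_limit n" for a i
    using vp lim by (simp add: word_input)
  moreover have "warr (filtration_input X ss) a i = 0 & garr (filtration_input X ss) a i = 0" if "5 \<le> a | n * n \<le> i" for a i
  proof (cases "5 \<le> a")
    case False
    then have i: "n * n \<le> i" using that by simp
    then have "n \<le> i" using nn by linarith
    then show ?thesis using i length_ss by (simp add: word_input grade_input list_array_def)
  qed (simp add: word_input grade_input)
  ultimately show ?thesis
    unfolding clean_input_def by (simp add: filtration_input_def blank_state_def length_ss)
qed

lemma input_represents: "input_mem (mem_of (filtration_input X ss))"
  unfolding input_mem_def
proof (intro allI impI conjI)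
  fix i assume i: "i < n"
  have card: "wmem (mem_of (filtration_input X ss)) 0 i = card (ss ! i)"
    using i length_ss by (simp add: mem_of_def word_input list_array_def)
  show "wmem (mem_of (filtration_input X ss)) 0 i = 1 \<longleftrightarrow> vertex_at i" "wmem (mem_of (filtration_input X ss)) 0 i = 2 \<longleftrightarrow> edge_at i"
    by (simp_all only: card vertex_at_def edge_at_def)
  show "gmem (mem_of (filtration_input X ss)) 0 i = birth i"
    using i length_ss by (simp add: mem_of_def grade_input list_array_def birth_def)
  assume e: "edge_at i"
  have len: "length (vertex_positions ss (ss ! i)) = 2" using edge_ends[OF i e] by blast
  have n2: "2 \<le> n" using ends[OF i e] by linarith
  have "i * n + n \<le> n * n" using i mult_le_mono1[of "Suc i" n n] by simp
  then have lt: "i * n < n * n" "i * n + 1 < n * n" using n2 by linarith+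
  have div: "(i * n + 1) div n = i" "(i * n + 1) mod n = 1" using n2 div_mult_self3[of n i 1] mod_mult_self3[of i n 1] by simp_all
  show "wmem (mem_of (filtration_input X ss)) 1 (i * n) = source i"
    using lt(1) n2 len by (simp add: mem_of_def word_input list_array_def source_def)
  show "wmem (mem_of (filtration_input X ss)) 1 (i * n + 1) = target i"
    using lt(2) len div by (simp add: mem_of_def word_input list_array_def target_def del: One_nat_def)
qed

lemma vertex_exists: "n = 0 | (\<exists>v<n. vertex_at v)"
proof (cases "n = 0")
  case False
  then have s: "ss ! 0 \<in> simplices X" by (intro simplex_at) simp
  then obtain a where "a \<in> ss ! 0" using simplex_finite by blast
  then obtain v where "v < n" "ss ! v = {a}" using face[OF s, of "{a}"] position[of "{a}"] by auto
  then show ?thesis by (auto simp: vertex_at_def)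
qed simp

lemma address_bound:
  assumes "l < n" "i < n" "j < n + n"
  shows "address l i j < (n + 2) ^ (4 * 20)"
proof -
  have nest: "a * M + b < c * M" if "a < c" "b < M" for a b c M :: nat
    using that mult_le_mono1[of "Suc a" c M] by simp
  have "i * (n + n) + j < n * (n + n)" by (rule nest[OF assms(2,3)])
  then have "i * (n + n) + j < n ^ 2 + n ^ 2" by (simp add: power2_eq_square algebra_simps)
  then have "address l i j < n * (n ^ 2 + n ^ 2)" unfolding address_def by (rule nest[OF assms(1)])
  also have "\<dots> \<le> (n + 2) * ((n + 2) ^ 2 + (n + 2) ^ 2)" by (intro mult_le_mono add_mono power_mono) auto
  also have "\<dots> = 2 * (n + 2) ^ 3" by (simp add: power3_eq_cube power2_eq_square algebra_simps)
  also have "\<dots> \<le> (n + 2) * (n + 2) ^ 3" by (intro mult_le_mono1) simp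
  also have "\<dots> = (n + 2) ^ 4" by (simp add: power_Suc[symmetric] del: power_Suc)
  also have "\<dots> \<le> (n + 2) ^ (4 * 20)" by (intro power_increasing) auto
  finally show ?thesis .
qed

lemma output_decomposition:
  fixes s' :: "'d grade state"
  assumes h': "h' = run n decompose (%_. 0) (mem_of (filtration_input X ss))"
    and reg: "wreg s' 0 = weval n (%_. 0) h' (WGet 7 wtwo)"
    and mem: "!!a i. a < 5 ==> i < (n + 2) ^ (4 * 20) ==> warr s' a i = wmem h' a i & farr s' a i = fmem h' a i & garr s' a i = gmem h' a i"
  shows "\<exists>Ms :: ('d grade => 'v chain set, 'd) gmod list.
    total_decomposition (persistent_homology 0 X) Ms & list_all2 is_presentation_matrix (output_matrices s') Ms"
proof -
  have z: "wmem (mem_of (filtration_input X ss)) 2 i = 0" "wmem (mem_of (filtration_input X ss)) 3 i = 0" for i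
    by (simp_all add: mem_of_def word_input)
  obtain E where idems: "idems (count h') E"
    and sep: "!!M l. endo M ==> l < count h' ==> \<not> separates M (E l)"
    and left: "!!l i j. l < count h' ==> i < n ==> j < n ==> fmem h' 0 (address l i j) = of_bool (edge_at j) * rel j i"
    and right: "!!l i j. l < count h' ==> i < n ==> j < n ==> fmem h' 0 (address l i (n + j)) = of_bool (i = j) + E l i j"
    and grades: "!!j. j < n ==> gmem h' 0 j = birth j & gmem h' 1 j = birth j & gmem h' 1 (n + j) = birth j"
    and sizes: "!!l. l < count h' ==> wmem h' 0 l = n & wmem h' 1 l = n + n & wmem h' 2 l = 0 & wmem h' 3 l = 0 & wmem h' 4 l = l * (n ^ 2 + n ^ 2)"
    by (rule decompose_correct[OF input_represents vertex_exists z h']) (rule that; assumption)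
  let ?L = "count h'" and ?P = "output_matrix s'"
  have Ln: "?L \<le> n" by (rule idems_le[OF idems])
  have small: "i < (n + 2) ^ (4 * 20)" if "i < n + n" for i
  proof (cases "n = 0")
    case False
    then show ?thesis using address_bound[of 0 0 i] that by (simp add: address_def)
  qed (use that in simp)
  have reg': "wreg s' 0 = ?L" unfolding reg by (simp add: numeral_2_eq_2)
  have out: "output_matrices s' = map ?P [0..<?L]" by (simp add: output_matrices_def reg')
  have size: "warr s' 0 l = n" "warr s' 1 l = n + n" "warr s' 2 l = 0" "warr s' 3 l = 0" "warr s' 4 l = l * (n ^ 2 + n ^ 2)" if l: "l < ?L" for l
    using mem[of 0 l] mem[of 1 l] mem[of 2 l] mem[of 3 l] mem[of 4 l] small[of l] sizes[OF l] l Ln by auto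
  have g0: "garr s' 0 i = birth i" if "i < n" for i using mem[of 0 i] small[of i] grades[OF that] that by simp
  have g1: "garr s' 1 j = birth j & garr s' 1 (n + j) = birth j" if "j < n" for j
    using mem[of 1 j] mem[of 1 "n + j"] small[of j] small[of "n + j"] grades[OF that] that by simp
  have entry: "entry (?P l) i j = fmem h' 0 (address l i j)" if l: "l < ?L" and ij: "i < n" "j < n + n" for l i j
  proof -
    have "entry (?P l) i j = farr s' 0 (address l i j)" by (simp add: output_matrix_def size[OF l] size(2)[OF l, unfolded One_nat_def] address_def add.assoc)
    also have "\<dots> = fmem h' 0 (address l i j)" using mem[of 0 "address l i j"] address_bound[OF _ ij, of l] l Ln by simp
    finally show ?thesis .
  qed
  show ?thesis
    unfolding out
  proof (rule decomposition_of_homology[OF idems sep])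
    fix l assume l: "l < ?L"
    show "length (row_grades (?P l)) = n" "length (col_grades (?P l)) = n + n" by (simp_all add: output_matrix_def size[OF l] size(2)[OF l, unfolded One_nat_def])
    show "row_grades (?P l) ! i = birth i" if "i < n" for i using that g0 by (simp add: output_matrix_def size[OF l] size(2)[OF l, unfolded One_nat_def])
    show "col_grades (?P l) ! j = birth j & col_grades (?P l) ! (n + j) = birth j" if "j < n" for j
      using that g1 by (simp add: output_matrix_def size[OF l] size(2)[OF l, unfolded One_nat_def] nth_append)
    show "entry (?P l) i j = of_bool (edge_at j) * rel j i" if "i < n" "j < n" for i j
      using entry[OF l that(1), of j] left[OF l that] that(2) by simp
    show "entry (?P l) i (n + j) = of_bool (i = j) + E l i j" if "i < n" "j < n" for i j
      using entry[OF l that(1), of "n + j"] right[OF l that] that(2) by simp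
  qed
qed

end

theorem mainTheorem3:
  fixes \<omega> :: real
  assumes "2 \<le> \<omega>" and "\<omega> < 2.373" and "matmul_exponent \<omega>"
  shows "\<exists>prog k T.
    (\<lambda>n. real (T n)) \<in> O(\<lambda>n. real n powr (2 * \<omega> + 1)) \<and>
    (\<forall>(X :: 'd::finite grade \<Rightarrow> 'v set set) ss n.
       simplicial_filtration X \<and> one_critical X \<and>
       distinct ss \<and> set ss = simplices X \<and> length ss = n \<and>
       (\<forall>u. card (new_simplices X u) \<le> 1) \<longrightarrow>
       (\<exists>t s (Ms :: ('d grade \<Rightarrow> 'v chain set, 'd) gmod list).
          exec ((n + 2) ^ k) prog (filtration_input X ss) t s \<and> t \<le> T n \<and>
          total_decomposition (persistent_homology 0 X) Ms \<and>
          list_all2 is_presentation_matrix (output_matrices s) Ms))"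
proof -
  obtain mm k T where T: "(%N. real (T N)) \<in> O(%N. real N powr \<omega>)"
    and mult: "!!N A B. \<exists>t s. exec ((N + 2) ^ k) mm (matmul_input N A B) t s & t \<le> T N &
      (\<forall>i<N. \<forall>j<N. farr s 2 (i * N + j) = (\<Sum>l<N. A i l * B l j))"
    using assms(3) unfolding matmul_exponent_def by blast
  define simulates where "simulates prog K a n s \<longleftrightarrow> (\<exists>t s'. exec ((n + 2) ^ K) prog s t s' &
      t \<le> a + cost n 0 decompose + calls n decompose * (a + 2 * T n + 21 * (n * n)) &
      wreg s' 0 = weval n (%_. 0) (run n decompose (%_. 0) (mem_of s)) (WGet 7 wtwo) &
      (\<forall>b<5. \<forall>i<(n + 2) ^ (4 * 20). warr s' b i = wmem (run n decompose (%_. 0) (mem_of s)) b i &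
        farr s' b i = fmem (run n decompose (%_. 0) (mem_of s)) b i &
        garr s' b i = gmem (run n decompose (%_. 0) (mem_of s)) b i))"
    for prog K a n and s :: "'d grade state"
  have "\<exists>prog K a. \<forall>n s. clean_input n s --> simulates prog K a n s"
    unfolding simulates_def by (rule run_on_machine[OF mult decompose_bounded])
  then obtain prog K a where simulates: "!!n s. clean_input n s ==> simulates prog K a n s" by blast
  let ?T = "%n. a + cost n 0 decompose + calls n decompose * (a + 2 * T n + 21 * (n * n))"
  show ?thesis
  proof (rule exI[of _ prog], rule exI[of _ K], rule exI[of _ ?T], intro conjI allI impI)
    show "(%n. real (?T n)) \<in> O(%n. real n powr (2 * \<omega> + 1))"
      by (rule cost_asymptotics[OF assms(1) T decompose_calls decompose_degree])
    fix X :: "'d grade => 'v set set" and ss n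
    assume X: "simplicial_filtration X & one_critical X & distinct ss & set ss = simplices X & length ss = n &
      (\<forall>u. card (new_simplices X u) \<le> 1)"
    interpret critical_filtration X ss n using X by unfold_locales auto
    have "simulates prog K a n (filtration_input X ss)" by (rule simulates[OF input_clean])
    then obtain t s' where s': "exec ((n + 2) ^ K) prog (filtration_input X ss) t s'" "t \<le> ?T n"
      and reg: "wreg s' 0 = weval n (%_. 0) (run n decompose (%_. 0) (mem_of (filtration_input X ss))) (WGet 7 wtwo)"
      and mem: "\<forall>b<5. \<forall>i<(n + 2) ^ (4 * 20). warr s' b i = wmem (run n decompose (%_. 0) (mem_of (filtration_input X ss))) b i &
        farr s' b i = fmem (run n decompose (%_. 0) (mem_of (filtration_input X ss))) b i &
        garr s' b i = gmem (run n decompose (%_. 0) (mem_of (filtration_input X ss))) b i"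
      unfolding simulates_def by (elim exE conjE) (rule that)
    obtain Ms :: "('d grade => 'v chain set, 'd) gmod list" where
      "total_decomposition (persistent_homology 0 X) Ms" "list_all2 is_presentation_matrix (output_matrices s') Ms"
      using output_decomposition[OF refl reg] mem by blast
    then show "\<exists>t s (Ms :: ('d grade => 'v chain set, 'd) gmod list).
        exec ((n + 2) ^ K) prog (filtration_input X ss) t s & t \<le> ?T n &
        total_decomposition (persistent_homology 0 X) Ms & list_all2 is_presentation_matrix (output_matrices s) Ms"
      using s' by (intro exI[of _ t] exI[of _ s'] exI[of _ Ms] conjI)
  qed
qed

end
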